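(* Let $\alpha\in(0,1)$ and $\theta>0$, let $U$ satisfy (U), and let $\nu$ be a symmetric Lévy measure satisfying (L2) with this $\alpha$, where (U), (L2) are the hypotheses spelled out in the context. For $\varepsilon>0$ let $L^{\varepsilon,\theta}$ be a Lévy process with jump measure $\nu^{\varepsilon,\theta}=\nu|_{[-\theta/\varepsilon,\theta/\varepsilon]}$, Gaussian variance $d\ge0$ and drift $\mu\in\mathbb R$, and let $\sigma_x(\varepsilon)$ be the first exit time from $(-1,1)$ of the corresponding solution $X^{\varepsilon,\theta}(x)$. Put $$\phi(\theta):=\Big[\frac1\theta\Big]\theta^\alpha+\Big(1-\Big[\frac1\theta\Big]\theta\Big)^\alpha=\inf\Big\{\sum_{i=1}^kx_i^\alpha:\ \sum_{i=1}^kx_i=1,\ x_i\in[0,\theta],\ k\ge1/\theta\Big\},\qquad C_{\varepsilon,\theta}:=\nu\big([\tfrac1\varepsilon,\infty)\big)^{\phi(\theta)}.$$ Then for any $\delta>0$ there is $\varepsilon_0>0$ such that for all $0<\varepsilon\le\varepsilon_0$ the following inequalities hold for all $t\ge0$ (with $\varepsilon_0$ not depending on $t$): $$(1-\delta)\exp(-C_{\varepsilon,\theta}^{1-\delta}t)\le\inf_{|x|\le1-\delta}\mathbf P(\sigma_x(\varepsilon)>t)\le\sup_{|x|\le1}\mathbf P(\sigma_x(\varepsilon)>t)\le(1+\delta)\exp(-C_{\varepsilon,\theta}^{1+\delta}t).$$ Consequently, for any $|x|<1$, $$\lim_{\varepsilon\to0}\Big(\phi(\theta)f\big(\tfrac1\varepsilon\big)\Big)^{-1}\ln\mathbf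 E\,\sigma_x(\varepsilon)=1.$$
   Context: $(\Omega,\mathcal F,(\mathcal F_t)_{t\ge0},\mathbf P)$ is a filtered probability space satisfying the usual hypotheses. $[\cdot]$ denotes the integer part; in the infimum, $k$ ranges over positive integers. (U): $U:\mathbb R\to\mathbb R$ is continuously differentiable, $U'$ is Lipschitz continuous, $U'(0)=0$, and $U'(x)x>0$ for $x\in(-1,1)\setminus\{0\}$. $\nu$ is a symmetric Lévy measure: $\int_{\mathbb R\setminus\{0\}}(y^2\wedge1)\,\nu(dy)<\infty$. (L2): with $f(u):=-\ln\nu([u,+\infty))$, $u>0$, one has $f(u)=u^\alpha l(u)$ for $u\ge1$, where $l$ is slowly varying at $+\infty$ (a positive Lebesgue measurable function with $\lim_{u\to\infty}l(\lambda u)/l(u)=1$ for every $\lambda>0$). $L^{\varepsilon,\theta}$ is a Lévy process with generating triplet $(d,\nu^{\varepsilon,\theta},\mu)$ (Gaussian variance, Lévy measure, drift), where $\nu^{\varepsilon,\theta}$ is the restriction of $\nu$ to $[-\theta/\varepsilon,\theta/\varepsilon]$, and $d\ge 0$, $\mu\in\mathbb R$ do not depend on $\varepsilon$. For $\varepsilon>0$, $x\in\mathbb R$, $X^{\varepsilon,\theta}(x)$ is the strong solution of $$X_t^{\varepsilon,\theta}(x)=x-\int_0^tU'(X^{\varepsilon,\theta}_{s-}(x))\,ds+\varepsilon L^{\varepsilon,\theta}_t,\qquad t\ge0,$$ and $\sigma_x(\varepsilon):=\inf\{t\ge0:|X_t^{\varepsilon,\theta}(x)|\ge1\}$. For $\delta>1$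 the set $\{|x|\le1-\delta\}$ is empty and the inequalities involving the infimum are regarded as void. *)

theory Defs
  imports "HOL-Probability.Probability"
begin

section \<open>Potential, Levy measure and slowly varying functions\<close>

definition cond_U :: "(real \<Rightarrow> real) \<Rightarrow> bool" where
  "cond_U U \<longleftrightarrow>
     U C1_differentiable_on UNIV \<and>
     (\<exists>K. K-lipschitz_on UNIV (deriv U)) \<and>
     deriv U 0 = 0 \<and>
     (\<forall>x\<in>{-1<..<1} - {0}. deriv U x * x > 0)"

text \<open>A measure on the punctured line is represented as a Borel measure on the whole line
  that does not charge the origin.\<close>

definition levy_measure :: "real measure \<Rightarrow> bool" where
  "levy_measure \<nu> \<longleftrightarrow>
     sets \<nu> = sets borel \<and> emeasure \<nu> {0} = 0 \<and>
     (\<integral>\<^sup>+ y. ennreal (min (y\<^sup>2) 1) \<partial>\<nu>) < \<infinity>"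

definition symmetric_measure :: "real measure \<Rightarrow> bool" where
  "symmetric_measure \<nu> \<longleftrightarrow> distr \<nu> borel uminus = \<nu>"

definition slowly_varying :: "(real \<Rightarrow> real) \<Rightarrow> bool" where
  "slowly_varying l \<longleftrightarrow>
     l \<in> borel_measurable (lebesgue_on {0<..}) \<and>
     (\<forall>u>0. l u > 0) \<and>
     (\<forall>c>0. ((\<lambda>u. l (c * u) / l u) \<longlongrightarrow> 1) at_top)"

text \<open>The function \<open>f\<close>. A Levy measure gives \<open>{u..}\<close> finite mass for \<open>u > 0\<close>.\<close>

definition log_tail :: "real measure \<Rightarrow> real \<Rightarrow> real" where
  "log_tail \<nu> u = - ln (measure \<nu> {u..})"

text \<open>Since \<open>ln 0 = 0\<close>, whereas the right-hand side below is positive, this condition forces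
  all the tails \<open>measure \<nu> {u..}\<close> with \<open>u \<ge> 1\<close> to be positive.\<close>

definition cond_L2 :: "real \<Rightarrow> real measure \<Rightarrow> bool" where
  "cond_L2 \<alpha> \<nu> \<longleftrightarrow>
     (\<exists>l. slowly_varying l \<and> (\<forall>u\<ge>1. log_tail \<nu> u = u powr \<alpha> * l u))"

definition restrict_jumps :: "real measure \<Rightarrow> real \<Rightarrow> real measure" where
  "restrict_jumps \<nu> r = density \<nu> (indicator {-r..r})"


section \<open>Filtered probability spaces and Levy processes\<close>

text \<open>Time is \<open>{0..}\<close>. Indices of processes and filtrations are real numbers, but values at
  negative times are irrelevant; this is what \<open>max 0 t\<close> achieves for the library's notion of
  a filtration.\<close>

definition usual_hypotheses :: "'a measure \<Rightarrow> (real \<Rightarrow> 'a measure) \<Rightarrow> bool" where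
  "usual_hypotheses M F \<longleftrightarrow>
     filtration (space M) (\<lambda>t. F (max 0 t)) \<and>
     (\<forall>t\<ge>0. sets (F t) \<subseteq> sets M) \<and>
     complete_measure M \<and>
     null_sets M \<subseteq> sets (F 0) \<and>
     (\<forall>t\<ge>0. sets (F t) = (\<Inter>s\<in>{t<..}. sets (F s)))"

definition adapted :: "(real \<Rightarrow> 'a measure) \<Rightarrow> (real \<Rightarrow> 'a \<Rightarrow> real) \<Rightarrow> bool" where
  "adapted F Y \<longleftrightarrow> (\<forall>t\<ge>0. Y t \<in> borel_measurable (F t))"

definition cadlag :: "(real \<Rightarrow> real) \<Rightarrow> bool" where
  "cadlag y \<longleftrightarrow>
     (\<forall>t\<ge>0. continuous (at_right t) y) \<and>
     (\<forall>t>0. \<exists>c. (y \<longlongrightarrow> c) (at_left t))"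

text \<open>Stochastic continuity is not listed, as it follows from right-continuity at \<open>0\<close> and
  stationarity of the increments.\<close>

definition levy_process ::
    "'a measure \<Rightarrow> (real \<Rightarrow> 'a measure) \<Rightarrow> (real \<Rightarrow> 'a \<Rightarrow> real) \<Rightarrow> bool" where
  "levy_process M F L \<longleftrightarrow>
     adapted F L \<and>
     (AE \<omega> in M. L 0 \<omega> = 0) \<and>
     (AE \<omega> in M. cadlag (\<lambda>t. L t \<omega>)) \<and>
     (\<forall>s\<ge>0. \<forall>h\<ge>0. prob_space.indep_set M (sets (F s))
        (sets (vimage_algebra (space M) (\<lambda>\<omega>. L (s + h) \<omega> - L s \<omega>) borel))) \<and>
     (\<forall>s\<ge>0. \<forall>h\<ge>0. distr M borel (\<lambda>\<omega>. L (s + h) \<omega> - L s \<omega>) = distr M borel (L h))"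

text \<open>Levy--Khinchin exponent of the triplet (Gaussian variance \<open>d\<close>, Levy measure \<open>\<rho>\<close>,
  drift \<open>\<mu>\<close>), with truncation function \<open>indicator {-1..1}\<close>. For symmetric \<open>\<rho>\<close> the drift does
  not depend on the choice among symmetric truncations.\<close>

definition levy_exponent :: "real \<Rightarrow> real measure \<Rightarrow> real \<Rightarrow> real \<Rightarrow> complex" where
  "levy_exponent d \<rho> \<mu> u =
     - complex_of_real (d * u\<^sup>2 / 2) + \<i> * complex_of_real (\<mu> * u) +
     (CLINT y|\<rho>. iexp (u * y) - 1 - \<i> * complex_of_real (u * y * indicator {-1..1} y))"

definition levy_process_triplet ::
    "'a measure \<Rightarrow> (real \<Rightarrow> 'a measure) \<Rightarrow> real \<Rightarrow> real measure \<Rightarrow> real \<Rightarrow>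
     (real \<Rightarrow> 'a \<Rightarrow> real) \<Rightarrow> bool" where
  "levy_process_triplet M F d \<rho> \<mu> L \<longleftrightarrow>
     levy_process M F L \<and>
     (\<forall>t\<ge>0. \<forall>u. char (distr M borel (L t)) u
        = exp (complex_of_real t * levy_exponent d \<rho> \<mu> u))"


section \<open>The equation and the exit time\<close>

text \<open>\<open>Lim (at_left s)\<close> is the left limit \<open>X\<^sub>s\<^sub>-\<close>; it is meaningful for \<open>s > 0\<close> on cadlag paths,
  and the value at \<open>s = 0\<close> does not affect the integral.\<close>

definition strong_solution ::
    "'a measure \<Rightarrow> (real \<Rightarrow> 'a measure) \<Rightarrow> (real \<Rightarrow> real) \<Rightarrow> real \<Rightarrow> (real \<Rightarrow> 'a \<Rightarrow> real) \<Rightarrow>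
     real \<Rightarrow> (real \<Rightarrow> 'a \<Rightarrow> real) \<Rightarrow> bool" where
  "strong_solution M F U \<epsilon> L x X \<longleftrightarrow>
     adapted F X \<and>
     (AE \<omega> in M. cadlag (\<lambda>t. X t \<omega>)) \<and>
     (AE \<omega> in M. \<forall>t\<ge>0.
        X t \<omega> = x - (LINT s:{0..t}|lborel. deriv U (Lim (at_left s) (\<lambda>r. X r \<omega>))) + \<epsilon> * L t \<omega>)"

text \<open>The infimum is taken in \<open>ennreal\<close>, so that it is \<open>\<infinity>\<close> if the path never exits.\<close>

definition exit_time :: "(real \<Rightarrow> 'a \<Rightarrow> real) \<Rightarrow> 'a \<Rightarrow> ennreal" where
  "exit_time X \<omega> = (INF t\<in>{t. 0 \<le> t \<and> \<bar>X t \<omega>\<bar> \<ge> 1}. ennreal t)"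


section \<open>Rate\<close>

definition phi :: "real \<Rightarrow> real \<Rightarrow> real" where
  "phi \<alpha> \<theta> = of_int \<lfloor>1 / \<theta>\<rfloor> * \<theta> powr \<alpha> + (1 - of_int \<lfloor>1 / \<theta>\<rfloor> * \<theta>) powr \<alpha>"

definition exit_rate :: "real \<Rightarrow> real measure \<Rightarrow> real \<Rightarrow> real \<Rightarrow> real" where
  "exit_rate \<alpha> \<nu> \<theta> \<epsilon> = measure \<nu> {1 / \<epsilon>..} powr phi \<alpha> \<theta>"

end

theory Submission
  imports Defs
begin

text \<open>
  Write \<open>v = 1 / \<epsilon>\<close>. For concave \<open>y powr \<alpha>\<close> the cheapest way to cover a distance \<open>x\<close> with jumps in
  \<open>[0, \<theta>]\<close> is greedy, and its cost \<open>jump_cost \<alpha> \<theta> x\<close> is monotone, subadditive and equals \<open>phi \<alpha> \<theta>\<close> at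
  \<open>x = 1\<close>. On a fixed time interval the truncated Levy process therefore exceeds \<open>x * v\<close> with
  probability \<open>exp (- jump_cost \<alpha> \<theta> x * log_tail \<nu> v)\<close> on the logarithmic scale. For the upper
  bound the law is a weak limit of a Gaussian part convolved with compound Poisson parts: the
  jumps below \<open>\<kappa> * v\<close>, for small \<open>\<kappa>\<close>, have exponential moments of the order needed for
  Chernoff's bound, and the larger ones are integrated against the
  submultiplicative weight \<open>exp ((1 - \<delta>) * log_tail \<nu> v * jump_cost \<alpha> \<theta> (\<bar>y\<bar> / v))\<close>. For the
  lower bound the finitely many jumps of an optimal configuration are prescribed.

  An increment of size slightly above \<open>v\<close>, directed outwards, forces an exit within a short time
  whatever the current position, which gives geometric decay of the survival probability.
  Conversely an exit requires an oscillation of size about \<open>v\<close> over a time window of bounded length,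
  because the drift carries the path back to the neighbourhood of the origin. Ottaviani's
  inequality, combined with the reversal of increments, bounds the probability of such an
  oscillation by the tail of the law, and since windows that do not overlap are independent, the
  survival probabilities satisfy the recursion of a one-dependent sequence.

  A path may survive although one of its left limits lies on the boundary. Quasi-left-continuity
  shows that this happens with probability zero, so up to a null set survival is decided by the
  path at countably many times and is measurable.
\<close>

section \<open>The cost of a displacement by bounded jumps\<close>

text \<open>Untruncated jumps have no exponential moments when \<alpha> < 1, so a Chernoff exponent
  must shrink with the scale: \<open>K * log_tail \<nu> v / v\<close> tends to 0. Below \<kappa> v
  it consumes at most half of the logarithmic tail, which is how \<kappa> is chosen. Since the
  exponent vanishes, the Gaussian variance and the drift contribute only bounded factors and leave
  no trace in the rate. Above \<kappa> v the cheapest combination of jumps decides, so the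
  exponential gives way to a weight built on the exact cost. The rate tends to infinity, hence
  factorials, window lengths and the constants of the maximal inequality are paid for with a small
  fraction of the exponent. The prefactors have other sources: 1 - \<delta> pays mainly for the
  initial phase, when the path may start at distance \<delta> from the boundary, and 1 + \<delta>
  pays for rounding the number of windows down. One order of choices matters: the window length in
  the geometric decay is fixed after the margin by which the noise exceeds v, so that margin must
  not depend on time.\<close>

definition jump_cost :: "real \<Rightarrow> real \<Rightarrow> real \<Rightarrow> real" where
  "jump_cost \<alpha> \<theta> s = of_int \<lfloor>s / \<theta>\<rfloor> * \<theta> powr \<alpha> + (s - of_int \<lfloor>s / \<theta>\<rfloor> * \<theta>) powr \<alpha>"

text \<open>The factor (x + y) powr (\<alpha> - 1) has a nonpositive exponent, so it grows when its
  base is lowered to x or to y; x + y is split into its two terms accordingly.\<close>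

lemma powr_add_le:
  fixes x y \<alpha> :: real
  assumes "0 < \<alpha>" "\<alpha> \<le> 1" "0 \<le> x" "0 \<le> y"
  shows "(x + y) powr \<alpha> \<le> x powr \<alpha> + y powr \<alpha>"
proof (cases "x = 0 \<or> y = 0")
  case True
  then show ?thesis by auto
next
  case False
  then have pos: "x > 0" "y > 0" using assms by auto
  have *: "z * (x + y) powr (\<alpha> - 1) \<le> z powr \<alpha>" if "0 < z" "z \<le> x + y" for z
  proof -
    have "(x + y) powr (\<alpha> - 1) \<le> z powr (\<alpha> - 1)"
      using that assms by (intro powr_mono2') auto
    then have "z * (x + y) powr (\<alpha> - 1) \<le> z powr 1 * z powr (\<alpha> - 1)"
      using that by simp
    also have "\<dots> = z powr \<alpha>" by (simp only: powr_add [symmetric]) simp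
    finally show ?thesis .
  qed
  have "(x + y) powr \<alpha> = (x + y) powr 1 * (x + y) powr (\<alpha> - 1)"
    by (simp only: powr_add [symmetric]) simp
  also have "\<dots> = x * (x + y) powr (\<alpha> - 1) + y * (x + y) powr (\<alpha> - 1)"
    using pos by (simp add: algebra_simps)
  also have "\<dots> \<le> x powr \<alpha> + y powr \<alpha>"
    using *[of x] *[of y] pos by simp
  finally show ?thesis .
qed

text \<open>The graph lies below its tangent at the weighted mean \<open>m\<close>. That tangent
  inequality is Young's inequality for z / m and 1, so no derivative at the origin is
  involved.\<close>

lemma concave_on_powr:
  fixes \<alpha> :: real
  assumes "0 < \<alpha>" "\<alpha> \<le> 1"
  shows "concave_on {0..} (\<lambda>x. x powr \<alpha>)"
proof -
  have "u * x powr \<alpha> + v * y powr \<alpha> \<le> (u * x + v * y) powr \<alpha>"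
    if "0 \<le> x" "0 \<le> y" "0 \<le> u" "0 \<le> v" "u + v = 1" for x y u v :: real
  proof (cases "u * x + v * y = 0")
    case True
    then have "u * x = 0" "v * y = 0"
      using that by (simp_all add: add_nonneg_eq_0_iff)
    then show ?thesis by auto
  next
    case False
    define m where "m = u * x + v * y"
    have m: "m > 0" using False that unfolding m_def by (simp add: order_less_le)
    have tangent: "z powr \<alpha> \<le> m powr \<alpha> * (1 + \<alpha> * (z / m - 1))" if "0 \<le> z" for z
    proof (cases "z = 0")
      case True
      then show ?thesis using assms by simp
    next
      case False
      then have z: "z > 0" using that by simp
      have "ln (z / m) \<le> z / m - 1" using z m by (intro ln_le_minus_one) auto
      have "(z / m) powr \<alpha> \<le> 1 + \<alpha> * (z / m - 1)"
        using Youngs_inequality_0[of "1 - \<alpha>" \<alpha> 1 "z / m"] assms z m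
        by (simp add: algebra_simps)
      then have "m powr \<alpha> * (z / m) powr \<alpha> \<le> m powr \<alpha> * (1 + \<alpha> * (z / m - 1))"
        by (intro mult_left_mono) auto
      then show ?thesis using z m by (simp add: powr_divide)
    qed
    have "u * x powr \<alpha> + v * y powr \<alpha>
        \<le> u * (m powr \<alpha> * (1 + \<alpha> * (x / m - 1))) + v * (m powr \<alpha> * (1 + \<alpha> * (y / m - 1)))"
      using that by (intro add_mono mult_left_mono tangent) auto
    also have "\<dots> = m powr \<alpha> * ((u + v) + \<alpha> * ((u * x + v * y) / m - (u + v)))"
      by (simp add: algebra_simps add_divide_distrib)
    also have "\<dots> = m powr \<alpha>" using m that by (simp add: m_def [symmetric])
    finally show ?thesis by (simp add: m_def)
  qed
  then show ?thesis
    by (auto simp: concave_on_iff)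
qed

text \<open>Concavity favours unequal pairs. Both x and y are convex combinations of the extreme
  values x + y - \<theta> and \<theta>, with complementary weights, so the weights disappear when
  the two concavity inequalities are added.\<close>

lemma powr_spread:
  fixes x y \<theta> \<alpha> :: real
  assumes "0 < \<alpha>" "\<alpha> \<le> 1" "0 \<le> x" "x \<le> \<theta>" "0 \<le> y" "y \<le> \<theta>" "\<theta> \<le> x + y"
  shows "\<theta> powr \<alpha> + (x + y - \<theta>) powr \<alpha> \<le> x powr \<alpha> + y powr \<alpha>"
proof (cases "x + y - \<theta> = \<theta>")
  case True
  then have "x = \<theta>" "y = \<theta>" using assms by linarith+
  then show ?thesis by simp
next
  case False
  define r where "r = x + y - \<theta>"
  have r: "0 \<le> r" "r < \<theta>" "r \<le> x" "r \<le> y" using assms False by (auto simp: r_def)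
  define u where "u = (x - r) / (\<theta> - r)"
  have u: "0 \<le> u" "u \<le> 1" using r assms by (auto simp: u_def field_simps)
  have x: "x = (1 - u) * r + u * \<theta>"
  proof -
    have "u * (\<theta> - r) = x - r" using r by (simp add: u_def)
    then show ?thesis by (simp add: algebra_simps)
  qed
  have y: "y = (1 - u) * \<theta> + u * r" using x by (simp add: r_def algebra_simps)
  have conc: "(1 - t) * a powr \<alpha> + t * b powr \<alpha> \<le> ((1 - t) * a + t * b) powr \<alpha>"
    if "0 \<le> t" "t \<le> 1" "0 \<le> a" "0 \<le> b" for t a b
    using concave_onD[OF concave_on_powr[OF assms(1,2)], of t a b] that by simp
  have "x powr \<alpha> + y powr \<alpha> \<ge> ((1 - u) * r powr \<alpha> + u * \<theta> powr \<alpha>) + ((1 - u) * \<theta> powr \<alpha> + u * r powr \<alpha>)"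
    unfolding x y using u r assms by (intro add_mono conc) auto
  then show ?thesis by (simp add: r_def algebra_simps)
qed

context
  fixes \<alpha> \<theta> :: real
  assumes \<alpha>: "0 < \<alpha>" "\<alpha> < 1" and \<theta>: "0 < \<theta>"
begin

text \<open>Later arguments split a displacement into full jumps and a remainder and use this
  formula instead of the floor.\<close>

lemma jump_cost_unique:
  assumes "0 \<le> r" "r < \<theta>"
  shows "jump_cost \<alpha> \<theta> (of_int n * \<theta> + r) = of_int n * \<theta> powr \<alpha> + r powr \<alpha>"
proof -
  have "\<lfloor>(of_int n * \<theta> + r) / \<theta>\<rfloor> = n"
    using assms \<theta> by (intro floor_unique) (auto simp: field_simps)
  then show ?thesis by (simp add: jump_cost_def)
qed

lemma jump_cost_decomp:
  assumes "0 \<le> s"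
  obtains n r where "s = of_int n * \<theta> + r" "0 \<le> n" "0 \<le> r" "r < \<theta>"
proof
  show "s = of_int \<lfloor>s / \<theta>\<rfloor> * \<theta> + (s - of_int \<lfloor>s / \<theta>\<rfloor> * \<theta>)" by simp
  show "0 \<le> \<lfloor>s / \<theta>\<rfloor>" using assms \<theta> by simp
  show "0 \<le> s - of_int \<lfloor>s / \<theta>\<rfloor> * \<theta>"
    using floor_divide_lower[OF \<theta>, of s] by simp
  show "s - of_int \<lfloor>s / \<theta>\<rfloor> * \<theta> < \<theta>"
    using floor_divide_upper[OF \<theta>, of s] by (simp add: algebra_simps)
qed

text \<open>If the remainder r and the new jump x together stay below \<theta>, subadditivity of the
  power suffices. Otherwise the pair r, x is spread into a full jump \<theta> and a smaller
  remainder, which concavity makes cheaper.\<close>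

lemma jump_cost_add_le:
  assumes "0 \<le> s" "0 \<le> x" "x \<le> \<theta>"
  shows "jump_cost \<alpha> \<theta> (s + x) \<le> jump_cost \<alpha> \<theta> s + x powr \<alpha>"
proof -
  obtain n r where s: "s = of_int n * \<theta> + r" "0 \<le> n" "0 \<le> r" "r < \<theta>"
    using jump_cost_decomp[OF assms(1)] .
  have 1: "jump_cost \<alpha> \<theta> s = of_int n * \<theta> powr \<alpha> + r powr \<alpha>"
    using s jump_cost_unique by simp
  show ?thesis
  proof (cases "r + x < \<theta>")
    case True
    have "jump_cost \<alpha> \<theta> (s + x) = of_int n * \<theta> powr \<alpha> + (r + x) powr \<alpha>"
      using jump_cost_unique[of "r + x" n] s True assms by (simp add: add.assoc)
    also have "(r + x) powr \<alpha> \<le> r powr \<alpha> + x powr \<alpha>"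
      using powr_add_le \<alpha> s assms by simp
    finally show ?thesis using 1 by simp
  next
    case False
    have "s + x = of_int (n + 1) * \<theta> + (r + x - \<theta>)" using s by (simp add: algebra_simps)
    then have "jump_cost \<alpha> \<theta> (s + x) = of_int (n + 1) * \<theta> powr \<alpha> + (r + x - \<theta>) powr \<alpha>"
      using jump_cost_unique[of "r + x - \<theta>" "n + 1"] s(3,4) False assms(3) by (simp only:)
    moreover have "\<theta> powr \<alpha> + (r + x - \<theta>) powr \<alpha> \<le> r powr \<alpha> + x powr \<alpha>"
      using powr_spread[of \<alpha> r \<theta> x] \<alpha> s False assms by simp
    ultimately show ?thesis using 1 by (simp add: algebra_simps)
  qed
qed

lemma jump_cost_0: "jump_cost \<alpha> \<theta> 0 = 0"
  by (simp add: jump_cost_def)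

lemma jump_cost_nonneg:
  assumes "0 \<le> s" shows "0 \<le> jump_cost \<alpha> \<theta> s"
proof -
  obtain n r where s: "s = of_int n * \<theta> + r" "0 \<le> n" "0 \<le> r" "r < \<theta>"
    using jump_cost_decomp[OF assms(1)] .
  then show ?thesis using jump_cost_unique by simp
qed

text \<open>With equal numbers of full jumps the remainders are compared. With different numbers,
  the extra full jump on the right costs \<theta> powr \<alpha>, more than any remainder on the
  left.\<close>

lemma jump_cost_mono:
  assumes "0 \<le> s" "s \<le> t"
  shows "jump_cost \<alpha> \<theta> s \<le> jump_cost \<alpha> \<theta> t"
proof -
  have "0 \<le> t" using assms by simp
  obtain n r where s: "s = of_int n * \<theta> + r" "0 \<le> n" "0 \<le> r" "r < \<theta>"
    using jump_cost_decomp[OF assms(1)] .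
  obtain m q where t: "t = of_int m * \<theta> + q" "0 \<le> m" "0 \<le> q" "q < \<theta>"
    using jump_cost_decomp[OF \<open>0 \<le> t\<close>] .
  have s1: "jump_cost \<alpha> \<theta> s = of_int n * \<theta> powr \<alpha> + r powr \<alpha>"
    using s jump_cost_unique by simp
  have t1: "jump_cost \<alpha> \<theta> t = of_int m * \<theta> powr \<alpha> + q powr \<alpha>"
    using t jump_cost_unique by simp
  have nm: "n \<le> m"
  proof (rule ccontr)
    assume "\<not> n \<le> m"
    then have "real_of_int (m + 1) * \<theta> \<le> of_int n * \<theta>"
      using \<theta> by (intro mult_right_mono) auto
    then show False using s t assms by (simp add: algebra_simps)
  qed
  show ?thesis
  proof (cases "n = m")
    case True
    then show ?thesis using s1 t1 s t assms \<alpha> by (auto intro!: powr_mono2)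
  next
    case False
    then have "real_of_int (n + 1) * \<theta> powr \<alpha> \<le> of_int m * \<theta> powr \<alpha>"
      using nm by (intro mult_right_mono) auto
    moreover have "r powr \<alpha> \<le> \<theta> powr \<alpha>" using s \<alpha> by (intro powr_mono2) auto
    moreover have "0 \<le> q powr \<alpha>" by simp
    ultimately show ?thesis unfolding s1 t1 of_int_add of_int_1 distrib_right by linarith
  qed
qed

text \<open>Optimality of the greedy configuration: the jumps are added one by one, each raising the
  greedy cost by at most its own cost.\<close>

lemma jump_cost_sum_le:
  assumes "finite I" "\<And>i. i \<in> I \<Longrightarrow> 0 \<le> x i \<and> x i \<le> \<theta>"
  shows "jump_cost \<alpha> \<theta> (\<Sum>i\<in>I. x i) \<le> (\<Sum>i\<in>I. x i powr \<alpha>)"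
  using assms
proof (induction I)
  case empty
  then show ?case by (simp add: jump_cost_0)
next
  case (insert i I)
  have "jump_cost \<alpha> \<theta> (\<Sum>i\<in>insert i I. x i) = jump_cost \<alpha> \<theta> ((\<Sum>i\<in>I. x i) + x i)"
    using insert by (simp add: add.commute)
  also have "\<dots> \<le> jump_cost \<alpha> \<theta> (\<Sum>i\<in>I. x i) + x i powr \<alpha>"
    using insert by (intro jump_cost_add_le sum_nonneg) auto
  finally show ?case using insert by simp
qed

lemma phi_eq_jump_cost: "phi \<alpha> \<theta> = jump_cost \<alpha> \<theta> 1"
  by (simp add: phi_def jump_cost_def)

lemma jump_cost_pos:
  assumes "0 < s" shows "0 < jump_cost \<alpha> \<theta> s"
proof -
  obtain n r where s: "s = of_int n * \<theta> + r" "0 \<le> n" "0 \<le> r" "r < \<theta>"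
    using jump_cost_decomp[of s] assms by auto
  have "jump_cost \<alpha> \<theta> s = of_int n * \<theta> powr \<alpha> + r powr \<alpha>"
    using jump_cost_unique[of r n] s by simp
  moreover have "0 < of_int n * \<theta> powr \<alpha> + r powr \<alpha>"
  proof (cases "n = 0")
    case True
    then show ?thesis using s assms by simp
  next
    case False
    then have "0 < of_int n * \<theta> powr \<alpha>" using s \<theta> by simp
    then show ?thesis by (simp add: add_pos_nonneg)
  qed
  ultimately show ?thesis by simp
qed

lemma phi_pos: "0 < phi \<alpha> \<theta>"
  by (simp add: phi_eq_jump_cost jump_cost_pos)

lemma phi_eq_Inf:
  "phi \<alpha> \<theta> = Inf {\<Sum>i=1..k. x i powr \<alpha> | (k::nat) (x::nat \<Rightarrow> real).
     k \<ge> 1 \<and> real k \<ge> 1 / \<theta> \<and> (\<forall>i\<in>{1..k}. x i \<in> {0..\<theta>}) \<and> (\<Sum>i=1..k. x i) = 1}"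
  (is "_ = Inf ?S")
proof (rule cInf_eq_minimum [symmetric])
  obtain n r where s: "1 = of_int n * \<theta> + r" "0 \<le> n" "0 \<le> r" "r < \<theta>"
    using jump_cost_decomp[of 1] by auto
  \<comment> \<open>The last entry is 0 when 1 / \<theta> is an integer; this is harmless because
    \<open>0 powr \<alpha>\<close> is 0.\<close>
  define x where "x i = (if i \<le> nat n then \<theta> else r)" for i :: nat
  have sum: "(\<Sum>i=1..Suc (nat n). g (x i)) = of_int n * g \<theta> + g r" for g :: "real \<Rightarrow> real"
    using s(2) by (simp add: x_def)
  have "real (Suc (nat n)) \<ge> 1 / \<theta>"
    using s \<theta> by (simp add: field_simps)
  moreover have "(\<Sum>i=1..Suc (nat n). x i) = 1" using sum[of "\<lambda>x. x"] s by simp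
  moreover have "\<forall>i\<in>{1..Suc (nat n)}. x i \<in> {0..\<theta>}" using s \<theta> by (auto simp: x_def)
  moreover have "phi \<alpha> \<theta> = (\<Sum>i=1..Suc (nat n). x i powr \<alpha>)"
    using sum[of "\<lambda>x. x powr \<alpha>"] jump_cost_unique[of r n] s by (simp add: phi_eq_jump_cost)
  ultimately show "phi \<alpha> \<theta> \<in> ?S"
    by (intro CollectI exI[of _ "Suc (nat n)"] exI[of _ x]) auto
next
  fix y assume "y \<in> ?S"
  then obtain k and x :: "nat \<Rightarrow> real" where "y = (\<Sum>i=1..k. x i powr \<alpha>)"
      "\<forall>i\<in>{1..k}. x i \<in> {0..\<theta>}" "(\<Sum>i=1..k. x i) = 1" by blast
  then show "phi \<alpha> \<theta> \<le> y"
    using jump_cost_sum_le[of "{1..k}" x] by (simp add: phi_eq_jump_cost)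
qed

end

section \<open>Weibull tails\<close>

lemma levy_tail_finite:
  assumes "levy_measure \<nu>" "0 < u"
  shows "emeasure \<nu> {u..} < \<infinity>"
proof -
  have [measurable_cong]: "sets \<nu> = sets borel" using assms by (simp add: levy_measure_def)
  define c where "c = min (u\<^sup>2) 1"
  have c: "0 < c" using assms by (simp add: c_def)
  have "ennreal c * emeasure \<nu> {u..} = (\<integral>\<^sup>+ y. ennreal c * indicator {u..} y \<partial>\<nu>)"
    by (simp add: nn_integral_cmult_indicator)
  also have "\<dots> \<le> (\<integral>\<^sup>+ y. ennreal (min (y\<^sup>2) 1) \<partial>\<nu>)"
  proof (intro nn_integral_mono)
    fix y :: real
    have "u \<le> y \<Longrightarrow> u\<^sup>2 \<le> y\<^sup>2" using assms by (intro power_mono) auto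
    then show "ennreal c * indicator {u..} y \<le> ennreal (min (y\<^sup>2) 1)"
      by (auto simp: c_def indicator_def intro!: ennreal_leI)
  qed
  also have "\<dots> < \<infinity>" using assms by (simp add: levy_measure_def)
  finally show ?thesis using c by (auto simp: ennreal_mult_less_top top.not_eq_extremum)
qed

locale weibull_tail =
  fixes \<nu> :: "real measure" and \<alpha> :: real
  assumes \<nu>: "levy_measure \<nu>" and L2: "cond_L2 \<alpha> \<nu>" and \<alpha>: "0 < \<alpha>" "\<alpha> < 1"
begin

lemma sets_nu [measurable_cong]: "sets \<nu> = sets borel"
  using \<nu> by (simp add: levy_measure_def)

lemma log_tail_pos: "1 \<le> u \<Longrightarrow> 0 < log_tail \<nu> u"
  using L2 by (auto simp: cond_L2_def slowly_varying_def)

lemma measure_tail_pos: "1 \<le> u \<Longrightarrow> 0 < measure \<nu> {u..}"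
  using log_tail_pos[of u] by (auto simp: log_tail_def zero_less_measure_iff)

lemma measure_tail: "1 \<le> u \<Longrightarrow> measure \<nu> {u..} = exp (- log_tail \<nu> u)"
  using measure_tail_pos[of u] by (simp add: log_tail_def)

lemma emeasure_tail: "1 \<le> u \<Longrightarrow> emeasure \<nu> {u..} = ennreal (exp (- log_tail \<nu> u))"
  using measure_tail[of u] levy_tail_finite[OF \<nu>, of u]
  by (subst emeasure_eq_ennreal_measure) auto

lemma log_tail_mono: "1 \<le> u \<Longrightarrow> u \<le> v \<Longrightarrow> log_tail \<nu> u \<le> log_tail \<nu> v"
proof -
  assume *: "1 \<le> u" "u \<le> v"
  have "emeasure \<nu> {v..} \<le> emeasure \<nu> {u..}"
    using * by (intro emeasure_mono) (auto simp: sets_nu)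
  then show ?thesis using * by (simp add: emeasure_tail)
qed

text \<open>The slowly varying factors cancel in the limit. Apart from positivity of the logarithmic
  tail, this regular variation of index \<alpha> is all that the later estimates extract from
  \<open>l\<close>.\<close>

lemma log_tail_ratio:
  assumes "0 < c"
  shows "((\<lambda>u. log_tail \<nu> (c * u) / log_tail \<nu> u) \<longlongrightarrow> c powr \<alpha>) at_top"
proof -
  obtain l where l: "slowly_varying l" "\<And>u. 1 \<le> u \<Longrightarrow> log_tail \<nu> u = u powr \<alpha> * l u"
    using L2 by (auto simp: cond_L2_def)
  have "((\<lambda>u. c powr \<alpha> * (l (c * u) / l u)) \<longlongrightarrow> c powr \<alpha> * 1) at_top"
    using l assms by (intro tendsto_intros) (auto simp: slowly_varying_def)
  moreover have "eventually (\<lambda>u. c powr \<alpha> * (l (c * u) / l u) = log_tail \<nu> (c * u) / log_tail \<nu> u) at_top"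
    using eventually_ge_at_top[of "max 1 (1 / c)"]
  proof eventually_elim
    case (elim u)
    then have "1 \<le> u" "1 \<le> c * u" using assms by (auto simp: field_simps)
    moreover have "l u > 0" using l(1) \<open>1 \<le> u\<close> by (auto simp: slowly_varying_def)
    ultimately show ?case using assms
      by (simp add: l(2) powr_mult field_simps)
  qed
  ultimately show ?thesis by (simp add: tendsto_cong)
qed

text \<open>A one-sided Potter bound; monotonicity of the tail replaces uniform convergence.\<close>

lemma log_tail_doubling:
  fixes \<beta> :: real
  assumes "\<beta> < \<alpha>"
  shows "eventually (\<lambda>u. 2 powr \<beta> * log_tail \<nu> u \<le> log_tail \<nu> (2 * u)) at_top"
proof -
  have "2 powr \<beta> < 2 powr \<alpha>" using assms by simp
  with log_tail_ratio[of 2]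
  have "eventually (\<lambda>u. 2 powr \<beta> < log_tail \<nu> (2 * u) / log_tail \<nu> u) at_top"
    by (intro order_tendstoD) auto
  with eventually_ge_at_top[of 1] show ?thesis
  proof eventually_elim
    case (elim u)
    then show ?case using log_tail_pos[of u] by (simp add: field_simps)
  qed
qed

text \<open>The ratio bound for doubling is iterated until the argument passes v. The number of
  doublings is log 2 (v / u) rounded up, so the overshoot is at most one doubling; it produces the
  extra factor \<open>2 powr \<beta>\<close>.\<close>

lemma log_tail_potter:
  assumes "\<alpha> < \<beta>"
  obtains R where "1 \<le> R"
    "\<And>u v. R \<le> u \<Longrightarrow> u \<le> v \<Longrightarrow> log_tail \<nu> v \<le> 2 powr \<beta> * (v / u) powr \<beta> * log_tail \<nu> u"
proof -
  have "2 powr \<alpha> < 2 powr \<beta>" using assms by simp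
  with log_tail_ratio[of 2]
  have "eventually (\<lambda>u. log_tail \<nu> (2 * u) / log_tail \<nu> u < 2 powr \<beta>) at_top"
    by (intro order_tendstoD) auto
  then obtain R0 where R0: "\<And>u. R0 \<le> u \<Longrightarrow> log_tail \<nu> (2 * u) / log_tail \<nu> u < 2 powr \<beta>"
    by (auto simp: eventually_at_top_linorder)
  define R where "R = max 1 R0"
  have step: "log_tail \<nu> (2 * u) \<le> 2 powr \<beta> * log_tail \<nu> u" if "R \<le> u" for u
    using R0[of u] log_tail_pos[of u] that by (simp add: R_def field_simps)
  have iter: "log_tail \<nu> (2 ^ k * u) \<le> (2 powr \<beta>) ^ k * log_tail \<nu> u" if "R \<le> u" for k u
  proof (induction k)
    case (Suc k)
    have u: "0 < u" "1 \<le> u" using that by (auto simp: R_def)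
    have "1 * u \<le> 2 ^ k * u" using u by (intro mult_right_mono) auto
    then have "R \<le> 2 ^ k * u" using that by simp
    from step[OF this] have "log_tail \<nu> (2 ^ Suc k * u) \<le> 2 powr \<beta> * log_tail \<nu> (2 ^ k * u)"
      by (simp add: mult.assoc)
    also have "\<dots> \<le> 2 powr \<beta> * ((2 powr \<beta>) ^ k * log_tail \<nu> u)"
      by (intro mult_left_mono Suc) auto
    finally show ?case by simp
  qed simp
  show ?thesis
  proof
    show "1 \<le> R" by (simp add: R_def)
    fix u v assume uv: "R \<le> u" "u \<le> v"
    then have u: "1 \<le> u" "1 \<le> v" by (auto simp: R_def)
    define k where "k = nat \<lceil>log 2 (v / u)\<rceil>"
    have "0 \<le> log 2 (v / u)" using uv u by simp
    then have k: "log 2 (v / u) \<le> k" "k \<le> log 2 (v / u) + 1"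
      unfolding k_def by linarith+
    have "v / u = 2 powr (log 2 (v / u))" using u by simp
    also have "\<dots> \<le> 2 powr k" using k by (intro powr_mono) auto
    finally have "v \<le> 2 ^ k * u" using u by (simp add: field_simps powr_realpow)
    then have "log_tail \<nu> v \<le> log_tail \<nu> (2 ^ k * u)" using u by (intro log_tail_mono) auto
    also have "\<dots> \<le> (2 powr \<beta>) ^ k * log_tail \<nu> u" by (intro iter uv)
    also have "\<dots> \<le> 2 powr \<beta> * (v / u) powr \<beta> * log_tail \<nu> u"
    proof (intro mult_right_mono)
      have "(2 powr \<beta>) ^ k = (2 powr k) powr \<beta>"
        by (simp add: powr_powr mult.commute flip: powr_realpow)
      also have "\<dots> \<le> (2 powr (log 2 (v / u) + 1)) powr \<beta>"
        using k assms \<alpha> by (intro powr_mono2) auto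
      also have "2 powr (log 2 (v / u) + 1) = 2 * (v / u)"
        using u by (simp add: powr_add)
      also have "(2 * (v / u)) powr \<beta> = 2 powr \<beta> * (v / u) powr \<beta>"
        by (rule powr_mult)
      finally show "(2 powr \<beta>) ^ k \<le> 2 powr \<beta> * (v / u) powr \<beta>" .
    qed (use log_tail_pos[of u] u in auto)
    finally show "log_tail \<nu> v \<le> 2 powr \<beta> * (v / u) powr \<beta> * log_tail \<nu> u" .
  qed
qed

text \<open>Geometric growth along dyadic points, here with ratio 2 powr (\<alpha> / 2), makes
  exponentials of the logarithmic tail summable over dyadic shells. The constant \<open>c\<close> is
  the value at 1, a lower bound at every later point by monotonicity.\<close>

lemma log_tail_dyadic_growth:
  obtains r :: real and c R where "1 < r" "0 < c" "1 \<le> R"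
    "\<And>k u. R \<le> u \<Longrightarrow> c * r ^ k \<le> log_tail \<nu> (2 ^ k * u)"
proof -
  define r :: real where "r = 2 powr (\<alpha> / 2)"
  have r: "1 < r" using \<alpha> by (simp add: r_def)
  have "eventually (\<lambda>u. r * log_tail \<nu> u \<le> log_tail \<nu> (2 * u)) at_top"
    unfolding r_def using \<alpha> by (intro log_tail_doubling) auto
  then obtain R0 where R0: "\<And>u. R0 \<le> u \<Longrightarrow> r * log_tail \<nu> u \<le> log_tail \<nu> (2 * u)"
    by (auto simp: eventually_at_top_linorder)
  define R where "R = max 1 R0"
  have iter: "r ^ k * log_tail \<nu> u \<le> log_tail \<nu> (2 ^ k * u)" if "R \<le> u" for k u
  proof (induction k)
    case (Suc k)
    have u: "0 < u" "1 \<le> u" using that by (auto simp: R_def)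
    have "1 * u \<le> 2 ^ k * u" using u by (intro mult_right_mono) auto
    then have "R \<le> 2 ^ k * u" using that by simp
    then have *: "R0 \<le> 2 ^ k * u" by (simp add: R_def)
    have "r ^ Suc k * log_tail \<nu> u \<le> r * log_tail \<nu> (2 ^ k * u)"
      using Suc r by simp
    also have "\<dots> \<le> log_tail \<nu> (2 ^ Suc k * u)"
      using R0[OF *] by (simp add: mult.assoc)
    finally show ?case .
  qed simp
  show ?thesis
  proof (rule that[OF r])
    show "0 < log_tail \<nu> 1" by (rule log_tail_pos) simp
    show "1 \<le> R" by (simp add: R_def)
    fix k u assume u: "R \<le> u"
    then have "log_tail \<nu> 1 \<le> log_tail \<nu> u" by (intro log_tail_mono) (auto simp: R_def)
    then have "log_tail \<nu> 1 * r ^ k \<le> r ^ k * log_tail \<nu> u" using r by simp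
    with iter[OF u, of k] show "log_tail \<nu> 1 * r ^ k \<le> log_tail \<nu> (2 ^ k * u)" by simp
  qed
qed

lemma log_tail_at_top: "filterlim (log_tail \<nu>) at_top at_top"
proof -
  obtain r c R where r: "1 < r" "0 < c" "1 \<le> R"
    "\<And>k u. R \<le> u \<Longrightarrow> c * r ^ k \<le> log_tail \<nu> (2 ^ k * u)"
    using log_tail_dyadic_growth by blast
  show ?thesis unfolding filterlim_at_top
  proof
    fix Z
    obtain k where k: "Z / c < r ^ k" using real_arch_pow[OF r(1)] by blast
    show "eventually (\<lambda>u. Z \<le> log_tail \<nu> u) at_top"
      using eventually_ge_at_top[of "2 ^ k * R"]
    proof eventually_elim
      case (elim u)
      have "Z \<le> c * r ^ k" using k r by (simp add: field_simps)
      also have "\<dots> \<le> log_tail \<nu> (2 ^ k * (u / 2 ^ k))" using elim by (intro r) (simp add: field_simps)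
      finally show ?case by simp
    qed
  qed
qed

text \<open>An exponent \<beta> strictly between \<alpha> and 1 in the Potter bound gives growth of
  order at most u powr \<beta>. Here \<alpha> < 1 is used: it makes the Chernoff exponents tend to
  0.\<close>

lemma log_tail_sublinear: "((\<lambda>u. log_tail \<nu> u / u) \<longlongrightarrow> 0) at_top"
proof -
  define \<beta> where "\<beta> = (1 + \<alpha>) / 2"
  have \<beta>: "\<alpha> < \<beta>" "\<beta> < 1" using \<alpha> by (auto simp: \<beta>_def)
  obtain R where R: "1 \<le> R"
    "\<And>u v. R \<le> u \<Longrightarrow> u \<le> v \<Longrightarrow> log_tail \<nu> v \<le> 2 powr \<beta> * (v / u) powr \<beta> * log_tail \<nu> u"
    using log_tail_potter[OF \<beta>(1)] by blast
  define K where "K = 2 powr \<beta> * (1 / R) powr \<beta> * log_tail \<nu> R"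
  show ?thesis
  proof (rule tendsto_sandwich)
    show "eventually (\<lambda>u. 0 \<le> log_tail \<nu> u / u) at_top"
      using eventually_ge_at_top[of 1] by eventually_elim (use log_tail_pos in \<open>auto intro: less_imp_le\<close>)
    show "eventually (\<lambda>u. log_tail \<nu> u / u \<le> K * u powr (\<beta> - 1)) at_top"
      using eventually_ge_at_top[of R]
    proof eventually_elim
      case (elim u)
      have u: "0 < u" using elim R by simp
      have "log_tail \<nu> u / u \<le> 2 powr \<beta> * (u / R) powr \<beta> * log_tail \<nu> R / u"
        using R(2)[of R u] elim u by (intro divide_right_mono) auto
      also have "\<dots> = K * u powr (\<beta> - 1)"
        using u R by (simp add: K_def powr_divide powr_diff)
      finally show ?case .
    qed
    have "((\<lambda>u. K * u powr (\<beta> - 1)) \<longlongrightarrow> K * 0) at_top"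
      using \<beta> by (intro tendsto_intros tendsto_neg_powr filterlim_ident) auto
    then show "((\<lambda>u. K * u powr (\<beta> - 1)) \<longlongrightarrow> 0) at_top" by simp
  qed auto
qed


section \<open>Exponential moments of the jump measure on the scale v\<close>

lemma nn_integral_tail_shell_le:
  assumes "1 \<le> u" "0 \<le> C" "S \<subseteq> {u..}" "S \<in> sets borel" "\<And>y. y \<in> S \<Longrightarrow> g y \<le> C"
  shows "(\<integral>\<^sup>+y. ennreal (g y) * indicator S y \<partial>\<nu>) \<le> ennreal (C * exp (- log_tail \<nu> u))"
proof -
  have "(\<integral>\<^sup>+y. ennreal (g y) * indicator S y \<partial>\<nu>) \<le> (\<integral>\<^sup>+y. ennreal C * indicator {u..} y \<partial>\<nu>)"
    using assms by (intro nn_integral_mono) (auto simp: indicator_def intro!: ennreal_leI)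
  also have "\<dots> = ennreal C * emeasure \<nu> {u..}"
    by (simp add: nn_integral_cmult_indicator sets_nu)
  also have "\<dots> = ennreal (C * exp (- log_tail \<nu> u))"
    using assms by (simp add: emeasure_tail ennreal_mult)
  finally show ?thesis .
qed

text \<open>On a dyadic shell from u to 2 u with u \<le> \<kappa> v, the Potter bound replaces
  \<open>log_tail \<nu> v\<close> by a multiple of \<open>log_tail \<nu> u\<close>, and the
  remaining factor (u / v) powr (1 - \<beta>) is small by the choice of \<kappa>. The exponential
  thus uses at most half of the tail exponent; the other half is summable over the shells.\<close>

lemma medium_jumps_exp_moment:
  assumes K: "0 < K"
  obtains \<kappa> B where "0 < \<kappa>" "\<kappa> \<le> 1" "0 \<le> B"
    "eventually (\<lambda>v. (\<integral>\<^sup>+y. ennreal (exp (K * log_tail \<nu> v / v * y)) * indicator {1..\<kappa> * v} y \<partial>\<nu>) \<le> ennreal B) at_top"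
proof -
  define \<beta> where "\<beta> = (1 + \<alpha>) / 2"
  have \<beta>: "\<alpha> < \<beta>" "\<beta> < 1" using \<alpha> by (auto simp: \<beta>_def)
  obtain R1 where R1: "1 \<le> R1"
    "\<And>u v. R1 \<le> u \<Longrightarrow> u \<le> v \<Longrightarrow> log_tail \<nu> v \<le> 2 powr \<beta> * (v / u) powr \<beta> * log_tail \<nu> u"
    using log_tail_potter[OF \<beta>(1)] by blast
  obtain r c R2 where r: "1 < r" "0 < c" "1 \<le> R2"
    "\<And>k u. R2 \<le> u \<Longrightarrow> c * r ^ k \<le> log_tail \<nu> (2 ^ k * u)"
    using log_tail_dyadic_growth by blast
  define R where "R = max R1 R2"
  have R: "1 \<le> R" "R1 \<le> R" "R2 \<le> R" using R1 by (auto simp: R_def)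
  \<comment> \<open>The 8 is a product of three factors 2: the ratio of the endpoints of a shell, a
    bound for \<open>2 powr \<beta>\<close>, and the half of the tail exponent that has to
    survive.\<close>
  define \<kappa> where "\<kappa> = min 1 ((1 / (8 * K)) powr (1 / (1 - \<beta>)))"
  have \<kappa>: "0 < \<kappa>" "\<kappa> \<le> 1" using K by (auto simp: \<kappa>_def)
  have \<kappa>2: "\<kappa> powr (1 - \<beta>) \<le> 1 / (8 * K)"
  proof -
    have "\<kappa> powr (1 - \<beta>) \<le> ((1 / (8 * K)) powr (1 / (1 - \<beta>))) powr (1 - \<beta>)"
      using \<beta> \<kappa> by (intro powr_mono2) (auto simp: \<kappa>_def)
    also have "\<dots> = 1 / (8 * K)" using \<beta> K by (simp add: powr_powr)
    finally show ?thesis .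
  qed
  define a where "a k = exp (- (c * r ^ k) / 2)" for k :: nat
  have a0: "0 \<le> a k" for k by (simp add: a_def)
  have "summable a"
  proof (rule summable_comparison_test')
    show "summable (\<lambda>k. 2 / c * (1 / r) ^ k)" using r by (intro summable_mult summable_geometric) auto
    fix k :: nat
    have "0 < c * r ^ k / 2" using r by simp
    moreover have "c * r ^ k / 2 \<le> exp (c * r ^ k / 2)"
      using exp_ge_add_one_self[of "c * r ^ k / 2"] by linarith
    ultimately have "inverse (exp (c * r ^ k / 2)) \<le> inverse (c * r ^ k / 2)" by (intro le_imp_inverse_le)
    then show "norm (a k) \<le> 2 / c * (1 / r) ^ k"
      by (simp add: a_def exp_minus divide_simps)
  qed
  \<comment> \<open>For large v the exponent \<gamma> is at most 1, so jumps in [1, R] contribute at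
    most the first term; beyond \<open>R\<close> the shells take over.\<close>
  define B where "B = exp R * measure \<nu> {1..} + suminf a"
  have B: "0 \<le> B" using a0 \<open>summable a\<close> by (simp add: B_def suminf_nonneg)
  have "eventually (\<lambda>v. log_tail \<nu> v / v < 1 / K) at_top"
    using K by (intro order_tendstoD(2)[OF log_tail_sublinear]) auto
  with eventually_ge_at_top[of R]
  have "eventually (\<lambda>v. (\<integral>\<^sup>+y. ennreal (exp (K * log_tail \<nu> v / v * y)) * indicator {1..\<kappa> * v} y \<partial>\<nu>) \<le> ennreal B) at_top"
  proof eventually_elim
    case (elim v)
    define \<gamma> where "\<gamma> = K * log_tail \<nu> v / v"
    have v: "1 \<le> v" "0 < log_tail \<nu> v" using elim R log_tail_pos[of v] by auto
    have \<gamma>: "0 < \<gamma>" "\<gamma> \<le> 1" using v elim K by (auto simp: \<gamma>_def field_simps)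
    define S where "S k = {2 ^ k * R..2 ^ Suc k * R} \<inter> {1..\<kappa> * v}" for k :: nat
    have shell: "(\<integral>\<^sup>+y. ennreal (exp (\<gamma> * y)) * indicator (S k) y \<partial>\<nu>) \<le> ennreal (a k)" for k
    proof -
      define u where "u = 2 ^ k * R"
      have "1 * R \<le> u" unfolding u_def using R by (intro mult_right_mono) auto
      then have u: "R1 \<le> u" "1 \<le> u" using R by auto
      have f: "c * r ^ k \<le> log_tail \<nu> u" using r(4)[of R k] R by (simp add: u_def)
      have *: "exp (\<gamma> * y) \<le> exp (log_tail \<nu> u / 2)" if "y \<in> S k" for y
      proof -
        have y: "u \<le> y" "y \<le> 2 * u" "y \<le> \<kappa> * v" using that by (auto simp: S_def u_def)
        have "\<kappa> * v \<le> 1 * v" using \<kappa> v by (intro mult_right_mono) auto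
        then have "u \<le> v" using y by linarith
        moreover have "u / v \<le> \<kappa>" using y v by (simp add: divide_le_eq)
        ultimately have uv: "u \<le> v" "u / v \<le> \<kappa>" by auto
        have "\<gamma> * y \<le> \<gamma> * (2 * u)" using y \<gamma> by (intro mult_left_mono) auto
        also have "\<dots> = 2 * K * (u / v) * log_tail \<nu> v" by (simp add: \<gamma>_def)
        also have "\<dots> \<le> 2 * K * (u / v) * (2 powr \<beta> * (v / u) powr \<beta> * log_tail \<nu> u)"
          using R1(2)[OF u(1) uv(1)] K u v by (intro mult_left_mono) auto
        also have "\<dots> = 2 * K * 2 powr \<beta> * ((u / v) * (v / u) powr \<beta>) * log_tail \<nu> u" by simp
        also have "(u / v) * (v / u) powr \<beta> = (u / v) powr (1 - \<beta>)"
          using u v by (simp add: powr_diff powr_divide)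
        also have "2 * K * 2 powr \<beta> * (u / v) powr (1 - \<beta>) * log_tail \<nu> u
            \<le> 2 * K * 2 powr 1 * (1 / (8 * K)) * log_tail \<nu> u"
        proof (intro mult_right_mono mult_mono)
          have "(u / v) powr (1 - \<beta>) \<le> \<kappa> powr (1 - \<beta>)"
            using u v uv \<beta> by (intro powr_mono2) auto
          then show "(u / v) powr (1 - \<beta>) \<le> 1 / (8 * K)" using \<kappa>2 by simp
          show "2 powr \<beta> \<le> 2 powr (1::real)" using \<beta> by (intro powr_mono) auto
        qed (use K log_tail_pos[OF u(2)] in auto)
        also have "\<dots> = log_tail \<nu> u / 2" using K by simp
        finally show ?thesis by simp
      qed
      have "(\<integral>\<^sup>+y. ennreal (exp (\<gamma> * y)) * indicator (S k) y \<partial>\<nu>)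
          \<le> ennreal (exp (log_tail \<nu> u / 2) * exp (- log_tail \<nu> u))"
        using * u by (intro nn_integral_tail_shell_le) (auto simp: S_def u_def)
      also have "\<dots> \<le> ennreal (a k)"
        using f by (intro ennreal_leI) (simp add: a_def flip: exp_add)
      finally show ?thesis .
    qed
    have le: "ennreal (exp (\<gamma> * y)) * indicator {1..\<kappa> * v} y
        \<le> ennreal (exp (\<gamma> * y)) * indicator {1..R} y + (\<Sum>k. ennreal (exp (\<gamma> * y)) * indicator (S k) y)" for y
    proof (cases "y \<in> {1..\<kappa> * v} \<and> R < y")
      case False
      then show ?thesis by (auto simp: indicator_def)
    next
      case True
      have Rp: "0 < R" using R by simp
      define k where "k = nat \<lfloor>log 2 (y / R)\<rfloor>"
      have "0 \<le> log 2 (y / R)" using True Rp by simp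
      then have k: "k \<le> log 2 (y / R)" "log 2 (y / R) \<le> Suc k"
        unfolding k_def by linarith+
      have "2 powr k \<le> 2 powr (log 2 (y / R))" "2 powr (log 2 (y / R)) \<le> 2 powr Suc k"
        using k by (intro powr_mono; simp)+
      then have "2 ^ k \<le> y / R" "y / R \<le> 2 ^ Suc k"
        using True Rp by (simp_all only: powr_realpow) (simp_all add: powr_realpow)
      then have "y \<in> S k" using True Rp by (auto simp: S_def field_simps)
      then have "ennreal (exp (\<gamma> * y)) * indicator {1..\<kappa> * v} y
          = (\<Sum>i\<in>{k}. ennreal (exp (\<gamma> * y)) * indicator (S i) y)" using True by simp
      also have "\<dots> \<le> (\<Sum>k. ennreal (exp (\<gamma> * y)) * indicator (S k) y)"
        by (intro sum_le_suminf) auto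
      finally show ?thesis by (simp add: add_increasing)
    qed
    have "(\<integral>\<^sup>+y. ennreal (exp (\<gamma> * y)) * indicator {1..\<kappa> * v} y \<partial>\<nu>)
        \<le> (\<integral>\<^sup>+y. ennreal (exp (\<gamma> * y)) * indicator {1..R} y + (\<Sum>k. ennreal (exp (\<gamma> * y)) * indicator (S k) y) \<partial>\<nu>)"
      by (intro nn_integral_mono le)
    also have "\<dots> = (\<integral>\<^sup>+y. ennreal (exp (\<gamma> * y)) * indicator {1..R} y \<partial>\<nu>)
        + (\<Sum>k. \<integral>\<^sup>+y. ennreal (exp (\<gamma> * y)) * indicator (S k) y \<partial>\<nu>)"
    proof (subst nn_integral_suminf [symmetric])
      show "(\<lambda>y. ennreal (exp (\<gamma> * y)) * indicator (S k) y) \<in> borel_measurable \<nu>" for k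
        unfolding S_def by measurable
      show "(\<integral>\<^sup>+y. ennreal (exp (\<gamma> * y)) * indicator {1..R} y + (\<Sum>k. ennreal (exp (\<gamma> * y)) * indicator (S k) y) \<partial>\<nu>)
        = (\<integral>\<^sup>+y. ennreal (exp (\<gamma> * y)) * indicator {1..R} y \<partial>\<nu>)
        + (\<integral>\<^sup>+y. (\<Sum>k. ennreal (exp (\<gamma> * y)) * indicator (S k) y) \<partial>\<nu>)"
        unfolding S_def by (intro nn_integral_add) measurable
    qed
    also have "\<dots> \<le> ennreal (exp R * exp (- log_tail \<nu> 1)) + (\<Sum>k. ennreal (a k))"
    proof (intro add_mono suminf_le shell nn_integral_tail_shell_le)
      show "exp (\<gamma> * y) \<le> exp R" if "y \<in> {1..R}" for y
      proof -
        have "\<gamma> * y \<le> 1 * R" using that \<gamma> by (intro mult_mono) auto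
        then show ?thesis by simp
      qed
    qed auto
    also have "(\<Sum>k. ennreal (a k)) = ennreal (suminf a)"
      using \<open>summable a\<close> a0 by (intro suminf_ennreal2)
    also have "ennreal (exp R * exp (- log_tail \<nu> 1)) + ennreal (suminf a) = ennreal B"
      using \<open>summable a\<close> a0 by (simp add: B_def measure_tail suminf_nonneg flip: ennreal_plus)
    finally show ?case by (simp add: \<gamma>_def)
  qed
  with \<kappa> B that show ?thesis by blast
qed

text \<open>The grid is equidistant in the scale of \<open>x powr \<alpha>\<close>, so the weight varies by the same
  small factor on every cell.\<close>

lemma big_jumps_weight:
  assumes "0 < \<kappa>" "0 < \<theta>" "0 < \<delta>" "\<delta> < 1" "0 < \<eta>"
  shows "eventually (\<lambda>v. (\<integral>\<^sup>+y. ennreal (exp ((1 - \<delta>) * log_tail \<nu> v * (y / v) powr \<alpha>))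
    * indicator {\<kappa> * v..\<theta> * v} y \<partial>\<nu>) \<le> ennreal \<eta>) at_top"
proof -
  \<comment> \<open>Passing to the next cell costs at most \<open>h\<close>, while the gap between
    \<delta> and \<delta> / 2 gains \<delta> / 2 times \<open>z i\<close>, which is at least 2 h.
    The net exponent is at most - h, uniformly over the cells.\<close>
  define h where "h = \<delta> * \<kappa> powr \<alpha> / 4"
  have h: "0 < h" using assms by (simp add: h_def)
  define z where "z i = \<kappa> powr \<alpha> + real i * h" for i :: nat
  have z: "\<kappa> powr \<alpha> \<le> z i" "0 < z i" for i using h assms by (auto simp: z_def add_pos_nonneg)
  define x where "x i = z i powr (1 / \<alpha>)" for i
  have x: "0 < x i" "x i powr \<alpha> = z i" for i using z[of i] \<alpha> by (auto simp: x_def powr_powr)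
  define N where "N = nat \<lceil>\<theta> powr \<alpha> / h\<rceil>"
  \<comment> \<open>Only finitely many grid points occur, so the pointwise limits of the tail ratios
    suffice. Half of \<delta> is given away here.\<close>
  have ev1: "eventually (\<lambda>v. \<forall>i\<in>{..N}. (1 - \<delta> / 2) * z i < log_tail \<nu> (x i * v) / log_tail \<nu> v) at_top"
  proof (intro eventually_ball_finite ballI)
    fix i
    have "(1 - \<delta> / 2) * z i < 1 * z i" using assms z[of i] by (intro mult_strict_right_mono) auto
    then show "eventually (\<lambda>v. (1 - \<delta> / 2) * z i < log_tail \<nu> (x i * v) / log_tail \<nu> v) at_top"
      using log_tail_ratio[OF x(1)[of i]] x(2)[of i] by (intro order_tendstoD(1)) auto
  qed simp
  have "((\<lambda>v. real (Suc N) * exp (- h * log_tail \<nu> v)) \<longlongrightarrow> real (Suc N) * 0) at_top"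
    using h
    by (intro tendsto_intros filterlim_compose[OF exp_at_bot]
          filterlim_tendsto_neg_mult_at_bot[OF tendsto_const _ log_tail_at_top]) auto
  then have ev2: "eventually (\<lambda>v. real (Suc N) * exp (- h * log_tail \<nu> v) < \<eta>) at_top"
    using assms by (intro order_tendstoD(2)) auto
  have ev3: "eventually (\<lambda>v. \<forall>i\<in>{..N}. 1 / x i \<le> v) at_top"
    by (intro eventually_ball_finite ballI eventually_ge_at_top) auto
  show ?thesis using ev1 ev2 ev3 eventually_ge_at_top[of 1]
  proof eventually_elim
    case (elim v)
    define g where "g y = exp ((1 - \<delta>) * log_tail \<nu> v * (y / v) powr \<alpha>)" for y
    have v: "1 \<le> v" "0 < log_tail \<nu> v" using elim log_tail_pos[of v] by auto
    define S where "S i = {x i * v..x (Suc i) * v}" for i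
    have shell: "(\<integral>\<^sup>+y. ennreal (g y) * indicator (S i) y \<partial>\<nu>) \<le> ennreal (exp (- h * log_tail \<nu> v))"
      if "i \<le> N" for i
    proof -
      have "1 / x i \<le> v" using elim(3) that by simp
      then have xv: "1 \<le> x i * v" using x(1)[of i] by (simp add: field_simps)
      have f: "(1 - \<delta> / 2) * z i * log_tail \<nu> v \<le> log_tail \<nu> (x i * v)"
        using bspec[OF elim(1), of i] that v by (simp add: field_simps)
      have g: "g y \<le> exp ((1 - \<delta>) * log_tail \<nu> v * z (Suc i))" if "y \<in> S i" for y
      proof -
        have "0 \<le> x i * v" using xv by simp
        then have y: "0 \<le> y / v" "y / v \<le> x (Suc i)" using that v by (auto simp: S_def field_simps)
        have "(y / v) powr \<alpha> \<le> x (Suc i) powr \<alpha>" using y \<alpha> by (intro powr_mono2) auto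
        then show ?thesis using x(2) v assms by (auto simp: g_def intro!: mult_left_mono)
      qed
      have "(\<integral>\<^sup>+y. ennreal (g y) * indicator (S i) y \<partial>\<nu>)
          \<le> ennreal (exp ((1 - \<delta>) * log_tail \<nu> v * z (Suc i)) * exp (- log_tail \<nu> (x i * v)))"
        using xv g by (intro nn_integral_tail_shell_le) (auto simp: S_def)
      also have "\<dots> \<le> ennreal (exp (- h * log_tail \<nu> v))"
      proof -
        have "(1 - \<delta>) * z (Suc i) - (1 - \<delta> / 2) * z i \<le> - h"
        proof -
          have "(1 - \<delta>) * z (Suc i) - (1 - \<delta> / 2) * z i = (1 - \<delta>) * h - \<delta> / 2 * z i"
            by (simp add: z_def algebra_simps)
          also have "\<dots> \<le> 1 * h - \<delta> / 2 * \<kappa> powr \<alpha>"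
            using assms z[of i] h by (intro diff_mono mult_right_mono mult_left_mono) auto
          also have "\<dots> = - h" by (simp add: h_def)
          finally show ?thesis .
        qed
        then have "((1 - \<delta>) * z (Suc i) - (1 - \<delta> / 2) * z i) * log_tail \<nu> v \<le> - h * log_tail \<nu> v"
          using v by (intro mult_right_mono) auto
        then have "(1 - \<delta>) * log_tail \<nu> v * z (Suc i) - log_tail \<nu> (x i * v) \<le> - h * log_tail \<nu> v"
          using f by (simp add: algebra_simps)
        then show ?thesis by (intro ennreal_leI) (simp flip: exp_add)
      qed
      finally show ?thesis .
    qed
    have le: "ennreal (g y) * indicator {\<kappa> * v..\<theta> * v} y \<le> (\<Sum>i\<le>N. ennreal (g y) * indicator (S i) y)" for y
    proof (cases "y \<in> {\<kappa> * v..\<theta> * v}")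
      case True
      define s where "s = (y / v) powr \<alpha>"
      have "\<kappa> \<le> y / v" "y / v \<le> \<theta>" using True v by (auto simp: field_simps)
      then have s: "\<kappa> powr \<alpha> \<le> s" "s \<le> \<theta> powr \<alpha>" and y: "0 < y / v"
        using assms \<alpha> by (auto simp: s_def intro!: powr_mono2)
      have "s powr (1 / \<alpha>) = (y / v) powr (\<alpha> * (1 / \<alpha>))" unfolding s_def by (rule powr_powr)
      also have "\<alpha> * (1 / \<alpha>) = 1" using \<alpha> by simp
      finally have ys: "y / v = s powr (1 / \<alpha>)" using y powr_one[of "y / v"] by linarith
      define i where "i = nat \<lfloor>(s - \<kappa> powr \<alpha>) / h\<rfloor>"
      have i: "real i \<le> (s - \<kappa> powr \<alpha>) / h" "(s - \<kappa> powr \<alpha>) / h \<le> Suc i"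
        using divide_nonneg_nonneg[of "s - \<kappa> powr \<alpha>" h] s h unfolding i_def by linarith+
      have "(s - \<kappa> powr \<alpha>) / h \<le> \<theta> powr \<alpha> / h"
        using s h powr_ge_zero[of \<kappa> \<alpha>] by (intro divide_right_mono; linarith)
      then have "i \<le> N" unfolding i_def N_def by linarith
      have "z i \<le> s" "s \<le> z (Suc i)" using i h by (auto simp: z_def field_simps)
      then have "x i \<le> y / v" "y / v \<le> x (Suc i)"
        unfolding ys x_def using z[of i] \<alpha> by (auto intro!: powr_mono2)
      then have "y \<in> S i" using v by (auto simp: S_def field_simps)
      then have "ennreal (g y) * indicator {\<kappa> * v..\<theta> * v} y = (\<Sum>i\<in>{i}. ennreal (g y) * indicator (S i) y)"
        using True by simp
      also have "\<dots> \<le> (\<Sum>i\<le>N. ennreal (g y) * indicator (S i) y)"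
        using \<open>i \<le> N\<close> by (intro sum_mono2) auto
      finally show ?thesis .
    qed simp
    have "(\<integral>\<^sup>+y. ennreal (g y) * indicator {\<kappa> * v..\<theta> * v} y \<partial>\<nu>)
        \<le> (\<integral>\<^sup>+y. (\<Sum>i\<le>N. ennreal (g y) * indicator (S i) y) \<partial>\<nu>)"
      by (intro nn_integral_mono le)
    also have "\<dots> = (\<Sum>i\<le>N. \<integral>\<^sup>+y. ennreal (g y) * indicator (S i) y \<partial>\<nu>)"
      by (intro nn_integral_sum) (auto simp: g_def S_def sets_nu)
    also have "\<dots> \<le> (\<Sum>i\<le>N. ennreal (exp (- h * log_tail \<nu> v)))"
      by (intro sum_mono shell) auto
    also have "\<dots> = ennreal (real (Suc N) * exp (- h * log_tail \<nu> v))"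
      by (simp add: ennreal_mult ennreal_of_nat_eq_real_of_nat)
    also have "\<dots> \<le> ennreal \<eta>" using elim by (intro ennreal_leI) auto
    finally show ?case by (simp add: g_def)
  qed
qed

end

section \<open>Compound Poisson laws\<close>

lemma real_distribution_convolution:
  assumes "real_distribution M" "real_distribution N"
  shows "real_distribution (M \<star> N)"
proof -
  interpret M: real_distribution M by fact
  interpret N: real_distribution N by fact
  interpret P: pair_prob_space M N ..
  have "prob_space (M \<star> N)" unfolding convolution_def
    by (intro P.prob_space_distr) simp
  then show ?thesis by (simp add: real_distribution_def real_distribution_axioms_def)
qed

lemma char_convolution:
  assumes "real_distribution M" "real_distribution N"
  shows "char (M \<star> N) u = char M u * char N u"
proof -
  interpret M: real_distribution M by fact
  interpret N: real_distribution N by fact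
  interpret P: pair_prob_space M N ..
  have "char (M \<star> N) u = (CLINT z|M \<Otimes>\<^sub>M N. iexp (u * (fst z + snd z)))"
    by (simp add: char_def convolution_def integral_distr split_beta)
  also have "\<dots> = (CLINT x|M. CLINT y|N. iexp (u * (x + y)))"
  proof -
    have "integrable (M \<Otimes>\<^sub>M N) (\<lambda>z. iexp (u * (fst z + snd z)))"
      by (rule P.integrable_const_bound[where B=1]) (simp_all del: of_real_mult of_real_add)
    from P.integral_fst'[OF this] show ?thesis by simp
  qed
  also have "\<dots> = (CLINT x|M. iexp (u * x) * char N u)"
    by (simp add: char_def distrib_left exp_add)
  also have "\<dots> = char M u * char N u" by (simp add: char_def)
  finally show ?thesis .
qed

primrec conv_pow :: "real measure \<Rightarrow> nat \<Rightarrow> real measure" where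
  "conv_pow p 0 = return borel 0"
| "conv_pow p (Suc k) = (p \<star> conv_pow p k)"

lemma real_distribution_return: "real_distribution (return borel (x :: real))"
  by (simp add: real_distribution_def real_distribution_axioms_def prob_space_return)

lemma real_distribution_conv_pow:
  "real_distribution p \<Longrightarrow> real_distribution (conv_pow p k)"
  by (induction k) (auto intro: real_distribution_return real_distribution_convolution)

lemma char_conv_pow:
  assumes "real_distribution p"
  shows "char (conv_pow p k) u = char p u ^ k"
  using assms
  by (induction k)
     (simp_all add: char_convolution real_distribution_conv_pow, simp add: char_def integral_return)

text \<open>The step hypothesis limits how much one summand can raise H, whatever the rest of the
  sum is; peeling off independent summands then produces a power. Both later uses fit: exponentials,
  where H and w coincide, and the weight built on the jump cost.\<close>

lemma nn_integral_conv_pow_le: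
  assumes p: "real_distribution p"
    and [measurable]: "H \<in> borel_measurable borel" "w \<in> borel_measurable borel"
    and step: "AE x in p. \<forall>y. H (x + y) \<le> w x * H y" and "H 0 \<le> (1 :: ennreal)"
  shows "(\<integral>\<^sup>+x. H x \<partial>conv_pow p k) \<le> (\<integral>\<^sup>+x. w x \<partial>p) ^ k"
proof (induction k)
  case 0
  then show ?case using assms by (simp add: nn_integral_return)
next
  case (Suc k)
  interpret p: real_distribution p by fact
  interpret q: real_distribution "conv_pow p k" using p by (rule real_distribution_conv_pow)
  have "(\<integral>\<^sup>+x. H x \<partial>conv_pow p (Suc k)) = (\<integral>\<^sup>+x. \<integral>\<^sup>+y. H (x + y) \<partial>conv_pow p k \<partial>p)"
    by (simp add: nn_integral_convolution p.finite_measure_axioms q.finite_measure_axioms)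
  also have "\<dots> \<le> (\<integral>\<^sup>+x. \<integral>\<^sup>+y. w x * H y \<partial>conv_pow p k \<partial>p)"
    using step by (intro nn_integral_mono_AE) (auto intro!: nn_integral_mono)
  also have "\<dots> = (\<integral>\<^sup>+x. w x * (\<integral>\<^sup>+y. H y \<partial>conv_pow p k) \<partial>p)"
    by (intro nn_integral_cong nn_integral_cmult) simp
  also have "\<dots> = (\<integral>\<^sup>+x. w x \<partial>p) * (\<integral>\<^sup>+y. H y \<partial>conv_pow p k)"
    by (intro nn_integral_multc) simp
  also have "\<dots> \<le> (\<integral>\<^sup>+x. w x \<partial>p) * (\<integral>\<^sup>+x. w x \<partial>p) ^ k"
    by (intro mult_left_mono Suc) auto
  finally show ?case by simp
qed

text \<open>One way for the sum to reach \<open>a\<close> is that every summand reaches its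
  prescribed share; by independence this has the product as its probability.\<close>

lemma emeasure_conv_pow_ge:
  assumes p: "real_distribution p" and "a \<le> (\<Sum>i<k. x i)"
  shows "(\<Prod>i<k. emeasure p {x i..}) \<le> emeasure (conv_pow p k) {a..}"
  using assms(2)
proof (induction k arbitrary: a)
  case 0
  then show ?case by (simp add: indicator_def)
next
  case (Suc k)
  interpret p: real_distribution p by fact
  interpret q: real_distribution "conv_pow p k" using p by (rule real_distribution_conv_pow)
  have "(\<Prod>i<Suc k. emeasure p {x i..}) \<le> emeasure p {x k..} * emeasure (conv_pow p k) {a - x k..}"
    using Suc.prems by (simp add: mult.commute) (intro mult_left_mono Suc.IH; simp)
  also have "\<dots> = (\<integral>\<^sup>+y. emeasure (conv_pow p k) {a - x k..} * indicator {x k..} y \<partial>p)"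
    by (subst nn_integral_cmult_indicator) (auto simp: mult.commute)
  also have "\<dots> \<le> (\<integral>\<^sup>+y. emeasure (conv_pow p k) {b. b + y \<in> {a..}} \<partial>p)"
    by (intro nn_integral_mono) (auto simp: indicator_def intro!: emeasure_mono)
  also have "\<dots> = emeasure (conv_pow p (Suc k)) {a..}"
    by (simp add: convolution_emeasure p.finite_measure_axioms q.finite_measure_axioms)
  finally show ?case .
qed

text \<open>A measure of mass zero cannot be normalised to a jump law, hence the separate
  branch.\<close>

definition compound_poisson :: "real measure \<Rightarrow> real measure" where
  "compound_poisson \<rho> =
     (if measure \<rho> UNIV = 0 then return borel 0
      else measure_pmf (poisson_pmf (measure \<rho> UNIV)) \<bind> conv_pow (density \<rho> (\<lambda>_. ennreal (1 / measure \<rho> UNIV))))"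

text \<open>This is the probability generating function of the Poisson law; it turns bounds for k
  summands into a bound for the mixture.\<close>

lemma exp_series_sums_ennreal:
  assumes "0 \<le> (m :: real)" "0 < c"
  shows "(\<integral>\<^sup>+k. ennreal m ^ k \<partial>measure_pmf (poisson_pmf c)) = ennreal (exp (c * (m - 1)))"
proof -
  have sums: "(\<lambda>k. exp (- c) * ((c * m) ^ k / fact k)) sums (exp (- c) * exp (c * m))"
    using exp_converges[of "c * m"] by (intro sums_mult) (simp add: divide_inverse mult.commute)
  have "(\<integral>\<^sup>+k. ennreal m ^ k \<partial>measure_pmf (poisson_pmf c))
      = (\<integral>\<^sup>+k. ennreal (exp (- c) * ((c * m) ^ k / fact k)) \<partial>count_space UNIV)"
    using assms by (subst nn_integral_measure_pmf)
      (simp add: ennreal_power power_mult_distrib mult_ac flip: ennreal_mult)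
  also have "\<dots> = (\<Sum>k. ennreal (exp (- c) * ((c * m) ^ k / fact k)))"
    by (rule nn_integral_count_space_nat)
  also have "\<dots> = ennreal (exp (- c) * exp (c * m))"
    using sums assms by (intro suminf_ennreal_eq) auto
  finally show ?thesis by (simp add: algebra_simps flip: exp_add)
qed

context
  fixes \<rho> :: "real measure"
  assumes fin: "finite_measure \<rho>" and sets [simp, measurable_cong]: "sets \<rho> = sets borel"
begin

interpretation finite_measure \<rho> by (rule fin)

lemma space_rho: "space \<rho> = UNIV"
  using sets_eq_imp_space_eq[OF sets] by simp

lemma real_distribution_normalized:
  assumes "measure \<rho> UNIV \<noteq> 0"
  shows "real_distribution (density \<rho> (\<lambda>_. ennreal (1 / measure \<rho> UNIV)))"
proof -
  have "emeasure (density \<rho> (\<lambda>_. ennreal (1 / measure \<rho> UNIV))) UNIV = 1"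
    using assms
    by (simp add: emeasure_density space_rho emeasure_eq_measure flip: ennreal_mult)
  then show ?thesis
    by (auto simp: real_distribution_def real_distribution_axioms_def space_rho intro!: prob_spaceI)
qed

lemma measurable_conv_pow:
  assumes "real_distribution p"
  shows "conv_pow p \<in> measurable (measure_pmf q) (subprob_algebra borel)"
proof -
  have "conv_pow p k \<in> space (subprob_algebra borel)" for k
  proof -
    interpret real_distribution "conv_pow p k" using assms by (rule real_distribution_conv_pow)
    show ?thesis by (simp add: space_subprob_algebra subprob_space_axioms)
  qed
  then show ?thesis
    by (subst measurable_cong_sets[OF sets_measure_pmf_count_space refl])
       (simp add: measurable_count_space_eq1 Pi_iff)
qed

lemma real_distribution_compound_poisson: "real_distribution (compound_poisson \<rho>)"
proof (cases "measure \<rho> UNIV = 0")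
  case True
  then show ?thesis by (simp add: compound_poisson_def real_distribution_return)
next
  case False
  define p where "p = density \<rho> (\<lambda>_. ennreal (1 / measure \<rho> UNIV))"
  have p: "real_distribution p" unfolding p_def using False by (rule real_distribution_normalized)
  have "prob_space (measure_pmf (poisson_pmf (measure \<rho> UNIV)) \<bind> conv_pow p)"
    by (intro measure_pmf.prob_space_bind[OF _ measurable_conv_pow[OF p]] AE_I2)
       (metis p real_distribution_conv_pow real_distribution.axioms(1))
  moreover have "sets (measure_pmf (poisson_pmf (measure \<rho> UNIV)) \<bind> conv_pow p) = sets borel"
    by (rule sets_bind[OF sets_kernel[OF measurable_conv_pow[OF p]]]) auto
  moreover have "space (measure_pmf (poisson_pmf (measure \<rho> UNIV)) \<bind> conv_pow p) = UNIV"
    using sets_eq_imp_space_eq[OF calculation(2)] by simp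
  ultimately show ?thesis
    using False by (simp add: compound_poisson_def p_def real_distribution_def real_distribution_axioms_def)
qed

lemma null_if_measure_0: "measure \<rho> UNIV = 0 \<Longrightarrow> AE x in \<rho>. False"
  by (simp add: AE_iff_measurable[OF _ refl] space_rho emeasure_eq_measure)

text \<open>Given the number k of jumps, the characteristic function is the k-th power of that of
  one jump, and the Poisson weights sum these powers to an exponential. The mixture formula
  \<open>bind\<close> is for bounded real integrands, so cosine and sine are treated
  separately.\<close>

lemma char_compound_poisson:
  "char (compound_poisson \<rho>) u = exp (CLINT y|\<rho>. iexp (u * y) - 1)"
proof (cases "measure \<rho> UNIV = 0")
  case True
  have "(CLINT y|\<rho>. iexp (u * y) - 1) = 0"
    using null_if_measure_0[OF True] by (intro integral_eq_zero_AE) auto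
  then show ?thesis using True
    by (simp add: compound_poisson_def char_def integral_return)
next
  case False
  define c where "c = measure \<rho> UNIV"
  have c: "0 < c" using False by (simp add: c_def order_less_le)
  define p where "p = density \<rho> (\<lambda>_. ennreal (1 / measure \<rho> UNIV))"
  have p: "real_distribution p" unfolding p_def using False by (rule real_distribution_normalized)
  interpret p: real_distribution p by fact
  interpret q: real_distribution "conv_pow p k" for k using p by (rule real_distribution_conv_pow)
  define P where "P = measure_pmf (poisson_pmf c)"
  have cp: "compound_poisson \<rho> = P \<bind> conv_pow p"
    using False by (simp add: compound_poisson_def p_def c_def P_def)
  interpret cp: real_distribution "P \<bind> conv_pow p"
    using real_distribution_compound_poisson by (simp add: cp)
  have bind: "integral\<^sup>L (P \<bind> conv_pow p) g = (\<integral>k. integral\<^sup>L (conv_pow p k) g \<partial>P)"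
    if "g \<in> borel_measurable borel" "\<And>x. \<bar>g x\<bar> \<le> 1" for g :: "real \<Rightarrow> real"
    unfolding P_def
    by (rule integral_bind[where K=borel and B=1 and B'=1, OF _ _ measurable_conv_pow[OF p]])
       (auto simp: that measure_pmf.finite_measure_axioms q.emeasure_space_1[simplified])
  have int: "integrable P (\<lambda>k. char p u ^ k)"
    unfolding P_def
    by (rule measure_pmf.integrable_const_bound[where B=1])
       (auto simp: norm_power p.cmod_char_le_1 power_le_one)
  have Re: "Re (char M u) = (\<integral>x. cos (u * x) \<partial>M)" and Im: "Im (char M u) = (\<integral>x. sin (u * x) \<partial>M)"
    if "real_distribution M" for M
  proof -
    interpret M: real_distribution M by fact
    have "integrable M (\<lambda>x. iexp (u * x))" by (intro M.integrable_iexp) auto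
    then show "Re (char M u) = (\<integral>x. cos (u * x) \<partial>M)" "Im (char M u) = (\<integral>x. sin (u * x) \<partial>M)"
      by (auto simp: char_def exp_Euler cos_of_real sin_of_real simp flip: integral_Re integral_Im of_real_mult)
  qed
  have "char (compound_poisson \<rho>) u = (CLINT k|P. char p u ^ k)"
  proof (rule complex_eqI)
    have "Re (char (P \<bind> conv_pow p) u) = (\<integral>k. Re (char (conv_pow p k) u) \<partial>P)"
      using Re[OF cp.real_distribution_axioms] Re[OF q.real_distribution_axioms] by (simp add: bind)
    then show "Re (char (compound_poisson \<rho>) u) = Re (CLINT k|P. char p u ^ k)"
      using int by (simp add: cp char_conv_pow p)
    have "Im (char (P \<bind> conv_pow p) u) = (\<integral>k. Im (char (conv_pow p k) u) \<partial>P)"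
      using Im[OF cp.real_distribution_axioms] Im[OF q.real_distribution_axioms] by (simp add: bind)
    then show "Im (char (compound_poisson \<rho>) u) = Im (CLINT k|P. char p u ^ k)"
      using int by (simp add: cp char_conv_pow p)
  qed
  also have "\<dots> = exp (c * (char p u - 1))"
  proof -
    have "(\<lambda>k. pmf (poisson_pmf c) k *\<^sub>R (char p u ^ k)) sums (CLINT k|P. char p u ^ k)"
    proof -
      have "integrable (count_space UNIV) (\<lambda>k. pmf (poisson_pmf c) k *\<^sub>R (char p u ^ k))"
        using int unfolding P_def by (simp add: integrable_density measure_pmf_eq_density)
      from sums_integral_count_space_nat[OF this] show ?thesis
        by (simp add: P_def measure_pmf_eq_density integral_density)
    qed
    moreover have "(\<lambda>k. pmf (poisson_pmf c) k *\<^sub>R (char p u ^ k)) sums (exp (- c) * exp (c * char p u))"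
    proof -
      have "(\<lambda>k. exp (- c) *\<^sub>R ((c * char p u) ^ k /\<^sub>R fact k)) sums (exp (- c) *\<^sub>R exp (c * char p u))"
        by (intro sums_scaleR_right exp_converges)
      moreover have "exp (- c) *\<^sub>R ((c * char p u) ^ k /\<^sub>R fact k) = pmf (poisson_pmf c) k *\<^sub>R (char p u ^ k)" for k
        using c by (simp add: scaleR_conv_of_real power_mult_distrib divide_inverse)
      ultimately show ?thesis by (simp add: scaleR_conv_of_real exp_of_real)
    qed
    ultimately have "(CLINT k|P. char p u ^ k) = exp (- c) * exp (c * char p u)"
      by (rule sums_unique2)
    then show ?thesis by (simp add: algebra_simps flip: exp_add exp_of_real)
  qed
  also have "c * (char p u - 1) = (CLINT y|\<rho>. iexp (u * y) - 1)"
  proof -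
    have "char p u - 1 = (CLINT y|p. iexp (u * y) - 1)"
      using p.prob_space by (subst Bochner_Integration.integral_diff)
        (auto intro!: p.integrable_iexp simp: char_def)
    also have "\<dots> = (CLINT y|\<rho>. (1 / c) *\<^sub>R (iexp (u * y) - 1))"
      unfolding p_def c_def by (subst integral_density) auto
    finally show ?thesis using c by (simp add: scaleR_conv_of_real)
  qed
  finally show ?thesis .
qed

text \<open>The Poisson generating function leaves only the excess of the integral of w over the
  total mass. This cancellation is essential for small jumps, whose total mass may grow without
  bound as the cut-off is lowered.\<close>

lemma nn_integral_compound_poisson_le:
  assumes [measurable]: "H \<in> borel_measurable borel" "w \<in> borel_measurable borel"
    and step: "AE x in \<rho>. \<forall>y. H (x + y) \<le> w x * H y" and "H 0 \<le> (1 :: ennreal)"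
    and w: "(\<integral>\<^sup>+x. w x \<partial>\<rho>) \<le> ennreal m" "0 \<le> m"
  shows "(\<integral>\<^sup>+x. H x \<partial>compound_poisson \<rho>) \<le> ennreal (exp (m - measure \<rho> UNIV))"
proof (cases "measure \<rho> UNIV = 0")
  case True
  have "H 0 \<le> ennreal (exp m)"
    by (rule order_trans[OF assms(4)]) (use w in simp)
  then show ?thesis using True by (simp add: compound_poisson_def nn_integral_return)
next
  case False
  define c where "c = measure \<rho> UNIV"
  have c: "0 < c" using False by (simp add: c_def order_less_le)
  define p where "p = density \<rho> (\<lambda>_. ennreal (1 / measure \<rho> UNIV))"
  have p: "real_distribution p" unfolding p_def using False by (rule real_distribution_normalized)
  have step': "AE x in p. \<forall>y. H (x + y) \<le> w x * H y"
    unfolding p_def using step by (subst AE_density) auto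
  have wp: "(\<integral>\<^sup>+x. w x \<partial>p) \<le> ennreal (m / c)"
  proof -
    have "(\<integral>\<^sup>+x. w x \<partial>p) = (\<integral>\<^sup>+x. ennreal (1 / c) * w x \<partial>\<rho>)"
      unfolding p_def c_def by (rule nn_integral_density) simp_all
    also have "\<dots> = ennreal (1 / c) * (\<integral>\<^sup>+x. w x \<partial>\<rho>)" by (rule nn_integral_cmult) simp
    also have "\<dots> \<le> ennreal (1 / c) * ennreal m" by (intro mult_left_mono w) auto
    also have "\<dots> = ennreal (m / c)" using c w(2) by (subst ennreal_mult [symmetric]) auto
    finally show ?thesis .
  qed
  have cp: "compound_poisson \<rho> = measure_pmf (poisson_pmf c) \<bind> conv_pow p"
    using False by (simp add: compound_poisson_def p_def c_def)
  have "(\<integral>\<^sup>+x. H x \<partial>compound_poisson \<rho>)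
      = (\<integral>\<^sup>+k. \<integral>\<^sup>+x. H x \<partial>conv_pow p k \<partial>measure_pmf (poisson_pmf c))"
    unfolding cp by (rule nn_integral_bind[OF assms(1) measurable_conv_pow[OF p]])
  also have "\<dots> \<le> (\<integral>\<^sup>+k. ennreal (m / c) ^ k \<partial>measure_pmf (poisson_pmf c))"
  proof (intro nn_integral_mono)
    fix k
    have "(\<integral>\<^sup>+x. H x \<partial>conv_pow p k) \<le> (\<integral>\<^sup>+x. w x \<partial>p) ^ k"
      using p assms(1,2) step' assms(4) by (rule nn_integral_conv_pow_le)
    also have "\<dots> \<le> ennreal (m / c) ^ k" using wp by (intro power_mono) auto
    finally show "(\<integral>\<^sup>+x. H x \<partial>conv_pow p k) \<le> ennreal (m / c) ^ k" .
  qed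
  also have "\<dots> = ennreal (exp (c * (m / c - 1)))"
    using c w by (intro exp_series_sums_ennreal) auto
  also have "c * (m / c - 1) = m - c" using c by (simp add: field_simps)
  finally show ?thesis by (simp add: c_def)
qed

text \<open>Only the outcomes with exactly k jumps are kept. The k-th power of the mass in the
  Poisson weight cancels the normalisation of the k jump laws.\<close>

lemma measure_compound_poisson_ge:
  assumes "0 < measure \<rho> UNIV" "a \<le> (\<Sum>i<k. x i)"
  shows "exp (- measure \<rho> UNIV) / fact k * (\<Prod>i<k. measure \<rho> {x i..}) \<le> measure (compound_poisson \<rho>) {a..}"
proof -
  define c where "c = measure \<rho> UNIV"
  have c: "0 < c" using assms by (simp add: c_def)
  define p where "p = density \<rho> (\<lambda>_. ennreal (1 / measure \<rho> UNIV))"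
  have p: "real_distribution p" unfolding p_def using assms by (intro real_distribution_normalized) simp
  have cp_eq: "compound_poisson \<rho> = measure_pmf (poisson_pmf c) \<bind> conv_pow p"
    using c by (simp add: compound_poisson_def p_def c_def)
  interpret cp: real_distribution "compound_poisson \<rho>" by (rule real_distribution_compound_poisson)
  have px: "emeasure p {x i..} = ennreal (measure \<rho> {x i..} / c)" for i
    using c unfolding p_def c_def
    by (simp add: emeasure_density nn_integral_cmult_indicator emeasure_eq_measure flip: ennreal_mult)
  have "ennreal (exp (- c) / fact k * (\<Prod>i<k. measure \<rho> {x i..}))
      = ennreal (pmf (poisson_pmf c) k) * (\<Prod>i<k. emeasure p {x i..})"
    using c by (subst px) (simp add: prod_ennreal prod_dividef prod_nonneg ennreal_mult [symmetric])
  also have "\<dots> \<le> ennreal (pmf (poisson_pmf c) k) * emeasure (conv_pow p k) {a..}"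
    by (intro mult_left_mono emeasure_conv_pow_ge assms p) auto
  also have "\<dots> = (\<integral>\<^sup>+j. emeasure (conv_pow p j) {a..} * indicator {k} j \<partial>measure_pmf (poisson_pmf c))"
    using c by (subst nn_integral_indicator_singleton) (auto simp: emeasure_pmf_single mult.commute)
  also have "\<dots> \<le> (\<integral>\<^sup>+j. emeasure (conv_pow p j) {a..} \<partial>measure_pmf (poisson_pmf c))"
    by (intro nn_integral_mono) (auto simp: indicator_def)
  also have "\<dots> = emeasure (compound_poisson \<rho>) {a..}"
    unfolding cp_eq by (intro emeasure_bind[OF _ measurable_conv_pow[OF p], symmetric]) auto
  finally show ?thesis by (simp add: cp.emeasure_eq_measure c_def)
qed

end

section \<open>Approximation of the truncated Levy law\<close>

definition jump_part :: "real measure \<Rightarrow> real \<Rightarrow> real set \<Rightarrow> real measure" where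
  "jump_part \<nu> t S = density \<nu> (\<lambda>y. ennreal t * indicator S y)"

text \<open>Open at the inner radius, so that adjacent shells are disjoint; closed at the outer one,
  so that the outermost shell includes the truncation bound.\<close>

definition jump_shell :: "real \<Rightarrow> real \<Rightarrow> real set" where
  "jump_shell a b = {y. a < \<bar>y\<bar> \<and> \<bar>y\<bar> \<le> b}"

definition gauss_part :: "real \<Rightarrow> real \<Rightarrow> real \<Rightarrow> real measure" where
  "gauss_part d \<mu> t = distr std_normal_distribution borel (\<lambda>z. \<mu> * t + sqrt (d * t) * z)"

text \<open>The cut-off 1 / (n + 1) keeps the jump measure finite and is removed in the limit, so
  every estimate for this law has to be uniform in \<open>n\<close>.\<close>

definition small_part :: "real \<Rightarrow> real \<Rightarrow> real measure \<Rightarrow> real \<Rightarrow> real \<Rightarrow> nat \<Rightarrow> real measure" where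
  "small_part d \<mu> \<nu> t b n =
     (gauss_part d \<mu> t \<star> compound_poisson (jump_part \<nu> t (jump_shell (1 / Suc n) b)))"

text \<open>The jumps below and above \<open>b\<close> form separate factors because their tails are
  estimated with different weights.\<close>

definition levy_approx :: "real \<Rightarrow> real \<Rightarrow> real measure \<Rightarrow> real \<Rightarrow> real \<Rightarrow> real \<Rightarrow> nat \<Rightarrow> real measure" where
  "levy_approx d \<mu> \<nu> t b r n =
     (small_part d \<mu> \<nu> t b n \<star> compound_poisson (jump_part \<nu> t (jump_shell b r)))"

lemma jump_shell_measurable [measurable]: "jump_shell a b \<in> sets borel"
  by (simp add: jump_shell_def)

section \<open>Tails of convolutions, the Gaussian part and weak limits\<close>

lemma emeasure_convolution_ge:
  assumes M: "real_distribution M" and N: "real_distribution N"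
  shows "measure M {a..} * measure N {b..} \<le> measure (M \<star> N) {a + b..}"
proof -
  interpret M: real_distribution M by fact
  interpret N: real_distribution N by fact
  interpret MN: real_distribution "M \<star> N" using M N by (rule real_distribution_convolution)
  have "emeasure M {a..} * emeasure N {b..} = (\<integral>\<^sup>+y. emeasure N {b..} * indicator {a..} y \<partial>M)"
    by (subst nn_integral_cmult_indicator) (auto simp: mult.commute)
  also have "\<dots> \<le> (\<integral>\<^sup>+y. emeasure N {z. z + y \<in> {a + b..}} \<partial>M)"
    by (intro nn_integral_mono) (auto simp: indicator_def intro!: emeasure_mono)
  also have "\<dots> = emeasure (M \<star> N) {a + b..}"
    by (simp add: convolution_emeasure M.finite_measure_axioms N.finite_measure_axioms)
  finally show ?thesis
    by (simp add: M.emeasure_eq_measure N.emeasure_eq_measure MN.emeasure_eq_measure flip: ennreal_mult)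
qed

lemma measure_convolution_le:
  assumes M: "real_distribution M" and N: "real_distribution N"
  shows "measure (M \<star> N) {a + b..} \<le> measure M {a..} + measure N {b..}"
proof -
  interpret M: real_distribution M by fact
  interpret N: real_distribution N by fact
  interpret P: pair_prob_space M N ..
  have "(\<lambda>(x, y). x + y) \<in> borel_measurable (M \<Otimes>\<^sub>M N)" by simp
  then have "measure (M \<star> N) {a + b..} = measure (M \<Otimes>\<^sub>M N) ((\<lambda>(x, y). x + y) -` {a + b..} \<inter> space (M \<Otimes>\<^sub>M N))"
    unfolding convolution_def by (rule measure_distr) simp
  also have "\<dots> \<le> measure (M \<Otimes>\<^sub>M N) ({a..} \<times> UNIV \<union> UNIV \<times> {b..})"
    by (intro P.finite_measure_mono) auto
  also have "\<dots> \<le> measure (M \<Otimes>\<^sub>M N) ({a..} \<times> UNIV) + measure (M \<Otimes>\<^sub>M N) (UNIV \<times> {b..})"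
    by (intro measure_Un_le) auto
  also have "measure (M \<Otimes>\<^sub>M N) ({a..} \<times> UNIV) = measure M {a..} * measure N UNIV"
    by (simp add: measure_def N.emeasure_pair_measure_Times enn2real_mult)
  also have "measure (M \<Otimes>\<^sub>M N) (UNIV \<times> {b..}) = measure M UNIV * measure N {b..}"
    by (simp add: measure_def N.emeasure_pair_measure_Times enn2real_mult)
  finally show ?thesis
    using M.prob_space N.prob_space by simp
qed

lemma real_distribution_gauss_part: "real_distribution (gauss_part d \<mu> t)"
proof -
  interpret real_distribution std_normal_distribution by (rule real_dist_normal_dist)
  show ?thesis unfolding gauss_part_def by (intro real_distribution_distr) simp
qed

lemma char_gauss_part:
  assumes "0 \<le> d" "0 \<le> t"
  shows "char (gauss_part d \<mu> t) u = exp (of_real t * (- complex_of_real (d * u\<^sup>2 / 2) + \<i> * complex_of_real (\<mu> * u)))"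
proof -
  have "char (gauss_part d \<mu> t) u
      = (CLINT z|std_normal_distribution. iexp (u * (\<mu> * t)) * iexp (u * sqrt (d * t) * z))"
    unfolding char_def gauss_part_def
    by (subst integral_distr) (auto simp: algebra_simps simp flip: exp_add intro!: Bochner_Integration.integral_cong)
  also have "\<dots> = iexp (u * (\<mu> * t)) * char std_normal_distribution (u * sqrt (d * t))"
    by (simp add: char_def)
  also have "char std_normal_distribution (u * sqrt (d * t)) = complex_of_real (exp (- (u\<^sup>2 * (d * t)) / 2))"
    using assms by (simp only: char_std_normal_distribution power_mult_distrib) simp
  also have "iexp (u * (\<mu> * t)) * complex_of_real (exp (- (u\<^sup>2 * (d * t)) / 2))
      = exp (of_real t * (- complex_of_real (d * u\<^sup>2 / 2) + \<i> * complex_of_real (\<mu> * u)))"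
    by (simp add: algebra_simps flip: exp_of_real exp_add)
  finally show ?thesis .
qed

lemma std_normal_mgf: "(\<integral>\<^sup>+z. ennreal (exp (c * z)) \<partial>std_normal_distribution) = ennreal (exp (c\<^sup>2 / 2))"
proof -
  have eq: "std_normal_density z * exp (c * z) = exp (c\<^sup>2 / 2) * normal_density c 1 z" for z
    by (simp add: normal_density_def field_simps power2_eq_square flip: exp_add)
  have "(\<integral>\<^sup>+z. ennreal (exp (c * z)) \<partial>std_normal_distribution)
      = (\<integral>\<^sup>+z. ennreal (exp (c\<^sup>2 / 2)) * ennreal (normal_density c 1 z) \<partial>lborel)"
    by (subst nn_integral_density) (auto simp: eq simp flip: ennreal_mult)
  also have "\<dots> = ennreal (exp (c\<^sup>2 / 2)) * (\<integral>\<^sup>+z. ennreal (normal_density c 1 z) \<partial>lborel)"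
    by (rule nn_integral_cmult) simp
  also have "(\<integral>\<^sup>+z. ennreal (normal_density c 1 z) \<partial>lborel) = 1"
    by (subst nn_integral_eq_integral) (auto simp: ennreal_1)
  finally show ?thesis by simp
qed

lemma gauss_part_mgf:
  assumes "0 \<le> d" "0 \<le> t"
  shows "(\<integral>\<^sup>+x. ennreal (exp (c * x)) \<partial>gauss_part d \<mu> t) = ennreal (exp (t * (c * \<mu> + c\<^sup>2 * d / 2)))"
proof -
  have "(\<integral>\<^sup>+x. ennreal (exp (c * x)) \<partial>gauss_part d \<mu> t)
      = (\<integral>\<^sup>+z. ennreal (exp (c * \<mu> * t)) * ennreal (exp (c * sqrt (d * t) * z)) \<partial>std_normal_distribution)"
    unfolding gauss_part_def
    by (subst nn_integral_distr) (auto simp: algebra_simps exp_add simp flip: ennreal_mult)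
  also have "\<dots> = ennreal (exp (c * \<mu> * t)) * ennreal (exp ((c * sqrt (d * t))\<^sup>2 / 2))"
    by (subst nn_integral_cmult) (simp_all add: std_normal_mgf)
  also have "\<dots> = ennreal (exp (t * (c * \<mu> + c\<^sup>2 * d / 2)))"
    using assms by (simp add: power_mult_distrib algebra_simps flip: ennreal_mult exp_add)
  finally show ?thesis .
qed

text \<open>Weak convergence controls tails only at continuity points of the limit. Atoms are
  countable, so such a point exists between any two thresholds; this is why tail bounds pass to the
  limit with a slightly changed threshold.\<close>

lemma exists_atomless_point:
  assumes "real_distribution Q" "a < b"
  obtains c where "a < c" "c < b" "isCont (cdf Q) c"
proof -
  interpret real_distribution Q by fact
  have "countable {x. measure Q {x} \<noteq> 0}" by (rule countable_support)
  then have "\<not> {a<..<b} \<subseteq> {x. measure Q {x} \<noteq> 0}"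
    using assms(2) uncountable_open_interval countable_subset by blast
  then show ?thesis using that isCont_cdf by auto
qed

lemma weak_conv_tail:
  assumes "\<And>n. real_distribution (R n)" "real_distribution Q" "weak_conv_m R Q" "isCont (cdf Q) c"
  shows "(\<lambda>n. measure (R n) {c<..}) \<longlonglongrightarrow> measure Q {c<..}"
proof -
  have *: "measure P {c<..} = 1 - cdf P c" if "real_distribution P" for P
  proof -
    interpret real_distribution P by fact
    have "{c<..} = UNIV - {..c}" by auto
    then show ?thesis using prob_compl[of "{..c}"] by (simp add: cdf_def)
  qed
  have "(\<lambda>n. cdf (R n) c) \<longlonglongrightarrow> cdf Q c"
    using assms by (simp add: weak_conv_m_def weak_conv_def)
  then show ?thesis using assms by (simp add: * tendsto_diff)
qed

lemma weak_conv_tail_le: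
  assumes R: "\<And>n. real_distribution (R n)" and Q: "real_distribution Q" and "weak_conv_m R Q"
    and "a < b" "\<And>n. measure (R n) {a..} \<le> C"
  shows "measure Q {b..} \<le> C"
proof -
  obtain c where c: "a < c" "c < b" "isCont (cdf Q) c" by (rule exists_atomless_point[OF Q \<open>a < b\<close>])
  interpret Q: real_distribution Q by fact
  have "measure (R n) {c<..} \<le> C" for n
  proof -
    interpret R: real_distribution "R n" by fact
    have "measure (R n) {c<..} \<le> measure (R n) {a..}"
      using c by (intro R.finite_measure_mono) auto
    then show ?thesis using assms(5)[of n] by simp
  qed
  then have "measure Q {c<..} \<le> C"
    by (intro LIMSEQ_le_const2[OF weak_conv_tail[OF R Q assms(3) c(3)]]) auto
  moreover have "measure Q {b..} \<le> measure Q {c<..}"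
    using c by (intro Q.finite_measure_mono) auto
  ultimately show ?thesis by simp
qed

lemma weak_conv_tail_ge:
  assumes R: "\<And>n. real_distribution (R n)" and Q: "real_distribution Q" and "weak_conv_m R Q"
    and "b < a" "\<And>n. C \<le> measure (R n) {a..}"
  shows "C \<le> measure Q {b..}"
proof -
  obtain c where c: "b < c" "c < a" "isCont (cdf Q) c" by (rule exists_atomless_point[OF Q \<open>b < a\<close>])
  interpret Q: real_distribution Q by fact
  have "C \<le> measure (R n) {c<..}" for n
  proof -
    interpret R: real_distribution "R n" by fact
    have "measure (R n) {a..} \<le> measure (R n) {c<..}"
      using c by (intro R.finite_measure_mono) auto
    then show ?thesis using assms(5)[of n] by simp
  qed
  then have "C \<le> measure Q {c<..}"
    by (intro LIMSEQ_le_const[OF weak_conv_tail[OF R Q assms(3) c(3)]]) auto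
  moreover have "measure Q {c<..} \<le> measure Q {b..}"
    using c by (intro Q.finite_measure_mono) auto
  ultimately show ?thesis by simp
qed

definition lk_integrand :: "real \<Rightarrow> real \<Rightarrow> complex" where
  "lk_integrand u y = iexp (u * y) - 1 - \<i> * complex_of_real (u * y * indicator {-1..1} y)"

lemma lk_integrand_measurable [measurable]: "lk_integrand u \<in> borel_measurable borel"
  unfolding lk_integrand_def by measurable

text \<open>Taylor's bound of second order where the compensator is active, the trivial bound 2
  elsewhere. The integrand is therefore integrable against \<nu>, and its norm serves as majorant
  when the cut-off is removed.\<close>

lemma lk_integrand_bound: "norm (lk_integrand u y) \<le> (u\<^sup>2 + 2) * min (y\<^sup>2) 1"
proof (cases "\<bar>y\<bar> \<le> 1")
  case True
  then have "lk_integrand u y = iexp (u * y) - (\<Sum>k\<le>1. (\<i> * complex_of_real (u * y))^k / fact k)"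
    by (simp add: lk_integrand_def abs_le_iff)
  then have "norm (lk_integrand u y) \<le> \<bar>u * y\<bar>\<^sup>2 / 2"
    using iexp_approx1[of "u * y" 1] by (simp add: numeral_2_eq_2)
  also have "\<dots> \<le> (u\<^sup>2 + 2) * y\<^sup>2"
    by (simp add: power_mult_distrib distrib_right)
  also have "y\<^sup>2 = min (y\<^sup>2) 1" using True by (simp add: abs_square_le_1)
  finally show ?thesis .
next
  case False
  then have "y \<notin> {-1..1}" by auto
  then have "lk_integrand u y = iexp (u * y) - 1"
    by (simp add: lk_integrand_def)
  also have "norm (iexp (u * y) - 1) \<le> norm (iexp (u * y)) + norm (1::complex)" by (rule norm_triangle_ineq4)
  also have "\<dots> = 2" by (simp del: of_real_mult)
  also have "\<dots> \<le> (u\<^sup>2 + 2) * 1" by simp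
  also have "1 = min (y\<^sup>2) 1" using False one_le_power[of "\<bar>y\<bar>" 2] by simp
  finally show ?thesis .
qed

locale symmetric_levy =
  fixes \<nu> :: "real measure"
  assumes levy: "levy_measure \<nu>" and sym: "symmetric_measure \<nu>"
begin

lemma sets_nu_borel [simp, measurable_cong]: "sets \<nu> = sets borel"
  using levy by (simp add: levy_measure_def)

lemma space_nu [simp]: "space \<nu> = UNIV"
  using sets_eq_imp_space_eq[OF sets_nu_borel] by simp

lemma nn_integral_nu_uminus:
  assumes [measurable]: "h \<in> borel_measurable borel"
  shows "(\<integral>\<^sup>+y. h (- y) \<partial>\<nu>) = (\<integral>\<^sup>+y. h y \<partial>\<nu>)"
proof -
  have "(\<integral>\<^sup>+y. h y \<partial>\<nu>) = (\<integral>\<^sup>+y. h y \<partial>distr \<nu> borel uminus)"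
    using sym by (simp add: symmetric_measure_def)
  also have "\<dots> = (\<integral>\<^sup>+y. h (- y) \<partial>\<nu>)" by (subst nn_integral_distr) auto
  finally show ?thesis ..
qed

lemma integral_nu_odd:
  assumes [measurable]: "h \<in> borel_measurable borel" and "\<And>y. h (- y) = - h y"
  shows "(\<integral>y. h y \<partial>\<nu>) = (0 :: real)"
proof -
  have "(\<integral>y. h y \<partial>\<nu>) = (\<integral>y. h y \<partial>distr \<nu> borel uminus)"
    using sym by (simp add: symmetric_measure_def)
  also have "\<dots> = (\<integral>y. h (- y) \<partial>\<nu>)" by (subst integral_distr) auto
  also have "\<dots> = - (\<integral>y. h y \<partial>\<nu>)" using assms by simp
  finally show ?thesis by simp
qed

lemma nn_integral_nu_abs:
  assumes [measurable]: "h \<in> borel_measurable borel" "S \<in> sets borel" and S: "S \<subseteq> {0<..}"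
  shows "(\<integral>\<^sup>+y. h \<bar>y\<bar> * indicator S \<bar>y\<bar> \<partial>\<nu>) = 2 * (\<integral>\<^sup>+y. h y * indicator S y \<partial>\<nu>)"
proof -
  have "h \<bar>y\<bar> * indicator S \<bar>y\<bar> = h y * indicator S y + h (- y) * indicator S (- y)" for y
    using S by (auto simp: indicator_def abs_if)
  then have "(\<integral>\<^sup>+y. h \<bar>y\<bar> * indicator S \<bar>y\<bar> \<partial>\<nu>)
      = (\<integral>\<^sup>+y. h y * indicator S y \<partial>\<nu>) + (\<integral>\<^sup>+y. h (- y) * indicator S (- y) \<partial>\<nu>)"
    by (simp add: nn_integral_add)
  also have "(\<integral>\<^sup>+y. h (- y) * indicator S (- y) \<partial>\<nu>) = (\<integral>\<^sup>+y. h y * indicator S y \<partial>\<nu>)"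
    by (rule nn_integral_nu_uminus[of "\<lambda>y. h y * indicator S y"]) simp
  finally show ?thesis by (simp add: mult_2)
qed

definition levy_mass :: real where "levy_mass = (\<integral>y. min (y\<^sup>2) 1 \<partial>\<nu>)"

lemma levy_mass_nonneg: "0 \<le> levy_mass"
  by (simp add: levy_mass_def)

lemma integrable_levy: "integrable \<nu> (\<lambda>y. min (y\<^sup>2) 1)"
proof (rule integrableI_nonneg)
  show "(\<integral>\<^sup>+ y. ennreal (min (y\<^sup>2) 1) \<partial>\<nu>) < \<infinity>" using levy by (simp add: levy_measure_def)
qed auto

lemma nn_integral_levy: "(\<integral>\<^sup>+ y. ennreal (min (y\<^sup>2) 1) \<partial>\<nu>) = ennreal levy_mass"
  unfolding levy_mass_def by (intro nn_integral_eq_integral integrable_levy) auto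

lemma finite_jump_part:
  assumes "0 < a" "0 \<le> t" "S \<in> sets borel" "S \<subseteq> {y. a \<le> \<bar>y\<bar>}"
  shows "finite_measure (jump_part \<nu> t S)"
proof
  have [measurable]: "S \<in> sets borel" by fact
  define c where "c = min (a\<^sup>2) 1"
  have c: "0 < c" using assms by (simp add: c_def)
  have ind: "indicator S y \<le> ennreal (1 / c) * ennreal (min (y\<^sup>2) 1)" for y
  proof (cases "y \<in> S")
    case True
    then have "a \<le> \<bar>y\<bar>" using assms by auto
    then have "a\<^sup>2 \<le> \<bar>y\<bar>\<^sup>2" using assms by (intro power_mono) auto
    then have "c \<le> min (y\<^sup>2) 1" by (auto simp: c_def)
    then have "1 \<le> 1 / c * min (y\<^sup>2) 1" using c by (simp add: field_simps)
    then have "ennreal 1 \<le> ennreal (1 / c * min (y\<^sup>2) 1)" by (intro ennreal_leI)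
    also have "\<dots> = ennreal (1 / c) * ennreal (min (y\<^sup>2) 1)" using c by (intro ennreal_mult) auto
    finally show ?thesis using True by simp
  qed simp
  have "emeasure (jump_part \<nu> t S) (space (jump_part \<nu> t S)) = ennreal t * emeasure \<nu> S"
    unfolding jump_part_def by (simp add: emeasure_density nn_integral_cmult_indicator)
  also have "emeasure \<nu> S = (\<integral>\<^sup>+y. indicator S y \<partial>\<nu>)" by simp
  also have "\<dots> \<le> (\<integral>\<^sup>+y. ennreal (1 / c) * ennreal (min (y\<^sup>2) 1) \<partial>\<nu>)"
    by (intro nn_integral_mono ind)
  also have "\<dots> = ennreal (1 / c) * ennreal levy_mass"
    by (subst nn_integral_cmult) (auto simp: nn_integral_levy)
  finally have "emeasure (jump_part \<nu> t S) (space (jump_part \<nu> t S)) \<le> ennreal t * (ennreal (1 / c) * ennreal levy_mass)"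
    by (simp add: mult_left_mono)
  also have "\<dots> < \<infinity>" by (simp add: ennreal_mult_less_top)
  finally show "emeasure (jump_part \<nu> t S) (space (jump_part \<nu> t S)) \<noteq> \<infinity>" by simp
qed

lemma sets_jump_part [simp, measurable_cong]: "sets (jump_part \<nu> t S) = sets borel"
  by (simp add: jump_part_def)

lemma finite_jump_shell:
  assumes "0 < a" "0 \<le> t"
  shows "finite_measure (jump_part \<nu> t (jump_shell a b))"
  by (rule finite_jump_part[OF assms]) (auto simp: jump_shell_def)

lemma real_distribution_shell:
  assumes "0 < a" "0 \<le> t"
  shows "real_distribution (compound_poisson (jump_part \<nu> t (jump_shell a b)))"
  using finite_jump_shell[OF assms] by (rule real_distribution_compound_poisson) simp

lemma real_distribution_small_part:
  "0 \<le> t \<Longrightarrow> real_distribution (small_part d \<mu> \<nu> t b n)"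
  unfolding small_part_def
  by (intro real_distribution_convolution real_distribution_gauss_part real_distribution_shell) auto

lemma real_distribution_levy_approx:
  "0 \<le> t \<Longrightarrow> 0 < b \<Longrightarrow> real_distribution (levy_approx d \<mu> \<nu> t b r n)"
  unfolding levy_approx_def
  by (intro real_distribution_convolution real_distribution_small_part real_distribution_shell) auto

text \<open>By symmetry of \<open>\<nu>\<close> the compensator integrates to zero over a symmetric shell.\<close>

lemma char_shell:
  assumes "0 < a" "0 \<le> t"
  shows "char (compound_poisson (jump_part \<nu> t (jump_shell a b))) u
    = exp (of_real t * (CLINT y|\<nu>. indicator (jump_shell a b) y *\<^sub>R lk_integrand u y))"
proof -
  let ?S = "jump_shell a b"
  interpret finite_measure "jump_part \<nu> 1 ?S" by (rule finite_jump_shell) (use assms in auto)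
  have intS: "integrable \<nu> (\<lambda>y. indicator ?S y *\<^sub>R (f y))"
    if "\<And>y. norm (f y) \<le> B" and [measurable]: "f \<in> borel_measurable borel" for f :: "real \<Rightarrow> complex" and B
  proof -
    have "integrable (jump_part \<nu> 1 ?S) f"
      by (rule integrable_const_bound[where B=B]) (use that in auto)
    then have "integrable (density \<nu> (\<lambda>y. ennreal (indicator ?S y))) f"
      by (simp add: jump_part_def ennreal_indicator)
    then show ?thesis by (subst (asm) integrable_density) auto
  qed
  have int1: "integrable \<nu> (\<lambda>y. indicator ?S y *\<^sub>R (iexp (u * y) - 1))"
  proof (rule intS)
    show "norm (iexp (u * y) - 1) \<le> 2" for y
      using norm_triangle_ineq4[of "iexp (u * y)" 1] by (simp del: of_real_mult)
  qed simp
  have int2: "integrable \<nu> (\<lambda>y. indicator ?S y *\<^sub>R (\<i> * complex_of_real (u * y * indicator {-1..1} y)))"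
  proof (rule intS)
    show "norm (\<i> * complex_of_real (u * y * indicator {-1..1} y)) \<le> \<bar>u\<bar>" for y
      by (auto simp: norm_mult indicator_def abs_mult abs_le_iff intro!: mult_left_le)
  qed simp
  have "(CLINT y|\<nu>. indicator ?S y *\<^sub>R lk_integrand u y)
      = (CLINT y|\<nu>. indicator ?S y *\<^sub>R (iexp (u * y) - 1)) -
        (CLINT y|\<nu>. indicator ?S y *\<^sub>R (\<i> * complex_of_real (u * y * indicator {-1..1} y)))"
    by (subst Bochner_Integration.integral_diff [symmetric, OF int1 int2])
       (simp add: lk_integrand_def algebra_simps)
  also have "(CLINT y|\<nu>. indicator ?S y *\<^sub>R (\<i> * complex_of_real (u * y * indicator {-1..1} y)))
      = (CLINT y|\<nu>. \<i> * complex_of_real (indicator ?S y * (u * y * indicator {-1..1} y)))"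
    by (intro Bochner_Integration.integral_cong) (auto simp: indicator_def)
  also have "\<dots> = \<i> * complex_of_real (\<integral>y. indicator ?S y * (u * y * indicator {-1..1} y) \<partial>\<nu>)"
    by (simp only: integral_mult_right_zero integral_complex_of_real)
  also have "(\<integral>y. indicator ?S y * (u * y * indicator {-1..1} y) \<partial>\<nu>) = 0"
    by (intro integral_nu_odd) (auto simp: indicator_def jump_shell_def)
  finally have "(CLINT y|\<nu>. indicator ?S y *\<^sub>R lk_integrand u y)
      = (CLINT y|\<nu>. indicator ?S y *\<^sub>R (iexp (u * y) - 1))" by simp
  moreover have "(CLINT y|jump_part \<nu> t ?S. iexp (u * y) - 1)
      = of_real t * (CLINT y|\<nu>. indicator ?S y *\<^sub>R (iexp (u * y) - 1))"
  proof -
    have "jump_part \<nu> t ?S = density \<nu> (\<lambda>y. ennreal (t * indicator ?S y))"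
      using assms by (simp add: jump_part_def ennreal_mult ennreal_indicator)
    then have "(CLINT y|jump_part \<nu> t ?S. iexp (u * y) - 1)
        = (CLINT y|\<nu>. (t * indicator ?S y) *\<^sub>R (iexp (u * y) - 1))"
      using assms by (simp add: integral_density)
    also have "\<dots> = (CLINT y|\<nu>. t *\<^sub>R (indicator ?S y *\<^sub>R (iexp (u * y) - 1)))"
      by (intro Bochner_Integration.integral_cong) auto
    also have "\<dots> = t *\<^sub>R (CLINT y|\<nu>. indicator ?S y *\<^sub>R (iexp (u * y) - 1))"
      by (rule integral_scaleR_right)
    finally show ?thesis by (simp add: scaleR_conv_of_real)
  qed
  ultimately show ?thesis
    using char_compound_poisson[OF finite_jump_shell[OF assms] sets_jump_part] by simp
qed

lemma integrable_lk: "integrable \<nu> (lk_integrand u)"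
proof (rule Bochner_Integration.integrable_bound)
  show "integrable \<nu> (\<lambda>y. (u\<^sup>2 + 2) * min (y\<^sup>2) 1)" by (intro integrable_mult_right integrable_levy)
  show "AE y in \<nu>. norm (lk_integrand u y) \<le> norm ((u\<^sup>2 + 2) * min (y\<^sup>2) 1)"
    using lk_integrand_bound by (intro AE_I2) (simp add: abs_mult)
qed simp

lemma char_levy_approx:
  assumes "0 \<le> t" "1 \<le> b" "b \<le> r" "0 \<le> d"
  shows "char (levy_approx d \<mu> \<nu> t b r n) u
    = exp (of_real t * (- complex_of_real (d * u\<^sup>2 / 2) + \<i> * complex_of_real (\<mu> * u)
        + (CLINT y|\<nu>. indicator (jump_shell (1 / Suc n) r) y *\<^sub>R lk_integrand u y)))"
proof -
  have int: "integrable \<nu> (\<lambda>y. indicator (jump_shell a b) y *\<^sub>R lk_integrand u y)" for a b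
    by (rule Bochner_Integration.integrable_bound[OF integrable_lk]) (auto simp: indicator_def)
  \<comment> \<open>Since b \<ge> 1, the inner radius never exceeds \<open>b\<close>, and the two
    shells are adjacent for every \<open>n\<close>.\<close>
  have "1 / real (Suc n) \<le> 1" by simp
  then have n: "1 / real (Suc n) \<le> b" using assms(2) by linarith
  have "indicator (jump_shell (1 / Suc n) r) y *\<^sub>R lk_integrand u y
      = indicator (jump_shell (1 / Suc n) b) y *\<^sub>R lk_integrand u y + indicator (jump_shell b r) y *\<^sub>R lk_integrand u y" for y
    using n assms by (auto simp: jump_shell_def indicator_def)
  then have split: "(CLINT y|\<nu>. indicator (jump_shell (1 / Suc n) r) y *\<^sub>R lk_integrand u y)
      = (CLINT y|\<nu>. indicator (jump_shell (1 / Suc n) b) y *\<^sub>R lk_integrand u y)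
      + (CLINT y|\<nu>. indicator (jump_shell b r) y *\<^sub>R lk_integrand u y)"
    by (simp only: Bochner_Integration.integral_add int)
  have "0 < 1 / real (Suc n)" "0 < b" using assms by auto
  note dist = real_distribution_shell[OF this(1) assms(1)] real_distribution_shell[OF this(2) assms(1)]
    and chars = char_shell[OF this(1) assms(1)] char_shell[OF this(2) assms(1)]
  have "char (levy_approx d \<mu> \<nu> t b r n) u = char (gauss_part d \<mu> t) u
      * char (compound_poisson (jump_part \<nu> t (jump_shell (1 / Suc n) b))) u
      * char (compound_poisson (jump_part \<nu> t (jump_shell b r))) u"
    unfolding levy_approx_def small_part_def
    by (simp only: char_convolution real_distribution_convolution real_distribution_gauss_part dist)
  then show ?thesis
    unfolding char_gauss_part[OF assms(4,1)] chars split exp_add [symmetric] by (simp only: distrib_left add.assoc)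
qed

lemma levy_exponent_restrict:
  "levy_exponent d (restrict_jumps \<nu> r) \<mu> u
    = - complex_of_real (d * u\<^sup>2 / 2) + \<i> * complex_of_real (\<mu> * u)
      + (CLINT y|\<nu>. indicator {-r..r} y *\<^sub>R lk_integrand u y)"
proof -
  have "(CLINT y|restrict_jumps \<nu> r. lk_integrand u y) = (CLINT y|density \<nu> (\<lambda>y. ennreal (indicator {-r..r} y)). lk_integrand u y)"
    by (simp add: restrict_jumps_def ennreal_indicator)
  also have "\<dots> = (CLINT y|\<nu>. indicator {-r..r} y *\<^sub>R lk_integrand u y)"
    by (rule integral_density) auto
  finally show ?thesis by (simp add: levy_exponent_def lk_integrand_def)
qed

text \<open>Dominated convergence removes the cut-off in the exponent, and Levy's continuity theorem
  converts this into weak convergence. The law Q enters only through its characteristic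
  function.\<close>

lemma levy_approx_weak_conv:
  assumes "0 \<le> t" "1 \<le> b" "b \<le> r" "0 \<le> d" and Q: "real_distribution Q"
    and char: "\<And>u. char Q u = exp (of_real t * levy_exponent d (restrict_jumps \<nu> r) \<mu> u)"
  shows "weak_conv_m (levy_approx d \<mu> \<nu> t b r) Q"
proof (rule levy_continuity)
  show "real_distribution (levy_approx d \<mu> \<nu> t b r n)" for n
    using assms by (intro real_distribution_levy_approx) auto
  show "real_distribution Q" by fact
  fix u
  have "(\<lambda>n. CLINT y|\<nu>. indicator (jump_shell (1 / Suc n) r) y *\<^sub>R lk_integrand u y)
      \<longlonglongrightarrow> (CLINT y|\<nu>. indicator {-r..r} y *\<^sub>R lk_integrand u y)"
  proof (rule integral_dominated_convergence)
    show "integrable \<nu> (\<lambda>y. norm (lk_integrand u y))" by (intro integrable_norm integrable_lk)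
    show "AE y in \<nu>. (\<lambda>n. indicator (jump_shell (1 / Suc n) r) y *\<^sub>R lk_integrand u y)
        \<longlonglongrightarrow> indicator {-r..r} y *\<^sub>R lk_integrand u y"
    proof (rule AE_I2)
      fix y
      show "(\<lambda>n. indicator (jump_shell (1 / Suc n) r) y *\<^sub>R lk_integrand u y)
        \<longlonglongrightarrow> indicator {-r..r} y *\<^sub>R lk_integrand u y"
      \<comment> \<open>The shells never contain 0 but the limiting interval does; the integrand
        vanishes at this point.\<close>
      proof (cases "y = 0")
        case True
        then show ?thesis by (simp add: lk_integrand_def)
      next
        case False
        have "eventually (\<lambda>n. 1 / real (Suc n) < \<bar>y\<bar>) sequentially"
          using False by (intro order_tendstoD(2)[OF LIMSEQ_Suc[OF lim_1_over_n]]) auto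
        then have "eventually (\<lambda>n. indicator (jump_shell (1 / Suc n) r) y *\<^sub>R lk_integrand u y
            = indicator {-r..r} y *\<^sub>R lk_integrand u y) sequentially"
          by eventually_elim (auto simp: jump_shell_def indicator_def)
        then show ?thesis by (rule tendsto_eventually)
      qed
    qed
  qed (auto simp: indicator_def)
  then have "(\<lambda>n. exp (of_real t * (- complex_of_real (d * u\<^sup>2 / 2) + \<i> * complex_of_real (\<mu> * u)
        + (CLINT y|\<nu>. indicator (jump_shell (1 / Suc n) r) y *\<^sub>R lk_integrand u y)))) \<longlonglongrightarrow> char Q u"
    unfolding char levy_exponent_restrict by (intro tendsto_exp tendsto_mult tendsto_add tendsto_const)
  then show "(\<lambda>n. char (levy_approx d \<mu> \<nu> t b r n) u) \<longlonglongrightarrow> char Q u"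
    using assms by (simp only: char_levy_approx)
qed

end

section \<open>Large deviations of the truncated Levy law\<close>

lemma markov_exp_tail:
  assumes "real_distribution Q" and "0 \<le> c" and H: "\<And>x. a \<le> x \<Longrightarrow> exp c \<le> H x" "\<And>x. 0 \<le> H x"
    and [measurable]: "H \<in> borel_measurable borel"
    and le: "(\<integral>\<^sup>+x. ennreal (H x) \<partial>Q) \<le> ennreal C" "0 \<le> C"
  shows "measure Q {a..} \<le> C * exp (- c)"
proof -
  interpret real_distribution Q by fact
  have "ennreal (exp c) * emeasure Q {a..} = (\<integral>\<^sup>+x. ennreal (exp c) * indicator {a..} x \<partial>Q)"
    by (subst nn_integral_cmult_indicator) auto
  also have "\<dots> \<le> (\<integral>\<^sup>+x. ennreal (H x) \<partial>Q)"
    using H by (intro nn_integral_mono) (auto simp: indicator_def intro!: ennreal_leI)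
  also have "\<dots> \<le> ennreal C" by fact
  finally have "exp c * measure Q {a..} \<le> C"
    using le(2) by (simp add: emeasure_eq_measure flip: ennreal_mult)
  then show ?thesis by (simp add: exp_minus field_simps)
qed

text \<open>Adding the values at y and - y cancels the linear term, which need not be integrable
  near 0 against a Levy measure; what remains is quadratic inside the unit interval and purely
  exponential outside.\<close>

lemma exp_cosh_bound:
  fixes c y :: real
  assumes "\<bar>c\<bar> \<le> 1"
  shows "exp (c * y) + exp (- (c * y)) \<le> 2 + 2 * min (y\<^sup>2) 1 + 2 * (exp (\<bar>c\<bar> * \<bar>y\<bar>) * indicator {1<..} \<bar>y\<bar>)"
proof (cases "\<bar>y\<bar> \<le> 1")
  case True
  have *: "exp x \<le> 1 + x + x\<^sup>2" if "\<bar>x\<bar> \<le> 1" for x :: real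
  proof (cases "0 \<le> x")
    case True
    then show ?thesis using exp_bound that by simp
  next
    case False
    then have "0 \<le> - x" by simp
    \<comment> \<open>The product is 1 - x ^ 3. Together with 1 - x \<le> exp (- x) this gives the
      quadratic bound for negative arguments.\<close>
    have "1 \<le> (1 + x + x\<^sup>2) * (1 + - x + 0)" if "x \<le> 0" for x :: real
    proof -
      have "x ^ 3 \<le> 0" using that by (simp add: power_le_zero_eq)
      then show ?thesis by (simp add: algebra_simps power2_eq_square power3_eq_cube)
    qed
    then have "1 \<le> (1 + x + x\<^sup>2) * (1 + - x)" using False by simp
    also have "\<dots> \<le> (1 + x + x\<^sup>2) * exp (- x)"
    proof (intro mult_left_mono exp_ge_add_one_self)
      have "0 \<le> (x + 1/2)\<^sup>2" by simp
      then show "0 \<le> 1 + x + x\<^sup>2" by (simp add: power2_eq_square algebra_simps)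
    qed
    finally show ?thesis by (simp add: exp_minus field_simps)
  qed
  have cy: "\<bar>c * y\<bar> \<le> \<bar>y\<bar>" using assms by (simp add: abs_mult mult_left_le_one_le)
  then have "\<bar>c * y\<bar> \<le> 1" using True by simp
  from *[of "c * y"] *[of "- (c * y)"] this
  have "exp (c * y) + exp (- (c * y)) \<le> 2 + 2 * (c * y)\<^sup>2" by simp
  also have "(c * y)\<^sup>2 \<le> y\<^sup>2" using cy by (simp add: abs_le_square_iff)
  also have "y\<^sup>2 = min (y\<^sup>2) 1" using True by (simp add: abs_square_le_1)
  finally show ?thesis using True by simp
next
  case False
  have "c * y \<le> \<bar>c\<bar> * \<bar>y\<bar>" "- (c * y) \<le> \<bar>c\<bar> * \<bar>y\<bar>"
    using abs_ge_self[of "c * y"] abs_ge_minus_self[of "c * y"] by (simp_all only: abs_mult)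
  then have "exp (c * y) \<le> exp (\<bar>c\<bar> * \<bar>y\<bar>)" "exp (- (c * y)) \<le> exp (\<bar>c\<bar> * \<bar>y\<bar>)"
    by (simp_all only: exp_le_cancel_iff)
  moreover have "indicator {1<..} \<bar>y\<bar> = (1::real)" using False by simp
  ultimately have "exp (c * y) + exp (- (c * y)) \<le> 2 * (exp (\<bar>c\<bar> * \<bar>y\<bar>) * indicator {1<..} \<bar>y\<bar>)"
    by (simp only: mult_1_right)
  moreover have "0 \<le> min (y\<^sup>2) 1" by simp
  ultimately show ?thesis by linarith
qed

text \<open>This is how multiplicative constants are absorbed into a small fraction of the
  exponent.\<close>

lemma exp_tail_at_top:
  assumes "filterlim f at_top F" "0 < (a :: real)" "0 < e"
  shows "eventually (\<lambda>v. C * exp (- a * f v) \<le> e) F"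
proof -
  have "((\<lambda>v. C * exp (- a * f v)) \<longlongrightarrow> C * 0) F"
    using assms
    by (intro tendsto_intros filterlim_compose[OF exp_at_bot]
          filterlim_tendsto_neg_mult_at_bot[OF tendsto_const _ assms(1)]) auto
  then have "eventually (\<lambda>v. C * exp (- a * f v) < e) F"
    using assms by (intro order_tendstoD(2)) auto
  then show ?thesis by eventually_elim simp
qed

context
  fixes \<alpha> \<theta> :: real
  assumes \<alpha>: "0 < \<alpha>" "\<alpha> < 1" and \<theta>: "0 < \<theta>"
begin

lemma jump_cost_measurable [measurable]: "jump_cost \<alpha> \<theta> \<in> borel_measurable borel"
  unfolding jump_cost_def by measurable

text \<open>A jump in the wrong direction is charged as if it went in the right one, so
  subadditivity for positive displacements suffices. The exponential of this inequality is the step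
  hypothesis for compound Poisson laws.\<close>

lemma jump_cost_abs_add_le:
  assumes "\<bar>x\<bar> \<le> \<theta>"
  shows "jump_cost \<alpha> \<theta> \<bar>x + y\<bar> \<le> \<bar>x\<bar> powr \<alpha> + jump_cost \<alpha> \<theta> \<bar>y\<bar>"
proof -
  have "jump_cost \<alpha> \<theta> \<bar>x + y\<bar> \<le> jump_cost \<alpha> \<theta> (\<bar>y\<bar> + \<bar>x\<bar>)"
    using \<alpha> \<theta> by (intro jump_cost_mono) auto
  also have "\<dots> \<le> jump_cost \<alpha> \<theta> \<bar>y\<bar> + \<bar>x\<bar> powr \<alpha>"
    using \<alpha> \<theta> assms by (intro jump_cost_add_le) auto
  finally show ?thesis by simp
qed

end

locale symmetric_weibull_tail = weibull_tail + symmetric_levy +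
  fixes d \<mu> \<theta> :: real
  assumes d: "0 \<le> d" and \<theta>: "0 < \<theta>"
begin

text \<open>Chernoff's bound with exponent \<open>K * log_tail \<nu> v / v\<close>.\<close>

lemma small_part_tail:
  assumes K: "0 < K" and T: "0 \<le> T"
  obtains \<kappa>\<^sub>0 C where "0 < \<kappa>\<^sub>0" "0 \<le> C"
    "\<And>\<kappa> e. 0 < \<kappa> \<Longrightarrow> \<kappa> \<le> \<kappa>\<^sub>0 \<Longrightarrow> 0 < e \<Longrightarrow> eventually (\<lambda>v. \<forall>t\<in>{0..T}. \<forall>n.
       measure (small_part d \<mu> \<nu> t (\<kappa> * v) n) {e * v..} \<le> C * exp (- (K * e * log_tail \<nu> v)) \<and>
       measure (small_part d \<mu> \<nu> t (\<kappa> * v) n) {.. - (e * v)} \<le> C * exp (- (K * e * log_tail \<nu> v))) at_top"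
proof -
  obtain \<kappa>\<^sub>0 B where \<kappa>0: "0 < \<kappa>\<^sub>0" "\<kappa>\<^sub>0 \<le> 1" and B: "0 \<le> B"
    "eventually (\<lambda>v. (\<integral>\<^sup>+y. ennreal (exp (K * log_tail \<nu> v / v * y)) * indicator {1..\<kappa>\<^sub>0 * v} y \<partial>\<nu>) \<le> ennreal B) at_top"
    using medium_jumps_exp_moment[OF K] by blast
  \<comment> \<open>Bounded jumps contribute through \<open>levy_mass\<close>, medium jumps through
    B once for each sign, and drift and variance through \<gamma> \<le> 1. Nothing here depends on
    v, t or n.\<close>
  define E where "E = T * (levy_mass + 2 * B) + T * (\<bar>\<mu>\<bar> + d / 2)"
  have E: "0 \<le> E" using T B levy_mass_nonneg d by (simp add: E_def)
  have ev: "eventually (\<lambda>v. log_tail \<nu> v / v < 1 / K) at_top"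
    using K by (intro order_tendstoD(2)[OF log_tail_sublinear]) auto
  have main: "eventually (\<lambda>v. \<forall>t\<in>{0..T}. \<forall>n.
       measure (small_part d \<mu> \<nu> t (\<kappa> * v) n) {e * v..} \<le> exp E * exp (- (K * e * log_tail \<nu> v)) \<and>
       measure (small_part d \<mu> \<nu> t (\<kappa> * v) n) {.. - (e * v)} \<le> exp E * exp (- (K * e * log_tail \<nu> v))) at_top"
    if \<kappa>: "0 < \<kappa>" "\<kappa> \<le> \<kappa>\<^sub>0" and e: "0 < e" for \<kappa> e
    using B(2) ev eventually_ge_at_top[of 1]
  proof eventually_elim
    case (elim v)
    define \<gamma> where "\<gamma> = K * log_tail \<nu> v / v"
    have v: "1 \<le> v" "0 < log_tail \<nu> v" using elim log_tail_pos[of v] by auto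
    have \<gamma>: "0 < \<gamma>" "\<gamma> \<le> 1" using v elim K by (auto simp: \<gamma>_def field_simps)
    have mgf: "(\<integral>\<^sup>+x. ennreal (exp (c * x)) \<partial>small_part d \<mu> \<nu> t (\<kappa> * v) n) \<le> ennreal (exp E)"
      if c: "\<bar>c\<bar> = \<gamma>" and t: "t \<in> {0..T}" for c t n
    proof -
      define S where "S = jump_shell (1 / Suc n) (\<kappa> * v)"
      have [measurable]: "S \<in> sets borel" by (simp add: S_def)
      define \<rho> where "\<rho> = jump_part \<nu> t S"
      have fin: "finite_measure \<rho>" unfolding \<rho>_def S_def using t by (intro finite_jump_shell) auto
      have [simp, measurable_cong]: "sets \<rho> = sets borel" by (simp add: \<rho>_def)
      interpret \<rho>: finite_measure \<rho> by (rule fin)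
      have sp: "space \<rho> = UNIV" using sets_eq_imp_space_eq[of \<rho> borel] by simp
      have \<rho>_int: "(\<integral>\<^sup>+y. h y \<partial>\<rho>) = ennreal t * (\<integral>\<^sup>+y. h y * indicator S y \<partial>\<nu>)"
        if [measurable]: "h \<in> borel_measurable borel" for h
      proof -
        have "(\<integral>\<^sup>+y. h y \<partial>\<rho>) = (\<integral>\<^sup>+y. ennreal t * (h y * indicator S y) \<partial>\<nu>)"
          unfolding \<rho>_def jump_part_def by (subst nn_integral_density) (auto simp: mult_ac)
        then show ?thesis by (simp add: nn_integral_cmult)
      qed
      have S_minus: "indicator S (- y) = indicator S y" for y
        by (simp add: S_def jump_shell_def indicator_def)
      have i1: "(\<integral>\<^sup>+y. ennreal (min (y\<^sup>2) 1) \<partial>\<rho>) \<le> ennreal (t * levy_mass)"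
      proof -
        have "(\<integral>\<^sup>+y. ennreal (min (y\<^sup>2) 1) \<partial>\<rho>) \<le> ennreal t * (\<integral>\<^sup>+y. ennreal (min (y\<^sup>2) 1) \<partial>\<nu>)"
          by (subst \<rho>_int) (auto intro!: mult_left_mono nn_integral_mono simp: indicator_def)
        then show ?thesis using t levy_mass_nonneg by (simp add: nn_integral_levy ennreal_mult)
      qed
      have i2: "(\<integral>\<^sup>+y. ennreal (exp (\<gamma> * \<bar>y\<bar>)) * indicator {1<..} \<bar>y\<bar> \<partial>\<rho>) \<le> ennreal (t * (2 * B))"
      proof -
        have eq: "(\<integral>\<^sup>+y. ennreal (exp (\<gamma> * \<bar>y\<bar>)) * indicator {1<..} \<bar>y\<bar> \<partial>\<rho>)
            = ennreal t * (\<integral>\<^sup>+y. ennreal (exp (\<gamma> * \<bar>y\<bar>)) * indicator {1<..} \<bar>y\<bar> * indicator S y \<partial>\<nu>)"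
          by (rule \<rho>_int) measurable
        have "(\<integral>\<^sup>+y. ennreal (exp (\<gamma> * \<bar>y\<bar>)) * indicator {1<..} \<bar>y\<bar> * indicator S y \<partial>\<nu>)
            \<le> (\<integral>\<^sup>+y. ennreal (exp (\<gamma> * \<bar>y\<bar>)) * indicator {1..\<kappa>\<^sub>0 * v} \<bar>y\<bar> \<partial>\<nu>)"
        proof -
          have "\<kappa> * v \<le> \<kappa>\<^sub>0 * v" using \<kappa> v by (intro mult_right_mono) auto
          then show ?thesis by (intro nn_integral_mono) (auto simp: indicator_def S_def jump_shell_def)
        qed
        also have "\<dots> = 2 * (\<integral>\<^sup>+y. ennreal (exp (\<gamma> * y)) * indicator {1..\<kappa>\<^sub>0 * v} y \<partial>\<nu>)"
          by (rule nn_integral_nu_abs) auto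
        also have "\<dots> \<le> 2 * ennreal B"
          using elim(1) by (intro mult_left_mono) (auto simp: \<gamma>_def)
        also have "\<dots> = ennreal (2 * B)" using B by (simp add: ennreal_mult)
        finally have "ennreal t * (\<integral>\<^sup>+y. ennreal (exp (\<gamma> * \<bar>y\<bar>)) * indicator {1<..} \<bar>y\<bar> * indicator S y \<partial>\<nu>)
            \<le> ennreal t * ennreal (2 * B)" by (rule mult_left_mono) simp
        then show ?thesis unfolding eq using t B by (simp add: ennreal_mult)
      qed
      \<comment> \<open>Symmetry of \<nu> allows the exponential to be averaged with its reflection
        before it is estimated.\<close>
      have "2 * (\<integral>\<^sup>+y. ennreal (exp (c * y)) \<partial>\<rho>) = (\<integral>\<^sup>+y. ennreal (exp (c * y)) \<partial>\<rho>) + (\<integral>\<^sup>+y. ennreal (exp (- (c * y))) \<partial>\<rho>)"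
        using nn_integral_nu_uminus[of "\<lambda>y. ennreal (exp (c * y)) * indicator S y"]
        by (simp add: \<rho>_int S_minus mult_2)
      also have "\<dots> = (\<integral>\<^sup>+y. ennreal (exp (c * y) + exp (- (c * y))) \<partial>\<rho>)"
        by (subst nn_integral_add [symmetric]) (auto simp: ennreal_plus)
      also have "\<dots> \<le> (\<integral>\<^sup>+y. ennreal (2 + 2 * min (y\<^sup>2) 1 + 2 * (exp (\<gamma> * \<bar>y\<bar>) * indicator {1<..} \<bar>y\<bar>)) \<partial>\<rho>)"
        using exp_cosh_bound[of c] \<gamma> c by (intro nn_integral_mono ennreal_leI) auto
      also have "\<dots> = (\<integral>\<^sup>+y. 2 + 2 * ennreal (min (y\<^sup>2) 1) + 2 * (ennreal (exp (\<gamma> * \<bar>y\<bar>)) * indicator {1<..} \<bar>y\<bar>) \<partial>\<rho>)"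
        by (intro nn_integral_cong) (auto simp: ennreal_plus ennreal_mult indicator_def)
      also have "\<dots> = 2 * emeasure \<rho> UNIV + 2 * (\<integral>\<^sup>+y. ennreal (min (y\<^sup>2) 1) \<partial>\<rho>)
          + 2 * (\<integral>\<^sup>+y. ennreal (exp (\<gamma> * \<bar>y\<bar>)) * indicator {1<..} \<bar>y\<bar> \<partial>\<rho>)"
        by (simp add: nn_integral_add nn_integral_cmult sp)
      also have "\<dots> \<le> 2 * emeasure \<rho> UNIV + 2 * ennreal (t * levy_mass) + 2 * ennreal (t * (2 * B))"
        by (intro add_mono mult_left_mono i1 i2) auto
      also have "\<dots> = 2 * ennreal (measure \<rho> UNIV + t * levy_mass + t * (2 * B))"
        using t B levy_mass_nonneg by (simp add: \<rho>.emeasure_eq_measure ennreal_plus distrib_left)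
      finally have "2 * (\<integral>\<^sup>+y. ennreal (exp (c * y)) \<partial>\<rho>)
          \<le> 2 * ennreal (measure \<rho> UNIV + t * levy_mass + t * (2 * B))" .
      then have le: "(\<integral>\<^sup>+y. ennreal (exp (c * y)) \<partial>\<rho>) \<le> ennreal (measure \<rho> UNIV + t * levy_mass + t * (2 * B))"
        by (simp add: ennreal_mult_le_mult_iff)
      \<comment> \<open>The mass of \<rho>, which may be unbounded in \<open>n\<close>, cancels
        against the normalisation of the compound Poisson law.\<close>
      have cp: "(\<integral>\<^sup>+y. ennreal (exp (c * y)) \<partial>compound_poisson \<rho>) \<le> ennreal (exp (t * (levy_mass + 2 * B)))"
      proof -
        have "(\<integral>\<^sup>+y. ennreal (exp (c * y)) \<partial>compound_poisson \<rho>)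
            \<le> ennreal (exp (measure \<rho> UNIV + t * levy_mass + t * (2 * B) - measure \<rho> UNIV))"
        proof (rule nn_integral_compound_poisson_le[OF fin _ _ _ _ _ le])
          show "AE x in \<rho>. \<forall>y. ennreal (exp (c * (x + y))) \<le> ennreal (exp (c * x)) * ennreal (exp (c * y))"
            by (simp add: distrib_left exp_add ennreal_mult)
          show "0 \<le> measure \<rho> UNIV + t * levy_mass + t * (2 * B)"
            using t B levy_mass_nonneg by simp
        qed auto
        then show ?thesis by (simp add: distrib_left)
      qed
      have rd: "real_distribution (compound_poisson \<rho>)" using fin by (rule real_distribution_compound_poisson) simp
      interpret cp: real_distribution "compound_poisson \<rho>" by (rule rd)
      interpret g: real_distribution "gauss_part d \<mu> t" by (rule real_distribution_gauss_part)
      have "(\<integral>\<^sup>+x. ennreal (exp (c * x)) \<partial>small_part d \<mu> \<nu> t (\<kappa> * v) n)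
          = (\<integral>\<^sup>+x. \<integral>\<^sup>+y. ennreal (exp (c * (x + y))) \<partial>compound_poisson \<rho> \<partial>gauss_part d \<mu> t)"
        unfolding small_part_def \<rho>_def [symmetric] S_def [symmetric]
        by (intro nn_integral_convolution) (auto simp: cp.finite_measure_axioms g.finite_measure_axioms)
      also have "\<dots> = (\<integral>\<^sup>+x. ennreal (exp (c * x)) * (\<integral>\<^sup>+y. ennreal (exp (c * y)) \<partial>compound_poisson \<rho>) \<partial>gauss_part d \<mu> t)"
        by (simp add: distrib_left exp_add ennreal_mult nn_integral_cmult)
      also have "\<dots> = (\<integral>\<^sup>+x. ennreal (exp (c * x)) \<partial>gauss_part d \<mu> t) * (\<integral>\<^sup>+y. ennreal (exp (c * y)) \<partial>compound_poisson \<rho>)"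
        by (rule nn_integral_multc) simp
      also have "\<dots> \<le> ennreal (exp (t * (c * \<mu> + c\<^sup>2 * d / 2))) * ennreal (exp (t * (levy_mass + 2 * B)))"
        using d t by (intro mult_mono cp) (auto simp: gauss_part_mgf)
      also have "\<dots> = ennreal (exp (t * (c * \<mu> + c\<^sup>2 * d / 2) + t * (levy_mass + 2 * B)))"
        by (simp add: exp_add ennreal_mult)
      also have "\<dots> \<le> ennreal (exp E)"
      proof -
        have "\<bar>c * \<mu>\<bar> \<le> \<bar>\<mu>\<bar>"
          using mult_right_mono[of "\<bar>c\<bar>" 1 "\<bar>\<mu>\<bar>"] \<gamma>(2) c unfolding abs_mult by linarith
        moreover have "c\<^sup>2 \<le> 1" using abs_square_le_1[of c] \<gamma>(2) c by simp
        then have "c\<^sup>2 * d \<le> 1 * d" by (rule mult_right_mono) (rule d)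
        ultimately have "c * \<mu> + c\<^sup>2 * d / 2 \<le> \<bar>\<mu>\<bar> + d / 2" by linarith
        then have "t * (c * \<mu> + c\<^sup>2 * d / 2) \<le> t * (\<bar>\<mu>\<bar> + d / 2)"
          using t by (intro mult_left_mono) auto
        also have "\<dots> \<le> T * (\<bar>\<mu>\<bar> + d / 2)"
          using t d by (intro mult_right_mono) auto
        finally have "t * (c * \<mu> + c\<^sup>2 * d / 2) \<le> T * (\<bar>\<mu>\<bar> + d / 2)" .
        moreover have "t * (levy_mass + 2 * B) \<le> T * (levy_mass + 2 * B)"
          using t B levy_mass_nonneg by (intro mult_right_mono) auto
        ultimately show ?thesis by (intro ennreal_leI) (simp add: E_def)
      qed
      finally show ?thesis .
    qed
    show ?case
    proof (intro ballI allI conjI)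
      fix t n assume t: "t \<in> {0..T}"
      then have rd: "real_distribution (small_part d \<mu> \<nu> t (\<kappa> * v) n)"
        by (intro real_distribution_small_part) auto
      have \<gamma>v: "K * e * log_tail \<nu> v = \<gamma> * (e * v)" using v by (simp add: \<gamma>_def)
      have nn: "0 \<le> \<gamma> * (e * v)" using \<gamma> e v by simp
      have mono: "exp (\<gamma> * (e * v)) \<le> exp (\<gamma> * x)" if "e * v \<le> x" for x
        using mult_left_mono[OF that, of \<gamma>] \<gamma> by simp
      have E0: "0 \<le> exp E" by simp
      have mgf1: "(\<integral>\<^sup>+x. ennreal (exp (\<gamma> * x)) \<partial>small_part d \<mu> \<nu> t (\<kappa> * v) n) \<le> ennreal (exp E)"
        by (rule mgf) (use \<gamma> t in simp_all)
      show "measure (small_part d \<mu> \<nu> t (\<kappa> * v) n) {e * v..} \<le> exp E * exp (- (K * e * log_tail \<nu> v))"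
        unfolding \<gamma>v
        by (rule markov_exp_tail[where H = "\<lambda>x. exp (\<gamma> * x)", OF rd nn mono _ _ mgf1 E0]) simp_all
      interpret Q: real_distribution "small_part d \<mu> \<nu> t (\<kappa> * v) n" by (rule rd)
      have rd': "real_distribution (distr (small_part d \<mu> \<nu> t (\<kappa> * v) n) borel uminus)"
        by (intro Q.real_distribution_distr) simp
      have mgf2: "(\<integral>\<^sup>+x. ennreal (exp (\<gamma> * x)) \<partial>distr (small_part d \<mu> \<nu> t (\<kappa> * v) n) borel uminus) \<le> ennreal (exp E)"
      proof (subst nn_integral_distr)
        show "(\<integral>\<^sup>+x. ennreal (exp (\<gamma> * - x)) \<partial>small_part d \<mu> \<nu> t (\<kappa> * v) n) \<le> ennreal (exp E)"
          using mgf[of "- \<gamma>" t n] \<gamma> t by simp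
      qed simp_all
      have "measure (small_part d \<mu> \<nu> t (\<kappa> * v) n) {.. - (e * v)}
          = measure (distr (small_part d \<mu> \<nu> t (\<kappa> * v) n) borel uminus) {e * v..}"
        by (subst measure_distr) (auto intro!: arg_cong2[where f=measure])
      also have "\<dots> \<le> exp E * exp (- (K * e * log_tail \<nu> v))"
        unfolding \<gamma>v
        by (rule markov_exp_tail[where H = "\<lambda>x. exp (\<gamma> * x)", OF rd' nn mono _ _ mgf2 E0]) simp_all
      finally show "measure (small_part d \<mu> \<nu> t (\<kappa> * v) n) {.. - (e * v)} \<le> exp E * exp (- (K * e * log_tail \<nu> v))" .
    qed
  qed
  show ?thesis
    by (rule that[of \<kappa>\<^sub>0 "exp E"]) (use \<kappa>0 main in auto)
qed


section \<open>Tails produced by the large jumps\<close>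

lemma nn_integral_jump_part:
  assumes [measurable]: "h \<in> borel_measurable borel" "S \<in> sets borel"
  shows "(\<integral>\<^sup>+y. h y \<partial>jump_part \<nu> t S) = ennreal t * (\<integral>\<^sup>+y. h y * indicator S y \<partial>\<nu>)"
proof -
  have "(\<integral>\<^sup>+y. h y \<partial>jump_part \<nu> t S) = (\<integral>\<^sup>+y. ennreal t * (h y * indicator S y) \<partial>\<nu>)"
    unfolding jump_part_def by (subst nn_integral_density) (auto simp: mult_ac)
  then show ?thesis by (simp add: nn_integral_cmult)
qed

lemma measure_jump_part:
  assumes "0 \<le> t" and [measurable]: "S \<in> sets borel" "A \<in> sets borel"
  shows "measure (jump_part \<nu> t S) A = t * measure \<nu> (A \<inter> S)"
proof -
  have "emeasure (jump_part \<nu> t S) A = (\<integral>\<^sup>+y. indicator A y \<partial>jump_part \<nu> t S)" by simp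
  also have "\<dots> = ennreal t * (\<integral>\<^sup>+y. indicator A y * indicator S y \<partial>\<nu>)"
    by (rule nn_integral_jump_part) auto
  also have "(\<integral>\<^sup>+y. indicator A y * indicator S y \<partial>\<nu>) = (\<integral>\<^sup>+y. indicator (A \<inter> S) y \<partial>\<nu>)"
    by (simp add: indicator_inter_arith)
  also have "\<dots> = emeasure \<nu> (A \<inter> S)" by simp
  finally show ?thesis using assms by (simp add: measure_def enn2real_mult)
qed

text \<open>By subadditivity of the cost, adding a jump x multiplies the weight H by at most w x,
  and w has integral at most 1 over the large jumps of either sign. This gives the factor exp (2 T);
  the rest is Markov's inequality, as the cost is monotone beyond \<open>a\<close>.\<close>

lemma big_part_tail:
  assumes T: "0 \<le> T" and a: "0 \<le> a" and \<delta>: "0 < \<delta>" "\<delta> < 1" and \<kappa>: "0 < \<kappa>"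
  shows "eventually (\<lambda>v. \<forall>t\<in>{0..T}.
    measure (compound_poisson (jump_part \<nu> t (jump_shell (\<kappa> * v) (\<theta> * v)))) {a * v..}
      \<le> exp (2 * T) * exp (- ((1 - \<delta>) * jump_cost \<alpha> \<theta> a * log_tail \<nu> v))) at_top"
  using big_jumps_weight[OF \<kappa> \<theta> \<delta>, of 1, simplified] eventually_ge_at_top[of 1]
proof eventually_elim
  case (elim v)
  show ?case
  proof
    fix t assume t: "t \<in> {0..T}"
    define \<Lambda> where "\<Lambda> = (1 - \<delta>) * log_tail \<nu> v"
    have v: "1 \<le> v" "0 < log_tail \<nu> v" using elim log_tail_pos[of v] by auto
    have \<Lambda>: "0 \<le> \<Lambda>" using v \<delta> by (simp add: \<Lambda>_def)
    define S where "S = jump_shell (\<kappa> * v) (\<theta> * v)"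
    have [measurable]: "S \<in> sets borel" by (simp add: S_def)
    define \<rho> where "\<rho> = jump_part \<nu> t S"
    have fin: "finite_measure \<rho>" unfolding \<rho>_def S_def using t v \<kappa> by (intro finite_jump_shell) auto
    have sets_\<rho>: "sets \<rho> = sets borel" by (simp add: \<rho>_def)
    define H where "H x = exp (\<Lambda> * jump_cost \<alpha> \<theta> \<bar>x / v\<bar>)" for x
    define w where "w x = exp (\<Lambda> * \<bar>x / v\<bar> powr \<alpha>)" for x
    note [measurable] = jump_cost_measurable[OF \<alpha> \<theta>]
    have [measurable]: "H \<in> borel_measurable borel" "w \<in> borel_measurable borel"
      unfolding H_def w_def by measurable
    have step: "ennreal (H (x + y)) \<le> ennreal (w x) * ennreal (H y)" if "x \<in> S" for x y
    proof -
      have "\<bar>x\<bar> \<le> \<theta> * v" using that by (simp add: S_def jump_shell_def)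
      then have "\<bar>x / v\<bar> \<le> \<theta>" using v by (simp add: field_simps)
      then have "jump_cost \<alpha> \<theta> \<bar>x / v + y / v\<bar> \<le> \<bar>x / v\<bar> powr \<alpha> + jump_cost \<alpha> \<theta> \<bar>y / v\<bar>"
        by (rule jump_cost_abs_add_le[OF \<alpha> \<theta>])
      from mult_left_mono[OF this \<Lambda>]
      have "H (x + y) \<le> w x * H y"
        by (simp only: H_def w_def exp_add [symmetric] distrib_left add_divide_distrib exp_le_cancel_iff)
      then have "ennreal (H (x + y)) \<le> ennreal (w x * H y)" by (rule ennreal_leI)
      also have "\<dots> = ennreal (w x) * ennreal (H y)" by (rule ennreal_mult) (auto simp: w_def H_def)
      finally show ?thesis .
    qed
    have AE: "AE x in \<rho>. \<forall>y. ennreal (H (x + y)) \<le> ennreal (w x) * ennreal (H y)"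
    proof -
      have "AE x in \<rho>. x \<in> S"
        unfolding \<rho>_def jump_part_def by (subst AE_density) (auto simp: indicator_def)
      then show ?thesis by eventually_elim (use step in blast)
    qed
    have H0: "ennreal (H 0) \<le> 1"
      using jump_cost_0[OF \<alpha> \<theta>] by (simp add: H_def)
    have wint: "(\<integral>\<^sup>+x. ennreal (w x) \<partial>\<rho>) \<le> ennreal (2 * t)"
    proof -
      have "(\<integral>\<^sup>+x. ennreal (w x) \<partial>\<rho>) = ennreal t * (\<integral>\<^sup>+x. ennreal (w x) * indicator S x \<partial>\<nu>)"
        unfolding \<rho>_def by (rule nn_integral_jump_part) auto
      also have "\<dots> \<le> ennreal t * (\<integral>\<^sup>+x. ennreal (w \<bar>x\<bar>) * indicator {\<kappa> * v..\<theta> * v} \<bar>x\<bar> \<partial>\<nu>)"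
        by (intro mult_left_mono nn_integral_mono) (auto simp: indicator_def S_def jump_shell_def w_def)
      also have "(\<integral>\<^sup>+x. ennreal (w \<bar>x\<bar>) * indicator {\<kappa> * v..\<theta> * v} \<bar>x\<bar> \<partial>\<nu>)
          = 2 * (\<integral>\<^sup>+x. ennreal (w x) * indicator {\<kappa> * v..\<theta> * v} x \<partial>\<nu>)"
        using \<kappa> v by (intro nn_integral_nu_abs) (auto intro: less_le_trans[of 0 "\<kappa> * v"])
      also have "(\<integral>\<^sup>+x. ennreal (w x) * indicator {\<kappa> * v..\<theta> * v} x \<partial>\<nu>)
          = (\<integral>\<^sup>+y. ennreal (exp ((1 - \<delta>) * log_tail \<nu> v * (y / v) powr \<alpha>)) * indicator {\<kappa> * v..\<theta> * v} y \<partial>\<nu>)"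
      proof (rule nn_integral_cong)
        fix y
        have "0 \<le> \<kappa> * v" using \<kappa> v by simp
        then show "ennreal (w y) * indicator {\<kappa> * v..\<theta> * v} y
            = ennreal (exp ((1 - \<delta>) * log_tail \<nu> v * (y / v) powr \<alpha>)) * indicator {\<kappa> * v..\<theta> * v} y"
          using v by (auto simp: w_def \<Lambda>_def indicator_def)
      qed
      finally have "(\<integral>\<^sup>+x. ennreal (w x) \<partial>\<rho>) \<le> ennreal t * (2 * (\<integral>\<^sup>+y. ennreal (exp ((1 - \<delta>) * log_tail \<nu> v * (y / v) powr \<alpha>)) * indicator {\<kappa> * v..\<theta> * v} y \<partial>\<nu>))" .
      also have "\<dots> \<le> ennreal t * (2 * 1)"
        using elim(1) by (intro mult_left_mono) auto
      also have "\<dots> = ennreal (2 * t)" using t by (simp add: ennreal_mult mult.commute)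
      finally show ?thesis .
    qed
    have Hint: "(\<integral>\<^sup>+x. ennreal (H x) \<partial>compound_poisson \<rho>) \<le> ennreal (exp (2 * T))"
    proof -
      have "(\<integral>\<^sup>+x. ennreal (H x) \<partial>compound_poisson \<rho>) \<le> ennreal (exp (2 * t - measure \<rho> UNIV))"
        by (rule nn_integral_compound_poisson_le[OF fin sets_\<rho> _ _ AE H0 wint]) (use t in auto)
      also have "\<dots> \<le> ennreal (exp (2 * T))"
      proof (intro ennreal_leI)
        have "2 * t - measure \<rho> UNIV \<le> 2 * T" using t measure_nonneg[of \<rho> UNIV] unfolding atLeastAtMost_iff by linarith
        then show "exp (2 * t - measure \<rho> UNIV) \<le> exp (2 * T)" by simp
      qed
      finally show ?thesis .
    qed
    have rd: "real_distribution (compound_poisson \<rho>)"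
      by (rule real_distribution_compound_poisson[OF fin sets_\<rho>])
    have nn: "0 \<le> \<Lambda> * jump_cost \<alpha> \<theta> a"
      using \<Lambda> jump_cost_nonneg[OF \<alpha> \<theta> a] by simp
    have mono: "exp (\<Lambda> * jump_cost \<alpha> \<theta> a) \<le> H x" if "a * v \<le> x" for x
    proof -
      have "a \<le> x / v" using that v by (simp add: field_simps)
      then have "a \<le> \<bar>x / v\<bar>" by linarith
      from mult_left_mono[OF jump_cost_mono[OF \<alpha> \<theta> a this] \<Lambda>] show ?thesis by (simp add: H_def)
    qed
    have "measure (compound_poisson \<rho>) {a * v..} \<le> exp (2 * T) * exp (- (\<Lambda> * jump_cost \<alpha> \<theta> a))"
      by (rule markov_exp_tail[where H = H, OF rd nn mono _ _ Hint]) (auto simp: H_def)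
    then show "measure (compound_poisson (jump_part \<nu> t (jump_shell (\<kappa> * v) (\<theta> * v)))) {a * v..}
      \<le> exp (2 * T) * exp (- ((1 - \<delta>) * jump_cost \<alpha> \<theta> a * log_tail \<nu> v))"
      by (simp add: \<rho>_def S_def \<Lambda>_def mult_ac)
  qed
qed

text \<open>Here \<open>v\<close> stands for 1 / \<epsilon>. Quantifying over all laws with this
  characteristic function makes the thresholds on \<open>v\<close> independent of the underlying
  process.\<close>

definition has_levy_law :: "real \<Rightarrow> real \<Rightarrow> real measure \<Rightarrow> bool" where
  "has_levy_law v t Q \<longleftrightarrow> real_distribution Q \<and>
     (\<forall>u. char Q u = exp (of_real t * levy_exponent d (restrict_jumps \<nu> (\<theta> * v)) \<mu> u))"

text \<open>The threshold a v is shared out: a - e for the large jumps, e / 2 for the small part,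
  and e / 2 as the gap used by the weak limit. Half of \<delta> is spent on the large jumps, the
  other half absorbs the constants.\<close>

lemma levy_tail_upper:
  assumes T: "0 \<le> T" and e: "0 < e" "e < a" and \<delta>: "0 < \<delta>" "\<delta> < 1"
    and c0: "0 < jump_cost \<alpha> \<theta> (a - e)"
  shows "eventually (\<lambda>v. \<forall>t\<in>{0..T}. \<forall>Q. has_levy_law v t Q \<longrightarrow>
     measure Q {a * v..} \<le> exp (- ((1 - \<delta>) * jump_cost \<alpha> \<theta> (a - e) * log_tail \<nu> v))) at_top"
proof -
  define c where "c = jump_cost \<alpha> \<theta> (a - e)"
  have c: "0 < c" using c0 by (simp add: c_def)
  \<comment> \<open>A deviation of e / 2 by the small part then costs c + 1, more than the cost
    \<open>c\<close> of the large jumps, so the small part is negligible.\<close>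
  define K where "K = 2 * (c + 1) / e"
  have K: "0 < K" "K * (e / 2) = c + 1" using c e by (auto simp: K_def)
  obtain \<kappa>\<^sub>0 C where \<kappa>0: "0 < \<kappa>\<^sub>0" "0 \<le> C"
    "\<And>\<kappa> e. 0 < \<kappa> \<Longrightarrow> \<kappa> \<le> \<kappa>\<^sub>0 \<Longrightarrow> 0 < e \<Longrightarrow> eventually (\<lambda>v. \<forall>t\<in>{0..T}. \<forall>n.
       measure (small_part d \<mu> \<nu> t (\<kappa> * v) n) {e * v..} \<le> C * exp (- (K * e * log_tail \<nu> v)) \<and>
       measure (small_part d \<mu> \<nu> t (\<kappa> * v) n) {.. - (e * v)} \<le> C * exp (- (K * e * log_tail \<nu> v))) at_top"
    using small_part_tail[OF K(1) T] by blast
  define \<kappa> where "\<kappa> = min \<kappa>\<^sub>0 \<theta>"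
  have \<kappa>: "0 < \<kappa>" "\<kappa> \<le> \<kappa>\<^sub>0" "\<kappa> \<le> \<theta>" using \<kappa>0 \<theta> by (auto simp: \<kappa>_def)
  have small: "eventually (\<lambda>v. \<forall>t\<in>{0..T}. \<forall>n.
       measure (small_part d \<mu> \<nu> t (\<kappa> * v) n) {e / 2 * v..} \<le> C * exp (- (K * (e / 2) * log_tail \<nu> v)) \<and>
       measure (small_part d \<mu> \<nu> t (\<kappa> * v) n) {.. - (e / 2 * v)} \<le> C * exp (- (K * (e / 2) * log_tail \<nu> v))) at_top"
    by (rule \<kappa>0(3)) (use \<kappa> e in auto)
  have \<delta>2: "0 < \<delta> / 2" "\<delta> / 2 < 1" using \<delta> by auto
  have ae: "0 \<le> a - e" using e by simp
  note big = big_part_tail[OF T ae \<delta>2 \<kappa>(1), folded c_def]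
  have "0 < \<delta> / 2 * c" using \<delta> c by simp
  note ev = exp_tail_at_top[OF log_tail_at_top this, of 1 "C + exp (2 * T)", simplified]
  show ?thesis
    using small big ev eventually_ge_at_top[of "max 1 (1 / \<kappa>)"]
  proof eventually_elim
    case (elim v)
    have v: "1 \<le> v" "0 < log_tail \<nu> v" "1 \<le> \<kappa> * v" using elim(4) log_tail_pos[of v] \<kappa> by (auto simp: field_simps)
    show ?case
    proof (intro ballI allI impI)
      fix t Q assume t: "t \<in> {0..T}" and Q: "has_levy_law v t Q"
      have t0: "0 \<le> t" using t by simp
      have kv: "\<kappa> * v \<le> \<theta> * v" using \<kappa> v by (intro mult_right_mono) auto
      have wc: "weak_conv_m (levy_approx d \<mu> \<nu> t (\<kappa> * v) (\<theta> * v)) Q"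
        by (rule levy_approx_weak_conv[OF t0 v(3) kv d]) (use Q in \<open>auto simp: has_levy_law_def\<close>)
      have rdR: "real_distribution (levy_approx d \<mu> \<nu> t (\<kappa> * v) (\<theta> * v) n)" for n
        by (rule real_distribution_levy_approx) (use t0 v in auto)
      have "measure (levy_approx d \<mu> \<nu> t (\<kappa> * v) (\<theta> * v) n) {e / 2 * v + (a - e) * v..}
          \<le> exp (- ((1 - \<delta>) * c * log_tail \<nu> v))" for n
      proof -
        have "measure (levy_approx d \<mu> \<nu> t (\<kappa> * v) (\<theta> * v) n) {e / 2 * v + (a - e) * v..}
          \<le> measure (small_part d \<mu> \<nu> t (\<kappa> * v) n) {e / 2 * v..}
            + measure (compound_poisson (jump_part \<nu> t (jump_shell (\<kappa> * v) (\<theta> * v)))) {(a - e) * v..}"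
          unfolding levy_approx_def
          by (rule measure_convolution_le[OF real_distribution_small_part[OF t0] real_distribution_shell[OF _ t0]])
             (use v in simp)
        also have "\<dots> \<le> C * exp (- (K * (e / 2) * log_tail \<nu> v)) + exp (2 * T) * exp (- ((1 - \<delta> / 2) * c * log_tail \<nu> v))"
          using elim(1) elim(2) t by (intro add_mono) blast+
        also have "\<dots> \<le> C * exp (- ((1 - \<delta> / 2) * c * log_tail \<nu> v)) + exp (2 * T) * exp (- ((1 - \<delta> / 2) * c * log_tail \<nu> v))"
        proof -
          have "(1 - \<delta> / 2) * c \<le> 1 * c" using c \<delta> by (intro mult_right_mono) auto
          then have "(1 - \<delta> / 2) * c \<le> K * (e / 2)" unfolding K(2) by simp
          then have "(1 - \<delta> / 2) * c * log_tail \<nu> v \<le> K * (e / 2) * log_tail \<nu> v"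
            using v by (intro mult_right_mono) auto
          then show ?thesis using \<kappa>0(2) by (intro add_right_mono mult_left_mono) simp_all
        qed
        also have "\<dots> = (C + exp (2 * T)) * exp (- (\<delta> / 2 * c * log_tail \<nu> v)) * exp (- ((1 - \<delta>) * c * log_tail \<nu> v))"
          by (simp add: distrib_right mult.assoc flip: exp_add) (simp add: algebra_simps)
        also have "\<dots> \<le> 1 * exp (- ((1 - \<delta>) * c * log_tail \<nu> v))"
          using elim(3) by (intro mult_right_mono) (auto simp: mult.assoc)
        finally show ?thesis by simp
      qed
      moreover have "e / 2 * v + (a - e) * v < a * v"
      proof -
        have "0 < e / 2 * v" using e v by simp
        then show ?thesis by (simp add: left_diff_distrib)
      qed
      ultimately show "measure Q {a * v..} \<le> exp (- ((1 - \<delta>) * jump_cost \<alpha> \<theta> (a - e) * log_tail \<nu> v))"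
        unfolding c_def [symmetric]
        using weak_conv_tail_le[OF rdR _ wc] Q by (auto simp: has_levy_law_def)
    qed
  qed
qed

text \<open>Each full jump is shortened slightly, and the deficit together with 3 \<eta> is put into
  the remainder. Sizes strictly between 0 and \<theta> are needed so that jumps of at least these
  sizes keep comparable mass after truncation. The surplus 3 \<eta> is later split between the small
  part, the weak limit and the final margin.\<close>

lemma phi_perturbed:
  assumes "0 < \<delta>"
  obtains \<eta> :: real and x :: "nat \<Rightarrow> real" and k :: nat where "0 < \<eta>"
    "\<And>i. i < k \<Longrightarrow> 0 < x i \<and> x i < \<theta>" "0 < k" "(\<Sum>i<k. x i) = 1 + 3 * \<eta>"
    "(\<Sum>i<k. x i powr \<alpha>) < (1 + \<delta>) * phi \<alpha> \<theta>"
proof -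
  define n where "n = nat \<lfloor>1 / \<theta>\<rfloor>"
  have n: "real n = of_int \<lfloor>1 / \<theta>\<rfloor>" using \<theta> by (simp add: n_def)
  define r where "r = 1 - real n * \<theta>"
  have r: "0 \<le> r" "r < \<theta>"
    unfolding r_def n using floor_divide_lower[OF \<theta>, of 1] floor_divide_upper[OF \<theta>, of 1]
    by (simp_all add: algebra_simps)
  have phi: "phi \<alpha> \<theta> = real n * \<theta> powr \<alpha> + r powr \<alpha>" by (simp add: phi_def r_def n)
  have phi0: "0 < phi \<alpha> \<theta>" by (rule phi_pos[OF \<alpha> \<theta>])
  define g where "g \<eta> = real n * (\<theta> * (1 - \<eta>)) powr \<alpha> + (r + (real n * \<theta> + 3) * \<eta>) powr \<alpha>" for \<eta>
  have "(g \<longlongrightarrow> real n * (\<theta> * (1 - 0)) powr \<alpha> + (r + (real n * \<theta> + 3) * 0) powr \<alpha>) (at_right 0)"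
    unfolding g_def
  \<comment> \<open>If 1 / \<theta> is an integer, then r = 0 and the limit of the power is taken at
    the origin, through nonnegative bases.\<close>
  proof (intro tendsto_add tendsto_mult tendsto_const tendsto_powr2)
    show "\<forall>\<^sub>F \<eta> in at_right 0. 0 \<le> \<theta> * (1 - \<eta>)"
      using eventually_at_right_real[of 0 1] by (rule eventually_mono) (use \<theta> in auto)
    show "\<forall>\<^sub>F \<eta> in at_right 0. 0 \<le> r + (real n * \<theta> + 3) * \<eta>"
      using eventually_at_right_less[of 0] by (rule eventually_mono) (use r \<theta> in auto)
  qed (use \<alpha> in \<open>auto intro!: tendsto_intros tendsto_eq_intros\<close>)
  then have "(g \<longlongrightarrow> phi \<alpha> \<theta>) (at_right 0)" by (simp add: phi)
  moreover have "phi \<alpha> \<theta> < (1 + \<delta>) * phi \<alpha> \<theta>" using phi0 assms by (simp add: distrib_right)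
  ultimately have e1: "\<forall>\<^sub>F \<eta> in at_right 0. g \<eta> < (1 + \<delta>) * phi \<alpha> \<theta>" by (rule order_tendstoD)
  have "((\<lambda>\<eta>. r + (real n * \<theta> + 3) * \<eta>) \<longlongrightarrow> r + (real n * \<theta> + 3) * 0) (at_right 0)"
    by (intro tendsto_intros)
  then have e2: "\<forall>\<^sub>F \<eta> in at_right 0. r + (real n * \<theta> + 3) * \<eta> < \<theta>"
    using r by (intro order_tendstoD(2)) auto
  have "\<forall>\<^sub>F \<eta> in at_right (0::real). \<eta> \<in> {0<..<1}" by (intro eventually_at_right_real) auto
  with e1 e2 have "\<forall>\<^sub>F \<eta> in at_right 0. g \<eta> < (1 + \<delta>) * phi \<alpha> \<theta> \<and> r + (real n * \<theta> + 3) * \<eta> < \<theta> \<and> 0 < \<eta> \<and> \<eta> < 1"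
    by eventually_elim auto
  then obtain \<eta> where \<eta>: "g \<eta> < (1 + \<delta>) * phi \<alpha> \<theta>" "r + (real n * \<theta> + 3) * \<eta> < \<theta>" "0 < \<eta>" "\<eta> < 1"
    using eventually_happens by fastforce
  define x where "x i = (if i < n then \<theta> * (1 - \<eta>) else r + (real n * \<theta> + 3) * \<eta>)" for i
  have sum: "(\<Sum>i<Suc n. h (x i)) = real n * h (\<theta> * (1 - \<eta>)) + h (r + (real n * \<theta> + 3) * \<eta>)" for h :: "real \<Rightarrow> real"
    by (simp add: x_def)
  show ?thesis
  proof
    have "0 < (real n * \<theta> + 3) * \<eta>" using \<eta> \<theta> by (intro mult_pos_pos add_nonneg_pos) auto
    then have "0 < r + (real n * \<theta> + 3) * \<eta>" using r by linarith
    moreover have "0 < \<theta> * (1 - \<eta>)" "\<theta> * (1 - \<eta>) < \<theta>" using \<eta> \<theta> by (auto simp: field_simps)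
    ultimately show "0 < x i \<and> x i < \<theta>" if "i < Suc n" for i using \<eta> by (simp add: x_def)
    show "(\<Sum>i<Suc n. x i) = 1 + 3 * \<eta>" using sum[of "\<lambda>x. x"] by (simp add: r_def algebra_simps)
    show "(\<Sum>i<Suc n. x i powr \<alpha>) < (1 + \<delta>) * phi \<alpha> \<theta>"
      using sum[of "\<lambda>x. x powr \<alpha>"] \<eta> by (simp add: g_def)
  qed (use \<eta> in auto)
qed

text \<open>Cutting the tail at \<theta> v removes a part that is exponentially smaller than the
  tail at x v, since x powr \<alpha> < \<theta> powr \<alpha>. Eventually at least half of the tail
  remains.\<close>

lemma measure_nu_interval_ge:
  assumes "0 < x" "x < \<theta>" "0 < \<zeta>"
  shows "eventually (\<lambda>v. exp (- ((x powr \<alpha> + \<zeta>) * log_tail \<nu> v)) / 2 \<le> measure \<nu> {x * v..\<theta> * v}) at_top"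
proof -
  define g where "g = (\<theta> powr \<alpha> - x powr \<alpha>) / 2"
  have g: "0 < g" using assms \<alpha> by (auto simp: g_def intro!: powr_less_mono2)
  have "((\<lambda>v. log_tail \<nu> (\<theta> * v) / log_tail \<nu> v - log_tail \<nu> (x * v) / log_tail \<nu> v) \<longlongrightarrow> \<theta> powr \<alpha> - x powr \<alpha>) at_top"
    using assms \<theta> by (intro tendsto_diff log_tail_ratio)
  then have e1: "eventually (\<lambda>v. g < log_tail \<nu> (\<theta> * v) / log_tail \<nu> v - log_tail \<nu> (x * v) / log_tail \<nu> v) at_top"
    using g by (intro order_tendstoD(1)) (auto simp: g_def)
  have e2: "eventually (\<lambda>v. log_tail \<nu> (x * v) / log_tail \<nu> v < x powr \<alpha> + \<zeta>) at_top"
    using assms by (intro order_tendstoD(2)[OF log_tail_ratio]) auto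
  have e3: "eventually (\<lambda>v. 1 * exp (- g * log_tail \<nu> v) \<le> 1 / 2) at_top"
    by (rule exp_tail_at_top[OF log_tail_at_top g]) simp
  show ?thesis using e1 e2 e3 eventually_ge_at_top[of "max 1 (1 / x)"]
  proof eventually_elim
    case (elim v)
    have v: "1 \<le> v" "0 < log_tail \<nu> v" "1 \<le> x * v" using elim(4) log_tail_pos[of v] assms by (auto simp: field_simps)
    have xv: "x * v \<le> \<theta> * v" using assms v by (intro mult_right_mono) auto
    then have tv: "1 \<le> \<theta> * v" using v(3) by linarith
    have f1: "g * log_tail \<nu> v \<le> log_tail \<nu> (\<theta> * v) - log_tail \<nu> (x * v)"
      using elim(1) v by (simp add: field_simps)
    have f2: "log_tail \<nu> (x * v) \<le> (x powr \<alpha> + \<zeta>) * log_tail \<nu> v"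
      using elim(2) v by (simp add: field_simps)
    have "exp (- log_tail \<nu> (\<theta> * v)) \<le> exp (- g * log_tail \<nu> v) * exp (- log_tail \<nu> (x * v))"
      using f1 by (simp flip: exp_add)
    also have "\<dots> \<le> 1 / 2 * exp (- log_tail \<nu> (x * v))"
      using elim(3) by (intro mult_right_mono) auto
    finally have "exp (- log_tail \<nu> (\<theta> * v)) \<le> exp (- log_tail \<nu> (x * v)) / 2" by simp
    moreover have "exp (- log_tail \<nu> (x * v)) \<le> measure \<nu> {x * v..\<theta> * v} + exp (- log_tail \<nu> (\<theta> * v))"
    proof -
      have "{x * v..} = {x * v..\<theta> * v} \<union> {\<theta> * v..}" using xv by auto
      then have "measure \<nu> {x * v..} \<le> measure \<nu> {x * v..\<theta> * v} + measure \<nu> {\<theta> * v..}"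
        using measure_Un_le[of "{x * v..\<theta> * v}" \<nu> "{\<theta> * v..}"] by simp
      then show ?thesis using v tv by (simp add: measure_tail)
    qed
    moreover have "exp (- ((x powr \<alpha> + \<zeta>) * log_tail \<nu> v)) \<le> exp (- log_tail \<nu> (x * v))"
      using f2 by simp
    ultimately show ?case by linarith
  qed
qed

text \<open>The logarithmic tail is positive from 1 on, so each one-sided tail has mass below 1. The
  bound keeps the Poisson factor exp (- mass) away from 0 uniformly in v.\<close>

lemma jump_part_mass_le:
  assumes "0 \<le> t" "1 \<le> b"
  shows "measure (jump_part \<nu> t (jump_shell b r)) UNIV \<le> 2 * t"
proof -
  have "emeasure \<nu> (jump_shell b r) = (\<integral>\<^sup>+y. indicator (jump_shell b r) y \<partial>\<nu>)" by simp
  also have "\<dots> \<le> (\<integral>\<^sup>+y. 1 * indicator {b..} \<bar>y\<bar> \<partial>\<nu>)"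
    by (intro nn_integral_mono) (auto simp: indicator_def jump_shell_def)
  also have "\<dots> = 2 * (\<integral>\<^sup>+y. 1 * indicator {b..} y \<partial>\<nu>)"
    by (rule nn_integral_nu_abs) (use assms in auto)
  also have "\<dots> = 2 * ennreal (exp (- log_tail \<nu> b))" using assms by (simp add: emeasure_tail)
  also have "\<dots> \<le> 2 * ennreal 1"
    using log_tail_pos[OF assms(2)] by (intro mult_left_mono ennreal_leI) auto
  finally have "measure \<nu> (jump_shell b r) \<le> 2"
    by (simp add: measure_def enn2real_leI)
  from mult_left_mono[OF this assms(1)] show ?thesis
    using assms by (simp add: measure_jump_part mult.commute)
qed

text \<open>The large jumps follow the perturbed optimal configuration, and the small part stays
  above - \<eta> v with probability at least 1 / 2. A quarter of \<delta> pays for the perturbed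
  cost, a quarter for the k errors \<zeta>, and half for constants. The margin \<eta> is obtained
  before t is fixed, because the window length will be chosen in terms of it.\<close>

lemma levy_tail_lower:
  assumes \<delta>: "0 < \<delta>"
  obtains \<eta> where "0 < \<eta>"
    "\<And>t. 0 < t \<Longrightarrow> eventually (\<lambda>v. \<forall>Q. has_levy_law v t Q \<longrightarrow>
     exp (- ((1 + \<delta>) * phi \<alpha> \<theta> * log_tail \<nu> v)) \<le> measure Q {(1 + \<eta>) * v..}) at_top"
proof -
  define \<phi> where "\<phi> = phi \<alpha> \<theta>"
  have \<phi>: "0 < \<phi>" unfolding \<phi>_def by (rule phi_pos[OF \<alpha> \<theta>])
  obtain \<eta> and x :: "nat \<Rightarrow> real" and k :: nat where \<eta>: "0 < \<eta>" and x: "\<And>i. i < k \<Longrightarrow> 0 < x i \<and> x i < \<theta>" and k: "0 < k"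
    and sum: "(\<Sum>i<k. x i) = 1 + 3 * \<eta>" and cost: "(\<Sum>i<k. x i powr \<alpha>) < (1 + \<delta> / 4) * \<phi>"
    using phi_perturbed[of "\<delta> / 4"] \<delta> unfolding \<phi>_def by (metis zero_less_divide_iff zero_less_numeral)
  define \<zeta> where "\<zeta> = \<delta> * \<phi> / (4 * k)"
  have \<zeta>: "0 < \<zeta>" "k * \<zeta> = \<delta> / 4 * \<phi>" using \<delta> \<phi> k by (auto simp: \<zeta>_def)
  have main: "eventually (\<lambda>v. \<forall>Q. has_levy_law v t Q \<longrightarrow>
     exp (- ((1 + \<delta>) * \<phi> * log_tail \<nu> v)) \<le> measure Q {(1 + \<eta>) * v..}) at_top" if t: "0 < t" for t
  proof -
    have t0: "0 \<le> t" using t by simp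
    obtain \<kappa>\<^sub>0 C where \<kappa>0: "0 < \<kappa>\<^sub>0" "0 \<le> C"
      "\<And>\<kappa> e. 0 < \<kappa> \<Longrightarrow> \<kappa> \<le> \<kappa>\<^sub>0 \<Longrightarrow> 0 < e \<Longrightarrow> eventually (\<lambda>v. \<forall>s\<in>{0..t}. \<forall>n.
         measure (small_part d \<mu> \<nu> s (\<kappa> * v) n) {e * v..} \<le> C * exp (- (1 * e * log_tail \<nu> v)) \<and>
         measure (small_part d \<mu> \<nu> s (\<kappa> * v) n) {.. - (e * v)} \<le> C * exp (- (1 * e * log_tail \<nu> v))) at_top"
      using small_part_tail[OF zero_less_one t0] by blast
    \<comment> \<open>Half of the smallest prescribed jump at most, so that all prescribed jumps
      belong to the large part.\<close>
    define \<kappa> where "\<kappa> = min \<kappa>\<^sub>0 (Min (x ` {..<k}) / 2)"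
    have "0 < Min (x ` {..<k})" using k x by (subst Min_gr_iff) auto
    then have \<kappa>: "0 < \<kappa>" "\<kappa> \<le> \<kappa>\<^sub>0" using \<kappa>0 by (auto simp: \<kappa>_def)
    have \<kappa>x: "\<kappa> < x i" if "i < k" for i
    proof -
      have "Min (x ` {..<k}) \<le> x i" using that by (intro Min_le) auto
      moreover have "\<kappa> \<le> Min (x ` {..<k}) / 2" by (simp add: \<kappa>_def)
      ultimately show ?thesis using x[OF that] by linarith
    qed
    have \<kappa>\<theta>: "\<kappa> < \<theta>" using \<kappa>x[OF k] x[OF k] by linarith
    have small: "eventually (\<lambda>v. \<forall>s\<in>{0..t}. \<forall>n.
         measure (small_part d \<mu> \<nu> s (\<kappa> * v) n) {\<eta> * v..} \<le> C * exp (- (1 * \<eta> * log_tail \<nu> v)) \<and>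
         measure (small_part d \<mu> \<nu> s (\<kappa> * v) n) {.. - (\<eta> * v)} \<le> C * exp (- (1 * \<eta> * log_tail \<nu> v))) at_top"
      using \<kappa>0(3)[OF \<kappa> \<eta>] .
    have half: "eventually (\<lambda>v. C * exp (- \<eta> * log_tail \<nu> v) \<le> 1 / 2) at_top"
      by (rule exp_tail_at_top[OF log_tail_at_top \<eta>]) simp
    have jumps: "eventually (\<lambda>v. \<forall>i\<in>{..<k}. exp (- ((x i powr \<alpha> + \<zeta>) * log_tail \<nu> v)) / 2 \<le> measure \<nu> {x i * v..\<theta> * v}) at_top"
      using x \<zeta> by (intro eventually_ball_finite ballI measure_nu_interval_ge) auto
    \<comment> \<open>The Poisson weight of k jumps, one factor t / 2 for each jump, and a last 1 /
      2 for the small part.\<close>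
    define c\<^sub>0 where "c\<^sub>0 = exp (- (2 * t)) / fact k * (t / 2) ^ k / 2"
    have c0: "0 < c\<^sub>0" using t by (simp add: c\<^sub>0_def)
    have "0 < \<delta> / 2 * \<phi>" using \<delta> \<phi> by simp
    then have const: "eventually (\<lambda>v. 1 * exp (- (\<delta> / 2 * \<phi>) * log_tail \<nu> v) \<le> c\<^sub>0) at_top"
      by (rule exp_tail_at_top[OF log_tail_at_top _ c0])
    show ?thesis
      using small half jumps const eventually_ge_at_top[of "max 1 (1 / \<kappa>)"]
    proof eventually_elim
      case (elim v)
      have v: "1 \<le> v" "0 < log_tail \<nu> v" "1 \<le> \<kappa> * v" using elim(5) log_tail_pos[of v] \<kappa> by (auto simp: field_simps)
      define S where "S = jump_shell (\<kappa> * v) (\<theta> * v)"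
      define \<rho> where "\<rho> = jump_part \<nu> t S"
      have [measurable]: "S \<in> sets borel" by (simp add: S_def)
      have fin: "finite_measure \<rho>" unfolding \<rho>_def S_def using v by (intro finite_jump_shell t0) auto
      have sets_\<rho>: "sets \<rho> = sets borel" by (simp add: \<rho>_def)
      interpret \<rho>: finite_measure \<rho> by (rule fin)
      have jump: "t / 2 * exp (- ((x i powr \<alpha> + \<zeta>) * log_tail \<nu> v)) \<le> measure \<rho> {x i * v..}" if i: "i < k" for i
      proof -
        have "\<kappa> * v < x i * v" using \<kappa>x[OF i] v by simp
        then have "y \<in> {x i * v..} \<inter> S \<longleftrightarrow> y \<in> {x i * v..\<theta> * v}" for y
          using v(3) unfolding S_def jump_shell_def Int_iff mem_Collect_eq atLeast_iff atLeastAtMost_iff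
          by (intro iffI; elim conjE; intro conjI; linarith)
        then have "{x i * v..} \<inter> S = {x i * v..\<theta> * v}" by blast
        then have "measure \<rho> {x i * v..} = t * measure \<nu> {x i * v..\<theta> * v}"
          unfolding \<rho>_def by (simp add: measure_jump_part t0)
        moreover have "exp (- ((x i powr \<alpha> + \<zeta>) * log_tail \<nu> v)) / 2 \<le> measure \<nu> {x i * v..\<theta> * v}"
          using elim(3) i by blast
        ultimately show ?thesis using mult_left_mono[OF _ t0] by fastforce
      qed
      have pos: "0 < measure \<rho> UNIV"
      proof -
        have "0 < t / 2 * exp (- ((x 0 powr \<alpha> + \<zeta>) * log_tail \<nu> v))" using t by simp
        also have "\<dots> \<le> measure \<rho> {x 0 * v..}" by (rule jump[OF k])
        also have "\<dots> \<le> measure \<rho> UNIV"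
          by (rule \<rho>.finite_measure_mono) (auto simp: sets_\<rho>)
        finally show ?thesis .
      qed
      have mass: "measure \<rho> UNIV \<le> 2 * t"
        unfolding \<rho>_def S_def by (rule jump_part_mass_le[OF t0 v(3)])
      have big: "2 * c\<^sub>0 * exp (- ((1 + \<delta> / 2) * \<phi> * log_tail \<nu> v)) \<le> measure (compound_poisson \<rho>) {(1 + 3 * \<eta>) * v..}"
      proof -
        have "(\<Sum>i<k. x i powr \<alpha> + \<zeta>) = (\<Sum>i<k. x i powr \<alpha>) + k * \<zeta>"
          by (simp add: sum.distrib)
        also have "\<dots> \<le> (1 + \<delta> / 2) * \<phi>" using cost \<zeta>(2) by (simp add: algebra_simps)
        finally have "exp (- ((1 + \<delta> / 2) * \<phi> * log_tail \<nu> v)) \<le> exp (- ((\<Sum>i<k. x i powr \<alpha> + \<zeta>) * log_tail \<nu> v))"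
          using v by (simp add: mult_right_mono)
        also have "\<dots> = (\<Prod>i<k. exp (- ((x i powr \<alpha> + \<zeta>) * log_tail \<nu> v)))"
          by (simp add: exp_sum [symmetric] sum_negf sum_distrib_right)
        finally have "2 * c\<^sub>0 * exp (- ((1 + \<delta> / 2) * \<phi> * log_tail \<nu> v))
            \<le> 2 * c\<^sub>0 * (\<Prod>i<k. exp (- ((x i powr \<alpha> + \<zeta>) * log_tail \<nu> v)))"
          using c0 by (intro mult_left_mono) auto
        also have "\<dots> = exp (- (2 * t)) / fact k * (\<Prod>i<k. t / 2 * exp (- ((x i powr \<alpha> + \<zeta>) * log_tail \<nu> v)))"
          by (simp only: c\<^sub>0_def prod.distrib prod_constant card_lessThan) simp
        also have "\<dots> \<le> exp (- measure \<rho> UNIV) / fact k * (\<Prod>i<k. measure \<rho> {x i * v..})"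
          using jump mass t by (intro mult_mono divide_right_mono prod_mono) (auto intro!: prod_nonneg)
        also have "\<dots> \<le> measure (compound_poisson \<rho>) {(1 + 3 * \<eta>) * v..}"
          by (rule measure_compound_poisson_ge[OF fin sets_\<rho> pos]) (simp add: sum [symmetric] sum_distrib_right)
        finally show ?thesis .
      qed
      show ?case
      proof (intro allI impI)
        fix Q assume Q: "has_levy_law v t Q"
        have kv: "\<kappa> * v \<le> \<theta> * v" using \<kappa>\<theta> v by (intro mult_right_mono) auto
        have wc: "weak_conv_m (levy_approx d \<mu> \<nu> t (\<kappa> * v) (\<theta> * v)) Q"
          by (rule levy_approx_weak_conv[OF t0 v(3) kv d]) (use Q in \<open>auto simp: has_levy_law_def\<close>)
        have rdR: "real_distribution (levy_approx d \<mu> \<nu> t (\<kappa> * v) (\<theta> * v) n)" for n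
          by (rule real_distribution_levy_approx) (use t0 v in auto)
        have "exp (- ((1 + \<delta>) * \<phi> * log_tail \<nu> v))
            \<le> measure (levy_approx d \<mu> \<nu> t (\<kappa> * v) (\<theta> * v) n) {- (\<eta> * v) + (1 + 3 * \<eta>) * v..}" for n
        proof -
          have rd: "real_distribution (small_part d \<mu> \<nu> t (\<kappa> * v) n)" by (rule real_distribution_small_part[OF t0])
          interpret N: real_distribution "small_part d \<mu> \<nu> t (\<kappa> * v) n" by (rule rd)
          have "measure (small_part d \<mu> \<nu> t (\<kappa> * v) n) {.. - (\<eta> * v)} \<le> C * exp (- (1 * \<eta> * log_tail \<nu> v))"
            using elim(1) t0 by (meson atLeastAtMost_iff order_refl)
          also have "\<dots> \<le> 1 / 2" using elim(2) by simp
          finally have "measure (small_part d \<mu> \<nu> t (\<kappa> * v) n) {.. - (\<eta> * v)} \<le> 1 / 2" .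
          moreover have "1 \<le> measure (small_part d \<mu> \<nu> t (\<kappa> * v) n) {.. - (\<eta> * v)}
              + measure (small_part d \<mu> \<nu> t (\<kappa> * v) n) {- (\<eta> * v)..}"
          proof -
            have "UNIV = {.. - (\<eta> * v)} \<union> {- (\<eta> * v)..}" by auto
            then show ?thesis
              using measure_Un_le[of "{.. - (\<eta> * v)}" "small_part d \<mu> \<nu> t (\<kappa> * v) n" "{- (\<eta> * v)..}"] N.prob_space by simp
          qed
          ultimately have half': "1 / 2 \<le> measure (small_part d \<mu> \<nu> t (\<kappa> * v) n) {- (\<eta> * v)..}" by linarith
          have "exp (- ((1 + \<delta>) * \<phi> * log_tail \<nu> v))
              = 1 * exp (- (\<delta> / 2 * \<phi>) * log_tail \<nu> v) * exp (- ((1 + \<delta> / 2) * \<phi> * log_tail \<nu> v))"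
            by (simp add: algebra_simps flip: exp_add)
          also have "\<dots> \<le> c\<^sub>0 * exp (- ((1 + \<delta> / 2) * \<phi> * log_tail \<nu> v))"
            by (rule mult_right_mono[OF elim(4)]) simp
          also have "\<dots> = 1 / 2 * (2 * c\<^sub>0 * exp (- ((1 + \<delta> / 2) * \<phi> * log_tail \<nu> v)))" by simp
          also have "\<dots> \<le> measure (small_part d \<mu> \<nu> t (\<kappa> * v) n) {- (\<eta> * v)..} * measure (compound_poisson \<rho>) {(1 + 3 * \<eta>) * v..}"
            using half' big c0 by (intro mult_mono) auto
          also have "\<dots> \<le> measure (levy_approx d \<mu> \<nu> t (\<kappa> * v) (\<theta> * v) n) {- (\<eta> * v) + (1 + 3 * \<eta>) * v..}"
            unfolding levy_approx_def \<rho>_def S_def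
            by (rule emeasure_convolution_ge[OF rd real_distribution_shell[OF _ t0]]) (use v in simp)
          finally show ?thesis .
        qed
        moreover have "(1 + \<eta>) * v < - (\<eta> * v) + (1 + 3 * \<eta>) * v"
        proof -
          have "0 < \<eta> * v" using \<eta> v by simp
          then show ?thesis by (simp add: algebra_simps)
        qed
        ultimately show "exp (- ((1 + \<delta>) * \<phi> * log_tail \<nu> v)) \<le> measure Q {(1 + \<eta>) * v..}"
          using weak_conv_tail_ge[OF rdR _ wc] Q by (auto simp: has_levy_law_def)
      qed
    qed
  qed
  show ?thesis
    using that[OF \<eta>] main unfolding \<phi>_def by blast
qed

text \<open>Reflection changes the sign of the drift and nothing else, because \<nu> is symmetric.
  Left tails therefore follow from the right tails of the same family with drift - \<mu>.\<close>

lemma levy_exponent_uminus: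
  "levy_exponent d (restrict_jumps \<nu> r) \<mu> (- u) = levy_exponent d (restrict_jumps \<nu> r) (- \<mu>) u"
proof -
  have "(CLINT y|\<nu>. indicator {-r..r} y *\<^sub>R lk_integrand (- u) y)
      = (CLINT y|distr \<nu> borel uminus. indicator {-r..r} y *\<^sub>R lk_integrand (- u) y)"
    using sym by (simp add: symmetric_measure_def)
  also have "\<dots> = (CLINT y|\<nu>. indicator {-r..r} (- y) *\<^sub>R lk_integrand (- u) (- y))"
    by (subst integral_distr) auto
  also have "\<dots> = (CLINT y|\<nu>. indicator {-r..r} y *\<^sub>R lk_integrand u y)"
    by (intro Bochner_Integration.integral_cong) (auto simp: lk_integrand_def indicator_def)
  finally show ?thesis by (simp add: levy_exponent_restrict)
qed

lemma has_levy_law_uminus: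
  assumes "has_levy_law v t Q"
  shows "symmetric_weibull_tail.has_levy_law \<nu> d (- \<mu>) \<theta> v t (distr Q borel uminus)"
proof -
  interpret R: symmetric_weibull_tail \<nu> \<alpha> d "- \<mu>" \<theta> ..
  interpret Q: real_distribution Q using assms by (simp add: has_levy_law_def)
  have "char (distr Q borel uminus) u = char Q (- u)" for u
    by (simp add: char_def integral_distr)
  then show ?thesis
    using assms by (auto simp: has_levy_law_def R.has_levy_law_def levy_exponent_uminus intro!: Q.real_distribution_distr)
qed

lemma levy_tail_upper_abs:
  assumes T: "0 \<le> T" and e: "0 < e" "e < a" and \<delta>: "0 < \<delta>" "\<delta> < 1"
    and c0: "0 < jump_cost \<alpha> \<theta> (a - e)"
  shows "eventually (\<lambda>v. \<forall>t\<in>{0..T}. \<forall>Q. has_levy_law v t Q \<longrightarrow>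
     measure Q {x. a * v \<le> \<bar>x\<bar>} \<le> 2 * exp (- ((1 - \<delta>) * jump_cost \<alpha> \<theta> (a - e) * log_tail \<nu> v))) at_top"
proof -
  interpret R: symmetric_weibull_tail \<nu> \<alpha> d "- \<mu>" \<theta> ..
  show ?thesis
    using levy_tail_upper[OF assms] R.levy_tail_upper[OF assms]
  proof eventually_elim
    case (elim v)
    show ?case
    proof (intro ballI allI impI)
      fix t Q assume t: "t \<in> {0..T}" and Q: "has_levy_law v t Q"
      interpret Q: real_distribution Q using Q by (simp add: has_levy_law_def)
      have "{x. a * v \<le> \<bar>x\<bar>} = {a * v..} \<union> {.. - (a * v)}" by auto
      then have "measure Q {x. a * v \<le> \<bar>x\<bar>} \<le> measure Q {a * v..} + measure Q {.. - (a * v)}"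
        using measure_Un_le[of "{a * v..}" Q "{.. - (a * v)}"] by simp
      also have "measure Q {.. - (a * v)} = measure (distr Q borel uminus) {a * v..}"
        by (subst measure_distr) (auto intro!: arg_cong2[where f=measure])
      finally show "measure Q {x. a * v \<le> \<bar>x\<bar>} \<le> 2 * exp (- ((1 - \<delta>) * jump_cost \<alpha> \<theta> (a - e) * log_tail \<nu> v))"
        using elim(1)[rule_format, OF t Q] elim(2)[rule_format, OF t has_levy_law_uminus[OF Q]] by simp
    qed
  qed
qed

lemma levy_tail_lower_both:
  assumes \<delta>: "0 < \<delta>"
  obtains \<eta> where "0 < \<eta>"
    "\<And>t. 0 < t \<Longrightarrow> eventually (\<lambda>v. \<forall>Q. has_levy_law v t Q \<longrightarrow>
     exp (- ((1 + \<delta>) * phi \<alpha> \<theta> * log_tail \<nu> v)) \<le> measure Q {(1 + \<eta>) * v..} \<and>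
     exp (- ((1 + \<delta>) * phi \<alpha> \<theta> * log_tail \<nu> v)) \<le> measure Q {..- ((1 + \<eta>) * v)}) at_top"
proof -
  interpret R: symmetric_weibull_tail \<nu> \<alpha> d "- \<mu>" \<theta> ..
  obtain \<eta>1 where \<eta>1: "0 < \<eta>1" "\<And>t. 0 < t \<Longrightarrow> eventually (\<lambda>v. \<forall>Q. has_levy_law v t Q \<longrightarrow>
     exp (- ((1 + \<delta>) * phi \<alpha> \<theta> * log_tail \<nu> v)) \<le> measure Q {(1 + \<eta>1) * v..}) at_top"
    using levy_tail_lower[OF \<delta>] by blast
  obtain \<eta>2 where \<eta>2: "0 < \<eta>2" "\<And>t. 0 < t \<Longrightarrow> eventually (\<lambda>v. \<forall>Q. R.has_levy_law v t Q \<longrightarrow>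
     exp (- ((1 + \<delta>) * phi \<alpha> \<theta> * log_tail \<nu> v)) \<le> measure Q {(1 + \<eta>2) * v..}) at_top"
    using R.levy_tail_lower[OF \<delta>] by blast
  show ?thesis
  proof (rule that[of "min \<eta>1 \<eta>2"])
    show "0 < min \<eta>1 \<eta>2" using \<eta>1 \<eta>2 by simp
    fix t :: real assume t: "0 < t"
    show "eventually (\<lambda>v. \<forall>Q. has_levy_law v t Q \<longrightarrow>
     exp (- ((1 + \<delta>) * phi \<alpha> \<theta> * log_tail \<nu> v)) \<le> measure Q {(1 + min \<eta>1 \<eta>2) * v..} \<and>
     exp (- ((1 + \<delta>) * phi \<alpha> \<theta> * log_tail \<nu> v)) \<le> measure Q {..- ((1 + min \<eta>1 \<eta>2) * v)}) at_top"
      using \<eta>1(2)[OF t] \<eta>2(2)[OF t] eventually_ge_at_top[of 0]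
    proof eventually_elim
      case (elim v)
      show ?case
      proof (intro allI impI conjI)
        fix Q assume Q: "has_levy_law v t Q"
        interpret Q: real_distribution Q using Q by (simp add: has_levy_law_def)
        have le: "(1 + min \<eta>1 \<eta>2) * v \<le> (1 + \<eta>1) * v" "(1 + min \<eta>1 \<eta>2) * v \<le> (1 + \<eta>2) * v"
          using elim(3) by (intro mult_right_mono; simp)+
        have "measure Q {(1 + \<eta>1) * v..} \<le> measure Q {(1 + min \<eta>1 \<eta>2) * v..}"
          using le by (intro Q.finite_measure_mono) auto
        then show "exp (- ((1 + \<delta>) * phi \<alpha> \<theta> * log_tail \<nu> v)) \<le> measure Q {(1 + min \<eta>1 \<eta>2) * v..}"
          using elim(1) Q by fastforce
        have "exp (- ((1 + \<delta>) * phi \<alpha> \<theta> * log_tail \<nu> v)) \<le> measure (distr Q borel uminus) {(1 + \<eta>2) * v..}"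
          using elim(2) has_levy_law_uminus[OF Q] by blast
        also have "\<dots> = measure Q {..- ((1 + \<eta>2) * v)}"
          by (subst measure_distr) (auto intro!: arg_cong2[where f=measure])
        also have "\<dots> \<le> measure Q {..- ((1 + min \<eta>1 \<eta>2) * v)}"
          using le by (intro Q.finite_measure_mono) auto
        finally show "exp (- ((1 + \<delta>) * phi \<alpha> \<theta> * log_tail \<nu> v)) \<le> measure Q {..- ((1 + min \<eta>1 \<eta>2) * v)}" .
      qed
    qed
  qed
qed

text \<open>A crude consequence of the upper tail, kept for fixed deviations whose exact cost is
  irrelevant: the factor 1 / 2 required by Ottaviani's inequality and the initial phase of the
  path.\<close>

lemma deviation_vanishes:
  assumes T: "0 \<le> T" and a: "0 < a" and e: "0 < e"
  shows "eventually (\<lambda>v. \<forall>t\<in>{0..T}. \<forall>Q. has_levy_law v t Q \<longrightarrow> measure Q {x. a * v \<le> \<bar>x\<bar>} \<le> e) at_top"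
proof -
  define c where "c = (1 - 1 / 2) * jump_cost \<alpha> \<theta> (a - a / 2)"
  have c0: "0 < jump_cost \<alpha> \<theta> (a - a / 2)" using a by (intro jump_cost_pos[OF \<alpha> \<theta>]) simp
  then have c: "0 < c" by (simp add: c_def)
  have up: "eventually (\<lambda>v. \<forall>t\<in>{0..T}. \<forall>Q. has_levy_law v t Q \<longrightarrow>
     measure Q {x. a * v \<le> \<bar>x\<bar>} \<le> 2 * exp (- (c * log_tail \<nu> v))) at_top"
    unfolding c_def by (rule levy_tail_upper_abs[OF T _ _ _ _ c0]) (use a in auto)
  show ?thesis
    using up exp_tail_at_top[OF log_tail_at_top c e, of 2]
  proof eventually_elim
    case (elim v)
    then have "2 * exp (- (c * log_tail \<nu> v)) \<le> e" by simp
    with elim(1) show ?case by (meson order_trans)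
  qed
qed

text \<open>The cost of slightly less than a unit displacement is close to \<open>phi\<close> by subadditivity.\<close>

lemma jump_cost_near_1:
  assumes \<gamma>: "0 < \<gamma>"
  obtains e where "0 < e" "\<And>e'. 0 < e' \<Longrightarrow> e' \<le> e \<Longrightarrow> (1 - \<gamma>) * phi \<alpha> \<theta> \<le> jump_cost \<alpha> \<theta> (1 - e')"
proof -
  define e where "e = min (min 1 \<theta>) ((\<gamma> * phi \<alpha> \<theta>) powr (1 / \<alpha>))"
  have p: "0 < \<gamma> * phi \<alpha> \<theta>" using \<gamma> phi_pos[OF \<alpha> \<theta>] by simp
  show ?thesis
  proof (rule that)
    show "0 < e" using \<theta> p less_imp_neq[OF p] by (auto simp: e_def)
    fix e' assume e': "0 < e'" "e' \<le> e"
    then have le: "e' \<le> 1" "e' \<le> \<theta>" "e' \<le> (\<gamma> * phi \<alpha> \<theta>) powr (1 / \<alpha>)" by (auto simp: e_def)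
    have "jump_cost \<alpha> \<theta> (1 - e' + e') \<le> jump_cost \<alpha> \<theta> (1 - e') + e' powr \<alpha>"
      using e' le by (intro jump_cost_add_le[OF \<alpha> \<theta>]) auto
    moreover have "e' powr \<alpha> \<le> ((\<gamma> * phi \<alpha> \<theta>) powr (1 / \<alpha>)) powr \<alpha>"
      using e' le \<alpha> by (intro powr_mono2) auto
    moreover have "((\<gamma> * phi \<alpha> \<theta>) powr (1 / \<alpha>)) powr \<alpha> = \<gamma> * phi \<alpha> \<theta>"
      using \<alpha> p by (simp add: powr_powr)
    ultimately show "(1 - \<gamma>) * phi \<alpha> \<theta> \<le> jump_cost \<alpha> \<theta> (1 - e')"
      by (simp add: phi_eq_jump_cost[OF \<alpha> \<theta>] algebra_simps)
  qed
qed

end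

section \<open>Oscillation of a Levy process\<close>

locale levy_noise = prob_space M for M :: "'a measure" +
  fixes F :: "real \<Rightarrow> 'a measure" and L :: "real \<Rightarrow> 'a \<Rightarrow> real"
  assumes usual: "usual_hypotheses M F" and levy: "levy_process M F L"
begin

lemma filtration_F: "filtration (space M) (\<lambda>t. F (max 0 t))"
  using usual unfolding usual_hypotheses_def by (elim conjE)

lemma complete: "complete_measure M"
  using usual unfolding usual_hypotheses_def by (elim conjE)

lemma space_F: "0 \<le> t \<Longrightarrow> space (F t) = space M"
  using filtration.space_F[OF filtration_F, of t] by (simp add: max_def)

lemma sets_F_mono: "0 \<le> s \<Longrightarrow> s \<le> t \<Longrightarrow> sets (F s) \<subseteq> sets (F t)"
  using filtration.sets_F_mono[OF filtration_F, of s t] by (simp add: max_def)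

lemma sets_F_M: "0 \<le> t \<Longrightarrow> A \<in> sets (F t) \<Longrightarrow> A \<in> sets M"
  using usual unfolding usual_hypotheses_def by blast

lemma sets_F_lift: "0 \<le> s \<Longrightarrow> s \<le> t \<Longrightarrow> A \<in> sets (F s) \<Longrightarrow> A \<in> sets (F t)"
  using sets_F_mono by blast

lemma measurable_F_mono:
  assumes f: "f \<in> measurable (F s) N" and s: "0 \<le> s" "s \<le> t" shows "f \<in> measurable (F t) N"
proof -
  have t: "0 \<le> t" using s by linarith
  show ?thesis
  proof (rule measurableI)
    show "f x \<in> space N" if "x \<in> space (F t)" for x
      using measurable_space[OF f] that unfolding space_F[OF s(1)] space_F[OF t] .
    show "f -` A \<inter> space (F t) \<in> sets (F t)" if "A \<in> sets N" for A
      using sets_F_lift[OF s measurable_sets[OF f that]] unfolding space_F[OF s(1)] space_F[OF t] .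
  qed
qed

lemma measurable_F_M:
  assumes f: "f \<in> measurable (F t) N" and t: "0 \<le> t" shows "f \<in> measurable M N"
proof (rule measurableI)
  show "f x \<in> space N" if "x \<in> space M" for x
    using measurable_space[OF f] that unfolding space_F[OF t] .
  show "f -` A \<inter> space M \<in> sets M" if "A \<in> sets N" for A
    using sets_F_M[OF t measurable_sets[OF f that]] unfolding space_F[OF t] .
qed

lemma adapted_L: "adapted F L"
  and increments_indep_set: "\<And>s h. 0 \<le> s \<Longrightarrow> 0 \<le> h \<Longrightarrow> indep_set (sets (F s))
        (sets (vimage_algebra (space M) (\<lambda>\<omega>. L (s + h) \<omega> - L s \<omega>) borel))"
  and increments_stationary: "\<And>s h. 0 \<le> s \<Longrightarrow> 0 \<le> h \<Longrightarrow>
        distr M borel (\<lambda>\<omega>. L (s + h) \<omega> - L s \<omega>) = distr M borel (L h)"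
  and L_0: "AE \<omega> in M. L 0 \<omega> = 0" and cadlag_L: "AE \<omega> in M. cadlag (\<lambda>t. L t \<omega>)"
  using levy unfolding levy_process_def by blast+

lemma L_measurable_F: "0 \<le> s \<Longrightarrow> s \<le> t \<Longrightarrow> L s \<in> borel_measurable (F t)"
  using adapted_L measurable_F_mono[of "L s" s _ t] unfolding adapted_def by blast

lemma L_measurable: "0 \<le> s \<Longrightarrow> L s \<in> borel_measurable M"
  using L_measurable_F[of s s] measurable_F_M by auto

definition law :: "real \<Rightarrow> real measure" where "law t = distr M borel (L t)"

lemma prob_space_law: "0 \<le> t \<Longrightarrow> prob_space (law t)"
  unfolding law_def by (intro prob_space_distr L_measurable)

lemma sets_law [simp, measurable_cong]: "sets (law t) = sets borel"
  by (simp add: law_def)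

lemma increment_indep:
  assumes s: "0 \<le> s" "0 \<le> h" and G: "G \<in> sets (F s)" and B: "B \<in> sets borel"
  shows "prob (G \<inter> {\<omega> \<in> space M. L (s + h) \<omega> - L s \<omega> \<in> B}) = prob G * measure (law h) B"
proof -
  let ?X = "\<lambda>\<omega>. L (s + h) \<omega> - L s \<omega>"
  have [measurable]: "?X \<in> borel_measurable M"
    using s by (intro borel_measurable_diff L_measurable) auto
  have "indep_set (sets (F s)) (sets (vimage_algebra (space M) ?X borel))"
    by (rule increments_indep_set[OF s])
  moreover have "?X -` B \<inter> space M \<in> sets (vimage_algebra (space M) ?X borel)"
    using B by (rule in_vimage_algebra)
  ultimately have "prob (G \<inter> (?X -` B \<inter> space M)) = prob G * prob (?X -` B \<inter> space M)"
    using G by (intro indep_setD) auto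
  also have "prob (?X -` B \<inter> space M) = measure (distr M borel ?X) B"
    using B by (simp add: measure_distr)
  also have "distr M borel ?X = law h"
    unfolding law_def by (rule increments_stationary[OF s])
  finally show ?thesis by (simp add: vimage_def Int_def conj_commute)
qed

section \<open>Joint law of the increments on a grid, and oscillation events\<close>

definition increments :: "real \<Rightarrow> real \<Rightarrow> nat \<Rightarrow> 'a \<Rightarrow> nat \<Rightarrow> real" where
  "increments s h n \<omega> = (\<lambda>j\<in>{..<n}. L (s + real (Suc j) * h) \<omega> - L (s + real j * h) \<omega>)"

lemma increments_measurable:
  assumes "0 \<le> s" "0 \<le> h" "s + real n * h \<le> t"
  shows "increments s h n \<in> measurable (F t) (PiM {..<n} (\<lambda>_. borel))"
  unfolding increments_def
proof (intro measurable_restrict borel_measurable_diff L_measurable_F)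
  fix j assume "j \<in> {..<n}"
  then have "real (Suc j) * h \<le> real n * h" "real j * h \<le> real n * h"
    using assms by (intro mult_right_mono; simp)+
  then show "s + real (Suc j) * h \<le> t" "s + real j * h \<le> t" using assms by linarith+
  show "0 \<le> s + real (Suc j) * h" "0 \<le> s + real j * h" using assms by auto
qed

text \<open>The event built from G and the earlier increments lies in the filtration at the start of
  the next increment, so the factors split off one at a time.\<close>

lemma increments_box:
  assumes s: "0 \<le> s" "0 \<le> h" and G: "G \<in> sets (F s)" and A: "\<And>j. j < n \<Longrightarrow> A j \<in> sets borel"
  shows "prob (G \<inter> {\<omega> \<in> space M. \<forall>j<n. L (s + real (Suc j) * h) \<omega> - L (s + real j * h) \<omega> \<in> A j})
    = prob G * (\<Prod>j<n. measure (law h) (A j))"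
  using A
proof (induction n)
  case 0
  have "G \<subseteq> space M" using sets_F_M[OF s(1) G] sets.sets_into_space by blast
  then have "G \<inter> space M = G" by blast
  then show ?case by simp
next
  case (Suc n)
  define G' where "G' = G \<inter> {\<omega> \<in> space M. \<forall>j<n. L (s + real (Suc j) * h) \<omega> - L (s + real j * h) \<omega> \<in> A j}"
  have nh: "0 \<le> real n * h" using s by simp
  have "{\<omega> \<in> space M. \<forall>j<n. L (s + real (Suc j) * h) \<omega> - L (s + real j * h) \<omega> \<in> A j}
      = {\<omega> \<in> space (F (s + real n * h)). \<forall>j\<in>{..<n}. L (s + real (Suc j) * h) \<omega> - L (s + real j * h) \<omega> \<in> A j}"
    using nh s by (auto simp: space_F)
  also have "\<dots> \<in> sets (F (s + real n * h))"
  proof (intro sets.sets_Collect_finite_All)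
    fix j assume j: "j \<in> {..<n}"
    then have "real (Suc j) * h \<le> real n * h" "real j * h \<le> real n * h"
      using s by (intro mult_right_mono; simp)+
    then have "(\<lambda>\<omega>. L (s + real (Suc j) * h) \<omega> - L (s + real j * h) \<omega>) \<in> borel_measurable (F (s + real n * h))"
      using s by (intro borel_measurable_diff L_measurable_F) auto
    from measurable_sets[OF this Suc.prems[of j]] j
    have "(\<lambda>\<omega>. L (s + real (Suc j) * h) \<omega> - L (s + real j * h) \<omega>) -` A j \<inter> space (F (s + real n * h)) \<in> sets (F (s + real n * h))"
      by (simp only: lessThan_iff less_SucI)
    then show "{\<omega> \<in> space (F (s + real n * h)). L (s + real (Suc j) * h) \<omega> - L (s + real j * h) \<omega> \<in> A j} \<in> sets (F (s + real n * h))"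
      by (rule back_subst[of "\<lambda>S. S \<in> sets (F (s + real n * h))"]) blast
  qed (rule finite_lessThan)
  finally have "{\<omega> \<in> space M. \<forall>j<n. L (s + real (Suc j) * h) \<omega> - L (s + real j * h) \<omega> \<in> A j} \<in> sets (F (s + real n * h))" .
  moreover have "G \<in> sets (F (s + real n * h))"
    by (rule sets_F_lift[OF s(1) _ G]) (use nh in linarith)
  ultimately have G': "G' \<in> sets (F (s + real n * h))" unfolding G'_def by (rule sets.Int[rotated])
  have step: "s + real (Suc n) * h = s + real n * h + h" by (simp add: distrib_right)
  have "G \<inter> {\<omega> \<in> space M. \<forall>j<Suc n. L (s + real (Suc j) * h) \<omega> - L (s + real j * h) \<omega> \<in> A j}
      = G' \<inter> {\<omega> \<in> space M. L ((s + real n * h) + h) \<omega> - L (s + real n * h) \<omega> \<in> A n}"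
    unfolding G'_def All_less_Suc step by blast
  also have "prob \<dots> = prob G' * measure (law h) (A n)"
    using s nh G' Suc.prems[of n] by (intro increment_indep) auto
  also have "prob G' = prob G * (\<Prod>j<n. measure (law h) (A j))"
    unfolding G'_def using Suc by auto
  finally show ?case by simp
qed

text \<open>As functions of B, both sides are finite measures: the image of the probability
  restricted to G, and a scaled product law. They agree on boxes, which generate the product
  \<sigma>-algebra.\<close>

lemma increments_indep:
  assumes s: "0 \<le> s" "0 \<le> h" and G: "G \<in> sets (F s)" and B: "B \<in> sets (PiM {..<n} (\<lambda>_. borel))"
  shows "prob (G \<inter> {\<omega> \<in> space M. increments s h n \<omega> \<in> B}) = prob G * measure (PiM {..<n} (\<lambda>_. law h)) B"
proof -
  let ?P = "PiM {..<n} (\<lambda>_. borel :: real measure)" and ?V = "increments s h n"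
  interpret P: product_prob_space "\<lambda>_. law h" "{..<n}"
    by (intro product_prob_spaceI prob_space_law s)
  have V [measurable]: "?V \<in> measurable M ?P"
  proof -
    have "?V \<in> measurable (F (s + real n * h)) ?P" by (rule increments_measurable[OF s]) simp
    then show ?thesis by (rule measurable_F_M) (use s in auto)
  qed
  have GM [measurable]: "G \<in> sets M" using sets_F_M[OF s(1) G] .
  define N1 where "N1 = distr (density M (indicator G)) ?P ?V"
  define N2 where "N2 = scale_measure (ennreal (prob G)) (PiM {..<n} (\<lambda>_. law h))"
  have setsP: "sets (PiM {..<n} (\<lambda>_. law h)) = sets ?P" by (intro sets_PiM_cong) auto
  have N1: "emeasure N1 C = ennreal (prob (G \<inter> {\<omega> \<in> space M. ?V \<omega> \<in> C}))" if C: "C \<in> sets ?P" for C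
  proof -
    have "?V -` C \<inter> space M \<in> sets M" using C by measurable
    then have "emeasure N1 C = emeasure M (G \<inter> (?V -` C \<inter> space M))"
      unfolding N1_def using C V
      by (simp add: emeasure_distr emeasure_density nn_integral_set_ennreal indicator_inter_arith [symmetric])
    then show ?thesis by (simp add: emeasure_eq_measure vimage_def Int_def conj_commute)
  qed
  have "N1 = N2"
  proof (rule measure_eqI_PiM_finite[where A = "\<lambda>_. space ?P"])
    show "sets N1 = sets ?P" "sets N2 = sets ?P" by (auto simp: N1_def N2_def setsP)
    fix A :: "nat \<Rightarrow> real set" assume A: "\<And>i. i \<in> {..<n} \<Longrightarrow> A i \<in> sets borel"
    then have "Pi\<^sub>E {..<n} A \<in> sets ?P" by (intro sets_PiM_I_finite) auto
    then have "emeasure N1 (Pi\<^sub>E {..<n} A) = ennreal (prob (G \<inter> {\<omega> \<in> space M. ?V \<omega> \<in> Pi\<^sub>E {..<n} A}))"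
      by (rule N1)
    also have "{\<omega> \<in> space M. ?V \<omega> \<in> Pi\<^sub>E {..<n} A}
        = {\<omega> \<in> space M. \<forall>j<n. L (s + real (Suc j) * h) \<omega> - L (s + real j * h) \<omega> \<in> A j}"
      by (auto simp: increments_def PiE_iff)
    also have "prob (G \<inter> \<dots>) = prob G * (\<Prod>j<n. measure (law h) (A j))"
      using A by (intro increments_box s G) auto
    also have "ennreal \<dots> = ennreal (prob G) * (\<Prod>j<n. emeasure (law h) (A j))"
      using P.M.emeasure_eq_measure by (simp add: ennreal_mult prod_nonneg prod_ennreal)
    also have "\<dots> = emeasure N2 (Pi\<^sub>E {..<n} A)"
      unfolding N2_def using A product_sigma_finite.emeasure_PiM[OF P.product_sigma_finite_axioms, of "{..<n}" A]
      by simp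
    finally show "emeasure N1 (Pi\<^sub>E {..<n} A) = emeasure N2 (Pi\<^sub>E {..<n} A)" .
  next
    show "range (\<lambda>_::nat. space ?P) \<subseteq> prod_algebra {..<n} (\<lambda>_. borel)"
      by (auto simp: space_PiM intro!: prod_algebraI_finite)
    show "emeasure N1 (space ?P) \<noteq> \<infinity>" for i :: nat by (subst N1) auto
  qed auto
  then have "emeasure N1 B = emeasure N2 B" by simp
  then have "ennreal (prob (G \<inter> {\<omega> \<in> space M. ?V \<omega> \<in> B})) = ennreal (prob G * measure (PiM {..<n} (\<lambda>_. law h)) B)"
    using B by (simp add: N1 N2_def P.P.emeasure_eq_measure ennreal_mult)
  then show ?thesis by simp
qed

text \<open>The oscillation events only look at dyadic grid points; on cadlag paths this determines
  the oscillation on the whole interval.\<close>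

definition osc_grid :: "nat \<Rightarrow> real \<Rightarrow> real \<Rightarrow> real \<Rightarrow> 'a set" where
  "osc_grid n s h a = {\<omega> \<in> space M. \<exists>i\<le>n. \<exists>j\<le>n. a < \<bar>L (s + real i * h) \<omega> - L (s + real j * h) \<omega>\<bar>}"

definition osc :: "real \<Rightarrow> real \<Rightarrow> real \<Rightarrow> 'a set" where
  "osc s H a = (\<Union>m. osc_grid (2 ^ m) s (H / 2 ^ m) a)"

lemma sum_increments:
  assumes "i \<le> n"
  shows "(\<Sum>l<i. increments s h n \<omega> l) = L (s + real i * h) \<omega> - L s \<omega>"
  using assms by (induction i) (auto simp: increments_def)

text \<open>Expressing the oscillation through partial sums of increments is what makes it
  stationary and independent of the past.\<close>

lemma osc_grid_eq:
  "osc_grid n s h a = {\<omega> \<in> space M. increments s h n \<omega> \<in>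
     {x \<in> space (PiM {..<n} (\<lambda>_. borel)). \<exists>i\<in>{..n}. \<exists>j\<in>{..n}. a < \<bar>(\<Sum>l<i. x l) - (\<Sum>l<j. x l)\<bar>}}"
proof -
  have "increments s h n \<omega> \<in> space (PiM {..<n} (\<lambda>_. borel))" for \<omega>
    by (auto simp: space_PiM increments_def)
  moreover have "(\<exists>i\<in>{..n}. \<exists>j\<in>{..n}. a < \<bar>L (s + real i * h) \<omega> - L (s + real j * h) \<omega>\<bar>)
      \<longleftrightarrow> (\<exists>i\<in>{..n}. \<exists>j\<in>{..n}. a < \<bar>(\<Sum>l<i. increments s h n \<omega> l) - (\<Sum>l<j. increments s h n \<omega> l)\<bar>)" for \<omega>
    by (intro bex_cong refl) (simp add: sum_increments)
  ultimately show ?thesis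
    unfolding osc_grid_def by (simp only: mem_Collect_eq atMost_iff [symmetric] Bex_def [symmetric]) blast
qed

lemma osc_grid_box_measurable:
  "{x \<in> space (PiM {..<n::nat} (\<lambda>_. borel)). \<exists>i\<in>{..n}. \<exists>j\<in>{..n}. a < \<bar>(\<Sum>l<i. x l) - (\<Sum>l<j. x l)\<bar>}
     \<in> sets (PiM {..<n} (\<lambda>_. borel :: real measure))"
proof (intro sets.sets_Collect_finite_Ex)
  fix i j assume "i \<in> {..n}" "j \<in> {..n}"
  then have [measurable]: "(\<lambda>x. \<Sum>l<i. x l) \<in> borel_measurable (PiM {..<n} (\<lambda>_. borel :: real measure))"
    "(\<lambda>x. \<Sum>l<j. x l) \<in> borel_measurable (PiM {..<n} (\<lambda>_. borel :: real measure))"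
    by (auto intro!: borel_measurable_sum measurable_component_singleton)
  show "{x \<in> space (PiM {..<n} (\<lambda>_. borel)). a < \<bar>(\<Sum>l<i. x l) - (\<Sum>l<j. x l)\<bar>} \<in> sets (PiM {..<n} (\<lambda>_. borel))"
    by measurable
qed auto

lemma osc_grid_indep:
  assumes s: "0 \<le> s" "0 \<le> h" and G: "G \<in> sets (F s)"
  shows "prob (G \<inter> osc_grid n s h a) = prob G * prob (osc_grid n 0 h a)"
proof -
  have *: "prob (G \<inter> osc_grid n s h a) = prob G * measure (PiM {..<n} (\<lambda>_. law h))
      {x \<in> space (PiM {..<n} (\<lambda>_. borel)). \<exists>i\<in>{..n}. \<exists>j\<in>{..n}. a < \<bar>(\<Sum>l<i. x l) - (\<Sum>l<j. x l)\<bar>}"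
    if "0 \<le> s" "G \<in> sets (F s)" for s G
    unfolding osc_grid_eq using that s osc_grid_box_measurable by (intro increments_indep) auto
  have "space M \<in> sets (F 0)" using sets.top[of "F 0"] by (simp add: space_F)
  from *[OF s(1) G] *[OF _ this] show ?thesis
    by (simp add: prob_space Int_absorb1 osc_grid_def)
qed

lemma osc_grid_sets:
  assumes s: "0 \<le> s" "0 \<le> h" and t: "s + real n * h \<le> t"
  shows "osc_grid n s h a \<in> sets (F t)"
proof -
  have "0 \<le> real n * h" using s by simp
  then have "0 \<le> t" using s t by linarith
  then have "osc_grid n s h a = increments s h n -`
     {x \<in> space (PiM {..<n} (\<lambda>_. borel)). \<exists>i\<in>{..n}. \<exists>j\<in>{..n}. a < \<bar>(\<Sum>l<i. x l) - (\<Sum>l<j. x l)\<bar>} \<inter> space (F t)"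
    unfolding osc_grid_eq by (auto simp: space_F)
  also have "\<dots> \<in> sets (F t)"
    by (rule measurable_sets[OF increments_measurable[OF s t] osc_grid_box_measurable])
  finally show ?thesis .
qed

lemma osc_grid_incseq: "incseq (\<lambda>m. osc_grid (2 ^ m) s (H / 2 ^ m) a)"
proof (rule incseq_SucI, rule subsetI)
  fix m \<omega> assume "\<omega> \<in> osc_grid (2 ^ m) s (H / 2 ^ m) a"
  then obtain i j where "\<omega> \<in> space M" "i \<le> 2 ^ m" "j \<le> 2 ^ m"
    "a < \<bar>L (s + real i * (H / 2 ^ m)) \<omega> - L (s + real j * (H / 2 ^ m)) \<omega>\<bar>"
    by (auto simp: osc_grid_def)
  moreover have "real (2 * k) * (H / 2 ^ Suc m) = real k * (H / 2 ^ m)" for k by simp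
  ultimately show "\<omega> \<in> osc_grid (2 ^ Suc m) s (H / 2 ^ Suc m) a"
    unfolding osc_grid_def mem_Collect_eq
    by (intro conjI exI[of _ "2 * i"] exI[of _ "2 * j"]) (simp_all only: power_Suc mult_le_mono2)
qed

lemma osc_sets_F:
  assumes "0 \<le> s" "0 \<le> H" "s + H \<le> t"
  shows "osc s H a \<in> sets (F t)"
  unfolding osc_def using assms by (intro sets.countable_UN) (auto intro!: osc_grid_sets)

lemma osc_sets: "0 \<le> s \<Longrightarrow> 0 \<le> H \<Longrightarrow> osc s H a \<in> sets M"
  by (rule sets_F_M[OF _ osc_sets_F[of s H "s + H"]]) auto

lemma osc_limit:
  assumes "0 \<le> s" "0 \<le> H" "G \<in> sets M"
  shows "(\<lambda>m. prob (G \<inter> osc_grid (2 ^ m) s (H / 2 ^ m) a)) \<longlonglongrightarrow> prob (G \<inter> osc s H a)"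
proof -
  have "osc_grid (2 ^ m) s (H / 2 ^ m) a \<in> sets M" for m
    by (rule sets_F_M[OF _ osc_grid_sets[where t = "s + H"]]) (use assms in auto)
  then have "(\<lambda>m. prob (G \<inter> osc_grid (2 ^ m) s (H / 2 ^ m) a)) \<longlonglongrightarrow> prob (\<Union>m. G \<inter> osc_grid (2 ^ m) s (H / 2 ^ m) a)"
    using assms osc_grid_incseq[of s H a]
    by (intro finite_Lim_measure_incseq) (auto simp: incseq_def)
  then show ?thesis by (simp add: osc_def)
qed

lemma osc_indep:
  assumes "0 \<le> s" "0 \<le> H" and G: "G \<in> sets (F s)"
  shows "prob (G \<inter> osc s H a) = prob G * prob (osc 0 H a)"
proof (rule LIMSEQ_unique)
  show "(\<lambda>m. prob (G \<inter> osc_grid (2 ^ m) s (H / 2 ^ m) a)) \<longlonglongrightarrow> prob (G \<inter> osc s H a)"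
    using assms sets_F_M by (intro osc_limit) auto
  have sub: "osc_grid n 0 h a \<subseteq> space M" "osc 0 H a \<subseteq> space M" for n h by (auto simp: osc_grid_def osc_def)
  have "(\<lambda>m. prob G * prob (space M \<inter> osc_grid (2 ^ m) 0 (H / 2 ^ m) a)) \<longlonglongrightarrow> prob G * prob (space M \<inter> osc 0 H a)"
    using assms by (intro tendsto_mult tendsto_const osc_limit) auto
  then show "(\<lambda>m. prob (G \<inter> osc_grid (2 ^ m) s (H / 2 ^ m) a)) \<longlonglongrightarrow> prob G * prob (osc 0 H a)"
    using assms sub by (simp add: osc_grid_indep Int_absorb1)
qed

lemma osc_prob: "0 \<le> s \<Longrightarrow> 0 \<le> H \<Longrightarrow> prob (osc s H a) = prob (osc 0 H a)"
  using osc_indep[of s H "space M" a] sets.top[of "F s"] space_F[of s]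
  by (simp add: prob_space Int_absorb1 osc_def osc_grid_def UN_subset_iff subset_eq)

text \<open>The union is decomposed by the first bad index j. The event \<open>A j\<close> is known
  at time j h, and the remaining increment up to n h is independent of it and at most b in size with
  probability at least 1 / 2, which leads into the target. Bad events and target stay abstract
  because two different choices are needed.\<close>

lemma ottaviani:
  assumes h: "0 \<le> h" and b: "\<And>j. j \<le> n \<Longrightarrow> 1 / 2 \<le> measure (law (real j * h)) {-b..b}"
    and bad: "\<And>j. j \<le> n \<Longrightarrow> bad j \<in> sets (F (real j * h))"
    and target: "T \<in> sets M"
    and hit: "\<And>j \<omega>. j \<le> n \<Longrightarrow> \<omega> \<in> bad j \<Longrightarrow> \<bar>L (real n * h) \<omega> - L (real j * h) \<omega>\<bar> \<le> b \<Longrightarrow> \<omega> \<in> T"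
  shows "prob (\<Union>j\<le>n. bad j) \<le> 2 * prob T"
proof -
  define A where "A j = bad j - (\<Union>i<j. bad i)" for j
  have nn: "0 \<le> real j * h" for j using h by simp
  have A: "A j \<in> sets (F (real j * h))" if "j \<le> n" for j
    unfolding A_def
  proof (intro sets.Diff sets.finite_UN bad that)
    fix i assume "i \<in> {..<j}"
    then have "real i * h \<le> real j * h" using h by (intro mult_right_mono) auto
    then show "bad i \<in> sets (F (real j * h))"
      using \<open>i \<in> {..<j}\<close> that bad[of i] nn by (intro sets_F_lift[of "real i * h" "real j * h"]) auto
  qed simp
  have AM: "A j \<in> sets M" if "j \<le> n" for j by (rule sets_F_M[OF nn A[OF that]])
  have disj: "disjoint_family_on A {..n}"
    unfolding disjoint_family_on_def
  proof (intro ballI impI)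
    fix i j :: nat assume "i \<noteq> j"
    then consider "i < j" | "j < i" by linarith
    then show "A i \<inter> A j = {}" by cases (auto simp: A_def)
  qed
  define D where "D j = {\<omega> \<in> space M. L (real j * h + real (n - j) * h) \<omega> - L (real j * h) \<omega> \<in> {-b..b}}" for j
  have Dm: "D j \<in> sets M" for j
  proof -
    have [measurable]: "(\<lambda>\<omega>. L (real j * h + real (n - j) * h) \<omega> - L (real j * h) \<omega>) \<in> borel_measurable M"
      using nn by (intro borel_measurable_diff L_measurable) auto
    show ?thesis unfolding D_def by measurable
  qed
  have "prob (\<Union>j\<le>n. bad j) = prob (\<Union>j\<le>n. A j)"
  proof -
    have "(\<Union>j\<le>n. bad j) = (\<Union>j\<le>n. A j)"
    proof (intro equalityI subsetI)
      fix \<omega> assume "\<omega> \<in> (\<Union>j\<le>n. bad j)"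
      then obtain j where j: "j \<le> n" "\<omega> \<in> bad j" by auto
      define i where "i = (LEAST i. \<omega> \<in> bad i)"
      have "\<omega> \<in> bad i" "i \<le> j" "\<And>k. k < i \<Longrightarrow> \<omega> \<notin> bad k"
        using j by (auto simp: i_def intro: LeastI Least_le dest: not_less_Least)
      then show "\<omega> \<in> (\<Union>j\<le>n. A j)" using j by (auto simp: A_def intro!: bexI[of _ i])
    qed (auto simp: A_def)
    then show ?thesis by simp
  qed
  also have "\<dots> = (\<Sum>j\<le>n. prob (A j))"
    by (intro finite_measure_finite_Union disj) (auto intro: AM)
  also have "\<dots> \<le> (\<Sum>j\<le>n. 2 * prob (A j \<inter> D j))"
  proof (intro sum_mono)
    fix j assume "j \<in> {..n}"
    then have j: "j \<le> n" by simp
    have "prob (A j \<inter> D j) = prob (A j) * measure (law (real (n - j) * h)) {-b..b}"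
      unfolding D_def using A[OF j] nn by (intro increment_indep) auto
    moreover have "prob (A j) * (1 / 2) \<le> prob (A j) * measure (law (real (n - j) * h)) {-b..b}"
      using b[of "n - j"] by (intro mult_left_mono) auto
    ultimately show "prob (A j) \<le> 2 * prob (A j \<inter> D j)" by simp
  qed
  also have "\<dots> = 2 * (\<Sum>j\<le>n. prob (A j \<inter> D j))" by (simp add: sum_distrib_left)
  also have "(\<Sum>j\<le>n. prob (A j \<inter> D j)) = prob (\<Union>j\<le>n. A j \<inter> D j)"
    using disj by (intro finite_measure_finite_Union [symmetric]) (auto simp: disjoint_family_on_def intro: AM Dm)
  finally have "prob (\<Union>j\<le>n. bad j) \<le> 2 * prob (\<Union>j\<le>n. A j \<inter> D j)" .
  moreover have "prob (\<Union>j\<le>n. A j \<inter> D j) \<le> prob T"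
  proof (intro finite_measure_mono target subsetI)
    fix \<omega> assume "\<omega> \<in> (\<Union>j\<le>n. A j \<inter> D j)"
    then obtain j where j: "j \<le> n" "\<omega> \<in> A j" "\<omega> \<in> D j" by auto
    have "real j * h + real (n - j) * h = real n * h" using j by (simp add: of_nat_diff algebra_simps)
    with j show "\<omega> \<in> T" by (intro hit[of j]) (auto simp: A_def D_def)
  qed
  ultimately show ?thesis by simp
qed


lemma measure_PiM_reverse:
  assumes "prob_space Q" "sets Q = sets borel" and [measurable]: "B \<in> sets (PiM {..<n::nat} (\<lambda>_. borel :: real measure))"
  shows "measure (PiM {..<n} (\<lambda>_. Q)) {x \<in> space (PiM {..<n} (\<lambda>_. borel)). (\<lambda>j\<in>{..<n}. x (n - 1 - j)) \<in> B}
    = measure (PiM {..<n} (\<lambda>_. Q)) B"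
proof -
  have setsP: "sets (PiM {..<n} (\<lambda>_. Q)) = sets (PiM {..<n} (\<lambda>_. borel :: real measure))"
    using assms by (intro sets_PiM_cong) auto
  have spaceP: "space (PiM {..<n} (\<lambda>_. Q)) = space (PiM {..<n} (\<lambda>_. borel :: real measure))"
    using sets_eq_imp_space_eq[OF setsP] .
  have "distr (PiM {..<n} (\<lambda>_. Q)) (PiM {..<n} (\<lambda>_. Q)) (\<lambda>\<omega>. \<lambda>j\<in>{..<n}. \<omega> (n - 1 - j)) = PiM {..<n} (\<lambda>_. Q)"
    by (rule distr_PiM_reindex[where f = "\<lambda>j. n - 1 - j" and K = "{..<n}" and I = "{..<n}" and M = "\<lambda>_. Q"])
       (use assms in \<open>auto simp: inj_on_def\<close>)
  then have "measure (PiM {..<n} (\<lambda>_. Q)) B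
      = measure (distr (PiM {..<n} (\<lambda>_. Q)) (PiM {..<n} (\<lambda>_. Q)) (\<lambda>\<omega>. \<lambda>j\<in>{..<n}. \<omega> (n - 1 - j))) B" by simp
  also have "\<dots> = measure (PiM {..<n} (\<lambda>_. Q)) ((\<lambda>\<omega>. \<lambda>j\<in>{..<n}. \<omega> (n - 1 - j)) -` B \<inter> space (PiM {..<n} (\<lambda>_. Q)))"
    using assms(3) setsP
    by (intro measure_distr measurable_restrict measurable_component_singleton) auto
  also have "(\<lambda>\<omega>. \<lambda>j\<in>{..<n}. \<omega> (n - 1 - j)) -` B \<inter> space (PiM {..<n} (\<lambda>_. Q))
      = {x \<in> space (PiM {..<n} (\<lambda>_. borel)). (\<lambda>j\<in>{..<n}. x (n - 1 - j)) \<in> B}"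
    unfolding spaceP by blast
  finally show ?thesis ..
qed

lemma tail_dev_sum_measurable:
  "{x \<in> space (PiM {..<n::nat} (\<lambda>_. borel)). \<exists>i\<in>{..n}. a < \<bar>\<Sum>l<i. x l\<bar>} \<in> sets (PiM {..<n} (\<lambda>_. borel :: real measure))"
proof (intro sets.sets_Collect_finite_Ex)
  fix i assume "i \<in> {..n}"
  then have [measurable]: "(\<lambda>x. \<Sum>l<i. x l) \<in> borel_measurable (PiM {..<n} (\<lambda>_. borel :: real measure))"
    by (auto intro!: borel_measurable_sum measurable_component_singleton)
  show "{x \<in> space (PiM {..<n} (\<lambda>_. borel)). a < \<bar>\<Sum>l<i. x l\<bar>} \<in> sets (PiM {..<n} (\<lambda>_. borel))"
    by measurable
qed auto

text \<open>Reversing the order of the increments exchanges deviations from the endpoint and deviations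
  from the starting point.\<close>

lemma prob_dev_end_eq_dev_start:
  assumes h: "0 \<le> h"
  shows "prob {\<omega> \<in> space M. \<exists>i\<le>n. a < \<bar>L (real n * h) \<omega> - L (real i * h) \<omega>\<bar>}
    = prob {\<omega> \<in> space M. \<exists>i\<le>n. a < \<bar>L (real i * h) \<omega> - L 0 \<omega>\<bar>}"
proof -
  let ?P = "PiM {..<n} (\<lambda>_. borel :: real measure)"
  let ?r = "\<lambda>x. \<lambda>j\<in>{..<n}. x (n - 1 - j) :: real"
  let ?B = "{x \<in> space ?P. \<exists>i\<in>{..n}. a < \<bar>\<Sum>l<i. x l\<bar>}"
  have sp: "space M \<in> sets (F 0)" using sets.top[of "F 0"] by (simp add: space_F)
  have law: "prob {\<omega> \<in> space M. increments 0 h n \<omega> \<in> C} = measure (PiM {..<n} (\<lambda>_. law h)) C"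
    if "C \<in> sets ?P" for C
  proof -
    have "space M \<inter> {\<omega> \<in> space M. increments 0 h n \<omega> \<in> C} = {\<omega> \<in> space M. increments 0 h n \<omega> \<in> C}" by blast
    with increments_indep[OF _ h sp that] show ?thesis by (simp add: prob_space)
  qed
  have inc: "increments 0 h n \<omega> \<in> space ?P" "?r (increments 0 h n \<omega>) \<in> space ?P" for \<omega>
    by (auto simp: space_PiM increments_def)
  have r: "?r \<in> measurable ?P ?P"
    by (intro measurable_restrict measurable_component_singleton) auto
  have B': "{x \<in> space ?P. ?r x \<in> ?B} \<in> sets ?P"
    using measurable_sets[OF r tail_dev_sum_measurable[of n a]] by (simp add: vimage_def Int_def conj_commute)
  have eq: "(\<Sum>l<k. ?r (increments 0 h n \<omega>) l) = L (real n * h) \<omega> - L (real (n - k) * h) \<omega>" if "k \<le> n" for k \<omega>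
    using that
  proof (induction k)
    case (Suc k)
    have "n - 1 - k = n - Suc k" "Suc (n - Suc k) = n - k" using Suc.prems by auto
    with Suc show ?case by (simp add: increments_def)
  qed simp
  have "{\<omega> \<in> space M. \<exists>i\<le>n. a < \<bar>L (real n * h) \<omega> - L (real i * h) \<omega>\<bar>}
      = {\<omega> \<in> space M. increments 0 h n \<omega> \<in> {x \<in> space ?P. ?r x \<in> ?B}}"
  proof -
    have "(\<exists>i\<le>n. a < \<bar>L (real n * h) \<omega> - L (real i * h) \<omega>\<bar>)
        \<longleftrightarrow> (\<exists>k\<in>{..n}. a < \<bar>\<Sum>l<k. ?r (increments 0 h n \<omega>) l\<bar>)" for \<omega>
    proof
      assume "\<exists>i\<le>n. a < \<bar>L (real n * h) \<omega> - L (real i * h) \<omega>\<bar>"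
      then obtain i where "i \<le> n" "a < \<bar>L (real n * h) \<omega> - L (real i * h) \<omega>\<bar>" by blast
      then show "\<exists>k\<in>{..n}. a < \<bar>\<Sum>l<k. ?r (increments 0 h n \<omega>) l\<bar>"
        using eq[of "n - i" \<omega>] by (intro bexI[of _ "n - i"]) (simp_all only: diff_diff_cancel diff_le_self atMost_iff)
    next
      assume "\<exists>k\<in>{..n}. a < \<bar>\<Sum>l<k. ?r (increments 0 h n \<omega>) l\<bar>"
      then obtain k where "k \<le> n" "a < \<bar>\<Sum>l<k. ?r (increments 0 h n \<omega>) l\<bar>" by blast
      then show "\<exists>i\<le>n. a < \<bar>L (real n * h) \<omega> - L (real i * h) \<omega>\<bar>"
        using eq[of k \<omega>] by (intro exI[of _ "n - k"]) (simp only: diff_le_self)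
    qed
    then show ?thesis using inc by blast
  qed
  then have "prob {\<omega> \<in> space M. \<exists>i\<le>n. a < \<bar>L (real n * h) \<omega> - L (real i * h) \<omega>\<bar>}
      = measure (PiM {..<n} (\<lambda>_. law h)) {x \<in> space ?P. ?r x \<in> ?B}"
    using law[OF B'] by simp
  also have "\<dots> = measure (PiM {..<n} (\<lambda>_. law h)) ?B"
    by (rule measure_PiM_reverse[OF prob_space_law[OF h] sets_law tail_dev_sum_measurable])
  also have "\<dots> = prob {\<omega> \<in> space M. increments 0 h n \<omega> \<in> ?B}"
    by (rule law[symmetric, OF tail_dev_sum_measurable])
  also have "{\<omega> \<in> space M. increments 0 h n \<omega> \<in> ?B} = {\<omega> \<in> space M. \<exists>i\<le>n. a < \<bar>L (real i * h) \<omega> - L 0 \<omega>\<bar>}"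
  proof -
    have "(\<exists>i\<in>{..n}. a < \<bar>\<Sum>l<i. increments 0 h n \<omega> l\<bar>) \<longleftrightarrow> (\<exists>i\<in>{..n}. a < \<bar>L (real i * h) \<omega> - L 0 \<omega>\<bar>)" for \<omega>
      by (intro bex_cong refl) (simp add: sum_increments)
    then show ?thesis using inc by blast
  qed
  finally show ?thesis .
qed

text \<open>Ottaviani's inequality is used twice, at the cost of a factor 2 and a margin b each
  time. The first use moves the later of the two times to the endpoint. Reversal of the increments
  then replaces the endpoint by the starting point as the fixed time, and the second use moves the
  remaining time to the endpoint.\<close>

lemma osc_grid_le:
  assumes h: "0 \<le> h" and b: "\<And>j. j \<le> n \<Longrightarrow> 1 / 2 \<le> measure (law (real j * h)) {-b..b}"
  shows "prob (osc_grid n 0 h (a + 2 * b)) \<le> 4 * prob {\<omega> \<in> space M. a < \<bar>L (real n * h) \<omega> - L 0 \<omega>\<bar>}"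
proof -
  have nn: "0 \<le> real j * h" for j using h by simp
  have mono: "real i * h \<le> real j * h" if "i \<le> j" for i j using h that by (intro mult_right_mono) auto
  have dev: "{\<omega> \<in> space M. c < \<bar>L x \<omega> - L y \<omega>\<bar>} \<in> sets (F t)" if "0 \<le> x" "x \<le> t" "0 \<le> y" "y \<le> t" for x y t c
  proof -
    have "(\<lambda>\<omega>. L x \<omega> - L y \<omega>) \<in> borel_measurable (F t)"
      using that by (intro borel_measurable_diff L_measurable_F)
    then have "(\<lambda>\<omega>. L x \<omega> - L y \<omega>) -` {z. c < \<bar>z\<bar>} \<inter> space (F t) \<in> sets (F t)"
      by (rule measurable_sets) measurable
    moreover have "(\<lambda>\<omega>. L x \<omega> - L y \<omega>) -` {z. c < \<bar>z\<bar>} \<inter> space (F t) = {\<omega> \<in> space M. c < \<bar>L x \<omega> - L y \<omega>\<bar>}"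
      using that space_F[of t] by auto
    ultimately show ?thesis by simp
  qed
  have devM: "{\<omega> \<in> space M. c < \<bar>L x \<omega> - L y \<omega>\<bar>} \<in> sets M" if "0 \<le> x" "0 \<le> y" for x y c
    using sets_F_M[OF _ dev[of x "max x y" y c]] that by simp
  have UN: "{\<omega> \<in> space M. \<exists>i\<le>n. P i \<omega>} = (\<Union>i\<in>{..n}. {\<omega> \<in> space M. P i \<omega>})" for P by blast
  have "prob (\<Union>j\<le>n. \<Union>i\<in>{..j}. {\<omega> \<in> space M. a + 2 * b < \<bar>L (real j * h) \<omega> - L (real i * h) \<omega>\<bar>})
      \<le> 2 * prob {\<omega> \<in> space M. \<exists>i\<le>n. a + b < \<bar>L (real n * h) \<omega> - L (real i * h) \<omega>\<bar>}"
  proof (rule ottaviani[OF h b])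
    show "(\<Union>i\<in>{..j}. {\<omega> \<in> space M. a + 2 * b < \<bar>L (real j * h) \<omega> - L (real i * h) \<omega>\<bar>}) \<in> sets (F (real j * h))" for j
      by (intro sets.finite_UN dev nn mono) auto
    show "{\<omega> \<in> space M. \<exists>i\<le>n. a + b < \<bar>L (real n * h) \<omega> - L (real i * h) \<omega>\<bar>} \<in> sets M"
      unfolding UN by (intro sets.finite_UN devM nn) auto
    fix j \<omega> assume "j \<le> n" "\<omega> \<in> (\<Union>i\<in>{..j}. {\<omega> \<in> space M. a + 2 * b < \<bar>L (real j * h) \<omega> - L (real i * h) \<omega>\<bar>})"
      and le: "\<bar>L (real n * h) \<omega> - L (real j * h) \<omega>\<bar> \<le> b"
    then obtain i where "i \<le> j" and i: "\<omega> \<in> space M" "a + 2 * b < \<bar>L (real j * h) \<omega> - L (real i * h) \<omega>\<bar>" by auto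
    then have "i \<le> n" using \<open>j \<le> n\<close> by simp
    from i have "a + b < \<bar>L (real n * h) \<omega> - L (real i * h) \<omega>\<bar>" using le by linarith
    then show "\<omega> \<in> {\<omega> \<in> space M. \<exists>i\<le>n. a + b < \<bar>L (real n * h) \<omega> - L (real i * h) \<omega>\<bar>}" using i \<open>i \<le> n\<close> by blast
  qed
  also have "prob {\<omega> \<in> space M. \<exists>i\<le>n. a + b < \<bar>L (real n * h) \<omega> - L (real i * h) \<omega>\<bar>}
      = prob {\<omega> \<in> space M. \<exists>i\<le>n. a + b < \<bar>L (real i * h) \<omega> - L 0 \<omega>\<bar>}"
    by (rule prob_dev_end_eq_dev_start[OF h])
  also have "{\<omega> \<in> space M. \<exists>i\<le>n. a + b < \<bar>L (real i * h) \<omega> - L 0 \<omega>\<bar>}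
      = (\<Union>j\<le>n. {\<omega> \<in> space M. a + b < \<bar>L (real j * h) \<omega> - L 0 \<omega>\<bar>})"
    by (rule UN)
  finally have 1: "prob (\<Union>j\<le>n. \<Union>i\<in>{..j}. {\<omega> \<in> space M. a + 2 * b < \<bar>L (real j * h) \<omega> - L (real i * h) \<omega>\<bar>})
      \<le> 2 * prob (\<Union>j\<le>n. {\<omega> \<in> space M. a + b < \<bar>L (real j * h) \<omega> - L 0 \<omega>\<bar>})" .
  have 2: "prob (\<Union>j\<le>n. {\<omega> \<in> space M. a + b < \<bar>L (real j * h) \<omega> - L 0 \<omega>\<bar>})
      \<le> 2 * prob {\<omega> \<in> space M. a < \<bar>L (real n * h) \<omega> - L 0 \<omega>\<bar>}"
  proof (rule ottaviani[OF h b])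
    show "{\<omega> \<in> space M. a + b < \<bar>L (real j * h) \<omega> - L 0 \<omega>\<bar>} \<in> sets (F (real j * h))" for j
      by (intro dev nn) auto
    show "{\<omega> \<in> space M. a < \<bar>L (real n * h) \<omega> - L 0 \<omega>\<bar>} \<in> sets M" by (intro devM nn) auto
  qed auto
  have "osc_grid n 0 h (a + 2 * b) = (\<Union>j\<le>n. \<Union>i\<in>{..j}. {\<omega> \<in> space M. a + 2 * b < \<bar>L (real j * h) \<omega> - L (real i * h) \<omega>\<bar>})"
  proof (intro equalityI subsetI)
    fix \<omega> assume "\<omega> \<in> osc_grid n 0 h (a + 2 * b)"
    then obtain i j where ij: "i \<le> n" "j \<le> n" "\<omega> \<in> space M" "a + 2 * b < \<bar>L (real i * h) \<omega> - L (real j * h) \<omega>\<bar>"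
      by (auto simp: osc_grid_def)
    show "\<omega> \<in> (\<Union>j\<le>n. \<Union>i\<in>{..j}. {\<omega> \<in> space M. a + 2 * b < \<bar>L (real j * h) \<omega> - L (real i * h) \<omega>\<bar>})"
    proof (cases "i \<le> j")
      case True
      then show ?thesis using ij by (intro UN_I[of j] UN_I[of i]) (auto simp: abs_minus_commute)
    next
      case False
      then show ?thesis using ij by (intro UN_I[of i] UN_I[of j]) auto
    qed
  next
    fix \<omega> assume "\<omega> \<in> (\<Union>j\<le>n. \<Union>i\<in>{..j}. {\<omega> \<in> space M. a + 2 * b < \<bar>L (real j * h) \<omega> - L (real i * h) \<omega>\<bar>})"
    then obtain i j where "j \<le> n" "i \<le> j" "\<omega> \<in> space M" "a + 2 * b < \<bar>L (real j * h) \<omega> - L (real i * h) \<omega>\<bar>" by auto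
    moreover from this have "i \<le> n" by simp
    ultimately show "\<omega> \<in> osc_grid n 0 h (a + 2 * b)"
      unfolding osc_grid_def by (intro CollectI conjI exI[of _ j] exI[of _ i]) simp_all
  qed
  with 1 2 show ?thesis by simp
qed

lemma osc_le:
  assumes H: "0 \<le> H" and b: "\<And>u. 0 \<le> u \<Longrightarrow> u \<le> H \<Longrightarrow> 1 / 2 \<le> measure (law u) {-b..b}"
  shows "prob (osc 0 H (a + 2 * b)) \<le> 4 * measure (law H) {x. a < \<bar>x\<bar>}"
proof -
  have meas: "(\<lambda>\<omega>. L (0 + H) \<omega> - L 0 \<omega>) \<in> borel_measurable M"
    using H by (intro borel_measurable_diff L_measurable) auto
  have "law H = distr M borel (\<lambda>\<omega>. L (0 + H) \<omega> - L 0 \<omega>)"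
    unfolding law_def by (rule increments_stationary[symmetric, OF _ H]) simp
  then have "measure (law H) {x. a < \<bar>x\<bar>} = prob ((\<lambda>\<omega>. L (0 + H) \<omega> - L 0 \<omega>) -` {x. a < \<bar>x\<bar>} \<inter> space M)"
    using meas by (simp add: measure_distr)
  also have "(\<lambda>\<omega>. L (0 + H) \<omega> - L 0 \<omega>) -` {x. a < \<bar>x\<bar>} \<inter> space M = {\<omega> \<in> space M. a < \<bar>L H \<omega> - L 0 \<omega>\<bar>}"
    by auto
  finally have eq: "measure (law H) {x. a < \<bar>x\<bar>} = prob {\<omega> \<in> space M. a < \<bar>L H \<omega> - L 0 \<omega>\<bar>}" .
  have le: "prob (osc_grid (2 ^ m) 0 (H / 2 ^ m) (a + 2 * b)) \<le> 4 * measure (law H) {x. a < \<bar>x\<bar>}" for m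
  proof -
    have "1 / 2 \<le> measure (law (real j * (H / 2 ^ m))) {-b..b}" if "j \<le> 2 ^ m" for j
    proof (rule b)
      have "real j \<le> 2 ^ m" using that by (metis of_nat_le_iff of_nat_numeral of_nat_power)
      then have "real j * (H / 2 ^ m) \<le> 2 ^ m * (H / 2 ^ m)" using H by (intro mult_right_mono) auto
      then show "real j * (H / 2 ^ m) \<le> H" by simp
    qed (use H in simp)
    with osc_grid_le[of "H / 2 ^ m" "2 ^ m" b a] H show ?thesis unfolding eq by simp
  qed
  have "osc 0 H (a + 2 * b) \<subseteq> space M" "osc_grid (2 ^ m) 0 (H / 2 ^ m) (a + 2 * b) \<subseteq> space M" for m
    by (auto simp: osc_def osc_grid_def)
  then show ?thesis
    using osc_limit[OF order_refl H sets.top, of "a + 2 * b"] le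
    by (intro LIMSEQ_le_const2[of "\<lambda>m. prob (osc_grid (2 ^ m) 0 (H / 2 ^ m) (a + 2 * b))"])
       (auto simp: Int_absorb1)
qed

end

section \<open>Paths of the driven equation\<close>

lemma cadlag_right_tendsto:
  assumes "cadlag y" "0 \<le> t" "\<And>n. t \<le> x n" "x \<longlonglongrightarrow> t"
  shows "(\<lambda>n. y (x n)) \<longlonglongrightarrow> y t"
proof -
  have "continuous (at t within {t..}) y"
    using assms(1,2) by (simp add: cadlag_def continuous_within at_within_Ici_at_right)
  then show ?thesis
    by (rule continuous_within_tendsto_compose') (use assms in auto)
qed

lemma cadlag_right_near:
  assumes "cadlag y" "0 \<le> t" "0 < e"
  obtains r where "0 < r" "\<And>u. t \<le> u \<Longrightarrow> u < t + r \<Longrightarrow> \<bar>y u - y t\<bar> < e"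
proof -
  have "(y \<longlongrightarrow> y t) (at_right t)"
    using assms by (simp add: cadlag_def continuous_within)
  then have "eventually (\<lambda>u. dist (y u) (y t) < e) (at_right t)"
    using assms(3) by (rule tendstoD)
  then obtain b where b: "t < b" "\<And>u. t < u \<Longrightarrow> u < b \<Longrightarrow> dist (y u) (y t) < e"
    by (auto simp: eventually_at_right_field)
  show ?thesis
  proof (rule that[of "b - t"])
    show "0 < b - t" using b by simp
    show "\<bar>y u - y t\<bar> < e" if "t \<le> u" "u < t + (b - t)" for u
      using b(2)[of u] that assms(3) by (cases "u = t") (auto simp: dist_real_def)
  qed
qed

lemma cadlag_uminus:
  assumes "cadlag y" shows "cadlag (\<lambda>t. - y t)"
  using assms unfolding cadlag_def by (blast intro: continuous_minus tendsto_minus)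

lemma cadlag_left_limit:
  assumes "cadlag y" "0 < t" shows "(y \<longlongrightarrow> Lim (at_left t) y) (at_left t)"
proof -
  obtain c where "(y \<longlongrightarrow> c) (at_left t)" using assms by (auto simp: cadlag_def)
  then show ?thesis using tendsto_Lim[of "at_left t" y c] by simp
qed

lemma Lim_uminus_cadlag:
  assumes "cadlag y" "0 < t" shows "Lim (at_left t) (\<lambda>r. - y r) = - Lim (at_left t) y"
  by (intro tendsto_Lim tendsto_minus cadlag_left_limit assms) simp

lemma cadlag_left_limit_mem:
  assumes "cadlag y" "0 < t" "u < t" and S: "\<And>r. u \<le> r \<Longrightarrow> r < t \<Longrightarrow> y r \<in> {lo..hi}"
  shows "Lim (at_left t) y \<in> {lo..hi}"
proof -
  have ev: "eventually (\<lambda>r. r \<in> {u<..<t}) (at_left t)"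
    using assms by (intro eventually_at_left_real)
  then have ev': "eventually (\<lambda>r. lo \<le> y r) (at_left t)" "eventually (\<lambda>r. y r \<le> hi) (at_left t)"
    by (eventually_elim, use S in force)+
  have "lo \<le> Lim (at_left t) y"
    by (rule tendsto_lowerbound[OF cadlag_left_limit[OF assms(1,2)] ev'(1)]) simp
  moreover have "Lim (at_left t) y \<le> hi"
    by (rule tendsto_upperbound[OF cadlag_left_limit[OF assms(1,2)] ev'(2)]) simp
  ultimately show ?thesis by simp
qed

lemma left_limit_measurable:
  assumes "cadlag y"
  shows "(\<lambda>s. if 0 < s then Lim (at_left s) y else 0) \<in> borel_measurable borel"
proof (rule borel_measurable_LIMSEQ_real)
  \<comment> \<open>This evaluates y at the largest grid point strictly below s. The ceiling minus
    one is essential: a floor could hit s itself and return the value instead of the left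
    limit.\<close>
  define g where "g n s = (if 0 < s then y ((of_int \<lceil>real (Suc n) * s\<rceil> - 1) / real (Suc n)) else 0)" for n s
  show "(\<lambda>n. g n s) \<longlonglongrightarrow> (if 0 < s then Lim (at_left s) y else 0)" for s
  proof (cases "0 < s")
    case True
    define x where "x n = (of_int \<lceil>real (Suc n) * s\<rceil> - 1) / real (Suc n)" for n
    have x: "x n < s" "s - 1 / real (Suc n) \<le> x n" for n
    proof -
      have "of_int \<lceil>real (Suc n) * s\<rceil> - 1 < real (Suc n) * s" by linarith
      then show "x n < s" unfolding x_def by (simp add: field_simps)
      have "real (Suc n) * s - 1 \<le> of_int \<lceil>real (Suc n) * s\<rceil> - 1" by linarith
      then have "(real (Suc n) * s - 1) / real (Suc n) \<le> x n" unfolding x_def by (intro divide_right_mono) auto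
      then show "s - 1 / real (Suc n) \<le> x n" by (simp add: diff_divide_distrib)
    qed
    have "x \<longlonglongrightarrow> s"
    proof (rule tendsto_sandwich)
      have "(\<lambda>n. s - 1 / real (Suc n)) \<longlonglongrightarrow> s - 0"
        by (intro tendsto_diff tendsto_const LIMSEQ_Suc[OF lim_1_over_n])
      then show "(\<lambda>n. s - 1 / real (Suc n)) \<longlonglongrightarrow> s" by simp
    qed (use x in \<open>auto intro!: always_eventually less_imp_le\<close>)
    then have "filterlim x (at_left s) sequentially"
      using x by (auto simp: filterlim_at intro!: always_eventually)
    then have "(\<lambda>n. y (x n)) \<longlonglongrightarrow> Lim (at_left s) y"
      by (rule filterlim_compose[OF cadlag_left_limit[OF assms True]])
    then show ?thesis using True by (simp add: g_def x_def)
  qed (simp add: g_def)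
  show "g n \<in> borel_measurable borel" for n
  proof -
    have "(\<lambda>s. y ((of_int \<lceil>real (Suc n) * s\<rceil> - 1) / real (Suc n))) \<in> borel_measurable borel"
      by (rule measurable_compose_countable[where f = "\<lambda>k s. y ((of_int k - 1) / real (Suc n))" and g = "\<lambda>s. \<lceil>real (Suc n) * s\<rceil>"])
         auto
    then show ?thesis unfolding g_def by (intro measurable_If) auto
  qed
qed

text \<open>A single realisation: \<open>x\<close> is the path of the solution, \<open>z\<close> the
  scaled noise and \<open>b\<close> the derivative of the potential. All arguments about drift and
  crossings are deterministic.\<close>

locale driven_path =
  fixes x z b :: "real \<Rightarrow> real" and x\<^sub>0 :: real
  assumes cad: "cadlag x" and cont: "continuous_on UNIV b"
    and eq: "\<And>t. 0 \<le> t \<Longrightarrow> x t = x\<^sub>0 - (LINT s:{0..t}|lborel. b (Lim (at_left s) x)) + z t"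
begin

lemma path_0: "x 0 = x\<^sub>0 + z 0"
proof -
  have "AE s in lborel. s \<noteq> (0::real)" by (rule AE_lborel_singleton)
  then have "AE s in lborel. indicator {0..0} s *\<^sub>R b (Lim (at_left s) x) = 0"
    by eventually_elim simp
  then have "(LINT s:{0..0}|lborel. b (Lim (at_left s) x)) = 0"
    unfolding set_lebesgue_integral_def by (rule integral_eq_zero_AE)
  then show ?thesis using eq[of 0] by simp
qed

text \<open>The expression for the left limit has an unspecified value at 0; on [0, w] it affects a
  single point, which is split off.\<close>

lemma drift_measurable:
  assumes [measurable]: "g \<in> borel_measurable borel" and fg: "\<And>s :: real. 0 < s \<Longrightarrow> f s = (g s :: real)"
  shows "(\<lambda>s. indicator {0..w} s *\<^sub>R f s) \<in> borel_measurable lborel"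
proof -
  have "indicator {0..w} s *\<^sub>R f s = indicator {0<..w} s * g s + indicator ({0..w} \<inter> {0}) s * f 0" for s
    using fg[of s] by (auto simp: indicator_def)
  then show ?thesis by simp
qed

lemma drift_measurable':
  "(\<lambda>s. indicator {0..w} s *\<^sub>R b (Lim (at_left s) x)) \<in> borel_measurable lborel"
proof (rule drift_measurable)
  have [measurable]: "b \<in> borel_measurable borel" using cont by (rule borel_measurable_continuous_onI)
  note [measurable] = left_limit_measurable[OF cad]
  show "(\<lambda>s. b (if 0 < s then Lim (at_left s) x else 0)) \<in> borel_measurable borel" by measurable
qed simp

lemma drift_integrable:
  assumes "0 \<le> w" "\<And>r. 0 \<le> r \<Longrightarrow> r < w \<Longrightarrow> \<bar>x r\<bar> \<le> 1"
  shows "set_integrable lborel {0..w} (\<lambda>s. b (Lim (at_left s) x))"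
proof -
  have "compact (b ` {-1..1})"
    by (intro compact_continuous_image compact_Icc continuous_on_subset[OF cont]) auto
  then obtain K where K: "\<And>y. y \<in> {-1..1} \<Longrightarrow> \<bar>b y\<bar> \<le> K"
    using compact_imp_bounded bounded_iff by (metis imageI real_norm_def)
  \<comment> \<open>The second entry of the maximum covers the unspecified left limit at 0.\<close>
  define C where "C = max K \<bar>b (Lim (at_left 0) x)\<bar>"
  show ?thesis unfolding set_integrable_def
  proof (rule Bochner_Integration.integrable_bound)
    show "integrable lborel (\<lambda>s. C * indicator {0..w} s :: real)" using assms(1) by simp
    show "(\<lambda>s. indicator {0..w} s *\<^sub>R b (Lim (at_left s) x)) \<in> borel_measurable lborel"
      by (rule drift_measurable')
    show "AE s in lborel. norm (indicator {0..w} s *\<^sub>R b (Lim (at_left s) x)) \<le> norm (C * indicator {0..w} s)"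
    proof (rule AE_I2)
      fix s
      have "\<bar>b (Lim (at_left s) x)\<bar> \<le> C" if s: "0 \<le> s" "s \<le> w"
      proof (cases "s = 0")
        case False
        then have "Lim (at_left s) x \<in> {-1..1}"
          using s by (intro cadlag_left_limit_mem[OF cad, of s 0] )
            (use assms(2) in \<open>auto simp: abs_le_iff minus_le_iff\<close>)
        then show ?thesis using K by (force simp: C_def)
      qed (simp add: C_def)
      then show "norm (indicator {0..w} s *\<^sub>R b (Lim (at_left s) x)) \<le> norm (C * indicator {0..w} s)"
        by (auto simp: indicator_def)
    qed
  qed
qed

text \<open>The path has to stay in the strip only before w. The drift is evaluated at left limits,
  so a jump out of the strip at time w itself is allowed.\<close>

lemma path_increment:
  assumes uw: "0 \<le> u" "u \<le> w" and bdd: "\<And>r. 0 \<le> r \<Longrightarrow> r < w \<Longrightarrow> \<bar>x r\<bar> \<le> 1"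
    and range: "\<And>r. u \<le> r \<Longrightarrow> r < w \<Longrightarrow> x r \<in> {lo..hi}"
    and drift: "\<And>y. y \<in> {lo..hi} \<Longrightarrow> c\<^sub>1 \<le> b y \<and> b y \<le> c\<^sub>2"
  shows "x w - x u \<le> z w - z u - c\<^sub>1 * (w - u)" "z w - z u - c\<^sub>2 * (w - u) \<le> x w - x u"
proof -
  let ?f = "\<lambda>s. b (Lim (at_left s) x)"
  have int: "set_integrable lborel {0..w} ?f"
    using uw bdd by (intro drift_integrable) auto
  have int1: "set_integrable lborel {0..u} ?f" "set_integrable lborel {u<..w} ?f"
    by (rule set_integrable_subset[OF int]; use uw in auto)+
  have "{0..w} = {0..u} \<union> {u<..w}" using uw by auto
  then have "(LINT s:{0..w}|lborel. ?f s) = (LINT s:{0..u}|lborel. ?f s) + (LINT s:{u<..w}|lborel. ?f s)"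
    by (subst \<open>{0..w} = _\<close>) (rule set_integral_Un, use int1 in auto)
  then have incr: "x w - x u = z w - z u - (LINT s:{u<..w}|lborel. ?f s)"
    using eq[of w] eq[of u] uw by simp
  have mem: "c\<^sub>1 \<le> ?f s \<and> ?f s \<le> c\<^sub>2" if "s \<in> {u<..w}" for s
  proof (rule drift, rule cadlag_left_limit_mem[OF cad])
    show "0 < s" "u < s" using that uw by auto
    show "x r \<in> {lo..hi}" if "u \<le> r" "r < s" for r using range[of r] that \<open>s \<in> {u<..w}\<close> by simp
  qed
  have const: "(LINT s:{u<..w}|lborel. c) = c * (w - u)" for c :: real
    using uw by (simp add: set_lebesgue_integral_def)
  have cint: "set_integrable lborel {u<..w} (\<lambda>_. c)" for c :: real
    using uw by (simp add: set_integrable_def)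
  have "c\<^sub>1 * (w - u) \<le> (LINT s:{u<..w}|lborel. ?f s)"
    unfolding const [symmetric] using mem by (intro set_integral_mono cint int1) auto
  moreover have "(LINT s:{u<..w}|lborel. ?f s) \<le> c\<^sub>2 * (w - u)"
    unfolding const [symmetric] using mem by (intro set_integral_mono cint int1) auto
  ultimately show "x w - x u \<le> z w - z u - c\<^sub>1 * (w - u)" "z w - z u - c\<^sub>2 * (w - u) \<le> x w - x u"
    using incr by linarith+
qed

lemma path_increment_bound:
  assumes uw: "0 \<le> u" "u \<le> w" and bdd: "\<And>r. 0 \<le> r \<Longrightarrow> r < w \<Longrightarrow> \<bar>x r\<bar> \<le> 1"
    and K: "\<And>y. \<bar>y\<bar> \<le> 1 \<Longrightarrow> \<bar>b y\<bar> \<le> K"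
  shows "\<bar>(x w - x u) - (z w - z u)\<bar> \<le> K * (w - u)"
proof -
  have K': "- K \<le> b y \<and> b y \<le> K" if "y \<in> {-1..1}" for y
    using K[of y] that by (auto simp: abs_le_iff)
  have range: "x r \<in> {-1..1}" if "u \<le> r" "r < w" for r
    using bdd[of r] that uw by (auto simp: abs_le_iff)
  have "x w - x u \<le> z w - z u - (- K) * (w - u)" "z w - z u - K * (w - u) \<le> x w - x u"
    by (rule path_increment[OF uw bdd range K']; assumption)+
  then show ?thesis by (simp add: abs_le_iff)
qed

text \<open>To climb from the level \<open>\<eta>\<close> to \<open>1 - \<eta>\<close> against a drift bounded below by \<open>m\<close> on
  \<open>[\<eta>, 1 - \<eta>]\<close>, the path has to use a noise increment of size about one over a time
  window of length at most \<open>1 / m\<close>: look back at the last visit below \<open>\<eta>\<close>.\<close>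

lemma no_up_crossing:
  assumes \<eta>: "0 < \<eta>" "\<eta> < \<delta> / 2" "\<delta> \<le> 1" and m: "0 < m" "1 \<le> m * T"
    and drift: "\<And>y. y \<in> {\<eta>..1 - \<eta>} \<Longrightarrow> m \<le> b y"
    and K: "0 \<le> K" "\<And>y. \<bar>y\<bar> \<le> 1 \<Longrightarrow> \<bar>b y\<bar> \<le> K"
    and s: "0 \<le> s" and before: "\<And>r. 0 \<le> r \<Longrightarrow> r < s \<Longrightarrow> \<bar>x r\<bar> < 1 - \<eta>"
    and start: "\<bar>x\<^sub>0\<bar> \<le> 1 - \<delta>" "z 0 = 0"
    and window: "\<And>u v. 0 \<le> u \<Longrightarrow> u \<le> v \<Longrightarrow> v \<le> s \<Longrightarrow> v - u \<le> T \<Longrightarrow> \<bar>z v - z u\<bar> \<le> 1 - 3 * \<eta>"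
    and initial: "\<And>v. 0 \<le> v \<Longrightarrow> v \<le> s \<Longrightarrow> v \<le> T \<Longrightarrow> \<bar>z v - z 0\<bar> \<le> \<delta> / 2"
  shows "x s < 1 - \<eta>"
proof -
  have T: "0 < T" using m by (metis zero_less_mult_pos less_le_trans zero_less_one)
  \<comment> \<open>The start of the window of length T that ends at s, cut off at 0; the cut-off
    case is the initial phase.\<close>
  define a where "a = max 0 (s - T)"
  have a: "0 \<le> a" "a \<le> s" "s - T \<le> a" using s T by (auto simp: a_def)
  have bdd: "\<bar>x r\<bar> \<le> 1" if "0 \<le> r" "r < s" for r using before[OF that] \<eta> by linarith
  define S where "S = {r. a \<le> r \<and> r < s \<and> x r \<le> \<eta>}"
  have above: "x w' \<le> x w + (z w' - z w) - m * (w' - w)"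
    if "0 \<le> w" "w \<le> w'" "w' \<le> s" and gt: "\<And>r. w \<le> r \<Longrightarrow> r < w' \<Longrightarrow> \<eta> < x r" for w w'
  proof -
    obtain c where c: "\<And>y. y \<in> {\<eta>..1 - \<eta>} \<Longrightarrow> m \<le> b y \<and> b y \<le> c"
    proof
      show "m \<le> b y \<and> b y \<le> K" if "y \<in> {\<eta>..1 - \<eta>}" for y
        using drift[OF that] K(2)[of y] that \<eta> by auto
    qed
    have "x w' - x w \<le> z w' - z w - m * (w' - w)"
    proof (rule path_increment[OF that(1,2) _ _ c])
      show "\<bar>x r\<bar> \<le> 1" if "0 \<le> r" "r < w'" for r using bdd[of r] that \<open>w' \<le> s\<close> by simp
      show "x r \<in> {\<eta>..1 - \<eta>}" if "w \<le> r" "r < w'" for r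
        using gt[OF that] before[of r] that \<open>0 \<le> w\<close> \<open>w' \<le> s\<close> by (auto simp: abs_less_iff)
    qed
    then show ?thesis by simp
  qed
  show ?thesis
  proof (cases "S = {}")
    case False
    have bS: "bdd_above S" by (rule bdd_aboveI[of _ s]) (auto simp: S_def)
    define r\<^sub>0 where "r\<^sub>0 = Sup S"
    have r0: "r\<^sub>0 \<le> s" unfolding r\<^sub>0_def using False by (intro cSup_least) (auto simp: S_def)
    \<comment> \<open>The last visit below \<eta> is a supremum and need not be attained. It is
      bracketed by a visit u shortly before and a time w shortly after, over which the drift moves
      the path by less than \<eta>.\<close>
    define \<zeta> where "\<zeta> = \<eta> / (4 * (K + 1))"
    have \<zeta>: "0 < \<zeta>" using \<eta> K by (simp add: \<zeta>_def)
    have K\<zeta>: "K * (2 * \<zeta>) < \<eta>"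
    proof -
      have "K * (2 * \<zeta>) \<le> (K + 1) * (2 * \<zeta>)" using \<zeta> by (intro mult_right_mono) auto
      also have "\<dots> = \<eta> / 2" using K by (simp add: \<zeta>_def field_simps)
      finally show ?thesis using \<eta> by simp
    qed
    obtain u where u: "u \<in> S" "r\<^sub>0 - \<zeta> < u"
      using less_cSupD[OF False, of "r\<^sub>0 - \<zeta>"] \<zeta> by (auto simp: r\<^sub>0_def)
    have ur: "u \<le> r\<^sub>0" unfolding r\<^sub>0_def using u bS by (intro cSup_upper)
    have u': "a \<le> u" "u < s" "x u \<le> \<eta>" using u by (auto simp: S_def)
    define w where "w = min (r\<^sub>0 + \<zeta>) s"
    have w: "u \<le> w" "w \<le> s" "w - u \<le> 2 * \<zeta>" using ur u u' \<zeta> by (auto simp: w_def)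
    have "\<bar>(x w - x u) - (z w - z u)\<bar> \<le> K * (w - u)"
    proof (rule path_increment_bound[OF _ w(1) _ K(2)])
      show "0 \<le> u" using u' a by simp
      show "\<bar>x r\<bar> \<le> 1" if "0 \<le> r" "r < w" for r using bdd[of r] that w by simp
    qed
    moreover have "K * (w - u) \<le> K * (2 * \<zeta>)" using w K by (intro mult_left_mono) auto
    ultimately have 1: "x w < \<eta> + (z w - z u) + \<eta>" using K\<zeta> u'(3) by linarith
    have 2: "x s \<le> x w + (z s - z w) - m * (s - w)"
    proof (rule above)
      show "0 \<le> w" using w u' a by linarith
      fix r assume r: "w \<le> r" "r < s"
      then have "r\<^sub>0 < r" using \<zeta> by (auto simp: w_def min_def split: if_splits)
      then have "r \<notin> S" using cSup_upper[OF _ bS, of r] by (auto simp: r\<^sub>0_def)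
      then show "\<eta> < x r" using r w u' by (auto simp: S_def)
    qed (use w in auto)
    have "0 \<le> m * (s - w)" using m w by simp
    \<comment> \<open>The budget closes: \<eta> for the position at u, less than \<eta> for the
      bracketing, and 1 - 3 \<eta> for the noise give less than 1 - \<eta>.\<close>
    moreover have "\<bar>z s - z u\<bar> \<le> 1 - 3 * \<eta>"
      using u' a by (intro window) auto
    ultimately show ?thesis using 1 2 by linarith
  next
    case True
    then have gt: "\<eta> < x r" if "a \<le> r" "r < s" for r using that by (force simp: S_def)
    have le: "x s \<le> x a + (z s - z a) - m * (s - a)"
      by (rule above) (use a gt in auto)
    show ?thesis
    \<comment> \<open>Over a full window above \<eta> the drift takes away m T \<ge> 1, more than
      the noise adds. In a shorter initial window the path starts at most at 1 - \<delta> and the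
      noise adds at most \<delta> / 2.\<close>
    proof (cases "T \<le> s")
      case True
      then have a': "a = s - T" using T by (simp add: a_def)
      have "\<bar>z s - z a\<bar> \<le> 1 - 3 * \<eta>" using a a' T by (intro window) auto
      moreover have "\<bar>x a\<bar> < 1 - \<eta>" using a a' T by (intro before) auto
      ultimately show ?thesis using le m a' \<eta> by simp
    next
      case False
      then have a': "a = 0" by (simp add: a_def)
      have "0 \<le> m * (s - a)" using m a by simp
      moreover have "\<bar>z s - z 0\<bar> \<le> \<delta> / 2" using False s by (intro initial) auto
      moreover have "x 0 \<le> 1 - \<delta>" using path_0 start by simp
      ultimately show ?thesis using le \<eta> unfolding a' by linarith
    qed
  qed
qed

text \<open>Reflection reduces the lower boundary to the upper one. The reflected left limits are
  known for positive times only, so the integrands are compared almost everywhere.\<close>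

lemma driven_path_uminus: "driven_path (\<lambda>t. - x t) (\<lambda>t. - z t) (\<lambda>y. - b (- y)) (- x\<^sub>0)"
proof
  show "cadlag (\<lambda>t. - x t)" using cad by (rule cadlag_uminus)
  have "continuous_on UNIV (\<lambda>y. b (- y))"
    by (rule continuous_on_compose2[OF cont]) (auto intro: continuous_intros)
  then show "continuous_on UNIV (\<lambda>y. - b (- y))" by (rule continuous_on_minus)
  fix t :: real assume t: "0 \<le> t"
  have "(LINT s:{0..t}|lborel. - b (- Lim (at_left s) (\<lambda>r. - x r))) = (LINT s:{0..t}|lborel. - b (Lim (at_left s) x))"
    unfolding set_lebesgue_integral_def
  proof (rule integral_cong_AE)
    have [measurable]: "b \<in> borel_measurable borel" using cont by (rule borel_measurable_continuous_onI)
    note [measurable] = left_limit_measurable[OF cad]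
    show "(\<lambda>s. indicator {0..t} s *\<^sub>R - b (- Lim (at_left s) (\<lambda>r. - x r))) \<in> borel_measurable lborel"
    proof (rule drift_measurable)
      show "(\<lambda>s. - b (if 0 < s then Lim (at_left s) x else 0)) \<in> borel_measurable borel" by measurable
    qed (simp add: Lim_uminus_cadlag[OF cad])
    show "(\<lambda>s. indicator {0..t} s *\<^sub>R - b (Lim (at_left s) x)) \<in> borel_measurable lborel"
    proof (rule drift_measurable)
      show "(\<lambda>s. - b (if 0 < s then Lim (at_left s) x else 0)) \<in> borel_measurable borel" by measurable
    qed simp
    have "AE s in lborel. s \<noteq> (0::real)" by (rule AE_lborel_singleton)
    then show "AE s in lborel. indicator {0..t} s *\<^sub>R - b (- Lim (at_left s) (\<lambda>r. - x r))
        = indicator {0..t} s *\<^sub>R - b (Lim (at_left s) x)"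
    proof eventually_elim
      case (elim s)
      then show ?case by (cases "0 < s") (auto simp: Lim_uminus_cadlag[OF cad] indicator_def)
    qed
  qed
  also have "\<dots> = - (LINT s:{0..t}|lborel. b (Lim (at_left s) x))"
    by (simp add: set_lebesgue_integral_def)
  finally show "- x t = - x\<^sub>0 - (LINT s:{0..t}|lborel. - b (- Lim (at_left s) (\<lambda>r. - x r))) + - z t"
    using eq[OF t] by simp
qed

text \<open>The first time at which the modulus reaches 1 - \<eta> is attained by right-continuity.
  Before it the hypotheses of the crossing estimate hold for the path and for its reflection, and
  both forbid the crossing.\<close>

lemma no_exit:
  assumes \<eta>: "0 < \<eta>" "\<eta> < \<delta> / 2" "\<delta> \<le> 1" and m: "0 < m" "1 \<le> m * T"
    and drift: "\<And>y. \<bar>y\<bar> \<in> {\<eta>..1 - \<eta>} \<Longrightarrow> m \<le> sgn y * b y"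
    and K: "0 \<le> K" "\<And>y. \<bar>y\<bar> \<le> 1 \<Longrightarrow> \<bar>b y\<bar> \<le> K"
    and start: "\<bar>x\<^sub>0\<bar> \<le> 1 - \<delta>" "z 0 = 0"
    and window: "\<And>u v. 0 \<le> u \<Longrightarrow> u \<le> v \<Longrightarrow> v \<le> t \<Longrightarrow> v - u \<le> T \<Longrightarrow> \<bar>z v - z u\<bar> \<le> 1 - 3 * \<eta>"
    and initial: "\<And>v. 0 \<le> v \<Longrightarrow> v \<le> t \<Longrightarrow> v \<le> T \<Longrightarrow> \<bar>z v - z 0\<bar> \<le> \<delta> / 2"
    and s: "0 \<le> s" "s \<le> t"
  shows "\<bar>x s\<bar> < 1 - \<eta>"
proof (rule ccontr)
  assume not: "\<not> \<bar>x s\<bar> < 1 - \<eta>"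
  define S where "S = {r. 0 \<le> r \<and> r \<le> s \<and> 1 - \<eta> \<le> \<bar>x r\<bar>}"
  have S: "S \<noteq> {}" "bdd_below S" using not s by (auto simp: S_def intro!: bdd_belowI[of _ 0])
  define r where "r = Inf S"
  have r: "0 \<le> r" "r \<le> s"
    unfolding r_def using S not s by (auto intro!: cInf_greatest cInf_lower simp: S_def)
  have before: "\<bar>x u\<bar> < 1 - \<eta>" if "0 \<le> u" "u < r" for u
  proof -
    have "u \<notin> S" using that cInf_lower[OF _ S(2), of u] by (auto simp: r_def)
    then show ?thesis using that r by (auto simp: S_def)
  qed
  have at: "1 - \<eta> \<le> \<bar>x r\<bar>"
  proof (rule ccontr)
    assume "\<not> 1 - \<eta> \<le> \<bar>x r\<bar>"
    then have "0 < 1 - \<eta> - \<bar>x r\<bar>" by simp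
    then obtain e where e: "0 < e" "\<And>u. r \<le> u \<Longrightarrow> u < r + e \<Longrightarrow> \<bar>x u - x r\<bar> < 1 - \<eta> - \<bar>x r\<bar>"
      using cadlag_right_near[OF cad r(1)] by metis
    obtain u where u: "u \<in> S" "u < r + e"
      using cInf_lessD[OF S(1), of "r + e"] e by (auto simp: r_def)
    then have "r \<le> u" using cInf_lower[OF _ S(2)] by (auto simp: r_def)
    then have "\<bar>x u - x r\<bar> < 1 - \<eta> - \<bar>x r\<bar>" using e u by blast
    then show False using u by (auto simp: S_def)
  qed
  interpret U: driven_path "\<lambda>t. - x t" "\<lambda>t. - z t" "\<lambda>y. - b (- y)" "- x\<^sub>0" by (rule driven_path_uminus)
  have rt: "r \<le> t" using r s by simp
  have "x r < 1 - \<eta>"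
  proof (rule no_up_crossing[OF \<eta> m _ K r(1) before start])
    show "m \<le> b y" if "y \<in> {\<eta>..1 - \<eta>}" for y using drift[of y] that \<eta> by (simp add: sgn_if)
    show "\<bar>z v - z u\<bar> \<le> 1 - 3 * \<eta>" if "0 \<le> u" "u \<le> v" "v \<le> r" "v - u \<le> T" for u v
      using window[OF that(1,2) _ that(4)] that(3) rt by simp
    show "\<bar>z v - z 0\<bar> \<le> \<delta> / 2" if "0 \<le> v" "v \<le> r" "v \<le> T" for v
      using initial[OF that(1) _ that(3)] that(2) rt by simp
  qed
  moreover have "- x r < 1 - \<eta>"
  proof (rule U.no_up_crossing[OF \<eta> m _ K(1) _ r(1)])
    show "m \<le> - b (- y)" if "y \<in> {\<eta>..1 - \<eta>}" for y using drift[of "- y"] that \<eta> by (simp add: sgn_if)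
    show "\<bar>- b (- y)\<bar> \<le> K" if "\<bar>y\<bar> \<le> 1" for y using K(2)[of "- y"] that by simp
    show "\<bar>- x u\<bar> < 1 - \<eta>" if "0 \<le> u" "u < r" for u using before[OF that] by simp
    show "\<bar>- x\<^sub>0\<bar> \<le> 1 - \<delta>" "- z 0 = 0" using start by auto
    show "\<bar>- z v - - z u\<bar> \<le> 1 - 3 * \<eta>" if "0 \<le> u" "u \<le> v" "v \<le> r" "v - u \<le> T" for u v
      using window[OF that(1,2) _ that(4)] that(3) rt by (simp add: abs_minus_commute)
    show "\<bar>- z v - - z 0\<bar> \<le> \<delta> / 2" if "0 \<le> v" "v \<le> r" "v \<le> T" for v
      using initial[OF that(1) _ that(3)] that(2) rt by (simp add: abs_minus_commute)
  qed
  ultimately show False using at by linarith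
qed

end

section \<open>Contact with the boundary\<close>

context levy_noise
begin

text \<open>Grid points are rounded up because cadlag paths are continuous from the right
  only.\<close>

lemma osc_grid_approx:
  assumes cad: "cadlag y" and s: "0 \<le> s" "0 < H" and u: "s \<le> u" "u \<le> s + H"
  obtains k :: "nat \<Rightarrow> nat" where "\<And>m. k m \<le> 2 ^ m"
    "(\<lambda>m. y (s + real (k m) * (H / 2 ^ m))) \<longlonglongrightarrow> y u"
proof
  define k where "k m = nat \<lceil>(u - s) / H * 2 ^ m\<rceil>" for m :: nat
  have nn: "0 \<le> (u - s) / H * 2 ^ m" for m :: nat using s u by simp
  have k: "(u - s) / H * 2 ^ m \<le> real (k m)" "real (k m) \<le> (u - s) / H * 2 ^ m + 1" for m
    unfolding k_def using nn[of m] by linarith+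
  show "k m \<le> 2 ^ m" for m
  proof -
    have "(u - s) / H * 2 ^ m \<le> 1 * 2 ^ m" using s u by (intro mult_right_mono) auto
    then have "\<lceil>(u - s) / H * 2 ^ m\<rceil> \<le> 2 ^ m" by (simp add: ceiling_le_iff)
    then show ?thesis unfolding k_def by (simp add: nat_le_iff)
  qed
  have lower: "u \<le> s + real (k m) * (H / 2 ^ m)" for m
  proof -
    have "(u - s) / H * 2 ^ m * (H / 2 ^ m) \<le> real (k m) * (H / 2 ^ m)"
      using k(1) s by (intro mult_right_mono) auto
    then show ?thesis using s by simp
  qed
  have upper: "s + real (k m) * (H / 2 ^ m) \<le> u + H * (1 / 2) ^ m" for m
  proof -
    have "real (k m) * (H / 2 ^ m) \<le> ((u - s) / H * 2 ^ m + 1) * (H / 2 ^ m)"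
      using k(2) s by (intro mult_right_mono) auto
    also have "\<dots> = (u - s) + H * (1 / 2) ^ m" using s by (simp add: distrib_right power_divide add_divide_distrib)
    finally show ?thesis by simp
  qed
  have lim: "(\<lambda>m. s + real (k m) * (H / 2 ^ m)) \<longlonglongrightarrow> u"
  proof (rule tendsto_sandwich[where f = "\<lambda>_. u" and h = "\<lambda>m. u + H * (1 / 2) ^ m"])
    have "(\<lambda>m. u + H * (1 / 2) ^ m) \<longlonglongrightarrow> u + H * 0"
      by (intro tendsto_intros LIMSEQ_power_zero) auto
    then show "(\<lambda>m. u + H * (1 / 2) ^ m) \<longlonglongrightarrow> u" by simp
  qed (use lower upper in auto)
  show "(\<lambda>m. y (s + real (k m) * (H / 2 ^ m))) \<longlonglongrightarrow> y u"
    using s u by (intro cadlag_right_tendsto[OF cad _ lower lim]) auto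
qed

text \<open>The strict inequality in \<open>osc_grid\<close> makes its negation closed under limits,
  so the bound passes from the grid to all times.\<close>

lemma osc_cadlag:
  assumes cad: "cadlag (\<lambda>t. L t \<omega>)" and \<omega>: "\<omega> \<in> space M" "\<omega> \<notin> osc s H a" and s: "0 \<le> s" "0 \<le> H"
    and u: "s \<le> u" "u \<le> s + H" and v: "s \<le> v" "v \<le> s + H"
  shows "\<bar>L u \<omega> - L v \<omega>\<bar> \<le> a"
proof -
  have grid: "\<bar>L (s + real i * (H / 2 ^ m)) \<omega> - L (s + real j * (H / 2 ^ m)) \<omega>\<bar> \<le> a"
    if "i \<le> 2 ^ m" "j \<le> 2 ^ m" for m i j
  proof (rule ccontr)
    assume "\<not> ?thesis"
    then have "\<omega> \<in> osc_grid (2 ^ m) s (H / 2 ^ m) a"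
      unfolding osc_grid_def using that \<omega>(1) by (intro CollectI conjI exI[of _ i] exI[of _ j]) auto
    then show False using \<omega>(2) by (auto simp: osc_def)
  qed
  show ?thesis
  proof (cases "H = 0")
    case True
    then have "u = s" "v = s" using u v by auto
    then show ?thesis using grid[of 0 0 0] by simp
  next
    case False
    then have H: "0 < H" using s by simp
    obtain k where k: "\<And>m. k m \<le> 2 ^ m" "(\<lambda>m. L (s + real (k m) * (H / 2 ^ m)) \<omega>) \<longlonglongrightarrow> L u \<omega>"
      using osc_grid_approx[OF cad s(1) H u] by blast
    obtain k' where k': "\<And>m. k' m \<le> 2 ^ m" "(\<lambda>m. L (s + real (k' m) * (H / 2 ^ m)) \<omega>) \<longlonglongrightarrow> L v \<omega>"
      using osc_grid_approx[OF cad s(1) H v] by blast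
    have "(\<lambda>m. \<bar>L (s + real (k m) * (H / 2 ^ m)) \<omega> - L (s + real (k' m) * (H / 2 ^ m)) \<omega>\<bar>) \<longlonglongrightarrow> \<bar>L u \<omega> - L v \<omega>\<bar>"
      by (intro tendsto_rabs tendsto_diff k k')
    then show ?thesis by (rule LIMSEQ_le_const2) (use grid k k' in auto)
  qed
qed

text \<open>On almost every path, right-continuity at 0 keeps all values at sufficiently small times
  within a / 2 of the initial one, so eventually no oscillation above \<open>a\<close> is
  possible.\<close>

lemma osc_vanishes:
  assumes "0 < a"
  shows "(\<lambda>k. prob (osc 0 (1 / real (Suc k)) a)) \<longlonglongrightarrow> 0"
proof -
  have "(\<lambda>k. \<integral>\<omega>. indicator (osc 0 (1 / real (Suc k)) a) \<omega> \<partial>M) \<longlonglongrightarrow> (\<integral>\<omega>. 0 \<partial>M :: real)"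
  proof (rule integral_dominated_convergence[where w = "\<lambda>_. 1"])
    show "AE \<omega> in M. (\<lambda>k. indicator (osc 0 (1 / real (Suc k)) a) \<omega> :: real) \<longlonglongrightarrow> 0"
      using cadlag_L
    proof eventually_elim
      case (elim \<omega>)
      obtain r where r: "0 < r" "\<And>u. 0 \<le> u \<Longrightarrow> u < 0 + r \<Longrightarrow> \<bar>L u \<omega> - L 0 \<omega>\<bar> < a / 2"
        using cadlag_right_near[OF elim, of 0 "a / 2"] assms by auto
      have "eventually (\<lambda>k. 1 / real (Suc k) < r) sequentially"
        using r by (intro order_tendstoD(2)[OF LIMSEQ_Suc[OF lim_1_over_n]]) auto
      then have "eventually (\<lambda>k. indicator (osc 0 (1 / real (Suc k)) a) \<omega> = (0::real)) sequentially"
      proof eventually_elim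
        case (elim k)
        have "\<omega> \<notin> osc_grid (2 ^ m) 0 (1 / real (Suc k) / 2 ^ m) a" for m
        proof
          assume "\<omega> \<in> osc_grid (2 ^ m) 0 (1 / real (Suc k) / 2 ^ m) a"
          then obtain i j where ij: "i \<le> 2 ^ m" "j \<le> 2 ^ m"
            "a < \<bar>L (0 + real i * (1 / real (Suc k) / 2 ^ m)) \<omega> - L (0 + real j * (1 / real (Suc k) / 2 ^ m)) \<omega>\<bar>"
            unfolding osc_grid_def by blast
          have *: "\<bar>L (0 + real i * (1 / real (Suc k) / 2 ^ m)) \<omega> - L 0 \<omega>\<bar> < a / 2" if "i \<le> 2 ^ m" for i
          proof (rule r(2))
            have "real i \<le> 2 ^ m" using that by (metis of_nat_le_iff of_nat_numeral of_nat_power)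
            then have "real i * (1 / real (Suc k) / 2 ^ m) \<le> 2 ^ m * (1 / real (Suc k) / 2 ^ m)"
              by (intro mult_right_mono) auto
            also have "\<dots> = 1 / real (Suc k)" by simp
            finally show "0 + real i * (1 / real (Suc k) / 2 ^ m) < 0 + r" using elim by simp
          qed simp
          show False using *[OF ij(1)] *[OF ij(2)] ij(3) by linarith
        qed
        then show ?case by (auto simp: osc_def)
      qed
      then show ?case by (rule tendsto_eventually)
    qed
    show "indicator (osc 0 (1 / real (Suc k)) a) \<in> borel_measurable M" for k
      by (intro borel_measurable_indicator osc_sets) auto
  qed (auto simp: indicator_def)
  moreover have "(\<integral>\<omega>. indicator (osc 0 (1 / real (Suc k)) a) \<omega> \<partial>M) = prob (osc 0 (1 / real (Suc k)) a)" for k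
    using osc_sets[of 0 "1 / real (Suc k)" a] by simp
  ultimately show ?thesis by simp
qed

lemma prob_liminf_le:
  fixes B :: "nat \<Rightarrow> 'a set"
  assumes "\<And>n. B n \<in> sets M" "\<And>n. prob (B n) \<le> q"
  shows "prob (\<Union>n\<^sub>0. \<Inter>n\<in>{n\<^sub>0..}. B n) \<le> q"
proof (rule LIMSEQ_le_const2)
  have meas: "(\<Inter>n\<in>{n\<^sub>0..}. B n) \<in> sets M" for n\<^sub>0 :: nat
    using assms by (intro sets.countable_INT') auto
  show "(\<lambda>n\<^sub>0. prob (\<Inter>n\<in>{n\<^sub>0..}. B n)) \<longlonglongrightarrow> prob (\<Union>n\<^sub>0. \<Inter>n\<in>{n\<^sub>0..}. B n)"
    using meas by (intro finite_Lim_measure_incseq) (auto simp: incseq_def)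
  have "prob (\<Inter>n\<in>{n\<^sub>0..}. B n) \<le> q" for n\<^sub>0
    using finite_measure_mono[of "\<Inter>n\<in>{n\<^sub>0..}. B n" "B n\<^sub>0"] assms(1,2)[of n\<^sub>0] by force
  then show "\<exists>N. \<forall>n\<ge>N. prob (\<Inter>n\<in>{n..}. B n) \<le> q" by blast
qed

text \<open>A first passage above the level c on a grid of mesh \<tau>, followed within time h by a
  noise oscillation larger than a. With c close to 1 this approximates a jump at the moment the
  boundary is approached.\<close>

definition hit_osc :: "(real \<Rightarrow> 'a \<Rightarrow> real) \<Rightarrow> nat \<Rightarrow> real \<Rightarrow> real \<Rightarrow> real \<Rightarrow> real \<Rightarrow> 'a set" where
  "hit_osc Y n \<tau> c h a = (\<Union>j\<le>n. {\<omega> \<in> space M. c < \<bar>Y (real j * \<tau>) \<omega>\<bar> \<and> (\<forall>i<j. \<bar>Y (real i * \<tau>) \<omega>\<bar> \<le> c)}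
     \<inter> osc (real j * \<tau>) h a)"

text \<open>The first passage on a grid takes finitely many values, so the strong Markov property
  reduces to independence after each fixed grid time. The passage events are disjoint, and the bound
  is free of n, \<tau> and c.\<close>

lemma hit_osc:
  assumes Y: "adapted F Y" and \<tau>: "0 \<le> \<tau>" and h: "0 \<le> h"
  shows "hit_osc Y n \<tau> c h a \<in> sets M" "prob (hit_osc Y n \<tau> c h a) \<le> prob (osc 0 h a)"
proof -
  define A where "A j = {\<omega> \<in> space M. c < \<bar>Y (real j * \<tau>) \<omega>\<bar> \<and> (\<forall>i<j. \<bar>Y (real i * \<tau>) \<omega>\<bar> \<le> c)}" for j
  have nn: "0 \<le> real j * \<tau>" for j using \<tau> by simp
  have A: "A j \<in> sets (F (real j * \<tau>))" for j
  proof -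
    have YF: "Y (real i * \<tau>) \<in> borel_measurable (F (real j * \<tau>))" if "i \<le> j" for i
    proof (rule measurable_F_mono[OF _ nn])
      show "Y (real i * \<tau>) \<in> borel_measurable (F (real i * \<tau>))" using Y nn by (auto simp: adapted_def)
      show "real i * \<tau> \<le> real j * \<tau>" using that \<tau> by (intro mult_right_mono) auto
    qed
    have "A j = {\<omega> \<in> space (F (real j * \<tau>)). c < \<bar>Y (real j * \<tau>) \<omega>\<bar>}
        \<inter> {\<omega> \<in> space (F (real j * \<tau>)). \<forall>i\<in>{..<j}. \<bar>Y (real i * \<tau>) \<omega>\<bar> \<le> c}"
      unfolding A_def space_F[OF nn] by blast
    also have "\<dots> \<in> sets (F (real j * \<tau>))"
    proof (intro sets.Int sets.sets_Collect_finite_All)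
      have [measurable]: "Y (real j * \<tau>) \<in> borel_measurable (F (real j * \<tau>))" by (rule YF) simp
      show "{\<omega> \<in> space (F (real j * \<tau>)). c < \<bar>Y (real j * \<tau>) \<omega>\<bar>} \<in> sets (F (real j * \<tau>))"
        by measurable
      fix i assume "i \<in> {..<j}"
      then have [measurable]: "Y (real i * \<tau>) \<in> borel_measurable (F (real j * \<tau>))" by (intro YF) simp
      show "{\<omega> \<in> space (F (real j * \<tau>)). \<bar>Y (real i * \<tau>) \<omega>\<bar> \<le> c} \<in> sets (F (real j * \<tau>))"
        by measurable
    qed simp
    finally show ?thesis .
  qed
  have AM: "A j \<in> sets M" for j by (rule sets_F_M[OF nn A])
  have oscM: "osc (real j * \<tau>) h a \<in> sets M" for j by (rule osc_sets[OF nn h])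
  have eq: "hit_osc Y n \<tau> c h a = (\<Union>j\<le>n. A j \<inter> osc (real j * \<tau>) h a)"
    by (simp add: hit_osc_def A_def)
  show "hit_osc Y n \<tau> c h a \<in> sets M"
    unfolding eq by (intro sets.finite_UN sets.Int AM oscM) auto
  have disj: "disjoint_family_on A {..n}"
    unfolding disjoint_family_on_def
  proof (intro ballI impI)
    fix i j :: nat assume "i \<noteq> j"
    then consider "i < j" | "j < i" by linarith
    then show "A i \<inter> A j = {}" by cases (auto simp: A_def)
  qed
  have "prob (hit_osc Y n \<tau> c h a) = (\<Sum>j\<le>n. prob (A j \<inter> osc (real j * \<tau>) h a))"
    unfolding eq using disj
    by (intro finite_measure_finite_Union) (auto simp: disjoint_family_on_def intro: AM oscM)
  also have "\<dots> = (\<Sum>j\<le>n. prob (A j) * prob (osc 0 h a))"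
    by (intro sum.cong refl osc_indep nn h A)
  also have "\<dots> = prob (\<Union>j\<le>n. A j) * prob (osc 0 h a)"
    unfolding sum_distrib_right [symmetric]
    by (subst finite_measure_finite_Union[OF _ _ disj]) (auto intro: AM)
  also have "\<dots> \<le> 1 * prob (osc 0 h a)"
    by (intro mult_right_mono) auto
  finally show "prob (hit_osc Y n \<tau> c h a) \<le> prob (osc 0 h a)" by simp
qed

end

text \<open>The time s is the infimum of those times by which the modulus has come arbitrarily close
  to 1. Since the modulus is below 1 at s, right-continuity keeps it away from 1 just after s, so
  the approach happens strictly before s.\<close>

lemma first_boundary_contact:
  assumes cad: "cadlag x" and inside: "\<And>s. 0 \<le> s \<Longrightarrow> s \<le> t \<Longrightarrow> \<bar>x s\<bar> < 1"
    and contact: "\<And>c. c < 1 \<Longrightarrow> \<exists>s\<in>{0..t}. c < \<bar>x s\<bar>"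
  obtains s where "0 < s" "s \<le> t" "\<And>c. c < 1 \<Longrightarrow> \<exists>u\<in>{0..<s}. c < \<bar>x u\<bar>"
    "\<And>u. u < s \<Longrightarrow> \<exists>c<1. \<forall>r\<in>{0..u}. \<bar>x r\<bar> \<le> c"
proof -
  define B where "B = {u. 0 \<le> u \<and> u \<le> t \<and> (\<forall>c<1. \<exists>s\<in>{0..u}. c < \<bar>x s\<bar>)}"
  obtain s' where "s' \<in> {0..t}" using contact[of 0] by auto
  then have t: "0 \<le> t" by auto
  have B: "B \<noteq> {}" "bdd_below B" using contact t by (auto simp: B_def intro!: bdd_belowI[of _ 0])
  define s where "s = Inf B"
  have s: "0 \<le> s" "s \<le> t"
    unfolding s_def using B contact t by (auto intro!: cInf_greatest cInf_lower simp: B_def)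
  have before: "\<exists>c<1. \<forall>r\<in>{0..u}. \<bar>x r\<bar> \<le> c" if "u < s" for u
  proof (cases "0 \<le> u")
    case True
    have "u \<notin> B" using that cInf_lower[OF _ B(2), of u] by (auto simp: s_def)
    then show ?thesis using that s True unfolding B_def by (auto simp: not_less)
  next
    case False
    then show ?thesis by (intro exI[of _ 0]) auto
  qed
  have near: "\<exists>u\<in>{0..<s}. c < \<bar>x u\<bar>" if c: "c < 1" for c
  proof -
    define g where "g = (1 - \<bar>x s\<bar>) / 2"
    have g: "0 < g" using inside[OF s] by (simp add: g_def)
    obtain r where r: "0 < r" "\<And>u. s \<le> u \<Longrightarrow> u < s + r \<Longrightarrow> \<bar>x u - x s\<bar> < g"
      using cadlag_right_near[OF cad s(1) g] by blast
    obtain w where w: "w \<in> B" "w < s + r"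
      using cInf_lessD[OF B(1), of "s + r"] r by (auto simp: s_def)
    have "max c (1 - g) < 1" using c g by simp
    then obtain u where u: "u \<in> {0..w}" "max c (1 - g) < \<bar>x u\<bar>"
      using w(1) unfolding B_def by blast
    have "u < s"
    proof (rule ccontr)
      assume "\<not> u < s"
      then have "\<bar>x u - x s\<bar> < g" using u w by (intro r) auto
      then have "\<bar>x u\<bar> < \<bar>x s\<bar> + g" by linarith
      also have "\<dots> = 1 - g" by (simp add: g_def field_simps)
      finally show False using u by simp
    qed
    then show ?thesis using u by auto
  qed
  obtain u where "u \<in> {0..<s}" using near[of 0] by auto
  then have "0 < s" by auto
  then show ?thesis using that s near before by blast
qed

text \<open>If the whole closed interval is spent inside, right-continuity at t provides a further
  positive time without exit; this makes the inequality strict.\<close>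

lemma exit_time_gt_iff:
  assumes cad: "cadlag (\<lambda>t. X t \<omega>)" and t: "0 \<le> t"
  shows "ennreal t < exit_time X \<omega> \<longleftrightarrow> (\<forall>s\<in>{0..t}. \<bar>X s \<omega>\<bar> < 1)"
proof
  assume gt: "ennreal t < exit_time X \<omega>"
  show "\<forall>s\<in>{0..t}. \<bar>X s \<omega>\<bar> < 1"
  proof (rule ballI, rule ccontr)
    fix s assume s: "s \<in> {0..t}" and "\<not> \<bar>X s \<omega>\<bar> < 1"
    then have "exit_time X \<omega> \<le> ennreal s" unfolding exit_time_def by (intro INF_lower) auto
    also have "\<dots> \<le> ennreal t" using s by (intro ennreal_leI) auto
    finally show False using gt by simp
  qed
next
  assume inside: "\<forall>s\<in>{0..t}. \<bar>X s \<omega>\<bar> < 1"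
  then have "0 < 1 - \<bar>X t \<omega>\<bar>" using t by simp
  then obtain r where r: "0 < r" "\<And>u. t \<le> u \<Longrightarrow> u < t + r \<Longrightarrow> \<bar>X u \<omega> - X t \<omega>\<bar> < 1 - \<bar>X t \<omega>\<bar>"
    using cadlag_right_near[OF cad t] by metis
  have "ennreal (t + r) \<le> exit_time X \<omega>"
    unfolding exit_time_def
  proof (rule INF_greatest)
    fix s assume s: "s \<in> {s. 0 \<le> s \<and> 1 \<le> \<bar>X s \<omega>\<bar>}"
    have "t + r \<le> s"
    proof (rule ccontr)
      assume less: "\<not> t + r \<le> s"
      show False
      proof (cases "s \<le> t")
        case True
        then show False using bspec[OF inside, of s] s by simp
      next
        case False
        then have "\<bar>X s \<omega> - X t \<omega>\<bar> < 1 - \<bar>X t \<omega>\<bar>" using less by (intro r) auto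
        then have "\<bar>X s \<omega>\<bar> < 1" by linarith
        then show False using s by simp
      qed
    qed
    then show "ennreal (t + r) \<le> ennreal s" by (rule ennreal_leI)
  qed
  moreover have "ennreal t < ennreal (t + r)" using t r by (simp add: ennreal_less_iff)
  ultimately show "ennreal t < exit_time X \<omega>" by (rule less_le_trans[rotated])
qed

locale levy_sde = levy_noise +
  fixes U :: "real \<Rightarrow> real" and \<epsilon> x\<^sub>0 :: real and X :: "real \<Rightarrow> 'a \<Rightarrow> real"
  assumes \<epsilon>: "0 < \<epsilon>" and U: "cond_U U" and solution: "strong_solution M F U \<epsilon> L x\<^sub>0 X"
begin

definition good :: "'a \<Rightarrow> bool" where
  "good \<omega> \<longleftrightarrow> driven_path (\<lambda>t. X t \<omega>) (\<lambda>t. \<epsilon> * L t \<omega>) (deriv U) x\<^sub>0 \<and> cadlag (\<lambda>t. L t \<omega>) \<and> L 0 \<omega> = 0"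

lemma continuous_deriv_U: "continuous_on UNIV (deriv U)"
  using U unfolding cond_U_def by (blast intro: lipschitz_on_continuous_on)

lemma deriv_U_bound: obtains K where "0 \<le> K" "\<And>y. \<bar>y\<bar> \<le> 1 \<Longrightarrow> \<bar>deriv U y\<bar> \<le> K"
proof -
  have "compact (deriv U ` {-1..1})"
    by (intro compact_continuous_image compact_Icc continuous_on_subset[OF continuous_deriv_U]) auto
  then obtain K where K: "\<And>y. y \<in> {-1..1} \<Longrightarrow> \<bar>deriv U y\<bar> \<le> K"
    using compact_imp_bounded bounded_iff by (metis imageI real_norm_def)
  show ?thesis
  proof (rule that[of K])
    show "0 \<le> K" using K[of 0] by simp
    show "\<bar>deriv U y\<bar> \<le> K" if "\<bar>y\<bar> \<le> 1" for y using K[of y] that by (simp add: abs_le_iff)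
  qed
qed

lemma adapted_X: "adapted F X"
  and cadlag_X: "AE \<omega> in M. cadlag (\<lambda>t. X t \<omega>)"
  and equation_X: "AE \<omega> in M. \<forall>t\<ge>0.
        X t \<omega> = x\<^sub>0 - (LINT s:{0..t}|lborel. deriv U (Lim (at_left s) (\<lambda>r. X r \<omega>))) + \<epsilon> * L t \<omega>"
  using solution unfolding strong_solution_def by blast+

lemma AE_good: "AE \<omega> in M. good \<omega>"
  using cadlag_X equation_X cadlag_L L_0
proof eventually_elim
  case (elim \<omega>)
  then show ?case
    unfolding good_def driven_path_def using continuous_deriv_U by blast
qed

lemma X_measurable: "0 \<le> t \<Longrightarrow> X t \<in> borel_measurable M"
  using adapted_X unfolding adapted_def by (blast intro: measurable_F_M)

text \<open>If the left limit at s touches the boundary while the value has modulus 1 - g, the path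
  moves by more than 3 g / 4 between a grid time close to s and s. The drift explains at most g / 4,
  so the noise must oscillate. The choices are nested: p from the size g, then the duration k, the
  level n, and the mesh m.\<close>

lemma boundary_contact_in_hit_osc:
  assumes \<omega>: "\<omega> \<in> space M" "good \<omega>" and t: "0 \<le> t"
    and inside: "\<And>s. 0 \<le> s \<Longrightarrow> s \<le> t \<Longrightarrow> \<bar>X s \<omega>\<bar> < 1"
    and contact: "\<And>c. c < 1 \<Longrightarrow> \<exists>s\<in>{0..t}. c < \<bar>X s \<omega>\<bar>"
  obtains p :: nat where "\<And>k. p \<le> k \<Longrightarrow> \<exists>n\<^sub>0. \<forall>n\<ge>n\<^sub>0. \<exists>m\<^sub>0. \<forall>m\<ge>m\<^sub>0.
     \<omega> \<in> hit_osc X (2 ^ m) (t / 2 ^ m) (1 - 1 / real (Suc n)) (1 / real (Suc k)) (1 / real (Suc p))"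
proof -
  interpret driven_path "\<lambda>t. X t \<omega>" "\<lambda>t. \<epsilon> * L t \<omega>" "deriv U" x\<^sub>0
    using \<omega> by (simp add: good_def)
  have cadL: "cadlag (\<lambda>t. L t \<omega>)" using \<omega> by (simp add: good_def)
  obtain K where K: "0 \<le> K" "\<And>y. \<bar>y\<bar> \<le> 1 \<Longrightarrow> \<bar>deriv U y\<bar> \<le> K" using deriv_U_bound by blast
  obtain s where s: "0 < s" "s \<le> t" "\<And>c. c < 1 \<Longrightarrow> \<exists>u\<in>{0..<s}. c < \<bar>X u \<omega>\<bar>"
    "\<And>u. u < s \<Longrightarrow> \<exists>c<1. \<forall>r\<in>{0..u}. \<bar>X r \<omega>\<bar> \<le> c"
    using first_boundary_contact[OF cad inside contact] by blast
  define g where "g = 1 - \<bar>X s \<omega>\<bar>"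
  have g: "0 < g" using inside[of s] s by (simp add: g_def)
  \<comment> \<open>The first bound makes a noise movement of 1 / (p + 1) too small to explain the
    jump; the second does the same for the drift over every duration with k \<ge> p.\<close>
  have "eventually (\<lambda>p. 1 / real (Suc p) < min (g / (4 * \<epsilon>)) (g / (4 * (K + 1)))) sequentially"
    using g \<epsilon> K by (intro order_tendstoD(2)[OF LIMSEQ_Suc[OF lim_1_over_n]]) auto
  then obtain p where p: "1 / real (Suc p) < g / (4 * \<epsilon>)" "1 / real (Suc p) < g / (4 * (K + 1))"
    by (auto simp: eventually_sequentially)
  have "\<exists>n\<^sub>0. \<forall>n\<ge>n\<^sub>0. \<exists>m\<^sub>0. \<forall>m\<ge>m\<^sub>0.
     \<omega> \<in> hit_osc X (2 ^ m) (t / 2 ^ m) (1 - 1 / real (Suc n)) (1 / real (Suc k)) (1 / real (Suc p))"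
    if k: "p \<le> k" for k
  proof -
    define h where "h = 1 / real (Suc k)"
    have h: "0 < h" "K * h \<le> g / 4"
    proof -
      show "0 < h" by (simp add: h_def)
      have "h \<le> 1 / real (Suc p)" unfolding h_def using k by (intro divide_left_mono) auto
      then have "h \<le> g / (4 * (K + 1))" using p by linarith
      then have "(K + 1) * h \<le> (K + 1) * (g / (4 * (K + 1)))" using K by (intro mult_left_mono) auto
      also have "\<dots> = g / 4" using K by (simp add: field_simps)
      finally show "K * h \<le> g / 4" using \<open>0 < h\<close> by (simp add: distrib_right)
    qed
    \<comment> \<open>Up to s - h the path stays below a level c < 1. A first passage above a level
      larger than c therefore falls into the last stretch of length h before s.\<close>
    obtain c where c: "c < 1" "\<And>r. r \<in> {0..s - h} \<Longrightarrow> \<bar>X r \<omega>\<bar> \<le> c" using s(4)[of "s - h"] h by auto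
    have "eventually (\<lambda>n. 1 / real (Suc n) < min (1 - c) (g / 4)) sequentially"
      using g c by (intro order_tendstoD(2)[OF LIMSEQ_Suc[OF lim_1_over_n]]) auto
    then obtain n\<^sub>0 where n0: "\<And>n. n\<^sub>0 \<le> n \<Longrightarrow> 1 / real (Suc n) < min (1 - c) (g / 4)"
      unfolding eventually_sequentially by blast
    have "\<exists>m\<^sub>0. \<forall>m\<ge>m\<^sub>0. \<omega> \<in> hit_osc X (2 ^ m) (t / 2 ^ m) (1 - 1 / real (Suc n)) h (1 / real (Suc p))"
      if n: "n\<^sub>0 \<le> n" for n
    proof -
      define C where "C = 1 - 1 / real (Suc n)"
      have C: "C < 1" "c < C" "1 - g / 4 < C" using n0[OF n] by (auto simp: C_def)
      obtain u where u: "0 \<le> u" "u < s" "C < \<bar>X u \<omega>\<bar>" using s(3)[OF C(1)] by auto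
      have "0 < \<bar>X u \<omega>\<bar> - C" using u by simp
      then obtain r where r: "0 < r" "\<And>w. u \<le> w \<Longrightarrow> w < u + r \<Longrightarrow> \<bar>X w \<omega> - X u \<omega>\<bar> < \<bar>X u \<omega>\<bar> - C"
        using cadlag_right_near[OF cad u(1)] by metis
      define r' where "r' = min r (s - u)"
      have r': "0 < r'" "r' \<le> r" "u + r' \<le> s" using r u by (auto simp: r'_def)
      have "(\<lambda>m. t * (1 / 2) ^ m) \<longlonglongrightarrow> t * 0" by (intro tendsto_intros LIMSEQ_power_zero) auto
      then have "eventually (\<lambda>m. t * (1 / 2) ^ m < r') sequentially"
        using r' by (intro order_tendstoD(2)) auto
      then obtain m\<^sub>0 where m0: "\<And>m. m\<^sub>0 \<le> m \<Longrightarrow> t * (1 / 2) ^ m < r'"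
        unfolding eventually_sequentially by blast
      have "\<omega> \<in> hit_osc X (2 ^ m) (t / 2 ^ m) C h (1 / real (Suc p))" if m: "m\<^sub>0 \<le> m" for m
      proof -
        define \<tau> where "\<tau> = t / 2 ^ m"
        have t': "0 < t" using s by simp
        have "t * (1 / 2) ^ m = \<tau>" unfolding \<tau>_def by (simp add: power_divide)
        then have "\<tau> < r'" using m0[OF m] by simp
        moreover have "0 < \<tau>" "real (2 ^ m) * \<tau> = t" unfolding \<tau>_def using t' by simp_all
        ultimately have \<tau>: "0 < \<tau>" "\<tau> < r'" "real (2 ^ m) * \<tau> = t" by blast+
        define i where "i = nat \<lceil>u / \<tau>\<rceil>"
        have "0 \<le> u / \<tau>" using u \<tau> by simp
        then have i: "u / \<tau> \<le> real i" "real i < u / \<tau> + 1" unfolding i_def by linarith+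
        have "u \<le> real i * \<tau>" using i(1) \<tau> by (simp add: field_simps)
        moreover have "real i * \<tau> < u + r'"
        proof -
          have "real i * \<tau> < (u / \<tau> + 1) * \<tau>" using i(2) \<tau> by (intro mult_strict_right_mono) auto
          also have "\<dots> = u + \<tau>" using \<tau> by (simp add: distrib_right)
          finally show ?thesis using \<tau> by simp
        qed
        ultimately have i\<tau>: "u \<le> real i * \<tau>" "real i * \<tau> < u + r'" by auto
        have Xi: "C < \<bar>X (real i * \<tau>) \<omega>\<bar>"
        proof -
          have "\<bar>X (real i * \<tau>) \<omega> - X u \<omega>\<bar> < \<bar>X u \<omega>\<bar> - C" using i\<tau> r' by (intro r) auto
          then show ?thesis by linarith
        qed
        define j where "j = (LEAST j. C < \<bar>X (real j * \<tau>) \<omega>\<bar>)"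
        have j: "C < \<bar>X (real j * \<tau>) \<omega>\<bar>" "j \<le> i" "\<And>l. l < j \<Longrightarrow> \<bar>X (real l * \<tau>) \<omega>\<bar> \<le> C"
          unfolding j_def using Xi by (auto intro: LeastI Least_le simp: not_less dest: not_less_Least)
        have "real j * \<tau> \<le> real i * \<tau>" using j \<tau> by (intro mult_right_mono) auto
        then have "real j * \<tau> < s" using i\<tau> r' by linarith
        moreover have "0 \<le> real j * \<tau>" using \<tau>(1) by simp
        ultimately have js: "0 \<le> real j * \<tau>" "real j * \<tau> < s" by auto
        have jh: "s - h < real j * \<tau>"
        proof (rule ccontr)
          assume "\<not> s - h < real j * \<tau>"
          then have "\<bar>X (real j * \<tau>) \<omega>\<bar> \<le> c" using js by (intro c) auto
          then show False using j C by simp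
        qed
        have jm: "j \<le> 2 ^ m"
        proof -
          have "real j * \<tau> < real (2 ^ m) * \<tau>" unfolding \<tau>(3) using js s by linarith
          then have "real j < real (2 ^ m)" using \<tau>(1) by (rule mult_less_cancel_right_pos[THEN iffD1, rotated])
          then show ?thesis by (simp only: of_nat_less_iff less_imp_le)
        qed
        have "\<omega> \<in> osc (real j * \<tau>) h (1 / real (Suc p))"
        proof (rule ccontr)
          assume no_osc: "\<omega> \<notin> osc (real j * \<tau>) h (1 / real (Suc p))"
          have "\<bar>L s \<omega> - L (real j * \<tau>) \<omega>\<bar> \<le> 1 / real (Suc p)"
            by (rule osc_cadlag[OF cadL \<omega>(1) no_osc js(1)]) (use js jh h in linarith)+
          then have "\<epsilon> * \<bar>L s \<omega> - L (real j * \<tau>) \<omega>\<bar> \<le> \<epsilon> * (g / (4 * \<epsilon>))"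
            using p(1) \<epsilon> by (intro mult_left_mono) auto
          then have osc: "\<epsilon> * \<bar>L s \<omega> - L (real j * \<tau>) \<omega>\<bar> \<le> g / 4" using \<epsilon> by simp
          have "\<bar>(X s \<omega> - X (real j * \<tau>) \<omega>) - (\<epsilon> * L s \<omega> - \<epsilon> * L (real j * \<tau>) \<omega>)\<bar> \<le> K * (s - real j * \<tau>)"
          proof (rule path_increment_bound[OF _ _ _ K(2)])
            show "\<bar>X r \<omega>\<bar> \<le> 1" if "0 \<le> r" "r < s" for r using inside[of r] that s by simp
          qed (use js in auto)
          also have "\<dots> \<le> K * h" using jh K by (intro mult_left_mono) auto
          also have "\<dots> \<le> g / 4" by (rule h)
          finally have "\<bar>X s \<omega> - X (real j * \<tau>) \<omega>\<bar> \<le> g / 4 + \<bar>\<epsilon> * (L s \<omega> - L (real j * \<tau>) \<omega>)\<bar>"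
            unfolding right_diff_distrib by linarith
          also have "\<bar>\<epsilon> * (L s \<omega> - L (real j * \<tau>) \<omega>)\<bar> = \<epsilon> * \<bar>L s \<omega> - L (real j * \<tau>) \<omega>\<bar>"
            using \<epsilon> by (simp add: abs_mult)
          finally have "\<bar>X s \<omega> - X (real j * \<tau>) \<omega>\<bar> \<le> g / 2" using osc by linarith
          moreover have "\<bar>X s \<omega>\<bar> = 1 - g" by (simp add: g_def)
          ultimately show False using j(1) C g by linarith
        qed
        moreover have "j \<in> {..2 ^ m}" using jm by simp
        ultimately show ?thesis
          unfolding hit_osc_def \<tau>_def [symmetric]
          by (intro UN_I[of j] IntI CollectI conjI allI impI \<omega>(1) j(1) j(3))
      qed
      then show ?thesis unfolding C_def by blast
    qed
    then show ?thesis unfolding h_def by blast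
  qed
  then show ?thesis by (rule that)
qed

text \<open>Quasi-left-continuity: almost surely the path does not jump away from the boundary at the
  moment its left limit reaches it.\<close>

lemma no_boundary_contact:
  assumes t: "0 \<le> t"
  obtains N where "N \<in> null_sets M"
    "\<And>\<omega>. \<omega> \<in> space M \<Longrightarrow> good \<omega> \<Longrightarrow> \<omega> \<notin> N \<Longrightarrow> (\<And>s. 0 \<le> s \<Longrightarrow> s \<le> t \<Longrightarrow> \<bar>X s \<omega>\<bar> < 1) \<Longrightarrow>
       \<exists>c<1. \<forall>s\<in>{0..t}. \<bar>X s \<omega>\<bar> \<le> c"
proof -
  define E where "E n m k p = hit_osc X (2 ^ m) (t / 2 ^ m) (1 - 1 / real (Suc n)) (1 / real (Suc k)) (1 / real (Suc p))"
    for n m k p :: nat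
  have \<tau>: "0 \<le> t / 2 ^ m" for m :: nat using t by simp
  have E: "E n m k p \<in> sets M" "prob (E n m k p) \<le> prob (osc 0 (1 / real (Suc k)) (1 / real (Suc p)))" for n m k p
    unfolding E_def by (rule hit_osc[OF adapted_X \<tau>]; simp)+
  \<comment> \<open>Each "for all sufficiently large" in the description of a contact becomes the
    limit inferior of a sequence of events, which preserves a common bound on the
    probabilities.\<close>
  define E1 where "E1 n k p = (\<Union>m\<^sub>0. \<Inter>m\<in>{m\<^sub>0..}. E n m k p)" for n k p
  have liminf_sets: "(\<Union>n\<^sub>0. \<Inter>n\<in>{n\<^sub>0..}. B n) \<in> sets M" if "\<And>n. B n \<in> sets M" for B :: "nat \<Rightarrow> 'a set"
    using that by (intro sets.countable_UN sets.countable_INT' image_subsetI) auto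
  have E1: "E1 n k p \<in> sets M" "prob (E1 n k p) \<le> prob (osc 0 (1 / real (Suc k)) (1 / real (Suc p)))" for n k p
    unfolding E1_def by (rule liminf_sets E prob_liminf_le)+
  define E2 where "E2 k p = (\<Union>n\<^sub>0. \<Inter>n\<in>{n\<^sub>0..}. E1 n k p)" for k p
  have E2: "E2 k p \<in> sets M" "prob (E2 k p) \<le> prob (osc 0 (1 / real (Suc k)) (1 / real (Suc p)))" for k p
    unfolding E2_def by (rule liminf_sets E1 prob_liminf_le)+
  define E3 where "E3 p = (\<Inter>k\<in>{p..}. E2 k p)" for p
  have E3: "E3 p \<in> null_sets M" for p
  proof -
    have m: "E3 p \<in> sets M" unfolding E3_def using E2 by (intro sets.countable_INT' image_subsetI) auto
    \<comment> \<open>This event lies in \<open>E2 k p\<close> for every k \<ge> p, so its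
      probability is bounded by that of a fixed oscillation over arbitrarily short times.\<close>
    have "prob (E3 p) \<le> 0"
    proof (rule LIMSEQ_le_const)
      show "(\<lambda>k. prob (osc 0 (1 / real (Suc k)) (1 / real (Suc p)))) \<longlonglongrightarrow> 0" by (rule osc_vanishes) simp
      have "prob (E3 p) \<le> prob (osc 0 (1 / real (Suc k)) (1 / real (Suc p)))" if "p \<le> k" for k
      proof -
        have "prob (E3 p) \<le> prob (E2 k p)" using that E2 by (intro finite_measure_mono) (auto simp: E3_def)
        also have "\<dots> \<le> prob (osc 0 (1 / real (Suc k)) (1 / real (Suc p)))" by (rule E2)
        finally show ?thesis .
      qed
      then show "\<exists>N. \<forall>k\<ge>N. prob (E3 p) \<le> prob (osc 0 (1 / real (Suc k)) (1 / real (Suc p)))" by blast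
    qed
    then have "prob (E3 p) = 0" by (intro antisym measure_nonneg)
    then show ?thesis using m by (simp add: null_sets_def emeasure_eq_measure)
  qed
  show ?thesis
  proof (rule that[of "\<Union>p. E3 p"])
    show "(\<Union>p. E3 p) \<in> null_sets M" using E3 by (intro null_sets_UN)
    fix \<omega> assume \<omega>: "\<omega> \<in> space M" "good \<omega>" "\<omega> \<notin> (\<Union>p. E3 p)"
      and inside: "\<And>s. 0 \<le> s \<Longrightarrow> s \<le> t \<Longrightarrow> \<bar>X s \<omega>\<bar> < 1"
    show "\<exists>c<1. \<forall>s\<in>{0..t}. \<bar>X s \<omega>\<bar> \<le> c"
    proof (rule ccontr)
      assume "\<not> (\<exists>c<1. \<forall>s\<in>{0..t}. \<bar>X s \<omega>\<bar> \<le> c)"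
      then have contact: "\<And>c. c < 1 \<Longrightarrow> \<exists>s\<in>{0..t}. c < \<bar>X s \<omega>\<bar>" by (meson not_less)
      show False
      proof (rule boundary_contact_in_hit_osc[OF \<omega>(1,2) t inside contact])
        fix p assume p: "\<And>k. p \<le> k \<Longrightarrow> \<exists>n\<^sub>0. \<forall>n\<ge>n\<^sub>0. \<exists>m\<^sub>0. \<forall>m\<ge>m\<^sub>0.
          \<omega> \<in> hit_osc X (2 ^ m) (t / 2 ^ m) (1 - 1 / real (Suc n)) (1 / real (Suc k)) (1 / real (Suc p))"
        have "\<omega> \<in> E2 k p" if k: "p \<le> k" for k
        proof -
          obtain n\<^sub>0 where n0: "\<forall>n\<ge>n\<^sub>0. \<exists>m\<^sub>0. \<forall>m\<ge>m\<^sub>0. \<omega> \<in> E n m k p"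
            using p[OF k] unfolding E_def by (elim exE)
          have "\<omega> \<in> E1 n k p" if n: "n\<^sub>0 \<le> n" for n
          proof -
            obtain m\<^sub>0 where "\<forall>m\<ge>m\<^sub>0. \<omega> \<in> E n m k p" using n0[rule_format, OF n] by (elim exE)
            then show ?thesis unfolding E1_def by (intro UN_I[of m\<^sub>0] INT_I) simp_all
          qed
          then show ?thesis unfolding E2_def by (intro UN_I[of n\<^sub>0] INT_I) simp_all
        qed
        then have "\<omega> \<in> E3 p" unfolding E3_def by (intro INT_I) simp
        then show False using \<omega>(3) by (simp add: UN_iff)
      qed
    qed
  qed
qed

text \<open>Grid values strictly below 1 would not survive a limit, whereas a margin 1 / (n + 1)
  does. Off a null set survival provides such a margin, and completeness of the measure removes the
  null set.\<close>

lemma survival_set_measurable: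
  assumes t: "0 \<le> t"
  shows "{\<omega> \<in> space M. ennreal t < exit_time X \<omega>} \<in> sets M"
proof -
  obtain N where N: "N \<in> null_sets M"
    "\<And>\<omega>. \<omega> \<in> space M \<Longrightarrow> good \<omega> \<Longrightarrow> \<omega> \<notin> N \<Longrightarrow> (\<And>s. 0 \<le> s \<Longrightarrow> s \<le> t \<Longrightarrow> \<bar>X s \<omega>\<bar> < 1) \<Longrightarrow>
       \<exists>c<1. \<forall>s\<in>{0..t}. \<bar>X s \<omega>\<bar> \<le> c"
    using no_boundary_contact[OF t] by blast
  define G where "G = (\<Union>n. \<Inter>m. \<Inter>j\<in>{..2 ^ m}. {\<omega> \<in> space M. \<bar>X (real j * (t / 2 ^ m)) \<omega>\<bar> \<le> 1 - 1 / real (Suc n)})"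
  have G: "G \<in> sets M"
    unfolding G_def
  proof (intro sets.countable_UN sets.countable_INT' image_subsetI)
    fix n m j :: nat
    have [measurable]: "X (real j * (t / 2 ^ m)) \<in> borel_measurable M" using t by (intro X_measurable) auto
    show "{\<omega> \<in> space M. \<bar>X (real j * (t / 2 ^ m)) \<omega>\<bar> \<le> 1 - 1 / real (Suc n)} \<in> sets M" by measurable
  qed auto
  interpret C: complete_measure M by (rule complete)
  have "AE \<omega> in M. \<omega> \<notin> N" using N(1) by (rule AE_not_in)
  with AE_good AE_space have "AE \<omega> in M. \<omega> \<in> G \<longleftrightarrow> \<omega> \<in> {\<omega> \<in> space M. ennreal t < exit_time X \<omega>}"
  proof eventually_elim
    case (elim \<omega>)
    then have cad: "cadlag (\<lambda>t. X t \<omega>)" by (simp add: good_def driven_path_def)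
    have "\<omega> \<in> G \<longleftrightarrow> (\<forall>s\<in>{0..t}. \<bar>X s \<omega>\<bar> < 1)"
    proof
      assume "\<omega> \<in> G"
      then obtain n where n: "\<And>m j. j \<le> 2 ^ m \<Longrightarrow> \<bar>X (real j * (t / 2 ^ m)) \<omega>\<bar> \<le> 1 - 1 / real (Suc n)"
        unfolding G_def by blast
      show "\<forall>s\<in>{0..t}. \<bar>X s \<omega>\<bar> < 1"
      proof
        fix s assume s: "s \<in> {0..t}"
        show "\<bar>X s \<omega>\<bar> < 1"
        proof (cases "t = 0")
          case True
          then have "\<bar>X s \<omega>\<bar> \<le> 1 - 1 / real (Suc n)" using n[of 0 0] s by simp
          also have "\<dots> < 1" by simp
          finally show ?thesis .
        next
          case False
          then have "0 < t" using t by simp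
          then obtain k where k: "\<And>m. k m \<le> 2 ^ m" "(\<lambda>m. X (0 + real (k m) * (t / 2 ^ m)) \<omega>) \<longlonglongrightarrow> X s \<omega>"
            using osc_grid_approx[OF cad order_refl, of t s] s by auto
          have "\<bar>X s \<omega>\<bar> \<le> 1 - 1 / real (Suc n)"
            by (rule LIMSEQ_le_const2[OF tendsto_rabs[OF k(2)]]) (use n k(1) in auto)
          also have "\<dots> < 1" by simp
          finally show ?thesis .
        qed
      qed
    next
      assume inside: "\<forall>s\<in>{0..t}. \<bar>X s \<omega>\<bar> < 1"
      have "good \<omega>" "\<omega> \<in> space M" "\<omega> \<notin> N" using elim by blast+
      then have "\<exists>c<1. \<forall>s\<in>{0..t}. \<bar>X s \<omega>\<bar> \<le> c" by (intro N(2)) (use inside in auto)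
      then obtain c where c: "c < 1" "\<forall>s\<in>{0..t}. \<bar>X s \<omega>\<bar> \<le> c" by blast
      have "eventually (\<lambda>n. 1 / real (Suc n) < 1 - c) sequentially"
        using c by (intro order_tendstoD(2)[OF LIMSEQ_Suc[OF lim_1_over_n]]) auto
      then obtain n where n: "1 / real (Suc n) < 1 - c" using eventually_happens'[OF sequentially_bot] by blast
      have "\<bar>X (real j * (t / 2 ^ m)) \<omega>\<bar> \<le> 1 - 1 / real (Suc n)" if "j \<le> 2 ^ m" for j m
      proof -
        have "real j \<le> 2 ^ m" using that by (metis of_nat_le_iff of_nat_numeral of_nat_power)
        then have "real j * (t / 2 ^ m) \<le> 2 ^ m * (t / 2 ^ m)" using t by (intro mult_right_mono) auto
        then have "real j * (t / 2 ^ m) \<in> {0..t}" using t by simp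
        then have "\<bar>X (real j * (t / 2 ^ m)) \<omega>\<bar> \<le> c" by (rule bspec[OF c(2)])
        then show ?thesis using n by linarith
      qed
      then show "\<omega> \<in> G"
        unfolding G_def using \<open>\<omega> \<in> space M\<close> by (intro UN_I[of n] INT_I CollectI conjI) simp_all
    qed
    then show ?case using exit_time_gt_iff[of X \<omega>, OF cad t] elim(1) elim(2) by simp
  qed
  then show ?thesis by (rule C.in_sets_AE[OF _ G]) auto
qed

end

section \<open>Survival probabilities\<close>

context levy_sde
begin

text \<open>The direction of the required push in a window is decided by the sign of the position at
  its start, which is known before the independent increment. A push of (1 + K T) / \<epsilon> beats
  the drift and carries the path across the boundary from the origin or from further out.\<close>

lemma survival_upper:
  assumes T: "0 < T" and K: "0 \<le> K" "\<And>y. \<bar>y\<bar> \<le> 1 \<Longrightarrow> \<bar>deriv U y\<bar> \<le> K"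
    and p: "p \<le> measure (law T) {(1 + K * T) / \<epsilon>..}" "p \<le> measure (law T) {.. - ((1 + K * T) / \<epsilon>)}"
    and p1: "p \<le> 1"
  shows "prob {\<omega> \<in> space M. ennreal (real n * T) < exit_time X \<omega>} \<le> (1 - p) ^ n"
proof -
  define c where "c = (1 + K * T) / \<epsilon>"
  have nn: "0 \<le> real j * T" for j using T by simp
  define up where "up j = {\<omega> \<in> space M. L (real j * T + T) \<omega> - L (real j * T) \<omega> \<in> {c..}}" for j
  define dn where "dn j = {\<omega> \<in> space M. L (real j * T + T) \<omega> - L (real j * T) \<omega> \<in> {..- c}}" for j
  define pos where "pos j = {\<omega> \<in> space M. 0 \<le> X (real j * T) \<omega>}" for j
  define H where "H j = (pos j \<inter> up j) \<union> ((space M - pos j) \<inter> dn j)" for j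
  define S where "S n = space M - (\<Union>j<n. H j)" for n
  have LF: "L s \<in> borel_measurable (F t)" if "0 \<le> s" "s \<le> t" for s t using that by (rule L_measurable_F)
  have pos: "pos j \<in> sets (F (real j * T))" for j
  proof -
    have [measurable]: "X (real j * T) \<in> borel_measurable (F (real j * T))"
      using adapted_X nn unfolding adapted_def by blast
    have "{\<omega> \<in> space (F (real j * T)). 0 \<le> X (real j * T) \<omega>} \<in> sets (F (real j * T))" by measurable
    then show ?thesis by (simp only: pos_def space_F[OF nn])
  qed
  have step: "real (Suc j) * T = real j * T + T" for j by (simp add: distrib_right)
  have incr: "{\<omega> \<in> space M. L (real j * T + T) \<omega> - L (real j * T) \<omega> \<in> B} \<in> sets (F (real (Suc j) * T))"
    if "B \<in> sets borel" for j B
  proof -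
    have [measurable]: "L (real j * T + T) \<in> borel_measurable (F (real (Suc j) * T))"
      "L (real j * T) \<in> borel_measurable (F (real (Suc j) * T))"
      unfolding step using nn[of j] T by (auto intro!: LF)
    have "{\<omega> \<in> space (F (real (Suc j) * T)). L (real j * T + T) \<omega> - L (real j * T) \<omega> \<in> B} \<in> sets (F (real (Suc j) * T))"
      using that by measurable
    then show ?thesis by (simp only: space_F[OF nn])
  qed
  have mono: "real i * T \<le> real j * T" if "i \<le> j" for i j using that T by (intro mult_right_mono) auto
  have spF: "space M \<in> sets (F (real j * T))" for j
    using sets.top[of "F (real j * T)"] by (simp only: space_F[OF nn])
  have H: "H j \<in> sets (F (real (Suc j) * T))" for j
    unfolding H_def up_def dn_def
    by (intro sets.Un sets.Int sets.Diff incr spF sets_F_lift[OF nn mono pos]) auto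
  have S: "S n \<in> sets (F (real n * T))" for n
    unfolding S_def
    by (intro sets.Diff spF sets.finite_UN sets_F_lift[OF nn mono H]) auto
  have SM: "S n \<in> sets M" for n by (rule sets_F_M[OF nn S])
  have HM: "H j \<in> sets M" for j by (rule sets_F_M[OF nn H])
  have compl: "prob (G - A) = prob G * (1 - q)" if "prob (G \<inter> A) = prob G * q" "G \<in> sets M" "A \<in> sets M" for G A q
  proof -
    have "prob (G - A) = prob G - prob (G \<inter> A)" using that by (intro finite_measure_Diff')
    then show ?thesis using that by (simp add: algebra_simps)
  qed
  have bound: "prob (S n) \<le> (1 - p) ^ n"
  proof (induction n)
    case (Suc n)
    have posM: "pos n \<in> sets M" by (rule sets_F_M[OF nn pos])
    have upM: "up n \<in> sets M" "dn n \<in> sets M"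
      unfolding up_def dn_def by (rule sets_F_M[OF nn incr]; simp)+
    have "S (Suc n) = ((S n \<inter> pos n) - up n) \<union> ((S n \<inter> (space M - pos n)) - dn n)"
      unfolding S_def H_def lessThan_Suc UN_insert by blast
    also have "prob \<dots> = prob ((S n \<inter> pos n) - up n) + prob ((S n \<inter> (space M - pos n)) - dn n)"
      using SM posM upM by (intro finite_measure_Union) auto
    also have "prob ((S n \<inter> pos n) - up n) = prob (S n \<inter> pos n) * (1 - measure (law T) {c..})"
    proof (rule compl)
      show "prob (S n \<inter> pos n \<inter> up n) = prob (S n \<inter> pos n) * measure (law T) {c..}"
        unfolding up_def using T by (intro increment_indep nn sets.Int S pos) auto
    qed (use SM posM upM in auto)
    also have "prob ((S n \<inter> (space M - pos n)) - dn n) = prob (S n \<inter> (space M - pos n)) * (1 - measure (law T) {..- c})"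
    proof (rule compl)
      show "prob (S n \<inter> (space M - pos n) \<inter> dn n) = prob (S n \<inter> (space M - pos n)) * measure (law T) {..- c}"
        unfolding dn_def using T by (intro increment_indep nn sets.Int sets.Diff spF S pos) auto
    qed (use SM posM upM in auto)
    finally have "prob (S (Suc n)) = prob (S n \<inter> pos n) * (1 - measure (law T) {c..})
        + prob (S n \<inter> (space M - pos n)) * (1 - measure (law T) {..- c})" .
    also have "\<dots> \<le> prob (S n \<inter> pos n) * (1 - p) + prob (S n \<inter> (space M - pos n)) * (1 - p)"
      using p by (intro add_mono mult_left_mono) (auto simp: c_def)
    also have "\<dots> = (prob (S n \<inter> pos n) + prob (S n \<inter> (space M - pos n))) * (1 - p)" by (simp add: distrib_right)
    also have "prob (S n \<inter> pos n) + prob (S n \<inter> (space M - pos n)) = prob ((S n \<inter> pos n) \<union> (S n \<inter> (space M - pos n)))"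
      using SM posM by (intro finite_measure_Union [symmetric]) auto
    also have "(S n \<inter> pos n) \<union> (S n \<inter> (space M - pos n)) = S n"
      unfolding S_def by blast
    also have "prob (S n) * (1 - p) \<le> (1 - p) ^ n * (1 - p)" using Suc p1 by (intro mult_right_mono) auto
    finally show ?case by (simp add: mult.commute)
  qed (simp add: S_def)
  have "prob {\<omega> \<in> space M. ennreal (real n * T) < exit_time X \<omega>} \<le> prob (S n)"
  proof (rule finite_measure_mono_AE[OF _ SM])
    show "AE \<omega> in M. \<omega> \<in> {\<omega> \<in> space M. ennreal (real n * T) < exit_time X \<omega>} \<longrightarrow> \<omega> \<in> S n"
      using AE_good
    proof eventually_elim
      case (elim \<omega>)
      interpret driven_path "\<lambda>t. X t \<omega>" "\<lambda>t. \<epsilon> * L t \<omega>" "deriv U" x\<^sub>0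
        using elim by (simp add: good_def)
      show ?case
      proof
        assume "\<omega> \<in> {\<omega> \<in> space M. ennreal (real n * T) < exit_time X \<omega>}"
        then have \<omega>: "\<omega> \<in> space M" and inside: "\<And>s. 0 \<le> s \<Longrightarrow> s \<le> real n * T \<Longrightarrow> \<bar>X s \<omega>\<bar> < 1"
          using exit_time_gt_iff[of X \<omega>, OF cad nn] by auto
        have "\<omega> \<notin> H j" if "j < n" for j
        proof
          assume H: "\<omega> \<in> H j"
          have jn: "real j * T + T \<le> real n * T" using mono[of "Suc j" n] that unfolding step by simp
          have "\<bar>(X (real j * T + T) \<omega> - X (real j * T) \<omega>) - (\<epsilon> * L (real j * T + T) \<omega> - \<epsilon> * L (real j * T) \<omega>)\<bar>
              \<le> K * (real j * T + T - real j * T)"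
          proof (rule path_increment_bound[OF nn _ _ K(2)])
            show "\<bar>X r \<omega>\<bar> \<le> 1" if "0 \<le> r" "r < real j * T + T" for r using inside[of r] that jn by simp
          qed (use T in auto)
          then have inc: "\<bar>(X (real j * T + T) \<omega> - X (real j * T) \<omega>) - \<epsilon> * (L (real j * T + T) \<omega> - L (real j * T) \<omega>)\<bar> \<le> K * T"
            by (simp add: right_diff_distrib)
          have Xn: "\<bar>X (real j * T + T) \<omega>\<bar> < 1" using nn[of j] T jn by (intro inside) auto
          from H consider "0 \<le> X (real j * T) \<omega>" "c \<le> L (real j * T + T) \<omega> - L (real j * T) \<omega>"
            | "X (real j * T) \<omega> < 0" "L (real j * T + T) \<omega> - L (real j * T) \<omega> \<le> - c"
            by (auto simp: H_def pos_def up_def dn_def)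
          then show False
          proof cases
            case 1
            then have "\<epsilon> * c \<le> \<epsilon> * (L (real j * T + T) \<omega> - L (real j * T) \<omega>)"
              using \<epsilon> by (intro mult_left_mono) auto
            then have "1 + K * T \<le> \<epsilon> * (L (real j * T + T) \<omega> - L (real j * T) \<omega>)"
              using \<epsilon> by (simp add: c_def)
            then show False using inc Xn 1(1) unfolding abs_le_iff abs_less_iff by linarith
          next
            case 2
            then have "\<epsilon> * (L (real j * T + T) \<omega> - L (real j * T) \<omega>) \<le> \<epsilon> * - c"
              using \<epsilon> by (intro mult_left_mono) auto
            then have "\<epsilon> * (L (real j * T + T) \<omega> - L (real j * T) \<omega>) \<le> - (1 + K * T)"
              using \<epsilon> by (simp add: c_def)
            then show False using inc Xn 2(1) unfolding abs_le_iff abs_less_iff by linarith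
          qed
        qed
        then show "\<omega> \<in> S n" using \<omega> by (auto simp: S_def)
      qed
    qed
  qed
  then show ?thesis using bound by simp
qed

end

text \<open>The recursion satisfied by the survival probabilities of a one-dependent sequence of
  bad events, each of probability at most \<open>q\<close>.\<close>

lemma one_dependent_recursion:
  fixes a :: "nat \<Rightarrow> real"
  assumes q: "0 \<le> q" "q \<le> 1 / 4" and a0: "1 / 2 \<le> a 0" and a1: "a 0 - q \<le> a 1"
    and rec: "\<And>n. a (Suc n) - q * a n \<le> a (Suc (Suc n))"
  shows "(1 - 2 * q) ^ n * (a 0 - q) \<le> a (Suc n)"
proof -
  \<comment> \<open>The terms at most halve, so \<open>q * a n\<close> is at most twice
    \<open>q * a (Suc n)\<close>; this is the origin of the ratio 1 - 2 q.\<close>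
  have main: "a n / 2 \<le> a (Suc n) \<and> 0 \<le> a n" for n
  proof (induction n)
    case 0
    then show ?case using assms by simp
  next
    case (Suc n)
    have "q * a n \<le> q * (2 * a (Suc n))" using Suc q by (intro mult_left_mono) auto
    moreover have "q * (2 * a (Suc n)) \<le> 1 / 4 * (2 * a (Suc n))"
      using Suc q by (intro mult_right_mono) auto
    ultimately show ?case using rec[of n] Suc by linarith
  qed
  show ?thesis
  proof (induction n)
    case 0
    then show ?case using a1 by simp
  next
    case (Suc n)
    have "(1 - 2 * q) ^ Suc n * (a 0 - q) = (1 - 2 * q) * ((1 - 2 * q) ^ n * (a 0 - q))" by simp
    also have "\<dots> \<le> (1 - 2 * q) * a (Suc n)" using Suc q by (intro mult_left_mono) auto
    also have "\<dots> = a (Suc n) - q * (2 * a (Suc n))" by (simp add: algebra_simps)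
    also have "\<dots> \<le> a (Suc n) - q * a n"
      using main[of n] q by (intro diff_left_mono mult_left_mono) auto
    also have "\<dots> \<le> a (Suc (Suc n))" by (rule rec)
    finally show ?case .
  qed
qed

context levy_sde
begin

text \<open>Outside the bad events the noise satisfies the window hypotheses of the crossing
  estimate, and outside D it satisfies the initial one. The good event \<open>G n\<close> is known
  at time (n + 1) T, exactly when the window of \<open>bad (Suc n)\<close> begins.\<close>

lemma survival_lower:
  assumes \<eta>: "0 < \<eta>" "\<eta> < \<delta> / 2" "\<delta> \<le> 1" and m: "0 < m" "1 \<le> m * T" and T: "0 < T"
    and drift: "\<And>y. \<bar>y\<bar> \<in> {\<eta>..1 - \<eta>} \<Longrightarrow> m \<le> sgn y * deriv U y"
    and start: "\<bar>x\<^sub>0\<bar> \<le> 1 - \<delta>"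
    and q: "prob (osc 0 (2 * T) ((1 - 3 * \<eta>) / \<epsilon>)) \<le> q" "q \<le> 1 / 4"
    and p0: "prob (osc 0 T (\<delta> / 2 / \<epsilon>)) \<le> p\<^sub>0" "p\<^sub>0 \<le> 1 / 2"
    and t: "0 \<le> t"
  shows "(1 - 2 * q) ^ nat \<lfloor>t / T\<rfloor> * (1 - p\<^sub>0 - q) \<le> prob {\<omega> \<in> space M. ennreal t < exit_time X \<omega>}"
proof -
  obtain K where K: "0 \<le> K" "\<And>y. \<bar>y\<bar> \<le> 1 \<Longrightarrow> \<bar>deriv U y\<bar> \<le> K" using deriv_U_bound by blast
  have q0: "0 \<le> q" using q(1) measure_nonneg[of M "osc 0 (2 * T) ((1 - 3 * \<eta>) / \<epsilon>)"] by linarith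
  have nn: "0 \<le> real k * T" for k using T by simp
  \<comment> \<open>Windows of length 2 T start every T, so each interval of length at most T is
    contained in one of them.\<close>
  define bad where "bad k = osc (real k * T) (2 * T) ((1 - 3 * \<eta>) / \<epsilon>)" for k
  define D where "D = osc 0 T (\<delta> / 2 / \<epsilon>)"
  define G where "G n = (space M - D) - (\<Union>k<n. bad k)" for n
  have mono: "real i * T \<le> real j * T" if "i \<le> j" for i j using that T by (intro mult_right_mono) auto
  have spF: "space M \<in> sets (F (real j * T))" for j
    using sets.top[of "F (real j * T)"] by (simp only: space_F[OF nn])
  have bad: "bad k \<in> sets (F (real j * T))" if "Suc (Suc k) \<le> j" for k j
    unfolding bad_def
  proof (rule osc_sets_F)
    show "real k * T + 2 * T \<le> real j * T" using mono[OF that] by (simp add: distrib_right)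
  qed (use nn T in auto)
  have badM: "bad k \<in> sets M" for k by (rule sets_F_M[OF nn bad[OF order_refl]])
  have bad_prob: "prob (bad k) \<le> q" for k
    unfolding bad_def using q(1) osc_prob[OF nn, of "2 * T"] T by simp
  have D: "D \<in> sets (F (real j * T))" if "1 \<le> j" for j
    unfolding D_def by (rule osc_sets_F) (use mono[OF that] T in auto)
  have DM: "D \<in> sets M" by (rule sets_F_M[OF nn D[OF order_refl]])
  have GF: "G n \<in> sets (F (real (Suc n) * T))" for n
    unfolding G_def by (intro sets.Diff sets.finite_UN spF D bad) auto
  have GM: "G n \<in> sets M" for n by (rule sets_F_M[OF nn GF])
  have G_Suc: "G (Suc n) = G n - bad n" for n unfolding G_def lessThan_Suc by blast
  have G_dec: "G (Suc n) \<subseteq> G n" for n unfolding G_Suc by blast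
  have diff: "prob (G (Suc n)) = prob (G n) - prob (G n \<inter> bad n)" for n
    unfolding G_Suc using GM badM by (rule finite_measure_Diff')
  have a0: "1 - p\<^sub>0 \<le> prob (G 0)"
    using p0(1) prob_compl[OF DM] by (simp add: G_def D_def)
  have "(1 - 2 * q) ^ n * (prob (G 0) - q) \<le> prob (G (Suc n))" for n
  proof (rule one_dependent_recursion[OF q0 q(2)])
    show "1 / 2 \<le> prob (G 0)" using a0 p0 by simp
    have "prob (G 0 \<inter> bad 0) \<le> prob (bad 0)" using badM by (intro finite_measure_mono) auto
    then show "prob (G 0) - q \<le> prob (G 1)" using diff[of 0] bad_prob[of 0] by simp
    fix n
    \<comment> \<open>Forgetting \<open>bad n\<close>, whose window overlaps that of
      \<open>bad (Suc n)\<close>, restores independence.\<close>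
    have "prob (G (Suc n) \<inter> bad (Suc n)) \<le> prob (G n \<inter> bad (Suc n))"
      using G_dec[of n] GM badM by (intro finite_measure_mono) auto
    also have "\<dots> = prob (G n) * prob (osc 0 (2 * T) ((1 - 3 * \<eta>) / \<epsilon>))"
      unfolding bad_def using T by (intro osc_indep nn GF) auto
    also have "\<dots> \<le> prob (G n) * q" using q(1) by (intro mult_left_mono) auto
    finally show "prob (G (Suc n)) - q * prob (G n) \<le> prob (G (Suc (Suc n)))"
      using diff[of "Suc n"] by (simp add: mult.commute)
  qed
  note this[of "nat \<lfloor>t / T\<rfloor>"]
  moreover have "(1 - 2 * q) ^ nat \<lfloor>t / T\<rfloor> * (1 - p\<^sub>0 - q) \<le> (1 - 2 * q) ^ nat \<lfloor>t / T\<rfloor> * (prob (G 0) - q)"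
    using a0 q by (intro mult_left_mono) auto
  moreover have "prob (G (Suc (nat \<lfloor>t / T\<rfloor>))) \<le> prob {\<omega> \<in> space M. ennreal t < exit_time X \<omega>}"
  proof (rule finite_measure_mono_AE[OF _ survival_set_measurable[OF t]])
    show "AE \<omega> in M. \<omega> \<in> G (Suc (nat \<lfloor>t / T\<rfloor>)) \<longrightarrow> \<omega> \<in> {\<omega> \<in> space M. ennreal t < exit_time X \<omega>}"
      using AE_good
    proof eventually_elim
      case (elim \<omega>)
      interpret driven_path "\<lambda>t. X t \<omega>" "\<lambda>t. \<epsilon> * L t \<omega>" "deriv U" x\<^sub>0
        using elim by (simp add: good_def)
      have cadL: "cadlag (\<lambda>t. L t \<omega>)" and L0: "\<epsilon> * L 0 \<omega> = 0" using elim by (auto simp: good_def)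
      show ?case
      proof
        assume \<omega>: "\<omega> \<in> G (Suc (nat \<lfloor>t / T\<rfloor>))"
        then have sp: "\<omega> \<in> space M" and nD: "\<omega> \<notin> D" and nb: "\<And>k. k \<le> nat \<lfloor>t / T\<rfloor> \<Longrightarrow> \<omega> \<notin> bad k"
          by (auto simp: G_def)
        have scale: "\<bar>\<epsilon> * L v \<omega> - \<epsilon> * L u \<omega>\<bar> \<le> c" if "\<bar>L v \<omega> - L u \<omega>\<bar> \<le> c / \<epsilon>" for u v c
        proof -
          have "\<epsilon> * \<bar>L v \<omega> - L u \<omega>\<bar> \<le> \<epsilon> * (c / \<epsilon>)" using that \<epsilon> by (intro mult_left_mono) auto
          then show ?thesis using \<epsilon> by (simp add: abs_mult flip: right_diff_distrib)
        qed
        have window: "\<bar>\<epsilon> * L v \<omega> - \<epsilon> * L u \<omega>\<bar> \<le> 1 - 3 * \<eta>" if uv: "0 \<le> u" "u \<le> v" "v \<le> t" "v - u \<le> T" for u v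
        proof -
          define k where "k = nat \<lfloor>u / T\<rfloor>"
          have "0 \<le> u / T" using uv T by simp
          then have k: "real k \<le> u / T" "u / T \<le> real k + 1" unfolding k_def by linarith+
          have "u / T \<le> t / T" using uv T by (intro divide_right_mono) auto
          then have "k \<le> nat \<lfloor>t / T\<rfloor>" unfolding k_def by (intro nat_mono floor_mono)
          then have "\<omega> \<notin> osc (real k * T) (2 * T) ((1 - 3 * \<eta>) / \<epsilon>)" using nb unfolding bad_def by blast
          moreover have "real k * T \<le> u" using k(1) T by (simp add: field_simps)
          moreover have "u \<le> real k * T + T" using k(2) T by (simp add: field_simps)
          ultimately have "\<bar>L v \<omega> - L u \<omega>\<bar> \<le> (1 - 3 * \<eta>) / \<epsilon>"
            using uv T by (intro osc_cadlag[OF cadL sp, where s = "real k * T" and H = "2 * T"]) auto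
          then show ?thesis by (rule scale)
        qed
        have initial: "\<bar>\<epsilon> * L v \<omega> - \<epsilon> * L 0 \<omega>\<bar> \<le> \<delta> / 2" if "0 \<le> v" "v \<le> t" "v \<le> T" for v
        proof (rule scale)
          show "\<bar>L v \<omega> - L 0 \<omega>\<bar> \<le> \<delta> / 2 / \<epsilon>"
            using nD that T unfolding D_def
            by (intro osc_cadlag[OF cadL sp, where s = 0 and H = T]) auto
        qed
        have "\<bar>X s \<omega>\<bar> < 1 - \<eta>" if "0 \<le> s" "s \<le> t" for s
          by (rule no_exit[OF \<eta> m drift K start L0 window initial that]) auto
        then have "\<forall>s\<in>{0..t}. \<bar>X s \<omega>\<bar> < 1" using \<eta> by fastforce
        then show "\<omega> \<in> {\<omega> \<in> space M. ennreal t < exit_time X \<omega>}"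
          using exit_time_gt_iff[of X \<omega>, OF cad t] sp by simp
      qed
    qed
  qed
  ultimately show ?thesis by linarith
qed

section \<open>From survival probabilities to the expected exit time\<close>

lemma expected_exit_time_ge:
  assumes "0 \<le> t"
  shows "ennreal (t * prob {\<omega> \<in> space M. ennreal t < exit_time X \<omega>}) \<le> (\<integral>\<^sup>+\<omega>. exit_time X \<omega> \<partial>M)"
proof -
  let ?A = "{\<omega> \<in> space M. ennreal t < exit_time X \<omega>}"
  have "ennreal (t * prob ?A) = ennreal t * emeasure M ?A"
    using assms by (simp add: emeasure_eq_measure ennreal_mult)
  also have "\<dots> = (\<integral>\<^sup>+\<omega>. ennreal t * indicator ?A \<omega> \<partial>M)"
    by (rule nn_integral_cmult_indicator[symmetric, OF survival_set_measurable[OF assms]])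
  also have "\<dots> \<le> (\<integral>\<^sup>+\<omega>. exit_time X \<omega> \<partial>M)"
    by (intro nn_integral_mono) (auto simp: indicator_def less_imp_le)
  finally show ?thesis .
qed

text \<open>The exit time is at most S times the number of indices n for which it exceeds n S. The
  geometric series with ratio exp (- 1) sums to less than 2.\<close>

lemma expected_exit_time_le:
  assumes S: "0 < S" and C: "0 \<le> C"
    and le: "\<And>n. prob {\<omega> \<in> space M. ennreal (real n * S) < exit_time X \<omega>} \<le> C * exp (- real n)"
  shows "(\<integral>\<^sup>+\<omega>. exit_time X \<omega> \<partial>M) \<le> ennreal (2 * C * S)"
proof -
  let ?A = "\<lambda>n. {\<omega> \<in> space M. ennreal (real n * S) < exit_time X \<omega>}"
  have A: "?A n \<in> sets M" for n using S by (intro survival_set_measurable) simp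
  have pointwise: "exit_time X \<omega> \<le> (\<Sum>n. ennreal S * indicator (?A n) \<omega>)" if \<omega>: "\<omega> \<in> space M" for \<omega>
  proof -
    have part: "ennreal (real N * S) \<le> (\<Sum>n. ennreal S * indicator (?A n) \<omega>)"
      if "\<And>n. n < N \<Longrightarrow> \<omega> \<in> ?A n" for N
    proof -
      have "ennreal (real N * S) = (\<Sum>n<N. ennreal S * indicator (?A n) \<omega>)"
        using that S by (simp add: ennreal_mult ennreal_of_nat_eq_real_of_nat)
      also have "\<dots> \<le> (\<Sum>n. ennreal S * indicator (?A n) \<omega>)" by (intro sum_le_suminf) auto
      finally show ?thesis .
    qed
    show ?thesis
    proof (cases "\<exists>N. exit_time X \<omega> \<le> ennreal (real N * S)")
      case True
      define N where "N = (LEAST N. exit_time X \<omega> \<le> ennreal (real N * S))"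
      have N: "exit_time X \<omega> \<le> ennreal (real N * S)" "\<And>n. n < N \<Longrightarrow> \<not> exit_time X \<omega> \<le> ennreal (real n * S)"
        unfolding N_def using True by (auto intro: LeastI_ex dest: not_less_Least)
      have "ennreal (real N * S) \<le> (\<Sum>n. ennreal S * indicator (?A n) \<omega>)"
        by (rule part) (use N(2) \<omega> in \<open>auto simp: not_le\<close>)
      with N(1) show ?thesis by (rule order_trans)
    next
      case False
      then have all: "\<omega> \<in> ?A n" for n using \<omega> by (auto simp: not_le)
      \<comment> \<open>A path that never leaves counts every index, so the series dominates an
        infinite exit time as well.\<close>
      have "(\<Sum>n. ennreal S * indicator (?A n) \<omega>) = top"
      proof (rule ccontr)
        assume "(\<Sum>n. ennreal S * indicator (?A n) \<omega>) \<noteq> top"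
        then obtain r where r: "0 \<le> r" "(\<Sum>n. ennreal S * indicator (?A n) \<omega>) = ennreal r"
          by (cases "(\<Sum>n. ennreal S * indicator (?A n) \<omega>)") auto
        obtain N :: nat where "r / S < real N" using reals_Archimedean2 by blast
        then have "r < real N * S" using S by (simp add: field_simps)
        then have "ennreal r < ennreal (real N * S)" using r by (simp add: ennreal_less_iff)
        also have "\<dots> \<le> ennreal r" unfolding r(2) [symmetric] by (rule part) (rule all)
        finally show False by simp
      qed
      then show ?thesis by simp
    qed
  qed
  have "(\<integral>\<^sup>+\<omega>. exit_time X \<omega> \<partial>M) \<le> (\<integral>\<^sup>+\<omega>. (\<Sum>n. ennreal S * indicator (?A n) \<omega>) \<partial>M)"
    by (intro nn_integral_mono pointwise)
  also have "\<dots> = (\<Sum>n. \<integral>\<^sup>+\<omega>. ennreal S * indicator (?A n) \<omega> \<partial>M)"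
    using A by (intro nn_integral_suminf) auto
  also have "\<dots> = (\<Sum>n. ennreal (S * prob (?A n)))"
    using A S by (simp add: nn_integral_cmult_indicator emeasure_eq_measure ennreal_mult)
  also have "\<dots> \<le> (\<Sum>n. ennreal (S * C * exp (- 1) ^ n))"
  proof (intro suminf_le ennreal_leI)
    fix n
    have "exp (- real n) = exp (- 1) ^ n" by (simp flip: exp_of_nat_mult)
    then show "S * prob (?A n) \<le> S * C * exp (- 1) ^ n"
      using mult_left_mono[OF le[of n], of S] S by (simp add: mult.assoc)
  qed auto
  also have "\<dots> = ennreal (S * C * (1 / (1 - exp (- 1))))"
  proof (rule suminf_ennreal_eq)
    show "(\<lambda>n. S * C * exp (- 1) ^ n) sums (S * C * (1 / (1 - exp (- 1))))"
      by (intro sums_mult geometric_sums) simp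
  qed (use S C in simp)
  also have "\<dots> \<le> ennreal (2 * C * S)"
  proof (intro ennreal_leI)
    have "(2::real) \<le> exp 1" using exp_ge_add_one_self[of 1] by simp
    then have "exp (- 1) \<le> (1 / 2 :: real)" by (simp add: exp_minus field_simps)
    then have "1 / (1 - exp (- 1)) \<le> (2::real)" by (simp add: field_simps)
    then have "S * C * (1 / (1 - exp (- 1))) \<le> S * C * 2" using S C by (intro mult_left_mono) auto
    then show "S * C * (1 / (1 - exp (- 1))) \<le> 2 * C * S" by (simp add: mult_ac)
  qed
  finally show ?thesis .
qed

end

section \<open>Exit estimates\<close>

locale levy_sde_family =
  fixes M :: "'a measure" and F :: "real \<Rightarrow> 'a measure" and U :: "real \<Rightarrow> real" and \<nu> :: "real measure"
    and \<alpha> \<theta> d \<mu> :: real and L :: "real \<Rightarrow> real \<Rightarrow> 'a \<Rightarrow> real" and X :: "real \<Rightarrow> real \<Rightarrow> real \<Rightarrow> 'a \<Rightarrow> real"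
  assumes prob: "prob_space M" and usual: "usual_hypotheses M F"
    and \<alpha>: "0 < \<alpha>" "\<alpha> < 1" and \<theta>: "\<theta> > 0" and d: "d \<ge> 0" and U: "cond_U U"
    and \<nu>: "levy_measure \<nu>" "symmetric_measure \<nu>" "cond_L2 \<alpha> \<nu>"
    and L: "\<And>\<epsilon>. \<epsilon> > 0 \<Longrightarrow> levy_process_triplet M F d (restrict_jumps \<nu> (\<theta> / \<epsilon>)) \<mu> (L \<epsilon>)"
    and X: "\<And>\<epsilon> x. \<epsilon> > 0 \<Longrightarrow> strong_solution M F U \<epsilon> (L \<epsilon>) x (X \<epsilon> x)"
begin

sublocale W: symmetric_weibull_tail \<nu> \<alpha> d \<mu> \<theta>
  by unfold_locales (use \<alpha> \<theta> d \<nu> in auto)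

sublocale P: prob_space M by (rule prob)

lemma levy_noise: "0 < \<epsilon> \<Longrightarrow> levy_noise M F (L \<epsilon>)"
  using prob usual L by (auto simp: levy_noise_def levy_noise_axioms_def levy_process_triplet_def)

lemma levy_sde: "0 < \<epsilon> \<Longrightarrow> levy_sde M F (L \<epsilon>) U \<epsilon> x (X \<epsilon> x)"
  using levy_noise U X by (auto simp: levy_sde_def levy_sde_axioms_def)

abbreviation law where "law \<epsilon> t \<equiv> levy_noise.law M (L \<epsilon>) t"

lemma law_has_levy_law:
  assumes "0 < \<epsilon>" "0 \<le> t" shows "W.has_levy_law (1 / \<epsilon>) t (law \<epsilon> t)"
proof -
  interpret N: levy_noise M F "L \<epsilon>" by (rule levy_noise[OF assms(1)])
  interpret Q: prob_space "law \<epsilon> t" by (rule N.prob_space_law[OF assms(2)])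
  have "space (law \<epsilon> t) = UNIV" by (simp add: N.law_def)
  then have "real_distribution (law \<epsilon> t)" by unfold_locales auto
  moreover have "char (law \<epsilon> t) u = exp (of_real t * levy_exponent d (restrict_jumps \<nu> (\<theta> * (1 / \<epsilon>))) \<mu> u)" for u
    using L[OF assms(1)] assms(2) by (simp add: levy_process_triplet_def N.law_def)
  ultimately show ?thesis by (simp add: W.has_levy_law_def)
qed

abbreviation rate :: "real \<Rightarrow> real" where "rate \<epsilon> \<equiv> phi \<alpha> \<theta> * log_tail \<nu> (1 / \<epsilon>)"

lemma eventually_inverse: "eventually P at_top \<Longrightarrow> eventually (\<lambda>\<epsilon>. P (1 / \<epsilon>)) (at_right (0::real))"
  using eventually_compose_filterlim[OF _ filterlim_inverse_at_top_right, of P] by (simp add: inverse_eq_divide)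

lemma rate_at_top: "filterlim rate at_top (at_right 0)"
proof -
  have "filterlim (\<lambda>v. phi \<alpha> \<theta> * log_tail \<nu> v) at_top at_top"
    by (rule filterlim_tendsto_pos_mult_at_top[OF tendsto_const phi_pos[OF \<alpha> \<theta>] W.log_tail_at_top])
  then show ?thesis
    using filterlim_compose[OF _ filterlim_inverse_at_top_right, of "\<lambda>v. phi \<alpha> \<theta> * log_tail \<nu> v"]
    by (simp add: inverse_eq_divide)
qed

lemma exit_rate_powr:
  assumes "0 < \<epsilon>" "\<epsilon> \<le> 1" shows "exit_rate \<alpha> \<nu> \<theta> \<epsilon> powr c = exp (- (c * rate \<epsilon>))"
proof -
  have "1 \<le> 1 / \<epsilon>" using assms by simp
  then show ?thesis
    using W.measure_tail[of "1 / \<epsilon>"] by (simp add: exit_rate_def powr_def)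
qed

lemma eventually_small: "eventually (\<lambda>\<epsilon>. 0 < \<epsilon> \<and> \<epsilon> \<le> 1) (at_right (0::real))"
  using eventually_at_right_real[of 0 1] by (rule eventually_mono) auto

lemma U_bound: obtains K where "0 \<le> K" "\<And>y. \<bar>y\<bar> \<le> 1 \<Longrightarrow> \<bar>deriv U y\<bar> \<le> K"
  by (rule levy_sde.deriv_U_bound[OF levy_sde[OF zero_less_one]]) (rule that)

text \<open>Each window of length T ends in an exit with probability at least
  \<open>p \<epsilon>\<close>. Half of \<delta> pays for the tail estimate and the other half
  absorbs T when decay per window becomes decay per unit of time.\<close>

lemma survival_upper_bound:
  assumes \<delta>: "0 < \<delta>"
  shows "eventually (\<lambda>\<epsilon>. \<forall>t\<ge>0. \<forall>x. \<P>(\<omega> in M. exit_time (X \<epsilon> x) \<omega> > ennreal t)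
    \<le> (1 + \<delta>) * exp (- (exit_rate \<alpha> \<nu> \<theta> \<epsilon> powr (1 + \<delta>)) * t)) (at_right 0)"
proof -
  obtain K where K: "0 \<le> K" "\<And>y. \<bar>y\<bar> \<le> 1 \<Longrightarrow> \<bar>deriv U y\<bar> \<le> K" using U_bound by blast
  have \<delta>2: "0 < \<delta> / 2" using \<delta> by simp
  obtain \<eta> where \<eta>: "0 < \<eta>" and lower: "\<And>t. 0 < t \<Longrightarrow> eventually (\<lambda>v. \<forall>Q. W.has_levy_law v t Q \<longrightarrow>
     exp (- ((1 + \<delta> / 2) * phi \<alpha> \<theta> * log_tail \<nu> v)) \<le> measure Q {(1 + \<eta>) * v..} \<and>
     exp (- ((1 + \<delta> / 2) * phi \<alpha> \<theta> * log_tail \<nu> v)) \<le> measure Q {..- ((1 + \<eta>) * v)}) at_top"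
    using W.levy_tail_lower_both[OF \<delta>2] by blast
  \<comment> \<open>The drift over one window must not use up the margin \<eta> by which the noise
    exceeds 1 / \<epsilon>.\<close>
  define T where "T = \<eta> / (K + 1)"
  have T: "0 < T" "K * T \<le> \<eta>"
  proof -
    show "0 < T" using \<eta> K by (simp add: T_def)
    then have "K * T \<le> (K + 1) * T" by (simp add: distrib_right)
    also have "\<dots> = \<eta>" using K by (simp add: T_def)
    finally show "K * T \<le> \<eta>" .
  qed
  define p where "p \<epsilon> = exp (- ((1 + \<delta> / 2) * rate \<epsilon>))" for \<epsilon>
  have "0 < 1 + \<delta> / 2" "0 < ln (1 + \<delta>)" using \<delta> by auto
  \<comment> \<open>Rounding t / T down loses at most one window, hence a factor exp (p); this is
    the source of 1 + \<delta>.\<close>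
  then have small_p: "eventually (\<lambda>\<epsilon>. 1 * exp (- ((1 + \<delta> / 2) * rate \<epsilon>)) \<le> ln (1 + \<delta>)) (at_right 0)"
    unfolding minus_mult_left by (rule exp_tail_at_top[OF rate_at_top])
  have small_T: "eventually (\<lambda>\<epsilon>. T * exp (- (\<delta> / 2) * rate \<epsilon>) \<le> 1) (at_right 0)"
    by (rule exp_tail_at_top[OF rate_at_top \<delta>2 zero_less_one])
  have rate_pos: "eventually (\<lambda>\<epsilon>. 0 \<le> rate \<epsilon>) (at_right 0)"
    using rate_at_top unfolding filterlim_at_top by blast
  show ?thesis
    using eventually_inverse[OF lower[OF T(1)]] small_p small_T rate_pos eventually_small
  proof eventually_elim
    case (elim \<epsilon>)
    have \<epsilon>: "0 < \<epsilon>" "\<epsilon> \<le> 1" using elim by auto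
    have p: "0 < p \<epsilon>" "p \<epsilon> \<le> 1" "p \<epsilon> \<le> ln (1 + \<delta>)"
      using elim \<delta> by (auto simp: p_def)
    have pT: "T * exp (- ((1 + \<delta>) * rate \<epsilon>)) \<le> p \<epsilon>"
    proof -
      have "T * exp (- ((1 + \<delta>) * rate \<epsilon>)) = T * exp (- (\<delta> / 2) * rate \<epsilon>) * p \<epsilon>"
        unfolding p_def mult.assoc exp_add [symmetric] by (simp add: algebra_simps)
      also have "\<dots> \<le> 1 * p \<epsilon>" using elim p by (intro mult_right_mono) auto
      finally show ?thesis by simp
    qed
    show ?case
    proof (intro allI impI)
      fix t :: real and x assume t: "0 \<le> t"
      interpret S: levy_sde M F "L \<epsilon>" U \<epsilon> x "X \<epsilon> x" by (rule levy_sde[OF \<epsilon>(1)])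
      define n where "n = nat \<lfloor>t / T\<rfloor>"
      have "0 \<le> t / T" using t T by simp
      then have n: "real n \<le> t / T" "t / T - 1 \<le> real n" unfolding n_def by linarith+
      interpret Q: prob_space "law \<epsilon> T" using T by (intro S.prob_space_law) simp
      have tails: "p \<epsilon> \<le> measure (law \<epsilon> T) {(1 + \<eta>) * (1 / \<epsilon>)..}" "p \<epsilon> \<le> measure (law \<epsilon> T) {..- ((1 + \<eta>) * (1 / \<epsilon>))}"
        using elim(1) law_has_levy_law[OF \<epsilon>(1), of T] T by (simp_all add: p_def mult.assoc)
      have c: "(1 + K * T) / \<epsilon> \<le> (1 + \<eta>) * (1 / \<epsilon>)" using T \<epsilon> by (simp add: divide_right_mono)
      have "measure (law \<epsilon> T) {(1 + \<eta>) * (1 / \<epsilon>)..} \<le> measure (law \<epsilon> T) {(1 + K * T) / \<epsilon>..}"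
        using c by (intro Q.finite_measure_mono) auto
      then have p1: "p \<epsilon> \<le> measure (law \<epsilon> T) {(1 + K * T) / \<epsilon>..}" using tails by linarith
      have "measure (law \<epsilon> T) {..- ((1 + \<eta>) * (1 / \<epsilon>))} \<le> measure (law \<epsilon> T) {..- ((1 + K * T) / \<epsilon>)}"
        using c by (intro Q.finite_measure_mono) auto
      then have p2: "p \<epsilon> \<le> measure (law \<epsilon> T) {..- ((1 + K * T) / \<epsilon>)}" using tails by linarith
      have "real n * T \<le> t" using n(1) T by (simp add: field_simps)
      then have "\<P>(\<omega> in M. exit_time (X \<epsilon> x) \<omega> > ennreal t) \<le> \<P>(\<omega> in M. exit_time (X \<epsilon> x) \<omega> > ennreal (real n * T))"
        using T by (intro P.finite_measure_mono S.survival_set_measurable)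
          (auto intro: le_less_trans[OF ennreal_leI])
      also have "\<dots> \<le> (1 - p \<epsilon>) ^ n"
        by (rule S.survival_upper[OF T(1) K p1 p2 p(2)])
      also have "\<dots> \<le> exp (- p \<epsilon>) ^ n"
        using p exp_ge_add_one_self[of "- p \<epsilon>"] by (intro power_mono) auto
      also have "\<dots> = exp (- (p \<epsilon> * real n))" by (simp add: exp_of_nat_mult [symmetric] mult.commute)
      also have "\<dots> \<le> exp (ln (1 + \<delta>) + - (exit_rate \<alpha> \<nu> \<theta> \<epsilon> powr (1 + \<delta>)) * t)"
      proof -
        have "p \<epsilon> * (t / T - 1) \<le> p \<epsilon> * real n" using n p by (intro mult_left_mono) auto
        moreover have "exp (- ((1 + \<delta>) * rate \<epsilon>)) * t \<le> p \<epsilon> * (t / T)"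
        proof -
          have "exp (- ((1 + \<delta>) * rate \<epsilon>)) \<le> p \<epsilon> / T" using pT T by (simp add: field_simps)
          from mult_right_mono[OF this t] show ?thesis by simp
        qed
        ultimately have "- (p \<epsilon> * real n) \<le> ln (1 + \<delta>) + - exp (- ((1 + \<delta>) * rate \<epsilon>)) * t"
          using p by (simp add: right_diff_distrib)
        then show ?thesis unfolding exit_rate_powr[OF \<epsilon>] by simp
      qed
      also have "\<dots> = (1 + \<delta>) * exp (- (exit_rate \<alpha> \<nu> \<theta> \<epsilon> powr (1 + \<delta>)) * t)"
        unfolding exp_add using \<delta> by simp
      finally show "\<P>(\<omega> in M. exit_time (X \<epsilon> x) \<omega> > ennreal t)
        \<le> (1 + \<delta>) * exp (- (exit_rate \<alpha> \<nu> \<theta> \<epsilon> powr (1 + \<delta>)) * t)" .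
    qed
  qed
qed

text \<open>Restates the oscillation bound in terms of two-sided tails, the form in which the large
  deviation estimates are available.\<close>

lemma osc_prob_le:
  assumes \<epsilon>: "0 < \<epsilon>" and H: "0 \<le> H" and b: "0 \<le> b"
    and half: "\<And>u. u \<in> {0..H} \<Longrightarrow> measure (law \<epsilon> u) {x. b \<le> \<bar>x\<bar>} \<le> 1 / 2"
  shows "P.prob (levy_noise.osc M (L \<epsilon>) 0 H (a + 2 * b)) \<le> 4 * measure (law \<epsilon> H) {x. a \<le> \<bar>x\<bar>}"
proof -
  interpret N: levy_noise M F "L \<epsilon>" by (rule levy_noise[OF \<epsilon>])
  have "1 / 2 \<le> measure (law \<epsilon> u) {-b..b}" if u: "0 \<le> u" "u \<le> H" for u
  proof -
    interpret Q: prob_space "law \<epsilon> u" by (rule N.prob_space_law[OF u(1)])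
    have "space (law \<epsilon> u) = UNIV" by (simp add: N.law_def)
    moreover have "UNIV = {-b..b} \<union> {x. b \<le> \<bar>x\<bar>}" by auto
    ultimately have "1 \<le> measure (law \<epsilon> u) {-b..b} + measure (law \<epsilon> u) {x. b \<le> \<bar>x\<bar>}"
      using measure_Un_le[of "{-b..b}" "law \<epsilon> u" "{x. b \<le> \<bar>x\<bar>}"] Q.prob_space by simp
    then show ?thesis using half[of u] u by simp
  qed
  then have "P.prob (N.osc 0 H (a + 2 * b)) \<le> 4 * measure (law \<epsilon> H) {x. a < \<bar>x\<bar>}"
    by (rule N.osc_le[OF H])
  also have "\<dots> \<le> 4 * measure (law \<epsilon> H) {x. a \<le> \<bar>x\<bar>}"
  proof -
    interpret Q: prob_space "law \<epsilon> H" by (rule N.prob_space_law[OF H])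
    have "measure (law \<epsilon> H) {x. a < \<bar>x\<bar>} \<le> measure (law \<epsilon> H) {x. a \<le> \<bar>x\<bar>}"
      by (intro Q.finite_measure_mono) auto
    then show ?thesis by simp
  qed
  finally show ?thesis .
qed

text \<open>On either side of the origin the sign is constant, so the function is continuous on a
  compact interval and attains a positive minimum. For \<eta> > 1 / 2 these intervals are empty and
  any positive constant serves.\<close>

lemma drift_lower_bound:
  assumes "0 < \<eta>" "\<eta> < 1"
  obtains m where "0 < m" "\<And>y. \<bar>y\<bar> \<in> {\<eta>..1 - \<eta>} \<Longrightarrow> m \<le> sgn y * deriv U y"
proof -
  have cont: "continuous_on UNIV (deriv U)"
    using levy_sde.continuous_deriv_U[OF levy_sde[OF zero_less_one]] .
  have pos: "0 < sgn y * deriv U y" if "\<bar>y\<bar> \<in> {\<eta>..1 - \<eta>}" for y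
  proof -
    have "y \<in> {-1<..<1} - {0}" using that assms by (auto simp: abs_le_iff)
    then have "0 < deriv U y * y" using U unfolding cond_U_def by blast
    then show ?thesis by (auto simp: sgn_if zero_less_mult_iff)
  qed
  have min: "\<exists>m>0. \<forall>y\<in>S. m \<le> sgn y * deriv U y"
    if S: "S \<subseteq> {y. \<bar>y\<bar> \<in> {\<eta>..1 - \<eta>}}" "compact S" "continuous_on S (\<lambda>y. sgn y * deriv U y)" for S
  proof (cases "S = {}")
    case True
    then show ?thesis by (intro exI[of _ 1]) auto
  next
    case False
    obtain y where y: "y \<in> S" "\<And>z. z \<in> S \<Longrightarrow> sgn y * deriv U y \<le> sgn z * deriv U z"
      using continuous_attains_inf[OF S(2) False S(3)] by blast
    then show ?thesis using pos[of y] S(1) by blast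
  qed
  have "continuous_on {\<eta>..1 - \<eta>} (\<lambda>y. sgn y * deriv U y)"
  proof -
    have "continuous_on {\<eta>..1 - \<eta>} (\<lambda>y. deriv U y)" by (rule continuous_on_subset[OF cont]) simp
    then show ?thesis by (rule continuous_on_eq) (use assms in auto)
  qed
  then obtain m1 where m1: "0 < m1" "\<And>y. y \<in> {\<eta>..1 - \<eta>} \<Longrightarrow> m1 \<le> sgn y * deriv U y"
    using min[of "{\<eta>..1 - \<eta>}"] assms by (auto simp: subset_eq)
  have "continuous_on {-(1 - \<eta>)..-\<eta>} (\<lambda>y. sgn y * deriv U y)"
  proof -
    have "continuous_on {-(1 - \<eta>)..-\<eta>} (\<lambda>y. - deriv U y)"
      by (intro continuous_on_minus continuous_on_subset[OF cont]) simp
    then show ?thesis by (rule continuous_on_eq) (use assms in auto)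
  qed
  then obtain m2 where m2: "0 < m2" "\<And>y. y \<in> {-(1 - \<eta>)..-\<eta>} \<Longrightarrow> m2 \<le> sgn y * deriv U y"
    using min[of "{-(1 - \<eta>)..-\<eta>}"] assms by (auto simp: subset_eq)
  show ?thesis
  proof (rule that[of "min m1 m2"])
    show "0 < min m1 m2" using m1 m2 by simp
    fix y assume y: "\<bar>y\<bar> \<in> {\<eta>..1 - \<eta>}"
    show "min m1 m2 \<le> sgn y * deriv U y"
    proof (cases "0 \<le> y")
      case True
      then show ?thesis using m1(2)[of y] y by (simp add: min.coboundedI1)
    next
      case False
      then show ?thesis using m2(2)[of y] y by (simp add: min.coboundedI2)
    qed
  qed
qed

text \<open>The loss 5 \<eta> consists of 3 \<eta> from the crossing argument, \<eta> for two
  margins \<eta> / 2 in the oscillation bound, and \<eta> for the gap in the tail estimate. The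
  factor (1 - \<gamma>) occurs twice, for the tail and for the cost near 1, and its square is at
  least 1 - \<delta> / 2.\<close>

lemma survival_lower_bound:
  assumes \<delta>: "0 < \<delta>" "\<delta> < 1"
  shows "eventually (\<lambda>\<epsilon>. \<forall>t\<ge>0. \<forall>x. \<bar>x\<bar> \<le> 1 - \<delta> \<longrightarrow>
    (1 - \<delta>) * exp (- (exit_rate \<alpha> \<nu> \<theta> \<epsilon> powr (1 - \<delta>)) * t)
      \<le> \<P>(\<omega> in M. exit_time (X \<epsilon> x) \<omega> > ennreal t)) (at_right 0)"
proof -
  define \<gamma> where "\<gamma> = \<delta> / 4"
  have \<gamma>: "0 < \<gamma>" "\<gamma> < 1" using \<delta> by (auto simp: \<gamma>_def)
  obtain e where e: "0 < e" "\<And>e'. 0 < e' \<Longrightarrow> e' \<le> e \<Longrightarrow> (1 - \<gamma>) * phi \<alpha> \<theta> \<le> jump_cost \<alpha> \<theta> (1 - e')"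
    using W.jump_cost_near_1[OF \<gamma>(1)] by blast
  define \<eta> where "\<eta> = min (\<delta> / 8) (e / 5)"
  have \<eta>: "0 < \<eta>" "\<eta> < \<delta> / 2" "\<eta> < 1" "5 * \<eta> \<le> e" "5 * \<eta> < 1"
    using \<delta> e by (auto simp: \<eta>_def min_def)
  define J where "J = jump_cost \<alpha> \<theta> ((1 - 4 * \<eta>) - \<eta>)"
  have J: "(1 - \<gamma>) * phi \<alpha> \<theta> \<le> J" using e(2)[of "5 * \<eta>"] \<eta> by (simp add: J_def)
  have phi: "0 < phi \<alpha> \<theta>" by (rule phi_pos[OF \<alpha> \<theta>])
  have J0: "0 < J" using J \<gamma> phi by (intro less_le_trans[OF _ J]) simp
  obtain m where m: "0 < m" "\<And>y. \<bar>y\<bar> \<in> {\<eta>..1 - \<eta>} \<Longrightarrow> m \<le> sgn y * deriv U y"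
    using drift_lower_bound[OF \<eta>(1,3)] by blast
  define T where "T = 1 / m"
  have T: "0 < T" "1 \<le> m * T" using m by (auto simp: T_def)
  have T2: "0 \<le> 2 * T" using T by simp
  \<comment> \<open>The 8 is 4 from the oscillation bound times 2 from the two tails.\<close>
  define q where "q \<epsilon> = 8 * exp (- ((1 - \<delta> / 2) * rate \<epsilon>))" for \<epsilon>
  have up: "eventually (\<lambda>v. \<forall>t\<in>{0..2 * T}. \<forall>Q. W.has_levy_law v t Q \<longrightarrow>
     measure Q {x. (1 - 4 * \<eta>) * v \<le> \<bar>x\<bar>} \<le> 2 * exp (- ((1 - \<gamma>) * J * log_tail \<nu> v))) at_top"
    unfolding J_def by (rule W.levy_tail_upper_abs[OF T2]) (use \<eta> \<gamma> J0 in \<open>auto simp: J_def\<close>)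
  have half1: "eventually (\<lambda>v. \<forall>t\<in>{0..2 * T}. \<forall>Q. W.has_levy_law v t Q \<longrightarrow> measure Q {x. \<eta> / 2 * v \<le> \<bar>x\<bar>} \<le> 1 / 2) at_top"
    by (rule W.deviation_vanishes[OF T2]) (use \<eta> in auto)
  have half2: "eventually (\<lambda>v. \<forall>t\<in>{0..2 * T}. \<forall>Q. W.has_levy_law v t Q \<longrightarrow> measure Q {x. \<delta> / 8 * v \<le> \<bar>x\<bar>} \<le> 1 / 2) at_top"
    by (rule W.deviation_vanishes[OF T2]) (use \<delta> in auto)
  have start: "eventually (\<lambda>v. \<forall>t\<in>{0..2 * T}. \<forall>Q. W.has_levy_law v t Q \<longrightarrow> measure Q {x. \<delta> / 4 * v \<le> \<bar>x\<bar>} \<le> \<delta> / 8) at_top"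
    by (rule W.deviation_vanishes[OF T2]) (use \<delta> in auto)
  have "0 < 1 - \<delta> / 2" "0 < \<delta> / 4" using \<delta> by auto
  then have small_q: "eventually (\<lambda>\<epsilon>. 8 * exp (- ((1 - \<delta> / 2) * rate \<epsilon>)) \<le> \<delta> / 4) (at_right 0)"
    unfolding minus_mult_left by (rule exp_tail_at_top[OF rate_at_top])
  have "0 < \<delta> / 2" using \<delta> by simp
  then have small_T: "eventually (\<lambda>\<epsilon>. 32 / T * exp (- (\<delta> / 2) * rate \<epsilon>) \<le> 1) (at_right 0)"
    by (rule exp_tail_at_top[OF rate_at_top _ zero_less_one])
  show ?thesis
    using eventually_inverse[OF up] eventually_inverse[OF half1] eventually_inverse[OF half2] eventually_inverse[OF start]
      small_q small_T eventually_small
  proof eventually_elim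
    case (elim \<epsilon>)
    have \<epsilon>: "0 < \<epsilon>" "\<epsilon> \<le> 1" using elim by auto
    have law: "W.has_levy_law (1 / \<epsilon>) u (law \<epsilon> u)" if "u \<in> {0..2 * T}" for u
      using that by (intro law_has_levy_law \<epsilon>) auto
    have TT: "2 * T \<in> {0..2 * T}" "T \<in> {0..2 * T}" using T by auto
    have q: "0 < q \<epsilon>" "q \<epsilon> \<le> \<delta> / 4" using elim by (auto simp: q_def)
    have eq1: "(1 - 3 * \<eta>) / \<epsilon> = (1 - 4 * \<eta>) * (1 / \<epsilon>) + 2 * (\<eta> / 2 * (1 / \<epsilon>))"
      using \<epsilon> by (simp add: field_simps)
    have "P.prob (levy_noise.osc M (L \<epsilon>) 0 (2 * T) ((1 - 3 * \<eta>) / \<epsilon>))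
        \<le> 4 * measure (law \<epsilon> (2 * T)) {x. (1 - 4 * \<eta>) * (1 / \<epsilon>) \<le> \<bar>x\<bar>}"
      unfolding eq1 using elim(2) law \<eta> \<epsilon> by (intro osc_prob_le[OF \<epsilon>(1) T2]) auto
    moreover have "measure (law \<epsilon> (2 * T)) {x. (1 - 4 * \<eta>) * (1 / \<epsilon>) \<le> \<bar>x\<bar>} \<le> 2 * exp (- ((1 - \<gamma>) * J * log_tail \<nu> (1 / \<epsilon>)))"
      using elim(1) law[OF TT(1)] TT(1) by blast
    moreover have "2 * exp (- ((1 - \<gamma>) * J * log_tail \<nu> (1 / \<epsilon>))) \<le> 2 * exp (- ((1 - \<delta> / 2) * rate \<epsilon>))"
    proof -
      have ltp: "0 < log_tail \<nu> (1 / \<epsilon>)" using \<epsilon> by (intro W.log_tail_pos) simp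
      have "(1 - \<delta> / 2) * phi \<alpha> \<theta> \<le> (1 - \<gamma>) * ((1 - \<gamma>) * phi \<alpha> \<theta>)"
      proof -
        have "1 - \<delta> / 2 \<le> (1 - \<gamma>) * (1 - \<gamma>)" by (simp add: \<gamma>_def field_simps)
        from mult_right_mono[OF this, of "phi \<alpha> \<theta>"] phi show ?thesis by (simp add: mult.assoc)
      qed
      also have "\<dots> \<le> (1 - \<gamma>) * J" using J \<gamma> by (intro mult_left_mono) auto
      finally have "(1 - \<delta> / 2) * phi \<alpha> \<theta> * log_tail \<nu> (1 / \<epsilon>) \<le> (1 - \<gamma>) * J * log_tail \<nu> (1 / \<epsilon>)"
        using ltp by (intro mult_right_mono) auto
      then show ?thesis by (simp add: mult.assoc)
    qed
    ultimately have osc1: "P.prob (levy_noise.osc M (L \<epsilon>) 0 (2 * T) ((1 - 3 * \<eta>) / \<epsilon>)) \<le> q \<epsilon>"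
      unfolding q_def by linarith
    have eq2: "\<delta> / 2 / \<epsilon> = \<delta> / 4 * (1 / \<epsilon>) + 2 * (\<delta> / 8 * (1 / \<epsilon>))"
      using \<epsilon> by (simp add: field_simps)
    have sub: "u \<in> {0..2 * T}" if "u \<in> {0..T}" for u using that by auto
    have "P.prob (levy_noise.osc M (L \<epsilon>) 0 T (\<delta> / 2 / \<epsilon>)) \<le> 4 * measure (law \<epsilon> T) {x. \<delta> / 4 * (1 / \<epsilon>) \<le> \<bar>x\<bar>}"
      unfolding eq2
    proof (rule osc_prob_le[OF \<epsilon>(1)])
      show "measure (law \<epsilon> u) {x. \<delta> / 8 * (1 / \<epsilon>) \<le> \<bar>x\<bar>} \<le> 1 / 2" if "u \<in> {0..T}" for u
        using elim(3) law[OF sub[OF that]] sub[OF that] by blast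
    qed (use \<delta> \<epsilon> T in auto)
    moreover have "measure (law \<epsilon> T) {x. \<delta> / 4 * (1 / \<epsilon>) \<le> \<bar>x\<bar>} \<le> \<delta> / 8"
      using elim(4) law[OF TT(2)] TT(2) by blast
    ultimately have osc2: "P.prob (levy_noise.osc M (L \<epsilon>) 0 T (\<delta> / 2 / \<epsilon>)) \<le> \<delta> / 2"
      by simp
    show ?case
    proof (intro allI impI)
      fix t x :: real assume t: "0 \<le> t" and x: "\<bar>x\<bar> \<le> 1 - \<delta>"
      interpret S: levy_sde M F "L \<epsilon>" U \<epsilon> x "X \<epsilon> x" by (rule levy_sde[OF \<epsilon>(1)])
      define n where "n = nat \<lfloor>t / T\<rfloor>"
      have "0 \<le> t / T" using t T by simp
      then have n: "real n \<le> t / T" unfolding n_def by linarith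
      have "(1 - 2 * q \<epsilon>) ^ n * (1 - \<delta> / 2 - q \<epsilon>) \<le> \<P>(\<omega> in M. exit_time (X \<epsilon> x) \<omega> > ennreal t)"
        unfolding n_def
        by (rule S.survival_lower[OF \<eta>(1,2) _ m(1) T(2,1) m(2) x osc1 _ osc2 _ t]) (use \<delta> q in auto)
      moreover have "(1 - \<delta>) * exp (- (exit_rate \<alpha> \<nu> \<theta> \<epsilon> powr (1 - \<delta>)) * t) \<le> (1 - 2 * q \<epsilon>) ^ n * (1 - \<delta> / 2 - q \<epsilon>)"
      proof -
        have "exp (- (4 * q \<epsilon>)) \<le> 1 - 2 * q \<epsilon>"
        proof -
          have "0 < 1 - 2 * q \<epsilon>" using q \<delta> by simp
          \<comment> \<open>The difference of the two sides is 2 q (1 - 4 q), which is nonnegative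
            because q \<le> \<delta> / 4 < 1 / 4.\<close>
          have "1 \<le> (1 + 4 * q \<epsilon>) * (1 - 2 * q \<epsilon>)"
            using q \<delta> mult_left_mono[of "8 * q \<epsilon>" 2 "q \<epsilon>"] by (simp add: algebra_simps)
          also have "\<dots> \<le> exp (4 * q \<epsilon>) * (1 - 2 * q \<epsilon>)"
            using \<open>0 < 1 - 2 * q \<epsilon>\<close> exp_ge_add_one_self[of "4 * q \<epsilon>"] by (intro mult_right_mono) auto
          finally show ?thesis by (simp add: exp_minus field_simps)
        qed
        then have "exp (- (4 * q \<epsilon>)) ^ n \<le> (1 - 2 * q \<epsilon>) ^ n" by (intro power_mono) auto
        moreover have "exp (- (4 * q \<epsilon>)) ^ n = exp (- (4 * q \<epsilon> * real n))"
          by (simp add: exp_of_nat_mult [symmetric] mult.commute)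
        moreover have "exp (- (exit_rate \<alpha> \<nu> \<theta> \<epsilon> powr (1 - \<delta>)) * t) \<le> exp (- (4 * q \<epsilon> * real n))"
        proof -
          have "4 * q \<epsilon> / T = 32 / T * exp (- (\<delta> / 2) * rate \<epsilon>) * exp (- ((1 - \<delta>) * rate \<epsilon>))"
            unfolding q_def mult.assoc exp_add [symmetric] by (simp add: algebra_simps)
          also have "\<dots> \<le> 1 * exp (- ((1 - \<delta>) * rate \<epsilon>))"
            using elim(6) by (intro mult_right_mono) auto
          finally have "4 * q \<epsilon> / T * t \<le> exit_rate \<alpha> \<nu> \<theta> \<epsilon> powr (1 - \<delta>) * t"
            unfolding exit_rate_powr[OF \<epsilon>] using t by (intro mult_right_mono) auto
          moreover have "4 * q \<epsilon> * real n \<le> 4 * q \<epsilon> * (t / T)" using n q by (intro mult_left_mono) auto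
          ultimately show ?thesis by simp
        qed
        ultimately have "exp (- (exit_rate \<alpha> \<nu> \<theta> \<epsilon> powr (1 - \<delta>)) * t) \<le> (1 - 2 * q \<epsilon>) ^ n" by linarith
        then have "exp (- (exit_rate \<alpha> \<nu> \<theta> \<epsilon> powr (1 - \<delta>)) * t) * (1 - \<delta>) \<le> (1 - 2 * q \<epsilon>) ^ n * (1 - \<delta> / 2 - q \<epsilon>)"
          using q \<delta> by (intro mult_mono) auto
        then show ?thesis by (simp add: mult.commute)
      qed
      ultimately show "(1 - \<delta>) * exp (- (exit_rate \<alpha> \<nu> \<theta> \<epsilon> powr (1 - \<delta>)) * t)
          \<le> \<P>(\<omega> in M. exit_time (X \<epsilon> x) \<omega> > ennreal t)" by linarith
    qed
  qed
qed

text \<open>For the lower bound a single time u suffices, at which survival still has probability at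
  least (1 - \<delta>) exp (- 1). For the upper bound time is measured in steps of s, and the
  survival probability decays by exp (- 1) in each step.\<close>

lemma expected_exit_time_bounds:
  assumes \<delta>: "0 < \<delta>" "\<delta> < 1" and x: "\<bar>x\<bar> \<le> 1 - \<delta>"
  shows "eventually (\<lambda>\<epsilon>. (\<integral>\<^sup>+\<omega>. exit_time (X \<epsilon> x) \<omega> \<partial>M) < \<infinity> \<and>
    (1 - \<delta>) * rate \<epsilon> + ln ((1 - \<delta>) * exp (- 1)) \<le> ln (enn2real (\<integral>\<^sup>+\<omega>. exit_time (X \<epsilon> x) \<omega> \<partial>M)) \<and>
    ln (enn2real (\<integral>\<^sup>+\<omega>. exit_time (X \<epsilon> x) \<omega> \<partial>M)) \<le> (1 + \<delta>) * rate \<epsilon> + ln (2 * (1 + \<delta>))) (at_right 0)"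
  using survival_lower_bound[OF \<delta>] survival_upper_bound[OF \<delta>(1)] eventually_small
proof eventually_elim
  case (elim \<epsilon>)
  have \<epsilon>: "0 < \<epsilon>" "\<epsilon> \<le> 1" using elim by auto
  interpret S: levy_sde M F "L \<epsilon>" U \<epsilon> x "X \<epsilon> x" by (rule levy_sde[OF \<epsilon>(1)])
  define E where "E = (\<integral>\<^sup>+\<omega>. exit_time (X \<epsilon> x) \<omega> \<partial>M)"
  define s where "s = exp ((1 + \<delta>) * rate \<epsilon>)"
  have s: "exit_rate \<alpha> \<nu> \<theta> \<epsilon> powr (1 + \<delta>) * s = 1" unfolding exit_rate_powr[OF \<epsilon>] s_def by (simp flip: exp_add)
  have s0: "0 < s" by (simp add: s_def)
  have Eup: "E \<le> ennreal (2 * (1 + \<delta>) * s)"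
    unfolding E_def
  proof (rule S.expected_exit_time_le)
    fix n
    have "\<P>(\<omega> in M. exit_time (X \<epsilon> x) \<omega> > ennreal (real n * s))
        \<le> (1 + \<delta>) * exp (- (exit_rate \<alpha> \<nu> \<theta> \<epsilon> powr (1 + \<delta>)) * (real n * s))"
      using elim(2) s0 by simp
    also have "- (exit_rate \<alpha> \<nu> \<theta> \<epsilon> powr (1 + \<delta>)) * (real n * s) = - real n * (exit_rate \<alpha> \<nu> \<theta> \<epsilon> powr (1 + \<delta>) * s)"
      by simp
    also have "\<dots> = - real n" unfolding s by simp
    finally show "\<P>(\<omega> in M. exit_time (X \<epsilon> x) \<omega> > ennreal (real n * s)) \<le> (1 + \<delta>) * exp (- real n)" .
  qed (use \<delta> s0 in auto)
  define u where "u = exp ((1 - \<delta>) * rate \<epsilon>)"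
  have u: "exit_rate \<alpha> \<nu> \<theta> \<epsilon> powr (1 - \<delta>) * u = 1" unfolding exit_rate_powr[OF \<epsilon>] u_def by (simp flip: exp_add)
  have u0: "0 < u" by (simp add: u_def)
  have Elow: "ennreal (u * ((1 - \<delta>) * exp (- 1))) \<le> E"
  proof -
    have "(1 - \<delta>) * exp (- (exit_rate \<alpha> \<nu> \<theta> \<epsilon> powr (1 - \<delta>)) * u) \<le> \<P>(\<omega> in M. exit_time (X \<epsilon> x) \<omega> > ennreal u)"
      using elim(1) u0 x by simp
    moreover have "- (exit_rate \<alpha> \<nu> \<theta> \<epsilon> powr (1 - \<delta>)) * u = - 1" using u by simp
    ultimately have "u * ((1 - \<delta>) * exp (- 1)) \<le> u * \<P>(\<omega> in M. exit_time (X \<epsilon> x) \<omega> > ennreal u)"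
      using u0 by (intro mult_left_mono) auto
    then have "ennreal (u * ((1 - \<delta>) * exp (- 1))) \<le> ennreal (u * \<P>(\<omega> in M. exit_time (X \<epsilon> x) \<omega> > ennreal u))"
      by (rule ennreal_leI)
    also have "\<dots> \<le> E" unfolding E_def using u0 by (intro S.expected_exit_time_ge) simp
    finally show ?thesis .
  qed
  have fin: "E < \<infinity>" using Eup by (rule le_less_trans) simp
  then obtain r where r: "E = ennreal r" "0 \<le> r" by (cases E) auto
  have pos: "0 < u * ((1 - \<delta>) * exp (- 1))" using u0 \<delta> by simp
  have rl: "u * ((1 - \<delta>) * exp (- 1)) \<le> r" using Elow r by simp
  have ru: "r \<le> 2 * (1 + \<delta>) * s" using Eup r \<delta> s0 by (simp add: ennreal_le_iff)
  have r0: "0 < r" using pos rl by linarith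
  have "ln (u * ((1 - \<delta>) * exp (- 1))) \<le> ln r" using pos rl r0 by simp
  moreover have "ln (u * ((1 - \<delta>) * exp (- 1))) = (1 - \<delta>) * rate \<epsilon> + ln ((1 - \<delta>) * exp (- 1))"
    using \<delta> by (subst ln_mult) (simp_all add: u_def)
  moreover have "ln r \<le> ln (2 * (1 + \<delta>) * s)" using ru r0 \<delta> s0 by simp
  moreover have "ln (2 * (1 + \<delta>) * s) = (1 + \<delta>) * rate \<epsilon> + ln (2 * (1 + \<delta>))"
    using \<delta> by (subst ln_mult) (simp_all add: s_def)
  ultimately show ?case using fin r unfolding E_def [symmetric] by simp
qed

lemma log_expected_exit_time:
  assumes x: "\<bar>x\<bar> < 1"
  shows "((\<lambda>\<epsilon>. inverse (rate \<epsilon>) * ln (enn2real (\<integral>\<^sup>+\<omega>. exit_time (X \<epsilon> x) \<omega> \<partial>M))) \<longlongrightarrow> 1) (at_right 0)"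
proof (rule tendstoI)
  fix e :: real assume e: "0 < e"
  \<comment> \<open>The bound 1 - \<bar>x\<bar> admits x as a starting point; e / 2 leaves the other
    half of e for the additive constants, which the growing rate makes negligible.\<close>
  define \<delta> where "\<delta> = min (min (1 / 2) (e / 2)) (1 - \<bar>x\<bar>)"
  have \<delta>: "0 < \<delta>" "\<delta> < 1" "\<bar>x\<bar> \<le> 1 - \<delta>" "\<delta> \<le> e / 2" using e x by (auto simp: \<delta>_def min_def)
  define c where "c = max \<bar>ln ((1 - \<delta>) * exp (- 1))\<bar> \<bar>ln (2 * (1 + \<delta>))\<bar>"
  have large: "eventually (\<lambda>\<epsilon>. 2 * c / e + 1 \<le> rate \<epsilon>) (at_right 0)"
    using rate_at_top unfolding filterlim_at_top by blast
  show "eventually (\<lambda>\<epsilon>. dist (inverse (rate \<epsilon>) * ln (enn2real (\<integral>\<^sup>+\<omega>. exit_time (X \<epsilon> x) \<omega> \<partial>M))) 1 < e) (at_right 0)"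
    using expected_exit_time_bounds[OF \<delta>(1-3)] large
  proof eventually_elim
    case (elim \<epsilon>)
    define r where "r = rate \<epsilon>"
    define l where "l = ln (enn2real (\<integral>\<^sup>+\<omega>. exit_time (X \<epsilon> x) \<omega> \<partial>M))"
    have "0 \<le> 2 * c / e" using e by (simp add: c_def)
    then have r: "0 < r" "2 * c / e < r" using elim(2) by (auto simp: r_def)
    then have cr: "2 * c < e * r" using e by (simp add: field_simps)
    have lc: "(1 - \<delta>) * r - c \<le> l" "l \<le> (1 + \<delta>) * r + c"
      using elim(1) unfolding r_def [symmetric] l_def [symmetric] c_def by linarith+
    have "\<bar>l - r\<bar> \<le> \<delta> * r + c" using lc by (simp add: abs_le_iff algebra_simps)
    also have "\<delta> * r \<le> e / 2 * r" using \<delta> r by (intro mult_right_mono) auto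
    finally have "\<bar>l - r\<bar> < e * r" using cr by simp
    then have "\<bar>l - r\<bar> / r < e" using r by (simp add: field_simps)
    moreover have "inverse r * l - 1 = (l - r) / r" using r by (simp add: field_simps)
    ultimately show ?case
      unfolding r_def [symmetric] l_def [symmetric] dist_real_def using r by simp
  qed
qed

lemma exit_estimates:
  assumes \<delta>: "0 < \<delta>"
  shows "\<exists>\<epsilon>\<^sub>0>0. \<forall>\<epsilon>. 0 < \<epsilon> \<and> \<epsilon> \<le> \<epsilon>\<^sub>0 \<longrightarrow> (\<forall>t\<ge>0.
           (\<delta> \<le> 1 \<longrightarrow>
              (1 - \<delta>) * exp (- (exit_rate \<alpha> \<nu> \<theta> \<epsilon> powr (1 - \<delta>)) * t)
                \<le> (INF x\<in>{x. \<bar>x\<bar> \<le> 1 - \<delta>}. \<P>(\<omega> in M. exit_time (X \<epsilon> x) \<omega> > ennreal t)) \<and>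
              (INF x\<in>{x. \<bar>x\<bar> \<le> 1 - \<delta>}. \<P>(\<omega> in M. exit_time (X \<epsilon> x) \<omega> > ennreal t))
                \<le> (SUP x\<in>{x. \<bar>x\<bar> \<le> 1}. \<P>(\<omega> in M. exit_time (X \<epsilon> x) \<omega> > ennreal t))) \<and>
           (SUP x\<in>{x. \<bar>x\<bar> \<le> 1}. \<P>(\<omega> in M. exit_time (X \<epsilon> x) \<omega> > ennreal t))
             \<le> (1 + \<delta>) * exp (- (exit_rate \<alpha> \<nu> \<theta> \<epsilon> powr (1 + \<delta>)) * t))"
proof -
  \<comment> \<open>For \<delta> = 1 the lower bound is 0, so only \<delta> < 1 calls on the
    survival estimate.\<close>
  have lower: "eventually (\<lambda>\<epsilon>. \<delta> \<le> 1 \<longrightarrow> (\<forall>t\<ge>0. \<forall>x. \<bar>x\<bar> \<le> 1 - \<delta> \<longrightarrow>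
    (1 - \<delta>) * exp (- (exit_rate \<alpha> \<nu> \<theta> \<epsilon> powr (1 - \<delta>)) * t)
      \<le> \<P>(\<omega> in M. exit_time (X \<epsilon> x) \<omega> > ennreal t))) (at_right 0)"
  proof (cases "\<delta> < 1")
    case True
    show ?thesis using survival_lower_bound[OF \<delta> True] by eventually_elim blast
  next
    case False
    then show ?thesis by (intro always_eventually) auto
  qed
  have "eventually (\<lambda>\<epsilon>. (\<delta> \<le> 1 \<longrightarrow> (\<forall>t\<ge>0. \<forall>x. \<bar>x\<bar> \<le> 1 - \<delta> \<longrightarrow>
    (1 - \<delta>) * exp (- (exit_rate \<alpha> \<nu> \<theta> \<epsilon> powr (1 - \<delta>)) * t)
      \<le> \<P>(\<omega> in M. exit_time (X \<epsilon> x) \<omega> > ennreal t))) \<and> (\<forall>t\<ge>0. \<forall>x. \<P>(\<omega> in M. exit_time (X \<epsilon> x) \<omega> > ennreal t)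
    \<le> (1 + \<delta>) * exp (- (exit_rate \<alpha> \<nu> \<theta> \<epsilon> powr (1 + \<delta>)) * t))) (at_right 0)"
    using lower survival_upper_bound[OF \<delta>] by eventually_elim blast
  then obtain b where b: "0 < b" "\<And>\<epsilon>. 0 < \<epsilon> \<Longrightarrow> \<epsilon> < b \<Longrightarrow>
    (\<delta> \<le> 1 \<longrightarrow> (\<forall>t\<ge>0. \<forall>x. \<bar>x\<bar> \<le> 1 - \<delta> \<longrightarrow>
    (1 - \<delta>) * exp (- (exit_rate \<alpha> \<nu> \<theta> \<epsilon> powr (1 - \<delta>)) * t)
      \<le> \<P>(\<omega> in M. exit_time (X \<epsilon> x) \<omega> > ennreal t))) \<and> (\<forall>t\<ge>0. \<forall>x. \<P>(\<omega> in M. exit_time (X \<epsilon> x) \<omega> > ennreal t)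
    \<le> (1 + \<delta>) * exp (- (exit_rate \<alpha> \<nu> \<theta> \<epsilon> powr (1 + \<delta>)) * t))"
    unfolding eventually_at_right_field by blast
  show ?thesis
  proof (rule exI[of _ "b / 2"], intro conjI allI impI)
    show "0 < b / 2" using b by simp
    fix \<epsilon> t :: real assume "0 < \<epsilon> \<and> \<epsilon> \<le> b / 2" and t: "0 \<le> t"
    then have \<epsilon>: "0 < \<epsilon>" "\<epsilon> < b" using b by auto
    let ?p = "\<lambda>x. \<P>(\<omega> in M. exit_time (X \<epsilon> x) \<omega> > ennreal t)"
    have bdd: "bdd_below (?p ` A)" "bdd_above (?p ` A)" for A
      by (auto intro!: bdd_belowI2[of _ 0] bdd_aboveI2[of _ _ 1])
    show "(SUP x\<in>{x. \<bar>x\<bar> \<le> 1}. ?p x) \<le> (1 + \<delta>) * exp (- (exit_rate \<alpha> \<nu> \<theta> \<epsilon> powr (1 + \<delta>)) * t)"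
    proof (rule cSUP_least)
      show "{x :: real. \<bar>x\<bar> \<le> 1} \<noteq> {}" by (auto intro: exI[of _ 0])
      show "?p x \<le> (1 + \<delta>) * exp (- (exit_rate \<alpha> \<nu> \<theta> \<epsilon> powr (1 + \<delta>)) * t)" for x
        using b(2)[OF \<epsilon>] t by blast
    qed
    assume \<delta>1: "\<delta> \<le> 1"
    have 0: "(0::real) \<in> {x. \<bar>x\<bar> \<le> 1 - \<delta>}" using \<delta>1 by simp
    show "(1 - \<delta>) * exp (- (exit_rate \<alpha> \<nu> \<theta> \<epsilon> powr (1 - \<delta>)) * t) \<le> (INF x\<in>{x. \<bar>x\<bar> \<le> 1 - \<delta>}. ?p x)"
    proof (rule cINF_greatest)
      show "{x :: real. \<bar>x\<bar> \<le> 1 - \<delta>} \<noteq> {}" using 0 by blast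
      show "(1 - \<delta>) * exp (- (exit_rate \<alpha> \<nu> \<theta> \<epsilon> powr (1 - \<delta>)) * t) \<le> ?p x" if "x \<in> {x. \<bar>x\<bar> \<le> 1 - \<delta>}" for x
        using b(2)[OF \<epsilon>] t \<delta>1 that by blast
    qed
    have "(INF x\<in>{x. \<bar>x\<bar> \<le> 1 - \<delta>}. ?p x) \<le> ?p 0" using 0 bdd by (intro cINF_lower) auto
    also have "\<dots> \<le> (SUP x\<in>{x. \<bar>x\<bar> \<le> 1}. ?p x)" using bdd by (intro cSUP_upper) auto
    finally show "(INF x\<in>{x. \<bar>x\<bar> \<le> 1 - \<delta>}. ?p x) \<le> (SUP x\<in>{x. \<bar>x\<bar> \<le> 1}. ?p x)" .
  qed
qed

text \<open>The function \<open>enn2real\<close> sends infinity to 0, so the limit of logarithms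
  describes the true expectation only together with finiteness.\<close>

lemma expected_exit_time_finite:
  assumes x: "\<bar>x\<bar> < 1"
  shows "\<forall>\<^sub>F \<epsilon> in at_right 0. (\<integral>\<^sup>+\<omega>. exit_time (X \<epsilon> x) \<omega> \<partial>M) < \<infinity>"
proof -
  define \<delta> where "\<delta> = (1 - \<bar>x\<bar>) / 2"
  have "0 < \<delta>" "\<delta> < 1" "\<bar>x\<bar> \<le> 1 - \<delta>" using x by (auto simp: \<delta>_def field_simps)
  from expected_exit_time_bounds[OF this] show ?thesis by eventually_elim blast
qed

end

theorem theorem2p3:
  fixes M :: "'a measure" and F :: "real \<Rightarrow> 'a measure"
    and U :: "real \<Rightarrow> real" and \<nu> :: "real measure"
    and \<alpha> \<theta> d \<mu> :: real
    and L :: "real \<Rightarrow> real \<Rightarrow> 'a \<Rightarrow> real"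
    and X :: "real \<Rightarrow> real \<Rightarrow> real \<Rightarrow> 'a \<Rightarrow> real"
  assumes "prob_space M" and "usual_hypotheses M F"
    and "0 < \<alpha>" and "\<alpha> < 1" and "\<theta> > 0" and "d \<ge> 0"
    and "cond_U U"
    and "levy_measure \<nu>" and "symmetric_measure \<nu>" and "cond_L2 \<alpha> \<nu>"
    and "\<And>\<epsilon>. \<epsilon> > 0 \<Longrightarrow> levy_process_triplet M F d (restrict_jumps \<nu> (\<theta> / \<epsilon>)) \<mu> (L \<epsilon>)"
    and "\<And>\<epsilon> x. \<epsilon> > 0 \<Longrightarrow> strong_solution M F U \<epsilon> (L \<epsilon>) x (X \<epsilon> x)"
  shows "phi \<alpha> \<theta> =
           Inf {\<Sum>i=1..k. x i powr \<alpha> | (k::nat) (x::nat \<Rightarrow> real).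
                  k \<ge> 1 \<and> real k \<ge> 1 / \<theta> \<and> (\<forall>i\<in>{1..k}. x i \<in> {0..\<theta>}) \<and> (\<Sum>i=1..k. x i) = 1}
       \<and> (\<forall>\<delta>>0. \<exists>\<epsilon>\<^sub>0>0. \<forall>\<epsilon>. 0 < \<epsilon> \<and> \<epsilon> \<le> \<epsilon>\<^sub>0 \<longrightarrow> (\<forall>t\<ge>0.
           (\<delta> \<le> 1 \<longrightarrow>
              (1 - \<delta>) * exp (- (exit_rate \<alpha> \<nu> \<theta> \<epsilon> powr (1 - \<delta>)) * t)
                \<le> (INF x\<in>{x. \<bar>x\<bar> \<le> 1 - \<delta>}. \<P>(\<omega> in M. exit_time (X \<epsilon> x) \<omega> > ennreal t)) \<and>
              (INF x\<in>{x. \<bar>x\<bar> \<le> 1 - \<delta>}. \<P>(\<omega> in M. exit_time (X \<epsilon> x) \<omega> > ennreal t))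
                \<le> (SUP x\<in>{x. \<bar>x\<bar> \<le> 1}. \<P>(\<omega> in M. exit_time (X \<epsilon> x) \<omega> > ennreal t))) \<and>
           (SUP x\<in>{x. \<bar>x\<bar> \<le> 1}. \<P>(\<omega> in M. exit_time (X \<epsilon> x) \<omega> > ennreal t))
             \<le> (1 + \<delta>) * exp (- (exit_rate \<alpha> \<nu> \<theta> \<epsilon> powr (1 + \<delta>)) * t)))
       \<and> (\<forall>x. \<bar>x\<bar> < 1 \<longrightarrow>
           (\<forall>\<^sub>F \<epsilon> in at_right 0. (\<integral>\<^sup>+ \<omega>. exit_time (X \<epsilon> x) \<omega> \<partial>M) < \<infinity>) \<and>
           ((\<lambda>\<epsilon>. inverse (phi \<alpha> \<theta> * log_tail \<nu> (1 / \<epsilon>))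
                 * ln (enn2real (\<integral>\<^sup>+ \<omega>. exit_time (X \<epsilon> x) \<omega> \<partial>M))) \<longlongrightarrow> 1) (at_right 0))"
proof -
  interpret levy_sde_family M F U \<nu> \<alpha> \<theta> d \<mu> L X
    by (rule levy_sde_family.intro) (rule assms, assumption?)+
  show ?thesis
    using exit_estimates expected_exit_time_finite log_expected_exit_time
    by (intro conjI phi_eq_Inf[OF \<alpha> \<theta>] allI impI)
qed

end
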